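(* Let $K=\mathbb{C}(t)$ and let $X\subset \mathbb{P}^3_K$ be an irreducible projective surface of degree $d\geq 6$ over $K$. Let $L$ denote the union of all lines $\ell\subset X$, and let $U\subset X$ be the complement of $L$ in $X$, which is a quasi-projective variety. Then for every integer $b\geq 1$, $$\dim U(b)\leq \left(1+\max\left\{ \frac{1}{2},\ \frac{3}{2\sqrt{d}} + \frac{1}{3}\right\}\right) b + 2.$$
   Context: Every point of $\mathbb{P}^n(K)$ can be written as $x=(x_0:\ldots:x_n)$ with $x_i\in\mathbb{C}[t]$ coprime; its height is $h(x)=\max_i\deg x_i$. For a quasi-projective variety $X\subset\mathbb{P}^n_K$ and an integer $b\ge 1$, put $X(b)=\{x\in X(K): h(x)<b\}$. Identifying $(n+1)$-tuples of polynomials of degree $<b$, up to $\mathbb{C}^\times$, with points of $\mathbb{P}^{b(n+1)-1}_{\mathbb{C}}$ (coordinates being the coefficients), and representing points by coprime tuples, $X(b)$ is naturally a quasi-projective variety over $\mathbb{C}$ in $\mathbb{P}^{b(n+1)-1}_{\mathbb{C}}$; its equations and inequations are obtained by expanding those of $X$ in powers of $t$. The dimension is that of this variety over $\mathbb{C}$. *)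

theory Defs
  imports
    "HOL-Analysis.Analysis"
    "HOL-Computational_Algebra.Computational_Algebra"
    "HOL-Library.Poly_Mapping"
    "HOL-Library.Numeral_Type"
begin

text \<open>
  The ring \<open>R[x\<^sub>i | i :: 'i]\<close> is the monoid algebra of the monomials \<open>'i \<Rightarrow>\<^sub>0 nat\<close>.
\<close>

type_synonym ('i, 'a) mpoly = "('i \<Rightarrow>\<^sub>0 nat) \<Rightarrow>\<^sub>0 'a"

definition mpoly_eval :: "('i, 'a::comm_semiring_1) mpoly \<Rightarrow> ('i \<Rightarrow> 'a) \<Rightarrow> 'a" where
  "mpoly_eval f v =
     (\<Sum>m\<in>Poly_Mapping.keys f. Poly_Mapping.lookup f m *
        (\<Prod>i\<in>Poly_Mapping.keys m. v i ^ Poly_Mapping.lookup m i))"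

text \<open>Forms of degree \<open>d\<close> in the variables \<open>x\<^sub>i\<close>, \<open>i \<in> I\<close>; the zero form has every degree.\<close>

definition is_form :: "'i set \<Rightarrow> nat \<Rightarrow> ('i, 'a::zero) mpoly \<Rightarrow> bool" where
  "is_form I d f \<longleftrightarrow>
     (\<forall>m\<in>Poly_Mapping.keys f. Poly_Mapping.keys m \<subseteq> I \<and>
        (\<Sum>i\<in>Poly_Mapping.keys m. Poly_Mapping.lookup m i) = d)"

text \<open>
  Homogeneous coordinates are indexed by a finite set \<open>I\<close>, so that \<open>proj_space I\<close> is the set of
  rational points of the projective space of dimension \<open>card I - 1\<close>. A point is the set of all
  its coordinate vectors.
\<close>

definition proj_point :: "('i \<Rightarrow> 'a::field) \<Rightarrow> ('i \<Rightarrow> 'a) set" where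
  "proj_point v = {(\<lambda>i. c * v i) | c. c \<noteq> 0}"

definition proj_space :: "'i set \<Rightarrow> ('i \<Rightarrow> 'a::field) set set" where
  "proj_space I = {proj_point v | v. v \<noteq> (\<lambda>_. 0) \<and> (\<forall>i. i \<notin> I \<longrightarrow> v i = 0)}"

definition proj_zeros :: "'i set \<Rightarrow> ('i, 'a::field) mpoly \<Rightarrow> ('i \<Rightarrow> 'a) set set" where
  "proj_zeros I f = {p \<in> proj_space I. \<forall>v\<in>p. mpoly_eval f v = 0}"

definition zariski :: "'i set \<Rightarrow> ('i \<Rightarrow> 'a::field) set topology" where
  "zariski I = topology_generated_by {proj_space I - proj_zeros I f | f. \<exists>d. is_form I d f}"

text \<open>
  A line is given by its rational points. Over an infinite field it lies on a hypersurface
  as a subvariety if and only if all its rational points do.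
\<close>

definition is_proj_line :: "('i \<Rightarrow> 'a::field) set set \<Rightarrow> bool" where
  "is_proj_line l \<longleftrightarrow>
     (\<exists>u v. (\<forall>r s. (\<forall>i. r * u i + s * v i = 0) \<longrightarrow> r = 0 \<and> s = 0) \<and>
        l = {proj_point (\<lambda>i. r * u i + s * v i) | r s. r \<noteq> 0 \<or> s \<noteq> 0})"

definition irreducible_in :: "'p topology \<Rightarrow> 'p set \<Rightarrow> bool" where
  "irreducible_in T Z \<longleftrightarrow> Z \<subseteq> topspace T \<and> Z \<noteq> {} \<and>
     (\<forall>A B. closedin T A \<and> closedin T B \<and> Z \<subseteq> A \<union> B \<longrightarrow> Z \<subseteq> A \<or> Z \<subseteq> B)"

text \<open>The Krull dimension of a space; it is \<open>-\<infinity>\<close> for the empty space.\<close>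

definition krull_dim :: "'p topology \<Rightarrow> ereal" where
  "krull_dim T = Sup {ereal (real n) | n.
     \<exists>Z :: nat \<Rightarrow> 'p set. (\<forall>i\<le>n. closedin T (Z i) \<and> irreducible_in T (Z i)) \<and>
        (\<forall>i<n. Z i \<subset> Z (Suc i))}"

type_synonym ratfun = "complex poly fract"

definition coprime_rep :: "('i \<Rightarrow> ratfun) set \<Rightarrow> ('i \<Rightarrow> complex poly) \<Rightarrow> bool" where
  "coprime_rep x y \<longleftrightarrow> (\<lambda>i. to_fract (y i)) \<in> x \<and> (\<forall>q. (\<forall>i. q dvd y i) \<longrightarrow> q dvd 1)"

text \<open>
  Any two coprime representatives differ by a factor in \<open>\<complex>\<^sup>\<times>\<close>, so the choice is immaterial.
\<close>

definition height :: "('i::finite \<Rightarrow> ratfun) set \<Rightarrow> nat" where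
  "height x = (MAX i. degree ((SOME y. coprime_rep x y) i))"

definition bounded_height ::
    "('i::finite \<Rightarrow> ratfun) set set \<Rightarrow> nat \<Rightarrow> ('i \<Rightarrow> ratfun) set set" where
  "bounded_height X b = {x \<in> X. height x < b}"

text \<open>
  The coefficient vectors of all coprime representatives of \<open>x\<close> form a single orbit under
  \<open>\<complex>\<^sup>\<times>\<close>, i.e. a point of a complex projective space; if \<open>height x < b\<close>, it is a point of
  \<open>proj_space (UNIV \<times> {..<b})\<close>, whose dimension is \<open>b * CARD('i) - 1\<close>.
\<close>

definition coeff_point :: "('i \<Rightarrow> ratfun) set \<Rightarrow> ('i \<times> nat \<Rightarrow> complex) set" where
  "coeff_point x = {(\<lambda>(i, j). coeff (y i) j) | y. coprime_rep x y}"

definition dim_bounded_height :: "('i::finite \<Rightarrow> ratfun) set set \<Rightarrow> nat \<Rightarrow> ereal" where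
  "dim_bounded_height X b =
     krull_dim (subtopology (zariski (UNIV \<times> {..<b})) (coeff_point ` bounded_height X b))"

end

theory Submission
  imports Defs "HOL-Computational_Algebra.Field_as_Ring"
begin

text \<open>
  A chain of irreducible closed subsets of length \<open>n\<close> yields \<open>n + 1\<close> coordinates that are algebraically
  independent on its largest member. Over an ultrapower of \<open>\<complex>\<close> this member has a generic point, that
  is a curve \<open>x\<close> on the surface with coefficients in a large field, and the independent coordinates
  provide derivations of this field that are dual to them. Let \<open>m = b - 1\<close>, \<open>r > 3m / (2 \<surd>d)\<close> and
  \<open>2r + 3s > 3m\<close>. If \<open>n > 2r + s\<close>, there is a derivation \<open>D\<close> that fixes the points of the surface
  in which \<open>x\<close> meets \<open>r\<close> given fibres, and for which the \<open>2 \<times> 2\<close> minors of \<open>(x, Dx)\<close> vanish at \<open>s\<close>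
  further places.

  Two derivations that fix \<open>r\<close> points of \<open>x\<close> and move it in independent tangent directions are excluded
  by the determinant method: words in them, applied to monomials that are independent on the
  surface, form a nonzero determinant, since a relation would descend to \<open>K\<close>. It vanishes at the \<open>r\<close>
  places to high order and has small degree, which contradicts \<open>r > 3m / (2 \<surd>d)\<close>.

  Hence all such derivations move \<open>x\<close> along one curve. Then the Wronskian \<open>(x, Dx, D\<^sup>2x)\<close> vanishes to
  order 2 at \<open>r\<close> places and to order 3 at \<open>s\<close> places, while its degree is at most \<open>3m < 2r + 3s\<close>. So it is
  zero, and \<open>x\<close> and \<open>Dx\<close> span a line in the surface, which specialises to a line through a point of
  \<open>U\<close>. Finally \<open>2r + s\<close> is within the asserted bound for the smallest admissible \<open>r\<close> and \<open>s\<close>.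
\<close>

section \<open>Derivations in characteristic zero\<close>

text \<open>Two conflicting demands shape the determinant. Derivations acting on the coefficients of
  \<open>x\<close> keep polynomials polynomial and do not raise degrees, but they do not commute, so
  only words in them are available. The partial derivatives \<open>P\<close> and \<open>Q\<close>
  along the surface commute, so there are few operators of each order, but they lose control of
  degrees. Hence the matrix is built from words, which bounds its degree, and its rows are expanded
  in \<open>P\<close> and \<open>Q\<close>, which bounds its order. With N about d q^2 / 2 monomials
  of degree about q, the order at each place is about k N - k^3 / 6. The best choice k = q sqrt d
  turns the comparison with the degree N q m into r sqrt d / 3 \<le> m / 2, whence 3m / (2 sqrt d).
  All places are natural numbers: every derivation kills them, so it commutes with evaluation there.
  Fixing a point of the surface costs two linear conditions and a vanishing minor one; one more
  condition removes the rescaling of \<open>x\<close>. Since coordinates are counted on the cone, n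
  + 1 of them meet 2r + s + 1 conditions.\<close>

definition rhom :: "('a::comm_ring_1 \<Rightarrow> 'b::comm_ring_1) \<Rightarrow> bool" where
  "rhom h \<longleftrightarrow> h 1 = 1 \<and> (\<forall>x y. h (x + y) = h x + h y) \<and> (\<forall>x y. h (x * y) = h x * h y)"

definition derivation :: "('a::comm_ring_1 \<Rightarrow> 'a) \<Rightarrow> bool" where
  "derivation D \<longleftrightarrow> (\<forall>x y. D (x + y) = D x + D y) \<and> (\<forall>x y. D (x * y) = x * D y + D x * y)"

context
  fixes h :: "'a::comm_ring_1 \<Rightarrow> 'b::comm_ring_1"
  assumes h: "rhom h"
begin

lemma rhom_add: "h (x + y) = h x + h y" and rhom_mult: "h (x * y) = h x * h y" and rhom_1: "h 1 = 1"
  using h by (auto simp: rhom_def)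

lemma rhom_0: "h 0 = 0"
  using rhom_add[of 0 0] by simp

lemma rhom_minus: "h (- x) = - h x"
  using rhom_add[of x "- x"] rhom_0 by (simp add: eq_neg_iff_add_eq_0 add.commute)

lemma rhom_diff: "h (x - y) = h x - h y"
  using rhom_add[of x "- y"] rhom_minus by simp

lemma rhom_sum: "h (sum f A) = (\<Sum>i\<in>A. h (f i))"
  by (induction A rule: infinite_finite_induct) (auto simp: rhom_0 rhom_add)

lemma rhom_prod: "h (prod f A) = (\<Prod>i\<in>A. h (f i))"
  by (induction A rule: infinite_finite_induct) (auto simp: rhom_1 rhom_mult)

lemma rhom_power: "h (x ^ n) = h x ^ n"
  by (induction n) (auto simp: rhom_1 rhom_mult)

lemma rhom_of_nat: "h (of_nat n) = of_nat n"
  by (induction n) (auto simp: rhom_1 rhom_0 rhom_add)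

lemma coeff_map_poly_rhom: "coeff (map_poly h p) n = h (coeff p n)"
  by (simp add: coeff_map_poly rhom_0)

lemma rhom_map_poly: "rhom (map_poly h)"
  unfolding rhom_def
  by (auto intro!: poly_eqI simp: coeff_map_poly_rhom rhom_add rhom_mult rhom_sum rhom_0 rhom_1 coeff_mult coeff_1)

lemma map_poly_rhom_pCons: "map_poly h (pCons a p) = pCons (h a) (map_poly h p)"
  by (simp add: map_poly_pCons rhom_0)

end

lemma rhom_poly_eval:
  assumes "rhom h"
  shows "rhom (\<lambda>p. poly (map_poly h p) y)"
  using rhom_add[OF rhom_map_poly[OF assms]] rhom_mult[OF rhom_map_poly[OF assms]]
    rhom_1[OF rhom_map_poly[OF assms]]
  by (simp add: rhom_def)

lemma map_poly_rhom_pderiv: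
  fixes h :: "'a::idom \<Rightarrow> 'b::idom"
  assumes "rhom h"
  shows "pderiv (map_poly h p) = map_poly h (pderiv p)"
  using assms by (intro poly_eqI)
     (simp add: coeff_map_poly_rhom coeff_pderiv rhom_mult rhom_of_nat rhom_add rhom_1)

lemma rhom_comp: "rhom g \<Longrightarrow> rhom h \<Longrightarrow> rhom (g \<circ> h)"
  by (auto simp: rhom_def)

lemma rhom_to_fract: "rhom to_fract"
  by (auto simp: rhom_def)

lemma rhom_const_poly: "rhom (\<lambda>c. [:c:])"
  by (auto simp: rhom_def one_pCons)

lemma rhom_id: "rhom (\<lambda>x. x)"
  by (auto simp: rhom_def)

lemma rhom_nonzero:
  fixes h :: "'a::field \<Rightarrow> 'b::idom"
  assumes "rhom h" "x \<noteq> 0" shows "h x \<noteq> 0"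
proof
  assume "h x = 0"
  then have "h (x * inverse x) = 0" using assms(1) by (simp only: rhom_mult) simp
  then show False using assms by (simp add: rhom_1)
qed

lemma rhom_inj:
  fixes h :: "'a::field \<Rightarrow> 'b::idom"
  assumes "rhom h" shows "inj h"
proof (rule injI)
  fix x y assume "h x = h y"
  then have "h (x - y) = 0" using assms by (simp add: rhom_diff)
  then show "x = y" using rhom_nonzero[OF assms, of "x - y"] by auto
qed

context
  fixes D :: "'a::comm_ring_1 \<Rightarrow> 'a"
  assumes D: "derivation D"
begin

lemma der_add: "D (x + y) = D x + D y" and der_mult: "D (x * y) = x * D y + D x * y"
  using D by (auto simp: derivation_def)

lemma der_0: "D 0 = 0"
  using der_add[of 0 0] by simp

lemma der_1: "D 1 = 0"
  using der_mult[of 1 1] by simp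

lemma der_minus: "D (- x) = - D x"
  using der_add[of x "- x"] der_0 by (simp add: eq_neg_iff_add_eq_0 add.commute)

lemma der_diff: "D (x - y) = D x - D y"
  using der_add[of x "- y"] der_minus by simp

lemma der_sum: "D (sum f A) = (\<Sum>i\<in>A. D (f i))"
  by (induction A rule: infinite_finite_induct) (auto simp: der_0 der_add)

lemma der_of_nat: "D (of_nat n) = 0"
  by (induction n) (auto simp: der_1 der_0 der_add)

lemma der_power_Suc: "D (x ^ Suc n) = of_nat (Suc n) * x ^ n * D x"
  by (induction n) (auto simp: der_mult der_1 algebra_simps)

lemma der_power: "D (x ^ n) = of_nat n * x ^ (n - 1) * D x"
  using der_power_Suc by (cases n) (auto simp: der_1)

lemma coeff_map_poly_der: "coeff (map_poly D p) n = D (coeff p n)"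
  by (simp add: coeff_map_poly der_0)

lemma derivation_map_poly: "derivation (map_poly D)"
  unfolding derivation_def
proof (intro conjI allI poly_eqI)
  fix p q n
  show "coeff (map_poly D (p + q)) n = coeff (map_poly D p + map_poly D q) n"
    by (simp add: coeff_map_poly_der der_add)
  show "coeff (map_poly D (p * q)) n = coeff (p * map_poly D q + map_poly D p * q) n"
    by (simp add: coeff_map_poly_der coeff_mult der_sum der_mult sum.distrib)
qed

lemma degree_map_poly_der: "degree (map_poly D p) \<le> degree p"
  by (rule degree_le) (simp add: coeff_map_poly_der coeff_eq_0 der_0)

lemma map_poly_der_pCons: "map_poly D (pCons a p) = pCons (D a) (map_poly D p)"
  by (simp add: map_poly_pCons der_0)

end

lemma der_poly:
  fixes D :: "'a::idom \<Rightarrow> 'a"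
  assumes "derivation D"
  shows "D (poly p x) = poly (map_poly D p) x + poly (pderiv p) x * D x"
  using assms by (induction p)
     (auto simp: map_poly_der_pCons der_0 der_add der_mult pderiv_pCons algebra_simps)

lemma derivation_scale: "derivation D \<Longrightarrow> derivation (\<lambda>x. c * D x)"
  by (auto simp: derivation_def algebra_simps)

lemma derivation_add: "derivation D \<Longrightarrow> derivation D' \<Longrightarrow> derivation (\<lambda>x. D x + D' x)"
  by (auto simp: derivation_def algebra_simps)

lemma derivation_minus: "derivation D \<Longrightarrow> derivation D' \<Longrightarrow> derivation (\<lambda>x. D x - D' x)"
  by (auto simp: derivation_def algebra_simps)

lemma derivation_zero: "derivation (\<lambda>x. 0)"
  by (auto simp: derivation_def)

lemma derivation_sum: "(\<And>i. i \<in> A \<Longrightarrow> derivation (D i)) \<Longrightarrow> derivation (\<lambda>x. \<Sum>i\<in>A. c i * D i x)"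
proof (induction A rule: infinite_finite_induct)
  case (insert a A)
  then show ?case
    using derivation_add[OF derivation_scale[of "D a" "c a"], of "\<lambda>x. \<Sum>i\<in>A. c i * D i x"] by simp
qed (auto simp: derivation_zero)

lemma derivation_bracket:
  "derivation D \<Longrightarrow> derivation D' \<Longrightarrow> derivation (\<lambda>x. D (D' x) - D' (D x))"
  by (auto simp: derivation_def algebra_simps)

lemma derivation_inverse:
  fixes D :: "'a::field \<Rightarrow> 'a"
  assumes "derivation D" "x \<noteq> 0"
  shows "D (inverse x) = - D x / x\<^sup>2"
proof -
  have "D (x * inverse x) = 0" using assms by (simp add: der_1)
  then have "x * D (inverse x) + D x * inverse x = 0" using assms(1) by (simp add: der_mult)
  then show ?thesis using assms(2) by (simp add: field_simps power2_eq_square eq_neg_iff_add_eq_0)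
qed

lemma derivation_divide:
  fixes D :: "'a::field \<Rightarrow> 'a"
  assumes "derivation D" "y \<noteq> 0"
  shows "D (x / y) = (D x * y - x * D y) / y\<^sup>2"
  using assms by (simp add: divide_inverse der_mult derivation_inverse)
     (simp add: field_simps power2_eq_square)

text \<open>
  A derivation defined on a subring is handled through its graph \<open>G\<close>; a pair \<open>(p, p')\<close> of
  polynomials whose coefficients are matched by \<open>G\<close> then stands for a polynomial over the subring
  together with the polynomial obtained by differentiating its coefficients.
\<close>

definition der_graph :: "('a::comm_ring_1 \<times> 'a) set \<Rightarrow> bool" where
  "der_graph G \<longleftrightarrow> (1, 0) \<in> G \<and> (\<forall>a x y. (a, x) \<in> G \<and> (a, y) \<in> G \<longrightarrow> x = y) \<and>
     (\<forall>a b x y. (a, x) \<in> G \<and> (b, y) \<in> G \<longrightarrow> (a - b, x - y) \<in> G \<and> (a * b, a * y + x * b) \<in> G)"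

definition poly_graph :: "('a::comm_ring_1 \<times> 'a) set \<Rightarrow> ('a poly \<times> 'a poly) set" where
  "poly_graph G = {(p, p'). \<forall>n. (coeff p n, coeff p' n) \<in> G}"

text \<open>The value that the chain rule prescribes for the derivative of \<open>poly p w\<close>
  once \<open>w\<close> is sent to \<open>c\<close>.\<close>

definition poly_graph_val :: "'a \<Rightarrow> 'a \<Rightarrow> 'a poly \<times> 'a poly \<Rightarrow> 'a::idom" where
  "poly_graph_val w c P = poly (snd P) w + poly (pderiv (fst P)) w * c"

context
  fixes G :: "('a::idom \<times> 'a) set"
  assumes G: "der_graph G"
begin

lemma der_graph_1: "(1, 0) \<in> G"
  and der_graph_diff: "(a, x) \<in> G \<Longrightarrow> (b, y) \<in> G \<Longrightarrow> (a - b, x - y) \<in> G"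
  and der_graph_mult: "(a, x) \<in> G \<Longrightarrow> (b, y) \<in> G \<Longrightarrow> (a * b, a * y + x * b) \<in> G"
  and der_graph_unique: "(a, x) \<in> G \<Longrightarrow> (a, y) \<in> G \<Longrightarrow> x = y"
  using G unfolding der_graph_def by blast+

lemma der_graph_0: "(0, 0) \<in> G"
  using der_graph_diff[OF der_graph_1 der_graph_1] by simp

lemma der_graph_add: "(a, x) \<in> G \<Longrightarrow> (b, y) \<in> G \<Longrightarrow> (a + b, x + y) \<in> G"
  using der_graph_diff[of a x "- b" "- y"] der_graph_diff[OF der_graph_0, of b y] by simp

lemma der_graph_sum: "(\<And>i. i \<in> A \<Longrightarrow> (f i, g i) \<in> G) \<Longrightarrow> (sum f A, sum g A) \<in> G"
  by (induction A rule: infinite_finite_induct) (auto simp: der_graph_0 der_graph_add)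

lemma poly_graph_diff: "(p, p') \<in> poly_graph G \<Longrightarrow> (q, q') \<in> poly_graph G \<Longrightarrow> (p - q, p' - q') \<in> poly_graph G"
  by (auto simp: poly_graph_def der_graph_diff)

lemma poly_graph_mult:
  "(p, p') \<in> poly_graph G \<Longrightarrow> (q, q') \<in> poly_graph G \<Longrightarrow> (p * q, p * q' + p' * q) \<in> poly_graph G"
  unfolding poly_graph_def
  by (auto simp: coeff_mult sum.distrib[symmetric] intro!: der_graph_sum der_graph_mult)

lemma poly_graph_const: "(a, x) \<in> G \<Longrightarrow> ([:a:], [:x:]) \<in> poly_graph G"
  unfolding poly_graph_def by (auto simp: coeff_pCons der_graph_0 split: nat.splits)

lemma poly_graph_monom: "(a, x) \<in> G \<Longrightarrow> (monom a n, monom x n) \<in> poly_graph G"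
  unfolding poly_graph_def by (auto simp: der_graph_0)

lemma poly_graph_val_mult:
  "poly_graph_val w c (p * q, p * q' + p' * q) =
     poly p w * poly_graph_val w c (q, q') + poly_graph_val w c (p, p') * poly q w"
  by (simp add: poly_graph_val_def pderiv_mult algebra_simps)

text \<open>The new graph consists of the values at \<open>w\<close> of all matched pairs. It is
  single-valued as soon as a pair with \<open>poly p w = 0\<close> receives the value 0, because the
  difference of two representations of one element is such a pair.\<close>

lemma der_graph_adjoin:
  assumes "\<And>p p'. (p, p') \<in> poly_graph G \<Longrightarrow> poly p w = 0 \<Longrightarrow> poly_graph_val w c (p, p') = 0"
  shows "\<exists>G'. der_graph G' \<and> G \<subseteq> G' \<and> (w, c) \<in> G'"
proof (intro exI conjI)
  let ?G = "{(poly p w, poly_graph_val w c (p, p')) |p p'. (p, p') \<in> poly_graph G}"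
  show "der_graph ?G" unfolding der_graph_def
  proof (intro conjI allI impI)
    show "(1, 0) \<in> ?G"
      using poly_graph_const[OF der_graph_1] by (force simp: poly_graph_val_def pderiv_pCons)
  next
    fix a x y assume *: "(a, x) \<in> ?G \<and> (a, y) \<in> ?G"
    then obtain p p' q q' where pq: "(p, p') \<in> poly_graph G" "(q, q') \<in> poly_graph G"
      "a = poly p w" "a = poly q w" "x = poly_graph_val w c (p, p')" "y = poly_graph_val w c (q, q')"
      by blast
    have "poly_graph_val w c (p - q, p' - q') = 0"
      using assms[OF poly_graph_diff[OF pq(1,2)]] pq by simp
    then show "x = y" using pq by (simp add: poly_graph_val_def pderiv_diff algebra_simps)
  next
    fix a b x y assume *: "(a, x) \<in> ?G \<and> (b, y) \<in> ?G"
    then obtain p p' q q' where pq: "(p, p') \<in> poly_graph G" "(q, q') \<in> poly_graph G"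
      "a = poly p w" "b = poly q w" "x = poly_graph_val w c (p, p')" "y = poly_graph_val w c (q, q')"
      by blast
    have "a - b = poly (p - q) w" "x - y = poly_graph_val w c (p - q, p' - q')"
      using pq by (simp_all add: poly_graph_val_def pderiv_diff algebra_simps)
    then show "(a - b, x - y) \<in> ?G" using poly_graph_diff[OF pq(1,2)] by blast
    have "a * b = poly (p * q) w" "a * y + x * b = poly_graph_val w c (p * q, p * q' + p' * q)"
      using pq by (simp_all only: poly_graph_val_mult poly_mult)
    then show "(a * b, a * y + x * b) \<in> ?G" using poly_graph_mult[OF pq(1,2)] by blast
  qed
  show "G \<subseteq> ?G"
  proof safe
    fix a x assume "(a, x) \<in> G"
    then show "\<exists>p p'. (a, x) = (poly p w, poly_graph_val w c (p, p')) \<and> (p, p') \<in> poly_graph G"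
      using poly_graph_const[of a x]
      by (intro exI[of _ "[:a:]"] exI[of _ "[:x:]"]) (auto simp: poly_graph_val_def pderiv_pCons)
  qed
  have "(monom 1 1, monom 0 1) \<in> poly_graph G" using poly_graph_monom[OF der_graph_1] .
  moreover have "(w, c) = (poly (monom 1 1) w, poly_graph_val w c (monom 1 1, monom 0 1))"
    by (simp add: poly_graph_val_def poly_monom pderiv_monom)
  ultimately show "(w, c) \<in> ?G" by blast
qed

end

text \<open>If \<open>w\<close> satisfies no nonzero relation over the domain of \<open>G\<close>,
  every \<open>c\<close> works. Otherwise a relation of least degree is separable in characteristic
  zero and determines \<open>c\<close>; all others are reduced to it by pseudo-division, which
  multiplies by leading coefficients since the domain is only a ring.\<close>

lemma der_graph_adjoin_exists:
  fixes w :: "'a::field_char_0"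
  assumes G: "der_graph G"
  shows "\<exists>c. \<forall>p p'. (p, p') \<in> poly_graph G \<longrightarrow> poly p w = 0 \<longrightarrow> poly_graph_val w c (p, p') = 0"
proof (cases "\<exists>p p'. (p, p') \<in> poly_graph G \<and> poly p w = 0 \<and> p \<noteq> 0")
  case False
  then have "poly_graph_val w 0 (p, p') = 0" if "(p, p') \<in> poly_graph G" "poly p w = 0" for p p'
  proof -
    have "p = 0" using False that by blast
    then have "coeff p' n = 0" for n
      using that der_graph_unique[OF G _ der_graph_0[OF G]] by (auto simp: poly_graph_def)
    then have "p' = 0" by (simp add: poly_eq_iff)
    then show ?thesis using \<open>p = 0\<close> by (simp add: poly_graph_val_def)
  qed
  then show ?thesis by blast
next
  case True
  let ?P = "\<lambda>n. \<exists>p p'. (p, p') \<in> poly_graph G \<and> poly p w = 0 \<and> p \<noteq> 0 \<and> degree p = n"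
  have ex: "\<exists>n. ?P n" using True by blast
  obtain q0 q0' where q0: "(q0, q0') \<in> poly_graph G" "poly q0 w = 0" "q0 \<noteq> 0" "degree q0 = Least ?P"
    using LeastI_ex[OF ex] by (elim exE conjE) simp
  have min: "p = 0" if "(p, p') \<in> poly_graph G" "poly p w = 0" "degree p < degree q0" for p p'
    using not_less_Least[of "degree p" ?P] that unfolding q0(4) by blast
  have deg: "degree q0 \<noteq> 0"
  proof
    assume "degree q0 = 0"
    then obtain a where "q0 = [:a:]" by (auto elim: degree_eq_zeroE)
    then show False using q0 by simp
  qed
  \<comment> \<open>A common root with the derivative would give a nonzero relation of smaller
    degree; \<open>pderiv\<close> stays within matched pairs because the graph is closed under
    natural multiples.\<close>
  have d0: "poly (pderiv q0) w \<noteq> 0"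
  proof
    assume z: "poly (pderiv q0) w = 0"
    have "(of_nat n * a, of_nat n * x) \<in> G" if "(a, x) \<in> G" for n a x
      using that by (induction n) (auto simp: der_graph_0[OF G] algebra_simps intro: der_graph_add[OF G])
    then have "(pderiv q0, pderiv q0') \<in> poly_graph G"
      using q0(1) by (auto simp: poly_graph_def coeff_pderiv simp del: of_nat_Suc)
    then have "pderiv q0 = 0" using min[of "pderiv q0" "pderiv q0'"] z deg by (auto simp: degree_pderiv)
    then show False using deg by (simp add: pderiv_eq_0_iff)
  qed
  define c where "c = - poly q0' w / poly (pderiv q0) w"
  have v0: "poly_graph_val w c (q0, q0') = 0" using d0 by (simp add: poly_graph_val_def c_def)
  have "poly_graph_val w c (p, p') = 0" if "(p, p') \<in> poly_graph G" "poly p w = 0" for p p'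
    using that
  proof (induction "degree p" arbitrary: p p' rule: less_induct)
    case less
    note p = less.prems
    show ?case
    proof (cases "degree p < degree q0")
      case True
      then have "p = 0" using min p by blast
      then have "coeff p' n = 0" for n
        using p der_graph_unique[OF G _ der_graph_0[OF G]] by (auto simp: poly_graph_def)
      then have "p' = 0" by (simp add: poly_eq_iff)
      then show ?thesis using \<open>p = 0\<close> by (simp add: poly_graph_val_def)
    next
      case False
      define k where "k = degree p - degree q0"
      define a a' b b' where "a = lead_coeff q0" and "a' = coeff q0' (degree q0)"
        and "b = lead_coeff p" and "b' = coeff p' (degree p)"
      have ab: "(a, a') \<in> G" "(b, b') \<in> G"
        using p q0(1) by (auto simp: poly_graph_def a_def a'_def b_def b'_def)
      note A = poly_graph_mult[OF G poly_graph_const[OF G ab(1)] p(1)]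
      note B = poly_graph_mult[OF G poly_graph_monom[OF G ab(2), of k] q0(1)]
      define r r' where "r = [:a:] * p - monom b k * q0"
        and "r' = [:a:] * p' + [:a':] * p - (monom b k * q0' + monom b' k * q0)"
      have r: "(r, r') \<in> poly_graph G" unfolding r_def r'_def by (rule poly_graph_diff[OF G A B])
      have rw: "poly r w = 0" using p q0 by (simp add: r_def)
      have "degree r < degree p \<or> r = 0"
      proof -
        have dp: "degree p = degree q0 + k" "degree p > 0" using False deg by (auto simp: k_def)
        have "degree r \<le> degree p" unfolding r_def
        proof (intro degree_diff_le)
          show "degree ([:a:] * p) \<le> degree p" by simp
          show "degree (monom b k * q0) \<le> degree p"
            using degree_mult_le[of "monom b k" q0] degree_monom_le[of b k] dp by linarith
        qed
        moreover have "coeff r (degree p) = 0"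
          using dp(1) by (simp add: r_def coeff_monom_mult a_def b_def)
        ultimately show ?thesis
          using eq_zero_or_degree_less by blast
      qed
      then have "poly_graph_val w c (r, r') = 0"
      proof
        assume "degree r < degree p"
        then show ?thesis using less.hyps r rw by blast
      next
        assume "r = 0"
        then have "coeff r' n = 0" for n
          using r der_graph_unique[OF G _ der_graph_0[OF G]] by (auto simp: poly_graph_def)
        then have "r' = 0" by (simp add: poly_eq_iff)
        then show ?thesis using \<open>r = 0\<close> by (simp add: poly_graph_val_def)
      qed
      moreover have "poly_graph_val w c (r, r') = poly_graph_val w c ([:a:] * p, [:a:] * p' + [:a':] * p)
          - poly_graph_val w c (monom b k * q0, monom b k * q0' + monom b' k * q0)"
        by (simp add: poly_graph_val_def r_def r'_def pderiv_diff algebra_simps)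
      moreover have "poly_graph_val w c (monom b k * q0, monom b k * q0' + monom b' k * q0) = 0"
        using v0 q0(2) by (simp only: poly_graph_val_mult[OF G]) simp
      moreover have "poly_graph_val w c ([:a:] * p, [:a:] * p' + [:a':] * p) = a * poly_graph_val w c (p, p')"
        using p(2) by (simp only: poly_graph_val_mult[OF G]) simp
      ultimately show ?thesis using q0(3) by (simp add: a_def)
    qed
  qed
  then show ?thesis by blast
qed

text \<open>A maximal single-valued graph is total, since any missing element could be
  adjoined.\<close>

theorem der_graph_extend:
  fixes G :: "('a::field_char_0 \<times> 'a) set"
  assumes "der_graph G"
  shows "\<exists>D. derivation D \<and> (\<forall>(a, x)\<in>G. D a = x)"
proof -
  let ?A = "{H. der_graph H \<and> G \<subseteq> H}"
  have "\<exists>M\<in>?A. \<forall>X\<in>?A. M \<subseteq> X \<longrightarrow> X = M"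
  proof (rule subset_Zorn_nonempty)
    show "?A \<noteq> {}" using assms by auto
    fix C assume C: "C \<noteq> {}" "subset.chain ?A C"
    have two: "\<exists>H\<in>C. u \<in> H \<and> v \<in> H" if "u \<in> \<Union>C" "v \<in> \<Union>C" for u v
    proof -
      obtain H1 H2 where H: "H1 \<in> C" "u \<in> H1" "H2 \<in> C" "v \<in> H2" using \<open>u \<in> \<Union>C\<close> \<open>v \<in> \<Union>C\<close> by blast
      then have "H1 \<subseteq> H2 \<or> H2 \<subseteq> H1" using C(2) by (auto simp: subset_chain_def)
      then show ?thesis using H by blast
    qed
    have H: "der_graph H" "G \<subseteq> H" if "H \<in> C" for H using that C(2) by (auto simp: subset_chain_def)
    have "der_graph (\<Union>C)" unfolding der_graph_def
    proof (intro conjI allI impI)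
      show "(1, 0) \<in> \<Union>C" using C(1) H(1)[THEN der_graph_1] by (meson Union_iff all_not_in_conv)
    next
      fix a x y assume "(a, x) \<in> \<Union>C \<and> (a, y) \<in> \<Union>C"
      then obtain K where "K \<in> C" "(a, x) \<in> K" "(a, y) \<in> K" using two by blast
      then show "x = y" by (intro der_graph_unique[OF H(1)])
    next
      fix a b x y assume "(a, x) \<in> \<Union>C \<and> (b, y) \<in> \<Union>C"
      then obtain K where K: "K \<in> C" "(a, x) \<in> K" "(b, y) \<in> K" using two by blast
      show "(a - b, x - y) \<in> \<Union>C" "(a * b, a * y + x * b) \<in> \<Union>C"
        using der_graph_diff[OF H(1)[OF K(1)] K(2,3)] der_graph_mult[OF H(1)[OF K(1)] K(2,3)] K(1)
        by (blast, blast)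
    qed
    moreover have "G \<subseteq> \<Union>C" using C(1) H(2) by blast
    ultimately show "\<Union>C \<in> ?A" by simp
  qed
  then obtain M where "M \<in> ?A" and M_max: "\<forall>X\<in>?A. M \<subseteq> X \<longrightarrow> X = M" by (elim bexE)
  then have M: "der_graph M" "G \<subseteq> M" by simp_all
  have "\<exists>c. (w, c) \<in> M" for w
  proof -
    obtain c where c: "\<forall>p p'. (p, p') \<in> poly_graph M \<longrightarrow> poly p w = 0 \<longrightarrow> poly_graph_val w c (p, p') = 0"
      using der_graph_adjoin_exists[OF M(1), of w] ..
    have "\<exists>M'. der_graph M' \<and> M \<subseteq> M' \<and> (w, c) \<in> M'" by (rule der_graph_adjoin[OF M(1)]) (use c in simp)
    then obtain M' where "der_graph M'" "M \<subseteq> M'" "(w, c) \<in> M'" by auto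
    then have "M' = M" using M_max M(2) by simp
    then show ?thesis using \<open>(w, c) \<in> M'\<close> by auto
  qed
  then have "\<forall>w. \<exists>c. (w, c) \<in> M" by simp
  from choice[OF this] obtain D where D: "\<And>w. (w, D w) \<in> M" by auto
  show ?thesis
  proof (intro exI[of _ D] conjI)
    show "derivation D" unfolding derivation_def
    proof (intro conjI allI)
      fix x y
      show "D (x + y) = D x + D y"
        using der_graph_unique[OF M(1) D der_graph_add[OF M(1) D D]] .
      show "D (x * y) = x * D y + D x * y"
        using der_graph_unique[OF M(1) D der_graph_mult[OF M(1) D D]] .
    qed
    show "\<forall>(a, x)\<in>G. D a = x"
      using der_graph_unique[OF M(1) D] M(2) by auto
  qed
qed

definition subring_set :: "'a::comm_ring_1 set \<Rightarrow> bool" where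
  "subring_set A \<longleftrightarrow> 1 \<in> A \<and> (\<forall>x\<in>A. \<forall>y\<in>A. x - y \<in> A \<and> x * y \<in> A)"

text \<open>The zero derivation on \<open>A\<close> is extended; transcendence of \<open>w\<close>
  leaves no relation to respect, so the value 1 may be prescribed.\<close>

theorem derivation_of_transcendental:
  fixes w :: "'a::field_char_0"
  assumes A: "subring_set A" and tr: "\<forall>p. (\<forall>n. coeff p n \<in> A) \<longrightarrow> poly p w = 0 \<longrightarrow> p = 0"
  shows "\<exists>D. derivation D \<and> (\<forall>a\<in>A. D a = 0) \<and> D w = 1"
proof -
  let ?G = "{(a, 0) |a. a \<in> A}"
  have G: "der_graph ?G" using A by (auto simp: der_graph_def subring_set_def)
  have "poly_graph_val w 1 (p, p') = 0" if "(p, p') \<in> poly_graph ?G" "poly p w = 0" for p p'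
  proof -
    from that(1) have "coeff p n \<in> A" "coeff p' n = 0" for n by (auto simp: poly_graph_def)
    then have "p = 0" "p' = 0" using tr that(2) by (auto simp: poly_eq_iff)
    then show ?thesis by (simp add: poly_graph_val_def)
  qed
  from der_graph_adjoin[OF G this] obtain G' where G': "der_graph G'" "?G \<subseteq> G'" "(w, 1) \<in> G'" by auto
  from der_graph_extend[OF G'(1)] obtain D where D: "derivation D" "\<forall>(a, x)\<in>G'. D a = x" by (elim exE conjE)
  have "D a = 0" if "a \<in> A" for a using D(2) G'(2) that by auto
  then show ?thesis using D G'(3) by (intro exI[of _ D]) auto
qed

section \<open>Rational functions\<close>

definition fract_hom :: "('a::idom \<Rightarrow> 'b::field) \<Rightarrow> 'a fract \<Rightarrow> 'b" where
  "fract_hom h x = (THE y. \<exists>p q. q \<noteq> 0 \<and> x = Fraction_Field.Fract p q \<and> y = h p / h q)"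

definition fract_der :: "('a::idom \<Rightarrow> 'a) \<Rightarrow> 'a fract \<Rightarrow> 'a fract" where
  "fract_der D x = (THE y. \<exists>p q. q \<noteq> 0 \<and> x = Fraction_Field.Fract p q \<and>
     y = (to_fract (D p) * to_fract q - to_fract p * to_fract (D q)) / (to_fract q)\<^sup>2)"

lemma fract_cases_to_fract:
  obtains p q where "x = to_fract p / to_fract q" "q \<noteq> 0"
  by (metis Fract_cases Fract_conv_to_fract)

context
  fixes h :: "'a::idom \<Rightarrow> 'b::field"
  assumes h: "rhom h" and inj: "inj h"
begin

lemma rhom_inj_nonzero: "q \<noteq> 0 \<Longrightarrow> h q \<noteq> 0"
  using inj rhom_0[OF h] by (metis injD)

lemma fract_hom_Fract:
  assumes "q \<noteq> 0"
  shows "fract_hom h (Fraction_Field.Fract p q) = h p / h q"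
  unfolding fract_hom_def
proof (rule the_equality)
  show "\<exists>p' q'. q' \<noteq> 0 \<and> Fraction_Field.Fract p q = Fraction_Field.Fract p' q' \<and> h p / h q = h p' / h q'"
    using assms by blast
  fix y assume "\<exists>p' q'. q' \<noteq> 0 \<and> Fraction_Field.Fract p q = Fraction_Field.Fract p' q' \<and> y = h p' / h q'"
  then obtain p' q' where *: "q' \<noteq> 0" "Fraction_Field.Fract p q = Fraction_Field.Fract p' q'" "y = h p' / h q'"
    by (elim exE conjE)
  have "p * q' = p' * q" using * assms by (simp add: eq_fract)
  then have "h p * h q' = h p' * h q" by (metis h rhom_mult)
  then show "y = h p / h q"
    using *(3) rhom_inj_nonzero[OF assms] rhom_inj_nonzero[OF *(1)] by (simp add: frac_eq_eq)
qed

lemma fract_hom_to_fract: "fract_hom h (to_fract p) = h p"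
  using fract_hom_Fract[of 1 p] rhom_1[OF h] by (simp add: to_fract_def)

lemma rhom_fract_hom: "rhom (fract_hom h)"
  unfolding rhom_def
proof (intro conjI allI)
  show "fract_hom h 1 = 1" using fract_hom_to_fract[of 1] rhom_1[OF h] by simp
  fix x y :: "'a fract"
  obtain a b where x: "x = Fraction_Field.Fract a b" "b \<noteq> 0" by (rule Fract_cases)
  obtain c d where y: "y = Fraction_Field.Fract c d" "d \<noteq> 0" by (rule Fract_cases)
  have nz: "h b \<noteq> 0" "h d \<noteq> 0" using x y rhom_inj_nonzero by auto
  show "fract_hom h (x + y) = fract_hom h x + fract_hom h y"
    using x y nz by (simp add: fract_hom_Fract rhom_add[OF h] rhom_mult[OF h] field_simps)
  show "fract_hom h (x * y) = fract_hom h x * fract_hom h y"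
    using x y nz by (simp add: fract_hom_Fract rhom_mult[OF h])
qed

end

lemma derivation_fract_eqI:
  assumes D: "derivation D" and D': "derivation D'"
    and eq: "\<And>p. D (to_fract p) = D' (to_fract p)"
  shows "D x = D' x"
proof -
  obtain p q where x: "x = to_fract p / to_fract q" "q \<noteq> 0" by (rule fract_cases_to_fract)
  then show ?thesis by (simp add: derivation_divide[OF D] derivation_divide[OF D'] eq)
qed

context
  fixes D :: "'a::idom \<Rightarrow> 'a"
  assumes D: "derivation D"
begin

lemma fract_der_Fract:
  assumes "q \<noteq> 0"
  shows "fract_der D (Fraction_Field.Fract p q) =
    (to_fract (D p) * to_fract q - to_fract p * to_fract (D q)) / (to_fract q)\<^sup>2"
  unfolding fract_der_def
proof (rule the_equality, goal_cases)
  case 1 show ?case using assms by blast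
next
  case (2 y)
  then obtain p' q' where *: "q' \<noteq> 0" "Fraction_Field.Fract p q = Fraction_Field.Fract p' q'"
    "y = (to_fract (D p') * to_fract q' - to_fract p' * to_fract (D q')) / (to_fract q')\<^sup>2"
    by (elim exE conjE)
  have e: "p * q' = p' * q" using * assms by (simp add: eq_fract)
  then have "D (p * q') = D (p' * q)" by simp
  then have d: "p * D q' + D p * q' = p' * D q + D p' * q" by (simp add: der_mult[OF D])
  have "(D p' * q' - p' * D q') * q\<^sup>2 = (D p * q - p * D q) * q'\<^sup>2"
    using e d by algebra
  then have "to_fract ((D p' * q' - p' * D q') * q\<^sup>2) = to_fract ((D p * q - p * D q) * q'\<^sup>2)" by simp
  then show ?case using * assms by (simp add: frac_eq_eq power2_eq_square)
qed

lemma fract_der_to_fract: "fract_der D (to_fract p) = to_fract (D p)"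
  using fract_der_Fract[of 1 p] by (simp add: to_fract_def[symmetric] der_1[OF D])

lemma derivation_fract_der: "derivation (fract_der D)"
  unfolding derivation_def
proof (intro conjI allI)
  fix x y :: "'a fract"
  obtain a b where x: "x = Fraction_Field.Fract a b" "b \<noteq> 0" by (rule Fract_cases)
  obtain c d where y: "y = Fraction_Field.Fract c d" "d \<noteq> 0" by (rule Fract_cases)
  have nz: "b * d \<noteq> 0" "to_fract b \<noteq> 0" "to_fract d \<noteq> 0" using x y by auto
  show "fract_der D (x + y) = fract_der D x + fract_der D y"
    using x y nz by (simp add: fract_der_Fract der_add[OF D] der_mult[OF D] divide_simps)
      (simp add: algebra_simps power2_eq_square)
  have "fract_der D (x * y) =
      (to_fract (D (a * c)) * to_fract (b * d) - to_fract (a * c) * to_fract (D (b * d))) / (to_fract (b * d))\<^sup>2"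
    using x y nz(1) by (simp add: fract_der_Fract)
  moreover have "fract_der D x = (to_fract (D a) * to_fract b - to_fract a * to_fract (D b)) / (to_fract b)\<^sup>2"
    "fract_der D y = (to_fract (D c) * to_fract d - to_fract c * to_fract (D d)) / (to_fract d)\<^sup>2"
    using fract_der_Fract[of b a] fract_der_Fract[of d c] x y by simp_all
  moreover have "x = to_fract a / to_fract b" "y = to_fract c / to_fract d"
    using x y by (simp_all only: Fract_conv_to_fract)
  ultimately show "fract_der D (x * y) = x * fract_der D y + fract_der D x * y"
    using nz by (simp only: der_mult[OF D] to_fract_add to_fract_mult) (simp add: field_simps power2_eq_square)
qed

end

text \<open>Acts on the coefficients and treats the variable as a constant.\<close>

definition lift_der :: "('a::idom \<Rightarrow> 'a) \<Rightarrow> 'a poly fract \<Rightarrow> 'a poly fract" where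
  "lift_der D = fract_der (map_poly D)"

lemma derivation_lift_der: "derivation D \<Longrightarrow> derivation (lift_der D)"
  by (simp add: lift_der_def derivation_fract_der derivation_map_poly)

lemma lift_der_to_fract: "derivation D \<Longrightarrow> lift_der D (to_fract p) = to_fract (map_poly D p)"
  by (simp add: lift_der_def fract_der_to_fract derivation_map_poly)

lemma lift_der_bracket:
  assumes "derivation D" "derivation D'"
  shows "lift_der (\<lambda>x. D (D' x) - D' (D x)) x = lift_der D (lift_der D' x) - lift_der D' (lift_der D x)"
proof (rule derivation_fract_eqI[where D = "lift_der (\<lambda>x. D (D' x) - D' (D x))"
      and D' = "\<lambda>x. lift_der D (lift_der D' x) - lift_der D' (lift_der D x)"])
  fix p
  have "map_poly (\<lambda>x. D (D' x) - D' (D x)) p = map_poly D (map_poly D' p) - map_poly D' (map_poly D p)"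
    using assms by (intro poly_eqI) (simp add: coeff_map_poly der_0)
  then show "lift_der (\<lambda>x. D (D' x) - D' (D x)) (to_fract p) =
      lift_der D (lift_der D' (to_fract p)) - lift_der D' (lift_der D (to_fract p))"
    using assms by (simp add: lift_der_to_fract derivation_bracket)
qed (use assms in \<open>auto intro!: derivation_lift_der derivation_bracket\<close>)

text \<open>Take a denominator of \<open>g\<close> of least degree and make it monic. Its derivative
  also clears the denominator of \<open>g\<close> but has smaller degree, hence vanishes, and then
  so does the derivative of the numerator.\<close>

lemma lift_der_constants:
  fixes g :: "'a::field poly fract"
  assumes S: "\<And>D. D \<in> S \<Longrightarrow> derivation D" and g: "\<And>D. D \<in> S \<Longrightarrow> lift_der D g = 0"
  obtains p q where "q \<noteq> 0" "g = to_fract p / to_fract q"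
    "\<And>D n. D \<in> S \<Longrightarrow> D (coeff p n) = 0" "\<And>D n. D \<in> S \<Longrightarrow> D (coeff q n) = 0"
proof -
  let ?P = "\<lambda>n. \<exists>q p. q \<noteq> 0 \<and> g * to_fract q = to_fract p \<and> degree q = n"
  have "\<exists>n. ?P n"
  proof -
    obtain p q where "g = to_fract p / to_fract q" "q \<noteq> 0" by (rule fract_cases_to_fract)
    then have "g * to_fract q = to_fract p" by simp
    then show ?thesis using \<open>q \<noteq> 0\<close> by auto
  qed
  then have "?P (Least ?P)" by (rule LeastI_ex)
  then obtain q1 p1 where q1: "q1 \<noteq> 0" "g * to_fract q1 = to_fract p1" "degree q1 = Least ?P" by auto
  have min: "q = 0" if "g * to_fract q = to_fract p" "degree q < degree q1" for p q
    using not_less_Least[of "degree q" ?P] that unfolding q1(3) by auto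
  define c where "c = inverse (lead_coeff q1)"
  define q where "q = smult c q1"
  define p where "p = smult c p1"
  have c: "c \<noteq> 0" using q1(1) by (simp add: c_def)
  have "c * lead_coeff q1 = 1" using \<open>q1 \<noteq> 0\<close> by (simp add: c_def)
  then have q: "q \<noteq> 0" "lead_coeff q = 1" "degree q = degree q1"
    using \<open>q1 \<noteq> 0\<close> c unfolding q_def by (auto simp: lead_coeff_smult simp del: lead_coeff_smult)
  have "to_fract q = to_fract [:c:] * to_fract q1" "to_fract p = to_fract [:c:] * to_fract p1"
    by (simp_all add: q_def p_def flip: to_fract_mult)
  then have gq: "g * to_fract q = to_fract p" using q1(2) by (simp add: mult.left_commute)
  have Dq: "map_poly D q = 0" "map_poly D p = 0" if D: "D \<in> S" for D
  proof -
    note d = S[OF D] and d' = derivation_lift_der[OF S[OF D]]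
    have "lift_der D (g * to_fract q) = lift_der D (to_fract p)" using gq by simp
    then have e: "g * to_fract (map_poly D q) = to_fract (map_poly D p)"
      using g[OF D] by (simp add: der_mult[OF d'] lift_der_to_fract[OF d])
    have "coeff (map_poly D q) (degree q1) = 0"
      using q by (simp add: coeff_map_poly_der[OF d] der_1[OF d])
    then have "map_poly D q = 0 \<or> degree (map_poly D q) < degree q1"
      using degree_map_poly_der[OF d, of q] q(3) eq_zero_or_degree_less by metis
    then show "map_poly D q = 0" using min[OF e] by blast
    then show "map_poly D p = 0" using e by simp
  qed
  show thesis
  proof (rule that[of q p])
    show "q \<noteq> 0" by (rule q(1))
    show "g = to_fract p / to_fract q" using gq q(1) by (simp add: field_simps)
    show "D (coeff p n) = 0" "D (coeff q n) = 0" if "D \<in> S" for D n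
      using Dq[OF that] coeff_map_poly_der[OF S[OF that]] by (metis coeff_0)+
  qed
qed

text \<open>For \<open>k = 0\<close> this is the local ring of functions regular at
  \<open>a\<close>; in general it is the \<open>k\<close>-th power of its maximal ideal.\<close>

definition vanish_at :: "'a::field \<Rightarrow> nat \<Rightarrow> 'a poly fract set" where
  "vanish_at a k = {to_fract ([:- a, 1:] ^ k * p) / to_fract q |p q. poly q a \<noteq> 0}"

lemma vanish_atI: "poly q a \<noteq> 0 \<Longrightarrow> x * to_fract q = to_fract ([:- a, 1:] ^ k * p) \<Longrightarrow> x \<in> vanish_at a k"
proof -
  assume q: "poly q a \<noteq> 0" and "x * to_fract q = to_fract ([:- a, 1:] ^ k * p)"
  moreover have "q \<noteq> 0" using q by auto
  ultimately have "x = to_fract ([:- a, 1:] ^ k * p) / to_fract q" by (simp add: eq_divide_eq)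
  then show ?thesis using q unfolding vanish_at_def by blast
qed

lemma vanish_atE:
  assumes "x \<in> vanish_at a k"
  obtains p q where "poly q a \<noteq> 0" "q \<noteq> 0" "x * to_fract q = to_fract ([:- a, 1:] ^ k * p)"
    "x = to_fract ([:- a, 1:] ^ k * p) / to_fract q"
proof -
  obtain p q where *: "x = to_fract ([:- a, 1:] ^ k * p) / to_fract q" "poly q a \<noteq> 0"
    using assms unfolding vanish_at_def by blast
  then have "q \<noteq> 0" by auto
  then show thesis using that[of q p] * by simp
qed

lemma vanish_at_add:
  assumes "x \<in> vanish_at a k" "y \<in> vanish_at a k"
  shows "x + y \<in> vanish_at a k"
proof -
  obtain p q where x: "poly q a \<noteq> 0" "x * to_fract q = to_fract ([:- a, 1:] ^ k * p)" by (rule vanish_atE[OF assms(1)])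
  obtain p' q' where y: "poly q' a \<noteq> 0" "y * to_fract q' = to_fract ([:- a, 1:] ^ k * p')" by (rule vanish_atE[OF assms(2)])
  have "(x + y) * to_fract (q * q') = x * to_fract q * to_fract q' + y * to_fract q' * to_fract q"
    by (simp add: algebra_simps)
  also have "\<dots> = to_fract ([:- a, 1:] ^ k * (p * q' + p' * q))"
    unfolding x y by (simp add: algebra_simps del: to_fract_mult flip: to_fract_mult to_fract_add)
  finally show ?thesis using x(1) y(1) by (intro vanish_atI[where q = "q * q'" and p = "p * q' + p' * q"]) auto
qed

lemma vanish_at_mult:
  assumes "x \<in> vanish_at a k" "y \<in> vanish_at a l"
  shows "x * y \<in> vanish_at a (k + l)"
proof -
  obtain p q where x: "poly q a \<noteq> 0" "x * to_fract q = to_fract ([:- a, 1:] ^ k * p)" by (rule vanish_atE[OF assms(1)])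
  obtain p' q' where y: "poly q' a \<noteq> 0" "y * to_fract q' = to_fract ([:- a, 1:] ^ l * p')" by (rule vanish_atE[OF assms(2)])
  have "(x * y) * to_fract (q * q') = (x * to_fract q) * (y * to_fract q')" by (simp add: algebra_simps)
  also have "\<dots> = to_fract ([:- a, 1:] ^ (k + l) * (p * p'))"
    unfolding x y by (simp add: algebra_simps power_add del: to_fract_mult flip: to_fract_mult)
  finally show ?thesis using x(1) y(1) by (intro vanish_atI[where q = "q * q'" and p = "p * p'"]) auto
qed

lemma vanish_at_mono:
  assumes "x \<in> vanish_at a k" "l \<le> k"
  shows "x \<in> vanish_at a l"
proof -
  obtain p q where x: "poly q a \<noteq> 0" "x * to_fract q = to_fract ([:- a, 1:] ^ k * p)" by (rule vanish_atE[OF assms(1)])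
  have "[:- a, 1:] ^ k * p = [:- a, 1:] ^ l * ([:- a, 1:] ^ (k - l) * p)"
    using assms(2) by (simp add: power_add[symmetric] mult.assoc[symmetric])
  then show ?thesis using x by (intro vanish_atI[where q = q and p = "[:- a, 1:] ^ (k - l) * p"]) auto
qed

lemma vanish_at_to_fract: "to_fract p \<in> vanish_at a 0"
  by (rule vanish_atI[of 1]) auto

lemma vanish_at_to_fract_root:
  assumes "poly p a = 0" shows "to_fract p \<in> vanish_at a 1"
proof -
  obtain q where "p = [:- a, 1:] * q" using assms by (auto simp: poly_eq_0_iff_dvd elim: dvdE)
  then show ?thesis by (intro vanish_atI[of 1 _ _ _ q]) auto
qed

lemma vanish_at_inverse:
  assumes "poly p a \<noteq> 0" shows "inverse (to_fract p) \<in> vanish_at a 0"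
proof -
  have "p \<noteq> 0" using assms by auto
  then show ?thesis using assms by (intro vanish_atI[of p _ _ _ 1]) auto
qed

lemma vanish_at_0: "0 \<in> vanish_at a k"
  by (rule vanish_atI[of 1 _ _ _ 0]) auto

lemma vanish_at_1: "1 \<in> vanish_at a 0"
  using vanish_at_to_fract[of 1 a] by simp

lemma vanish_at_uminus: "x \<in> vanish_at a k \<Longrightarrow> - x \<in> vanish_at a k"
  using vanish_at_mult[of "to_fract (- 1)" a 0 x k] vanish_at_to_fract[of "- 1" a] by simp

lemma vanish_at_diff: "x \<in> vanish_at a k \<Longrightarrow> y \<in> vanish_at a k \<Longrightarrow> x - y \<in> vanish_at a k"
  using vanish_at_add[OF _ vanish_at_uminus] by fastforce

lemma vanish_at_mult0: "x \<in> vanish_at a 0 \<Longrightarrow> y \<in> vanish_at a k \<Longrightarrow> x * y \<in> vanish_at a k"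
  using vanish_at_mult[of x a 0 y k] by simp

lemma vanish_at_sum: "(\<And>i. i \<in> A \<Longrightarrow> f i \<in> vanish_at a k) \<Longrightarrow> sum f A \<in> vanish_at a k"
  by (induction A rule: infinite_finite_induct) (auto simp: vanish_at_0 vanish_at_add)

lemma vanish_at_prod: "(\<And>i. i \<in> A \<Longrightarrow> f i \<in> vanish_at a (k i)) \<Longrightarrow> prod f A \<in> vanish_at a (sum k A)"
  by (induction A rule: infinite_finite_induct) (auto simp: vanish_at_1 vanish_at_mult)

lemma vanish_at_dvd:
  assumes "to_fract p \<in> vanish_at a k" shows "[:- a, 1:] ^ k dvd p"
proof -
  obtain r q where q: "poly q a \<noteq> 0" "to_fract p * to_fract q = to_fract ([:- a, 1:] ^ k * r)"
    by (rule vanish_atE[OF assms])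
  have e: "p * q = [:- a, 1:] ^ k * r" using q(2) by (simp only: to_fract_eq_iff flip: to_fract_mult)
  show ?thesis
  proof (cases "p = 0")
    case False
    then have "p * q \<noteq> 0" using q by auto
    then have "k \<le> order a (p * q)" using e order_divides[of a k "p * q"] by (metis dvd_triv_left)
    moreover have "order a (p * q) = order a p"
      using q order_mult[OF \<open>p * q \<noteq> 0\<close>] by (simp add: order_0I)
    ultimately show ?thesis by (simp add: order_divides)
  qed simp
qed

lemma vanish_at_eval:
  assumes "poly q a \<noteq> 0" "to_fract p / to_fract q \<in> vanish_at a 1"
  shows "poly p a = 0"
proof -
  have "q \<noteq> 0" using assms by auto
  then have "to_fract p = to_fract q * (to_fract p / to_fract q)" by simp
  then have "to_fract p \<in> vanish_at a 1" using vanish_at_mult0[OF vanish_at_to_fract assms(2)] by metis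
  from vanish_at_dvd[OF this] show ?thesis by (simp add: poly_eq_0_iff_dvd)
qed

text \<open>As \<open>D\<close> kills \<open>a\<close>, it kills the linear factor
  \<open>[:- a, 1:]\<close>, whose power therefore survives differentiation undiminished. This is
  why all places are chosen among constants.\<close>

lemma vanish_at_lift_der:
  assumes D: "derivation D" and a: "D a = 0" and x: "x \<in> vanish_at a k"
  shows "lift_der D x \<in> vanish_at a k"
proof -
  note d = derivation_lift_der[OF D] and m = derivation_map_poly[OF D]
  obtain p q where q: "poly q a \<noteq> 0" "q \<noteq> 0" "x = to_fract ([:- a, 1:] ^ k * p) / to_fract q"
    by (rule vanish_atE[OF x])
  have l: "map_poly D [:- a, 1:] = 0"
    using a by (simp add: map_poly_der_pCons[OF D] der_minus[OF D] der_1[OF D])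
  then have "map_poly D ([:- a, 1:] ^ k) = 0" by (simp add: der_power[OF m])
  then have "map_poly D ([:- a, 1:] ^ k * p) = [:- a, 1:] ^ k * map_poly D p" by (simp add: der_mult[OF m])
  then have "lift_der D x = to_fract ([:- a, 1:] ^ k * (map_poly D p * q - p * map_poly D q)) / to_fract (q\<^sup>2)"
    unfolding q(3) using q(2)
    by (simp add: derivation_divide[OF d] lift_der_to_fract[OF D] del: to_fract_mult)
      (simp add: power2_eq_square algebra_simps)
  then show ?thesis using q
    by (intro vanish_atI[where q = "q\<^sup>2" and p = "map_poly D p * q - p * map_poly D q"]) auto
qed

section \<open>Fraction fields as Euclidean rings of characteristic zero\<close>

instantiation fract ::
  (idom) "{unique_euclidean_ring, normalization_euclidean_semiring, normalization_semidom_multiplicative}"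
begin

definition [simp]: "normalize_fract = (normalize_field :: 'a fract \<Rightarrow> _)"
definition [simp]: "unit_factor_fract = (unit_factor_field :: 'a fract \<Rightarrow> _)"
definition [simp]: "modulo_fract = (mod_field :: 'a fract \<Rightarrow> _)"
definition [simp]: "euclidean_size_fract = (euclidean_size_field :: 'a fract \<Rightarrow> _)"
definition [simp]: "division_segment (x :: 'a fract) = 1"

instance
  by standard (simp_all add: dvd_field_iff field_split_simps split: if_splits)

end

instantiation fract :: (idom) euclidean_ring_gcd
begin

definition gcd_fract :: "'a fract \<Rightarrow> 'a fract \<Rightarrow> 'a fract" where "gcd_fract = Euclidean_Algorithm.gcd"
definition lcm_fract :: "'a fract \<Rightarrow> 'a fract \<Rightarrow> 'a fract" where "lcm_fract = Euclidean_Algorithm.lcm"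
definition Gcd_fract :: "'a fract set \<Rightarrow> 'a fract" where "Gcd_fract = Euclidean_Algorithm.Gcd"
definition Lcm_fract :: "'a fract set \<Rightarrow> 'a fract" where "Lcm_fract = Euclidean_Algorithm.Lcm"

instance by standard (simp_all add: gcd_fract_def lcm_fract_def Gcd_fract_def Lcm_fract_def)

end

instance fract :: (idom) field_gcd ..

instance fract :: ("{idom, ring_char_0}") field_char_0
proof
  show "inj (of_nat :: nat \<Rightarrow> 'a fract)"
  proof (rule injI)
    fix m n :: nat assume "(of_nat m :: 'a fract) = of_nat n"
    then have "to_fract (of_nat m :: 'a) = to_fract (of_nat n)"
      by (simp add: rhom_of_nat[OF rhom_to_fract])
    then show "m = n" by simp
  qed
qed

section \<open>Evaluation of forms\<close>

definition mon_val :: "('i \<Rightarrow>\<^sub>0 nat) \<Rightarrow> ('i \<Rightarrow> 'b::comm_ring_1) \<Rightarrow> 'b" where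
  "mon_val m v = (\<Prod>i\<in>Poly_Mapping.keys m. v i ^ Poly_Mapping.lookup m i)"

text \<open>Coefficients and points live in different rings: the equation of the surface is given
  over the rational functions, its generic point over a larger field.\<close>

definition ev_hom :: "('a \<Rightarrow> 'b) \<Rightarrow> ('i, 'a::comm_ring_1) mpoly \<Rightarrow> ('i \<Rightarrow> 'b::comm_ring_1) \<Rightarrow> 'b" where
  "ev_hom h f v = (\<Sum>m\<in>Poly_Mapping.keys f. h (Poly_Mapping.lookup f m) * mon_val m v)"

lemma mpoly_eval_ev_hom: "mpoly_eval f v = ev_hom (\<lambda>x. x) f v"
  by (simp add: mpoly_eval_def ev_hom_def mon_val_def)

lemma mon_val_superset:
  assumes "finite A" "Poly_Mapping.keys m \<subseteq> A"
  shows "mon_val m v = (\<Prod>i\<in>A. v i ^ Poly_Mapping.lookup m i)"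
  unfolding mon_val_def using assms by (intro prod.mono_neutral_left) (auto simp: in_keys_iff)

lemma mon_val_add: "mon_val (m + m') v = mon_val m v * mon_val m' v"
proof -
  let ?A = "Poly_Mapping.keys m \<union> Poly_Mapping.keys m'"
  have "mon_val (m + m') v = (\<Prod>i\<in>?A. v i ^ Poly_Mapping.lookup (m + m') i)"
    using keys_add[of m m'] by (intro mon_val_superset) auto
  then show ?thesis
    by (simp add: mon_val_superset[of ?A] lookup_add power_add prod.distrib)
qed

lemma mon_val_0: "mon_val 0 v = 1"
  by (simp add: mon_val_def)

lemma mon_val_single: "mon_val (Poly_Mapping.single i n) v = v i ^ n"
  by (simp add: mon_val_def)

lemma mon_val_hom: "rhom g \<Longrightarrow> g (mon_val m v) = mon_val m (\<lambda>i. g (v i))"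
  by (simp add: mon_val_def rhom_prod rhom_power)

lemma ev_hom_hom: "rhom g \<Longrightarrow> g (ev_hom h f v) = ev_hom (\<lambda>x. g (h x)) f (\<lambda>i. g (v i))"
  by (simp add: ev_hom_def rhom_sum rhom_mult mon_val_hom)

lemma mpoly_as_sum: "f = (\<Sum>m\<in>Poly_Mapping.keys f. Poly_Mapping.single m (Poly_Mapping.lookup f m))"
proof (rule poly_mapping_eqI)
  fix k
  show "Poly_Mapping.lookup f k =
      Poly_Mapping.lookup (\<Sum>m\<in>Poly_Mapping.keys f. Poly_Mapping.single m (Poly_Mapping.lookup f m)) k"
    by (simp add: lookup_sum lookup_single when_def in_keys_iff)
qed

context
  fixes h :: "'a::comm_ring_1 \<Rightarrow> 'b::comm_ring_1"
  assumes h: "rhom h"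
begin

lemma ev_hom_superset:
  assumes "finite A" "Poly_Mapping.keys f \<subseteq> A"
  shows "ev_hom h f v = (\<Sum>m\<in>A. h (Poly_Mapping.lookup f m) * mon_val m v)"
  unfolding ev_hom_def using assms
  by (intro sum.mono_neutral_left) (auto simp: in_keys_iff rhom_0[OF h])

lemma ev_hom_add: "ev_hom h (f + g) v = ev_hom h f v + ev_hom h g v"
proof -
  let ?A = "Poly_Mapping.keys f \<union> Poly_Mapping.keys g"
  have "ev_hom h (f + g) v = (\<Sum>m\<in>?A. h (Poly_Mapping.lookup (f + g) m) * mon_val m v)"
    using keys_add[of f g] by (intro ev_hom_superset) auto
  then show ?thesis
    by (simp add: ev_hom_superset[of ?A] lookup_add rhom_add[OF h] sum.distrib algebra_simps)
qed

lemma ev_hom_0: "ev_hom h 0 v = 0"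
  by (simp add: ev_hom_def)

lemma ev_hom_sum: "ev_hom h (sum f A) v = (\<Sum>i\<in>A. ev_hom h (f i) v)"
  by (induction A rule: infinite_finite_induct) (auto simp: ev_hom_0 ev_hom_add)

lemma ev_hom_single: "ev_hom h (Poly_Mapping.single m c) v = h c * mon_val m v"
  by (simp add: ev_hom_def rhom_0[OF h])

lemma ev_hom_mult: "ev_hom h (f * g) v = ev_hom h f v * ev_hom h g v"
proof -
  have "f * g = (\<Sum>m\<in>Poly_Mapping.keys f. \<Sum>n\<in>Poly_Mapping.keys g.
      Poly_Mapping.single (m + n) (Poly_Mapping.lookup f m * Poly_Mapping.lookup g n))"
    by (subst (1) mpoly_as_sum[of f], subst (1) mpoly_as_sum[of g])
       (simp add: sum_product mult_single)
  then have "ev_hom h (f * g) v = (\<Sum>m\<in>Poly_Mapping.keys f. \<Sum>n\<in>Poly_Mapping.keys g.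
      h (Poly_Mapping.lookup f m * Poly_Mapping.lookup g n) * mon_val (m + n) v)"
    by (simp add: ev_hom_sum ev_hom_single)
  also have "\<dots> = ev_hom h f v * ev_hom h g v"
    by (simp add: ev_hom_def sum_product mon_val_add rhom_mult[OF h] algebra_simps)
  finally show ?thesis .
qed

lemma rhom_ev_hom: "rhom (\<lambda>f. ev_hom h f v)"
  unfolding rhom_def using ev_hom_single[of 0 1 v]
  by (auto simp: ev_hom_add ev_hom_mult mon_val_0 rhom_1[OF h])

end

definition mconst :: "'a \<Rightarrow> ('i, 'a::comm_ring_1) mpoly" where
  "mconst c = Poly_Mapping.single 0 c"

definition mvar :: "'i \<Rightarrow> ('i, 'a::comm_ring_1) mpoly" where
  "mvar i = Poly_Mapping.single (Poly_Mapping.single i 1) 1"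

lemma rhom_mconst: "rhom mconst"
  by (auto simp: rhom_def mconst_def single_add mult_single)

lemma mon_val_mvar: "mon_val m mvar = Poly_Mapping.single m (1::'a::comm_ring_1)"
proof -
  have pow: "mvar i ^ n = Poly_Mapping.single (Poly_Mapping.single i n) (1::'a)" for i :: 'b and n
    by (induction n) (simp_all add: mvar_def mult_single flip: single_add)
  have "(\<Prod>i\<in>A. Poly_Mapping.single (Poly_Mapping.single i (Poly_Mapping.lookup m i)) (1::'a)) =
     Poly_Mapping.single (\<Sum>i\<in>A. Poly_Mapping.single i (Poly_Mapping.lookup m i)) 1" for A
    by (induction A rule: infinite_finite_induct) (auto simp: mult_single)
  moreover have "(\<Sum>i\<in>Poly_Mapping.keys m. Poly_Mapping.single i (Poly_Mapping.lookup m i)) = m"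
    by (rule poly_mapping_eqI) (simp add: lookup_sum lookup_single when_def in_keys_iff)
  ultimately show ?thesis by (simp add: mon_val_def pow)
qed

lemma ev_hom_mvar: "ev_hom mconst f mvar = f"
  using mpoly_as_sum[of f]
  by (simp add: ev_hom_def mon_val_mvar mconst_def mult_single)

lemma ev_hom_const: "rhom h \<Longrightarrow> ev_hom h (mconst c) v = h c"
  by (simp add: mconst_def ev_hom_single mon_val_0)

lemma ev_hom_var: "rhom h \<Longrightarrow> ev_hom h (mvar i) v = v i"
  by (simp add: mvar_def ev_hom_single mon_val_single rhom_1)

lemma mon_val_scale: "mon_val m (\<lambda>i. c * v i) = c ^ (\<Sum>i\<in>Poly_Mapping.keys m. Poly_Mapping.lookup m i) * mon_val m v"
  by (simp add: mon_val_def power_mult_distrib prod.distrib power_sum)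

lemma ev_hom_scale:
  assumes "is_form I d f"
  shows "ev_hom h f (\<lambda>i. c * v i) = c ^ d * ev_hom h f v"
  using assms unfolding is_form_def ev_hom_def sum_distrib_left
  by (intro sum.cong) (auto simp: mon_val_scale)

lemma mpoly_eval_scale:
  fixes f :: "('i, 'a::comm_ring_1) mpoly"
  shows "is_form I d f \<Longrightarrow> mpoly_eval f (\<lambda>i. c * v i) = c ^ d * mpoly_eval f v"
  by (simp add: mpoly_eval_ev_hom ev_hom_scale)

text \<open>The value at \<open>v\<close> of the partial derivative of \<open>f\<close> in the
  variable \<open>i\<close>, with coefficients carried along \<open>h\<close>.\<close>

definition ev_pd :: "('a \<Rightarrow> 'b) \<Rightarrow> ('i, 'a::comm_ring_1) mpoly \<Rightarrow> ('i \<Rightarrow> 'b::comm_ring_1) \<Rightarrow> 'i \<Rightarrow> 'b" where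
  "ev_pd h f v i = (\<Sum>m\<in>Poly_Mapping.keys f. h (Poly_Mapping.lookup f m) *
     (if i \<in> Poly_Mapping.keys m then of_nat (Poly_Mapping.lookup m i) * v i ^ (Poly_Mapping.lookup m i - 1) *
        (\<Prod>j\<in>Poly_Mapping.keys m - {i}. v j ^ Poly_Mapping.lookup m j) else 0))"

lemma der_prod:
  assumes "derivation D" "finite A"
  shows "D (prod f A) = (\<Sum>i\<in>A. D (f i) * prod f (A - {i}))"
  using assms(2)
proof (induction A rule: finite_induct)
  case empty then show ?case using der_1[OF assms(1)] by simp
next
  case (insert a A)
  have "(\<Sum>i\<in>A. D (f i) * prod f (insert a A - {i})) = f a * (\<Sum>i\<in>A. D (f i) * prod f (A - {i}))"
    unfolding sum_distrib_left
  proof (intro sum.cong refl)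
    fix i assume "i \<in> A"
    then have "insert a A - {i} = insert a (A - {i})" using insert by auto
    then show "D (f i) * prod f (insert a A - {i}) = f a * (D (f i) * prod f (A - {i}))"
      using insert by (simp add: algebra_simps)
  qed
  then show ?case using insert by (simp add: der_mult[OF assms(1)] algebra_simps)
qed

lemma der_ev_hom:
  fixes D :: "'b::comm_ring_1 \<Rightarrow> 'b" and f :: "('i::finite, 'a::comm_ring_1) mpoly"
  assumes D: "derivation D" and h: "\<And>c. D (h c) = 0"
  shows "D (ev_hom h f v) = (\<Sum>i\<in>UNIV. ev_pd h f v i * D (v i))"
proof -
  let ?l = Poly_Mapping.lookup and ?k = Poly_Mapping.keys
  have m: "D (mon_val m v) = (\<Sum>i\<in>UNIV. (if i \<in> ?k m then of_nat (?l m i) * v i ^ (?l m i - 1) *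
        (\<Prod>j\<in>?k m - {i}. v j ^ ?l m j) else 0) * D (v i))" for m
  proof -
    have "D (mon_val m v) = (\<Sum>i\<in>?k m. D (v i ^ ?l m i) * (\<Prod>j\<in>?k m - {i}. v j ^ ?l m j))"
      unfolding mon_val_def by (rule der_prod[OF D]) simp
    also have "\<dots> = (\<Sum>i\<in>?k m. (if i \<in> ?k m then of_nat (?l m i) * v i ^ (?l m i - 1) *
        (\<Prod>j\<in>?k m - {i}. v j ^ ?l m j) else 0) * D (v i))"
      by (intro sum.cong) (auto simp: der_power[OF D] algebra_simps)
    also have "\<dots> = (\<Sum>i\<in>UNIV. (if i \<in> ?k m then of_nat (?l m i) * v i ^ (?l m i - 1) *
        (\<Prod>j\<in>?k m - {i}. v j ^ ?l m j) else 0) * D (v i))"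
      by (intro sum.mono_neutral_left) auto
    finally show ?thesis .
  qed
  have "D (ev_hom h f v) = (\<Sum>m\<in>?k f. h (?l f m) * D (mon_val m v))"
    by (simp add: ev_hom_def der_sum[OF D] der_mult[OF D] h)
  also have "\<dots> = (\<Sum>i\<in>UNIV. \<Sum>m\<in>?k f. h (?l f m) * ((if i \<in> ?k m then of_nat (?l m i) * v i ^ (?l m i - 1) *
        (\<Prod>j\<in>?k m - {i}. v j ^ ?l m j) else 0) * D (v i)))"
    by (simp only: m sum_distrib_left) (rule sum.swap)
  also have "\<dots> = (\<Sum>i\<in>UNIV. ev_pd h f v i * D (v i))"
    by (simp only: ev_pd_def sum_distrib_right mult.assoc)
  finally show ?thesis .
qed

lemma ev_pd_hom:
  assumes "rhom g" shows "g (ev_pd h f v i) = ev_pd (\<lambda>x. g (h x)) f (\<lambda>i. g (v i)) i"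
proof -
  have "g (if b then x else 0) = (if b then g x else 0)" for b x using rhom_0[OF assms] by simp
  then show ?thesis
    by (simp add: ev_pd_def rhom_sum[OF assms] rhom_mult[OF assms] rhom_of_nat[OF assms]
      rhom_power[OF assms] rhom_prod[OF assms] cong: if_cong)
qed

lemma subring_set_closed:
  assumes "subring_set A"
  shows "0 \<in> A" "1 \<in> A" "x \<in> A \<Longrightarrow> y \<in> A \<Longrightarrow> x + y \<in> A" "x \<in> A \<Longrightarrow> y \<in> A \<Longrightarrow> x * y \<in> A"
    "x \<in> A \<Longrightarrow> - x \<in> A" "x \<in> A \<Longrightarrow> y \<in> A \<Longrightarrow> x - y \<in> A"
proof -
  show 1: "1 \<in> A" using assms by (simp add: subring_set_def)
  have d: "x - y \<in> A" if "x \<in> A" "y \<in> A" for x y using assms that by (simp add: subring_set_def)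
  show 0: "0 \<in> A" using d[OF 1 1] by simp
  have m: "- x \<in> A" if "x \<in> A" for x using d[OF 0 that] by simp
  show "x \<in> A \<Longrightarrow> y \<in> A \<Longrightarrow> x + y \<in> A" using d[OF _ m, of x y] by simp
  show "x \<in> A \<Longrightarrow> - x \<in> A" by (rule m)
  show "x \<in> A \<Longrightarrow> y \<in> A \<Longrightarrow> x - y \<in> A" by (rule d)
  show "x \<in> A \<Longrightarrow> y \<in> A \<Longrightarrow> x * y \<in> A" using assms by (simp add: subring_set_def)
qed

lemma subring_set_sum: "subring_set A \<Longrightarrow> (\<And>i. i \<in> I \<Longrightarrow> f i \<in> A) \<Longrightarrow> sum f I \<in> A"
  by (induction I rule: infinite_finite_induct) (auto simp: subring_set_closed)

lemma subring_set_prod: "subring_set A \<Longrightarrow> (\<And>i. i \<in> I \<Longrightarrow> f i \<in> A) \<Longrightarrow> prod f I \<in> A"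
  by (induction I rule: infinite_finite_induct) (auto simp: subring_set_closed)

lemma subring_set_power: "subring_set A \<Longrightarrow> x \<in> A \<Longrightarrow> x ^ n \<in> A"
  by (induction n) (auto simp: subring_set_closed)

lemma subring_set_of_nat: "subring_set A \<Longrightarrow> of_nat n \<in> A"
  by (induction n) (auto simp: subring_set_closed)

lemma ev_pd_in_subring:
  assumes "subring_set A" "\<And>m. m \<in> Poly_Mapping.keys f \<Longrightarrow> h (Poly_Mapping.lookup f m) \<in> A" "\<And>i. v i \<in> A"
  shows "ev_pd h f v i \<in> A"
  unfolding ev_pd_def
  using assms by (auto intro!: subring_set_sum subring_set_prod subring_set_closed(4) subring_set_power
    subring_set_of_nat subring_set_closed(1))

definition ev_poly :: "('a::comm_ring_1 \<Rightarrow> 'b::comm_ring_1) \<Rightarrow> 'b \<Rightarrow> 'a poly \<Rightarrow> 'b" where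
  "ev_poly h y p = poly (map_poly h p) y"

lemma rhom_ev_poly: "rhom h \<Longrightarrow> rhom (ev_poly h y)"
  unfolding ev_poly_def by (rule rhom_poly_eval)

lemma ev_poly_const: "rhom h \<Longrightarrow> ev_poly h y [:c:] = h c"
  by (simp add: ev_poly_def map_poly_rhom_pCons)

lemma ev_poly_X: "rhom h \<Longrightarrow> ev_poly h y [:0, 1:] = y"
  by (simp add: ev_poly_def map_poly_rhom_pCons rhom_0 rhom_1)

lemma ev_poly_pCons: "rhom h \<Longrightarrow> ev_poly h y (pCons c p) = h c + y * ev_poly h y p"
  by (simp add: ev_poly_def map_poly_rhom_pCons)

lemma rhom_poly_eqI:
  assumes "rhom g" "rhom h" "\<And>c. g [:c:] = h [:c:]" "g [:0, 1:] = h [:0, 1:]"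
  shows "g p = h p"
proof (induction p)
  case 0 then show ?case using assms by (simp add: rhom_0)
next
  case (pCons c p)
  have "pCons c p = [:c:] + [:0, 1:] * p" by simp
  then show ?case using assms pCons by (simp only: rhom_add rhom_mult)
qed

text \<open>A relation \<open>ev_poly h y p = 0\<close> is differentiated by \<open>D\<close>, which
  kills the image of \<open>h\<close>. What remains is \<open>D y\<close> times the value of
  \<open>pderiv p\<close>, so a relation of smaller degree; the induction ends with a
  constant.\<close>

lemma ev_poly_injective:
  fixes h :: "'a::{idom, ring_char_0} \<Rightarrow> 'b::idom"
  assumes h: "rhom h" "inj h" and D: "derivation D" "\<And>a. D (h a) = 0" and y: "D y \<noteq> 0"
  shows "inj (ev_poly h y)"
proof -
  have "p = 0" if "ev_poly h y p = 0" for p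
    using that
  proof (induction "degree p" arbitrary: p rule: less_induct)
    case less
    have "D (ev_poly h y p) = poly (map_poly D (map_poly h p)) y + poly (pderiv (map_poly h p)) y * D y"
      unfolding ev_poly_def by (rule der_poly[OF D(1)])
    also have "map_poly D (map_poly h p) = 0"
      by (rule poly_eqI) (simp add: coeff_map_poly_der[OF D(1)] coeff_map_poly_rhom[OF h(1)] D(2))
    finally have e: "ev_poly h y (pderiv p) = 0"
      using less.prems y der_0[OF D(1)] by (simp add: map_poly_rhom_pderiv[OF h(1)] ev_poly_def)
    show ?case
    proof (cases "degree p = 0")
      case True
      then obtain a where a: "p = [:a:]" by (auto elim: degree_eq_zeroE)
      then have "h a = h 0" using less.prems by (simp add: ev_poly_const[OF h(1)] rhom_0[OF h(1)])
      then show ?thesis using a h(2) by (simp add: inj_eq)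
    next
      case False
      then have "pderiv p = 0" using less.hyps[OF _ e] by (simp add: degree_pderiv)
      then show ?thesis using False by (simp add: pderiv_eq_0_iff)
    qed
  qed
  then show ?thesis using rhom_diff[OF rhom_ev_poly[OF h(1)]]
    by (intro injI) (metis eq_iff_diff_eq_0)
qed

section \<open>Monomials on an irreducible surface\<close>

type_synonym 'k poly4 = "'k poly poly poly poly"

definition vec4 :: "'a \<Rightarrow> 'a \<Rightarrow> 'a \<Rightarrow> 'a \<Rightarrow> 4 \<Rightarrow> 'a" where
  "vec4 a b c d i = (if i = 1 then a else if i = 2 then b else if i = 3 then c else d)"

lemma vec4_simps [simp]: "vec4 a b c d 1 = a" "vec4 a b c d 2 = b" "vec4 a b c d 3 = c" "vec4 a b c d 4 = d"
  by (simp_all add: vec4_def)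

lemma fun_eq_4: "f = g \<longleftrightarrow> f (1::4) = g 1 \<and> f 2 = g 2 \<and> f 3 = g 3 \<and> f 4 = g 4"
  using forall_4[of "\<lambda>i. f i = g i"] by (simp add: fun_eq_iff)

definition const4 :: "'k::comm_ring_1 \<Rightarrow> 'k poly4" where "const4 k = [:[:[:[:k:]:]:]:]"
definition Y1 :: "'k::comm_ring_1 poly4" where "Y1 = [:[:[:[:0, 1:]:]:]:]"
definition Y2 :: "'k::comm_ring_1 poly4" where "Y2 = [:[:[:0, 1:]:]:]"
definition Y3 :: "'k::comm_ring_1 poly4" where "Y3 = [:[:0, 1:]:]"
definition Y4 :: "'k::comm_ring_1 poly4" where "Y4 = [:0, 1:]"

definition ev3 :: "('k::comm_ring_1 \<Rightarrow> 'b::comm_ring_1) \<Rightarrow> 'b \<Rightarrow> 'b \<Rightarrow> 'b \<Rightarrow> 'k poly poly poly \<Rightarrow> 'b" where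
  "ev3 h a b c = ev_poly (ev_poly (ev_poly h a) b) c"

definition ev4 :: "('k::comm_ring_1 \<Rightarrow> 'b::comm_ring_1) \<Rightarrow> 'b \<Rightarrow> 'b \<Rightarrow> 'b \<Rightarrow> 'b \<Rightarrow> 'k poly4 \<Rightarrow> 'b" where
  "ev4 h a b c d = ev_poly (ev3 h a b c) d"

lemma rhom_const4: "rhom const4"
  by (auto simp: rhom_def const4_def one_pCons)

lemma rhom_ev3: "rhom h \<Longrightarrow> rhom (ev3 h a b c)"
  by (simp add: ev3_def rhom_ev_poly)

lemma rhom_ev4: "rhom h \<Longrightarrow> rhom (ev4 h a b c d)"
  by (simp add: ev4_def rhom_ev3 rhom_ev_poly)

lemma ev4_simps:
  assumes "rhom h"
  shows "ev4 h a b c d (const4 k) = h k" "ev4 h a b c d Y1 = a" "ev4 h a b c d Y2 = b"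
    "ev4 h a b c d Y3 = c" "ev4 h a b c d Y4 = d"
  using assms
  by (simp_all add: ev4_def ev3_def const4_def Y1_def Y2_def Y3_def Y4_def ev_poly_const ev_poly_X rhom_ev_poly)

lemma rhom_poly4_eqI:
  assumes g: "rhom g" and h: "rhom h" and c: "\<And>k. g (const4 k) = h (const4 k)"
    and "g Y1 = h Y1" "g Y2 = h Y2" "g Y3 = h Y3" "g Y4 = h Y4"
  shows "g p = h p"
proof (rule rhom_poly_eqI[OF g h])
  have r: "rhom (\<lambda>x. f [:x:])" if "rhom f" for f :: "'x::comm_ring_1 poly \<Rightarrow> 'y::comm_ring_1"
    using rhom_comp[OF that rhom_const_poly] by (simp add: comp_def)
  show "g [:q:] = h [:q:]" for q
  proof (rule rhom_poly_eqI[OF r[OF g] r[OF h]])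
    show "g [:[:q:]:] = h [:[:q:]:]" for q
    proof (rule rhom_poly_eqI[OF r[OF r[OF g]] r[OF r[OF h]]])
      show "g [:[:[:q:]:]:] = h [:[:[:q:]:]:]" for q
        using rhom_poly_eqI[OF r[OF r[OF r[OF g]]] r[OF r[OF r[OF h]]]] assms
        by (simp add: const4_def Y1_def)
    qed (use assms in \<open>simp add: Y2_def\<close>)
  qed (use assms in \<open>simp add: Y3_def\<close>)
qed (use assms in \<open>simp add: Y4_def\<close>)

text \<open>For \<open>c 4 = 1\<close> the new coordinates move the point \<open>c\<close> to
  \<open>(0, 0, 0, 1)\<close>. Iterated univariate polynomials replace \<open>mpoly\<close> because
  Gauss's lemma concerns one variable over a factorial ring; \<open>Y4\<close> is the outermost
  variable, so \<open>degree\<close> is the degree in \<open>Y4\<close>.\<close>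

definition subst4 :: "(4 \<Rightarrow> 'k) \<Rightarrow> 4 \<Rightarrow> 'k::comm_ring_1 poly4" where
  "subst4 c = vec4 (Y1 + const4 (c 1) * Y4) (Y2 + const4 (c 2) * Y4) (Y3 + const4 (c 3) * Y4) Y4"

definition to_poly4 :: "(4 \<Rightarrow> 'k) \<Rightarrow> (4, 'k) mpoly \<Rightarrow> 'k::comm_ring_1 poly4" where
  "to_poly4 c F = ev_hom const4 F (subst4 c)"

definition of_poly4 :: "(4 \<Rightarrow> 'k) \<Rightarrow> 'k::comm_ring_1 poly4 \<Rightarrow> (4, 'k) mpoly" where
  "of_poly4 c = ev4 mconst (mvar 1 - mconst (c 1) * mvar 4) (mvar 2 - mconst (c 2) * mvar 4)
     (mvar 3 - mconst (c 3) * mvar 4) (mvar 4)"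

lemma rhom_to_poly4: "rhom (to_poly4 c)"
  unfolding to_poly4_def by (rule rhom_ev_hom[OF rhom_const4])

lemma rhom_of_poly4: "rhom (of_poly4 c)"
  unfolding of_poly4_def by (rule rhom_ev4[OF rhom_mconst])

lemma of_poly4_simps:
  "of_poly4 c (const4 k) = mconst k" "of_poly4 c Y1 = mvar 1 - mconst (c 1) * mvar 4"
  "of_poly4 c Y2 = mvar 2 - mconst (c 2) * mvar 4" "of_poly4 c Y3 = mvar 3 - mconst (c 3) * mvar 4"
  "of_poly4 c Y4 = mvar 4"
  by (simp_all add: of_poly4_def ev4_simps[OF rhom_mconst])

lemma of_poly4_to_poly4: "of_poly4 c (to_poly4 c F) = F"
proof -
  have "of_poly4 c (to_poly4 c F) = ev_hom (\<lambda>x. of_poly4 c (const4 x)) F (\<lambda>i. of_poly4 c (subst4 c i))"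
    unfolding to_poly4_def by (rule ev_hom_hom[OF rhom_of_poly4])
  also have "(\<lambda>i. of_poly4 c (subst4 c i)) = mvar"
    by (simp add: fun_eq_4 subst4_def rhom_add[OF rhom_of_poly4] rhom_mult[OF rhom_of_poly4] of_poly4_simps)
  finally show ?thesis by (simp add: of_poly4_simps ev_hom_mvar)
qed

lemma to_poly4_of_poly4: "to_poly4 c (of_poly4 c p) = p"
proof (rule rhom_poly4_eqI[where g = "\<lambda>p. to_poly4 c (of_poly4 c p)" and h = "\<lambda>p. p"])
  show "rhom (\<lambda>p. to_poly4 c (of_poly4 c p))"
    using rhom_comp[OF rhom_to_poly4 rhom_of_poly4] by (simp add: comp_def)
  note r = rhom_diff[OF rhom_to_poly4] rhom_mult[OF rhom_to_poly4]
  have v: "to_poly4 c (mvar i) = subst4 c i" "to_poly4 c (mconst k) = const4 k" for i k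
    by (simp_all add: to_poly4_def ev_hom_var[OF rhom_const4] ev_hom_const[OF rhom_const4])
  show "to_poly4 c (of_poly4 c (const4 k)) = const4 k" for k by (simp add: of_poly4_simps v)
  show "to_poly4 c (of_poly4 c Y1) = Y1" "to_poly4 c (of_poly4 c Y2) = Y2"
    "to_poly4 c (of_poly4 c Y3) = Y3" "to_poly4 c (of_poly4 c Y4) = Y4"
    by (simp_all add: of_poly4_simps v r subst4_def)
qed (rule rhom_id)

lemma irreducible_to_poly4:
  assumes "irreducible F" shows "irreducible (to_poly4 c F)"
proof (rule irreducibleI)
  note t = of_poly4_to_poly4[of c]
  show "to_poly4 c F \<noteq> 0"
  proof
    assume "to_poly4 c F = 0"
    then have "F = 0" using t[of F] rhom_0[OF rhom_of_poly4, of c] by simp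
    then show False using assms by simp
  qed
  have unit: "of_poly4 c p dvd 1" if "p dvd 1" for p
  proof -
    from that obtain q where "1 = p * q" by (elim dvdE)
    then have "1 = of_poly4 c p * of_poly4 c q"
      using rhom_mult[OF rhom_of_poly4, of c p q] rhom_1[OF rhom_of_poly4, of c] by simp
    then show ?thesis by (rule dvdI)
  qed
  show "\<not> to_poly4 c F dvd 1" using unit[of "to_poly4 c F"] t[of F] assms by (auto simp: irreducible_def)
  fix a b assume ab: "to_poly4 c F = a * b"
  then have "F = of_poly4 c a * of_poly4 c b" using t[of F] rhom_mult[OF rhom_of_poly4, of c a b] by simp
  then have "of_poly4 c a dvd 1 \<or> of_poly4 c b dvd 1" using assms by (auto simp: irreducible_def)
  moreover have "p dvd 1" if "of_poly4 c p dvd 1" for p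
  proof -
    from that obtain q where "1 = of_poly4 c p * q" by (elim dvdE)
    then have "1 = p * to_poly4 c q"
      using rhom_mult[OF rhom_to_poly4, of c "of_poly4 c p" q] rhom_1[OF rhom_to_poly4, of c]
      by (simp add: to_poly4_of_poly4)
    then show ?thesis by (rule dvdI)
  qed
  ultimately show "a dvd 1 \<or> b dvd 1" by blast
qed

text \<open>Setting \<open>Y1\<close>, \<open>Y2\<close>, \<open>Y3\<close> to zero turns the form
  into \<open>F(c)\<close> times the \<open>d\<close>-th power of \<open>Y4\<close>, since
  \<open>c\<close> has become the point \<open>(0, 0, 0, 1)\<close>.\<close>

lemma degree_to_poly4:
  fixes F :: "(4, 'k::field) mpoly"
  assumes "is_form UNIV d F" "ev_hom (\<lambda>x. x) F c \<noteq> 0" "c 4 = 1"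
  shows "degree (to_poly4 c F) \<ge> d"
proof -
  define e :: "'k poly poly poly \<Rightarrow> 'k" where "e = ev3 (\<lambda>x. x) 0 0 0"
  have e: "rhom e" unfolding e_def by (rule rhom_ev3[OF rhom_id])
  note m = rhom_map_poly[OF e]
  have ec: "e [:[:[:k:]:]:] = k" "e [:[:[:0, 1:]:]:] = 0" "e [:[:0, 1:]:] = 0" "e [:0, 1:] = 0" for k
    by (simp_all add: e_def ev3_def ev_poly_const ev_poly_X rhom_ev_poly rhom_id)
  have s: "map_poly e (const4 k) = [:k:]" "map_poly e Y1 = 0" "map_poly e Y2 = 0" "map_poly e Y3 = 0"
     "map_poly e Y4 = [:0, 1:]" for k
    by (simp_all add: const4_def Y1_def Y2_def Y3_def Y4_def map_poly_rhom_pCons[OF e] rhom_0[OF e] rhom_1[OF e] ec)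
  have "map_poly e (to_poly4 c F) = ev_hom (\<lambda>x. map_poly e (const4 x)) F (\<lambda>i. map_poly e (subst4 c i))"
    unfolding to_poly4_def by (rule ev_hom_hom[OF m])
  also have "(\<lambda>i. map_poly e (subst4 c i)) = (\<lambda>i. [:0, 1:] * [:c i:])"
    using assms(3) by (simp add: fun_eq_4 subst4_def rhom_add[OF m] rhom_mult[OF m] s)
  also have "ev_hom (\<lambda>x. map_poly e (const4 x)) F (\<lambda>i. [:0, 1:] * [:c i:]) = [:0, 1:] ^ d * ev_hom (\<lambda>x. [:x:]) F (\<lambda>i. [:c i:])"
    by (simp only: ev_hom_scale[OF assms(1)] s)
  also have "ev_hom (\<lambda>x. [:x:]) F (\<lambda>i. [:c i:]) = [:ev_hom (\<lambda>x. x) F c:]"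
    using ev_hom_hom[OF rhom_const_poly, of "\<lambda>x. x" F c] by simp
  finally have "map_poly e (to_poly4 c F) = [:0, 1:] ^ d * [:ev_hom (\<lambda>x. x) F c:]" .
  then have "degree (map_poly e (to_poly4 c F)) = d"
    using assms(2) by (simp add: degree_mult_eq degree_power_eq)
  moreover have "degree (map_poly e (to_poly4 c F)) \<le> degree (to_poly4 c F)"
    by (rule degree_le) (simp add: coeff_map_poly_rhom[OF e] coeff_eq_0 rhom_0[OF e])
  ultimately show ?thesis by simp
qed

text \<open>By Gauss's lemma \<open>P\<close> stays irreducible over the fraction field, so there it
  is coprime to every nonzero \<open>Q\<close> of smaller degree. Evaluating a Bezout identity at
  \<open>y\<close> would give \<open>0 = 1\<close>; injectivity of \<open>h\<close> extends the
  evaluation to fractions.\<close>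

lemma no_relation_of_low_degree:
  fixes P Q :: "'a::{idom_divide, factorial_ring_gcd, semiring_gcd_mult_normalize} poly" and h :: "'a \<Rightarrow> 'b::field"
  assumes P: "irreducible P" and h: "rhom h" "inj h"
    and P0: "ev_poly h y P = 0" and Q0: "ev_poly h y Q = 0" and deg: "degree Q < degree P"
  shows "Q = 0"
proof (rule ccontr)
  assume Q: "Q \<noteq> 0"
  have irr: "irreducible (fract_poly P)" using P deg nonconst_poly_irreducible_iff[of P] by simp
  have degf: "degree (fract_poly R) = degree R" for R :: "'a poly"
    by (rule degree_map_poly) simp
  have "\<not> fract_poly P dvd fract_poly Q"
    using dvd_imp_degree_le[of "fract_poly P" "fract_poly Q"] Q deg by (auto simp: degf)
  then have "coprime (fract_poly P) (fract_poly Q)"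
    using irr by (metis coprimeI dvd_trans irreducibleD')
  then obtain a b where ab: "a * fract_poly P + b * fract_poly Q = 1"
    by (metis bezout_coefficients_fst_snd coprime_iff_gcd_eq_1)
  define e where "e = ev_poly (fract_hom h) y"
  have re: "rhom e" unfolding e_def by (intro rhom_ev_poly rhom_fract_hom h)
  have ef: "e (fract_poly R) = ev_poly h y R" for R
    unfolding e_def ev_poly_def by (simp add: map_poly_map_poly o_def fract_hom_to_fract[OF h] rhom_0[OF rhom_fract_hom[OF h]])
  have "e (a * fract_poly P + b * fract_poly Q) = 0"
    by (simp add: rhom_add[OF re] rhom_mult[OF re] ef P0 Q0)
  then show False using ab rhom_1[OF re] by simp
qed

context
  fixes F :: "(4, 'k::{field_gcd, field_char_0}) mpoly" and kk :: "'k \<Rightarrow> 'b::field_char_0"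
    and c :: "4 \<Rightarrow> 'k" and y1 y2 y3 y4 :: 'b and d :: nat
  assumes F: "irreducible F" "is_form UNIV d F" "d > 0" and kk: "rhom kk"
    and c: "c 4 = 1" "ev_hom (\<lambda>x. x) F c \<noteq> 0"
    and x0: "ev_hom kk F (vec4 (y1 + kk (c 1) * y4) (y2 + kk (c 2) * y4) (y3 + kk (c 3) * y4) y4) = 0"
    and solve: "\<And>v1 v2 v3. \<exists>D. derivation D \<and> (\<forall>k. D (kk k) = 0) \<and> D y1 = v1 \<and> D y2 = v2 \<and> D y3 = v3"
begin

text \<open>Derivations with triangular values on \<open>y1\<close>, \<open>y2\<close>,
  \<open>y3\<close> show that these are algebraically independent over the base field, one variable
  at a time.\<close>

lemma inj_ev3_of_derivations: "inj (ev3 kk y1 y2 y3)"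
proof -
  obtain D1 where D1: "derivation D1" "\<And>k. D1 (kk k) = 0" "D1 y1 = 1" using solve[of 1 0 0] by metis
  obtain D2 where D2: "derivation D2" "\<And>k. D2 (kk k) = 0" "D2 y1 = 0" "D2 y2 = 1" using solve[of 0 1 0] by metis
  obtain D3 where D3: "derivation D3" "\<And>k. D3 (kk k) = 0" "D3 y1 = 0" "D3 y2 = 0" "D3 y3 = 1" using solve[of 0 0 1] by metis
  have ker: "D (ev_poly h y p) = 0"
    if "derivation D" "rhom h" "\<And>a. D (h a) = 0" "D y = 0" for D :: "'b \<Rightarrow> 'b" and h :: "'z::comm_ring_1 \<Rightarrow> 'b" and y p
    by (induction p) (simp_all add: ev_poly_pCons that rhom_0[OF rhom_ev_poly] der_0 der_add der_mult)
  have i1: "inj (ev_poly kk y1)" by (rule ev_poly_injective[OF kk rhom_inj[OF kk] D1(1,2)]) (simp add: D1)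
  have i2: "inj (ev_poly (ev_poly kk y1) y2)"
    by (rule ev_poly_injective[OF rhom_ev_poly[OF kk] i1 D2(1) ker[OF D2(1) kk D2(2,3)]]) (simp add: D2)
  show ?thesis unfolding ev3_def
    by (rule ev_poly_injective[OF rhom_ev_poly[OF rhom_ev_poly[OF kk]] i2 D3(1)
        ker[OF D3(1) rhom_ev_poly[OF kk] ker[OF D3(1) kk D3(2,3)] D3(4)]]) (simp add: D3)
qed

lemma ev4_to_poly4:
  "ev4 kk y1 y2 y3 y4 (to_poly4 c F) = 0"
proof -
  note r = rhom_ev4[OF kk, of y1 y2 y3 y4]
  have "ev4 kk y1 y2 y3 y4 (to_poly4 c F) =
      ev_hom (\<lambda>x. ev4 kk y1 y2 y3 y4 (const4 x)) F (\<lambda>i. ev4 kk y1 y2 y3 y4 (subst4 c i))"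
    unfolding to_poly4_def by (rule ev_hom_hom[OF r])
  also have "(\<lambda>i. ev4 kk y1 y2 y3 y4 (subst4 c i)) = vec4 (y1 + kk (c 1) * y4) (y2 + kk (c 2) * y4) (y3 + kk (c 3) * y4) y4"
    by (simp add: fun_eq_4 subst4_def rhom_add[OF r] rhom_mult[OF r] ev4_simps[OF kk])
  finally show ?thesis by (simp add: ev4_simps[OF kk] x0)
qed

lemma poly4_no_relation:
  assumes "ev4 kk y1 y2 y3 y4 G = 0" "degree G < degree (to_poly4 c F)"
  shows "G = 0"
  using no_relation_of_low_degree[OF irreducible_to_poly4[OF F(1)] rhom_ev3[OF kk] inj_ev3_of_derivations
      ev4_to_poly4[unfolded ev4_def] assms(1)[unfolded ev4_def] assms(2)] .

text \<open>The sum is the value of the derivative of \<open>to_poly4 c F\<close> in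
  \<open>Y4\<close>. This nonzero polynomial has smaller degree than the irreducible equation, so it
  cannot vanish at a point whose first three coordinates are independent.\<close>

lemma directional_derivative_nonzero:
  "(\<Sum>i\<in>UNIV. ev_pd kk F (vec4 (y1 + kk (c 1) * y4) (y2 + kk (c 2) * y4) (y3 + kk (c 3) * y4) y4) i * kk (c i)) \<noteq> 0"
proof
  note r = rhom_ev4[OF kk, of y1 y2 y3 y4]
  let ?e = "ev4 kk y1 y2 y3 y4" and ?x = "vec4 (y1 + kk (c 1) * y4) (y2 + kk (c 2) * y4) (y3 + kk (c 3) * y4) y4"
  assume z: "(\<Sum>i\<in>UNIV. ev_pd kk F ?x i * kk (c i)) = 0"
  have dp: "derivation (pderiv :: 'k poly4 \<Rightarrow> 'k poly4)"
    by (auto simp: derivation_def pderiv_add pderiv_mult algebra_simps)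
  have "pderiv (to_poly4 c F) = (\<Sum>i\<in>UNIV. ev_pd const4 F (subst4 c) i * pderiv (subst4 c i))"
    unfolding to_poly4_def by (rule der_ev_hom[OF dp]) (simp add: const4_def pderiv_pCons)
  also have "(\<lambda>i. pderiv (subst4 c i)) = (\<lambda>i. const4 (c i))"
    using c by (simp add: fun_eq_4 subst4_def Y1_def Y2_def Y3_def Y4_def const4_def pderiv_pCons pderiv_add one_pCons)
  then have "pderiv (subst4 c i) = const4 (c i)" for i by (rule fun_cong)
  then have "(\<Sum>i\<in>UNIV. ev_pd const4 F (subst4 c) i * pderiv (subst4 c i)) =
      (\<Sum>i\<in>UNIV. ev_pd const4 F (subst4 c) i * const4 (c i))" by simp
  finally have p: "pderiv (to_poly4 c F) = (\<Sum>i\<in>UNIV. ev_pd const4 F (subst4 c) i * const4 (c i))" .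
  have "(\<lambda>i. ?e (subst4 c i)) = ?x"
    by (simp add: fun_eq_4 subst4_def rhom_add[OF r] rhom_mult[OF r] ev4_simps[OF kk])
  then have "?e (ev_pd const4 F (subst4 c) i) = ev_pd kk F ?x i" for i
    by (simp add: ev_pd_hom[OF r] ev4_simps[OF kk])
  then have "?e (pderiv (to_poly4 c F)) = 0"
    using z by (simp add: p rhom_sum[OF r] rhom_mult[OF r] ev4_simps[OF kk])
  moreover have "degree (to_poly4 c F) > 0" using degree_to_poly4[OF F(2) c(2,1)] F(3) by simp
  ultimately have "pderiv (to_poly4 c F) = 0" by (intro poly4_no_relation) (auto simp: degree_pderiv)
  then show False using \<open>degree (to_poly4 c F) > 0\<close> by (simp add: pderiv_eq_0_iff)
qed

text \<open>The equation has degree at least \<open>d\<close> in \<open>Y4\<close>, so a relation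
  whose exponents of \<open>y4\<close> stay below \<open>d\<close> is trivial already as a
  polynomial.\<close>

lemma monomials_independent:
  assumes J: "finite J" "\<And>l i j k. (l, i, j, k) \<in> J \<Longrightarrow> k < d"
    and rel: "(\<Sum>(l, i, j, k)\<in>J. kk (\<kappa> (l, i, j, k)) * (y1 ^ l * y2 ^ i * y3 ^ j * y4 ^ k)) = 0"
    and t: "t \<in> J"
  shows "\<kappa> t = 0"
proof -
  note r = rhom_ev4[OF kk, of y1 y2 y3 y4]
  define G :: "'k poly4" where "G = (\<Sum>(l, i, j, k)\<in>J. monom (monom (monom (monom (\<kappa> (l, i, j, k)) l) i) j) k)"
  have ev_monom: "ev_poly h y (monom a n) = h a * y ^ n" if "rhom h" for h :: "'z::comm_ring_1 \<Rightarrow> 'y::comm_ring_1" and y a n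
    using that by (simp add: ev_poly_def map_poly_monom rhom_0 poly_monom)
  have "ev4 kk y1 y2 y3 y4 G = 0"
    using rel unfolding G_def rhom_sum[OF r]
    by (simp add: case_prod_beta ev4_def ev3_def ev_monom kk rhom_ev_poly mult.assoc)
  moreover have "degree G < degree (to_poly4 c F)"
  proof -
    have "degree G \<le> d - 1" unfolding G_def
    proof (rule degree_sum_le[OF J(1)])
      fix p assume "p \<in> J"
      then show "degree (case p of (l, i, j, k) \<Rightarrow> monom (monom (monom (monom (\<kappa> (l, i, j, k)) l) i) j) k) \<le> d - 1"
        using J(2) by (cases p) (fastforce intro!: order_trans[OF degree_monom_le])
    qed
    then show ?thesis using degree_to_poly4[OF F(2) c(2,1)] F(3) by simp
  qed
  ultimately have "G = 0" by (rule poly4_no_relation)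
  obtain l i j k where t': "t = (l, i, j, k)" by (cases t) auto
  have "0 = coeff (coeff (coeff (coeff G k) j) i) l" using \<open>G = 0\<close> by simp
  also have "\<dots> = (\<Sum>p\<in>J. if p = t then \<kappa> t else 0)"
    unfolding G_def coeff_sum by (intro sum.cong) (auto simp: t' split: if_splits)
  also have "\<dots> = \<kappa> t" using t J(1) by simp
  finally show ?thesis by simp
qed

end

section \<open>Determinants\<close>

text \<open>The size \<open>N\<close> arises inside proofs and varies, so the Leibniz formula over
  \<open>{..<N}\<close> is used instead of matrices indexed by a finite type.\<close>

definition det_n :: "nat \<Rightarrow> (nat \<Rightarrow> nat \<Rightarrow> 'a::comm_ring_1) \<Rightarrow> 'a" where
  "det_n N A = (\<Sum>p | p permutes {..<N}. of_int (sign p) * (\<Prod>i<N. A i (p i)))"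

lemma rhom_of_int:
  assumes "rhom h" shows "h (of_int n) = of_int n"
proof (cases n rule: int_cases2)
  case (nonneg m) then show ?thesis using rhom_of_nat[OF assms] by simp
next
  case (nonpos m) then show ?thesis using rhom_of_nat[OF assms] rhom_minus[OF assms] by simp
qed

lemma det_n_hom: "rhom h \<Longrightarrow> h (det_n N A) = det_n N (\<lambda>i j. h (A i j))"
  by (simp add: det_n_def rhom_sum rhom_mult rhom_of_int rhom_prod)

text \<open>Expansion along the last row. The cofactors \<open>c\<close> depend only on the earlier
  rows, so one \<open>c\<close> serves every later choice of the last row.\<close>

lemma det_n_Suc:
  obtains c where "\<forall>A'. (\<forall>i j. i < N \<longrightarrow> A' i j = A i j) \<longrightarrow> det_n (Suc N) A' = (\<Sum>j<Suc N. A' N j * c j)"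
    and "c N = det_n N A"
proof -
  let ?P = "{p. p permutes {..<Suc N}}"
  let ?c = "\<lambda>j. \<Sum>p\<in>{p\<in>?P. p N = j}. of_int (sign p) * (\<Prod>i<N. A i (p i))"
  have 1: "det_n (Suc N) A' = (\<Sum>j<Suc N. A' N j * ?c j)" if A': "\<And>i j. i < N \<Longrightarrow> A' i j = A i j" for A'
  proof -
    have "det_n (Suc N) A' = (\<Sum>p\<in>?P. A' N (p N) * (of_int (sign p) * (\<Prod>i<N. A i (p i))))"
      unfolding det_n_def using A' by (intro sum.cong) (auto simp: algebra_simps)
    also have "\<dots> = (\<Sum>j<Suc N. \<Sum>p\<in>{p\<in>?P. p N = j}. A' N (p N) * (of_int (sign p) * (\<Prod>i<N. A i (p i))))"
      by (rule sum.group[symmetric]) (auto simp: finite_permutations permutes_in_image dest: permutes_in_image[of _ "{..<Suc N}" N])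
    also have "\<dots> = (\<Sum>j<Suc N. A' N j * ?c j)"
      unfolding sum_distrib_left by (intro sum.cong refl) auto
    finally show ?thesis .
  qed
  have "{p\<in>?P. p N = N} = {p. p permutes {..<N}}"
  proof (intro equalityI subsetI)
    fix p assume p: "p \<in> {p\<in>?P. p N = N}"
    have "p permutes {..<N}"
      by (rule permutes_superset[of p "{..<Suc N}"]) (use p in \<open>auto simp: less_Suc_eq\<close>)
    then show "p \<in> {p. p permutes {..<N}}" by simp
  next
    fix p assume p: "p \<in> {p. p permutes {..<N}}"
    then show "p \<in> {p\<in>?P. p N = N}"
      using permutes_not_in[of p "{..<N}" N] permutes_subset[of p "{..<N}" "{..<Suc N}"] by auto
  qed
  then have "?c N = det_n N A" by (simp add: det_n_def)
  with 1 show thesis by (intro that[of ?c]) simp_all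
qed

text \<open>Rows are chosen greedily. The cofactors of the row to be added have a nonzero last
  entry, so they are no linear relation among the functions, and some \<theta> in \<open>W\<close>
  makes the enlarged determinant nonzero.\<close>

lemma det_n_select:
  fixes f :: "nat \<Rightarrow> 'w \<Rightarrow> 'a::field"
  assumes "\<And>c. (\<And>\<theta>. \<theta> \<in> W \<Longrightarrow> (\<Sum>j<N. c j * f j \<theta>) = 0) \<Longrightarrow> (\<And>j. j < N \<Longrightarrow> c j = 0)"
  shows "\<exists>\<theta>s. (\<forall>i<N. \<theta>s i \<in> W) \<and> det_n N (\<lambda>i j. f j (\<theta>s i)) \<noteq> 0"
  using assms
proof (induction N)
  case 0 then show ?case by (simp add: det_n_def)
next
  case (Suc N)
  have "\<exists>\<theta>s. (\<forall>i<N. \<theta>s i \<in> W) \<and> det_n N (\<lambda>i j. f j (\<theta>s i)) \<noteq> 0"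
  proof (rule Suc.IH)
    fix c j assume c: "\<And>\<theta>. \<theta> \<in> W \<Longrightarrow> (\<Sum>j<N. c j * f j \<theta>) = 0" and j: "j < N"
    have "(\<Sum>j<Suc N. (if j < N then c j else 0) * f j \<theta>) = 0" if "\<theta> \<in> W" for \<theta>
      using c[OF that] by simp
    from Suc.prems[of "\<lambda>j. if j < N then c j else 0", OF this, of j] have "(if j < N then c j else 0) = 0"
      using j by simp
    then show "c j = 0" using j by simp
  qed
  then obtain \<theta>s where t: "\<And>i. i < N \<Longrightarrow> \<theta>s i \<in> W" and nz: "det_n N (\<lambda>i j. f j (\<theta>s i)) \<noteq> 0" by auto
  obtain c where c: "\<forall>A'. (\<forall>i j. i < N \<longrightarrow> A' i j = f j (\<theta>s i)) \<longrightarrow> det_n (Suc N) A' = (\<Sum>j<Suc N. A' N j * c j)"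
    and cN: "c N = det_n N (\<lambda>i j. f j (\<theta>s i))"
    by (rule det_n_Suc[of N "\<lambda>i j. f j (\<theta>s i)"])
  have "\<exists>\<theta>\<in>W. (\<Sum>j<Suc N. c j * f j \<theta>) \<noteq> 0"
  proof (rule ccontr)
    assume "\<not> (\<exists>\<theta>\<in>W. (\<Sum>j<Suc N. c j * f j \<theta>) \<noteq> 0)"
    then have "c N = 0" using Suc.prems[of c N] by auto
    then show False using cN nz by simp
  qed
  then obtain \<theta> where th: "\<theta> \<in> W" "(\<Sum>j<Suc N. c j * f j \<theta>) \<noteq> 0" by blast
  define \<theta>' where "\<theta>' i = (if i < N then \<theta>s i else \<theta>)" for i
  have "det_n (Suc N) (\<lambda>i j. f j (\<theta>' i)) = (\<Sum>j<Suc N. f j (\<theta>' N) * c j)"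
    by (rule c[rule_format]) (simp add: \<theta>'_def)
  also have "\<dots> = (\<Sum>j<Suc N. c j * f j \<theta>)" by (intro sum.cong) (auto simp: \<theta>'_def)
  finally show ?case using th t by (intro exI[of _ \<theta>']) (auto simp: \<theta>'_def)
qed

lemma det_n_equal_rows:
  fixes A :: "nat \<Rightarrow> nat \<Rightarrow> 'a::{idom, ring_char_0}"
  assumes ik: "i < N" "k < N" "i \<noteq> k" and eq: "\<And>j. A i j = A k j"
  shows "det_n N A = 0"
proof -
  define t where "t = Transposition.transpose i k"
  have t: "t permutes {..<N}" unfolding t_def using ik by (intro permutes_swap_id) auto
  have "det_n N A = (\<Sum>p | p permutes {..<N}. of_int (sign (p \<circ> t)) * (\<Prod>l<N. A l ((p \<circ> t) l)))"
    unfolding det_n_def by (rule sum_permutations_compose_right[OF t])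
  also have "\<dots> = (\<Sum>p | p permutes {..<N}. - (of_int (sign p) * (\<Prod>l<N. A l (p l))))"
  proof (intro sum.cong refl)
    fix p assume "p \<in> {p. p permutes {..<N}}"
    then have p: "p permutes {..<N}" by simp
    have "sign (p \<circ> t) = - sign p"
      using sign_compose[of p t] permutation_permutes[of p] permutation_permutes[of t] p t finite_lessThan ik
      by (auto simp: t_def sign_swap_id)
    moreover have "(\<Prod>l<N. A l ((p \<circ> t) l)) = (\<Prod>l<N. A (t l) (p l))"
    proof -
      have "(\<Prod>l<N. A l ((p \<circ> t) l)) = (\<Prod>l\<in>t ` {..<N}. A (t l) ((p \<circ> t) (t l)))"
        by (subst permutes_image[OF t]) (rule prod.reindex_bij_betw[OF permutes_imp_bij[OF t], symmetric])
      also have "\<dots> = (\<Prod>l<N. A (t l) (p l))" unfolding permutes_image[OF t] by (simp add: t_def)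
      finally show ?thesis .
    qed
    moreover have "A (t l) j = A l j" for l j
      using eq by (simp add: t_def Transposition.transpose_def)
    ultimately show "of_int (sign (p \<circ> t)) * (\<Prod>l<N. A l ((p \<circ> t) l)) = - (of_int (sign p) * (\<Prod>l<N. A l (p l)))"
      by simp
  qed
  also have "\<dots> = - det_n N A" by (simp add: det_n_def sum_negf)
  finally have "2 * det_n N A = 0" by simp
  then show ?thesis by simp
qed

lemma det_n_expand_rows:
  assumes "finite S"
  shows "det_n N (\<lambda>i j. \<Sum>\<alpha>\<in>S. C i \<alpha> * R \<alpha> j) =
    (\<Sum>g\<in>{..<N} \<rightarrow>\<^sub>E S. (\<Prod>i<N. C i (g i)) * det_n N (\<lambda>i. R (g i)))"
proof -
  have "det_n N (\<lambda>i j. \<Sum>\<alpha>\<in>S. C i \<alpha> * R \<alpha> j) = (\<Sum>p | p permutes {..<N}. of_int (sign p) *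
      (\<Sum>g\<in>{..<N} \<rightarrow>\<^sub>E S. \<Prod>i<N. C i (g i) * R (g i) (p i)))"
    unfolding det_n_def by (intro sum.cong refl) (simp add: prod_sum_PiE assms)
  also have "\<dots> = (\<Sum>p | p permutes {..<N}. \<Sum>g\<in>{..<N} \<rightarrow>\<^sub>E S. (\<Prod>i<N. C i (g i)) * (of_int (sign p) * (\<Prod>i<N. R (g i) (p i))))"
    by (simp add: sum_distrib_left prod.distrib algebra_simps)
  also have "\<dots> = (\<Sum>g\<in>{..<N} \<rightarrow>\<^sub>E S. \<Sum>p | p permutes {..<N}. (\<Prod>i<N. C i (g i)) * (of_int (sign p) * (\<Prod>i<N. R (g i) (p i))))"
    by (rule sum.swap)
  also have "\<dots> = (\<Sum>g\<in>{..<N} \<rightarrow>\<^sub>E S. (\<Prod>i<N. C i (g i)) * det_n N (\<lambda>i. R (g i)))"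
    by (simp add: det_n_def sum_distrib_left)
  finally show ?thesis .
qed

text \<open>In the multilinear expansion a choice \<open>g\<close> that repeats an index gives two
  equal rows. The remaining choices use \<open>N\<close> distinct elements of \<open>S\<close>,
  whose total weight is at least \<open>W\<close>.\<close>

lemma det_n_vanish_at:
  fixes R :: "'s \<Rightarrow> nat \<Rightarrow> 'a::field_char_0 poly fract"
  assumes "finite S" and C: "\<And>i \<alpha>. i < N \<Longrightarrow> \<alpha> \<in> S \<Longrightarrow> C i \<alpha> \<in> vanish_at a (w \<alpha>)"
    and R: "\<And>\<alpha> j. \<alpha> \<in> S \<Longrightarrow> j < N \<Longrightarrow> R \<alpha> j \<in> vanish_at a 0"
    and W: "\<And>T. T \<subseteq> S \<Longrightarrow> card T = N \<Longrightarrow> W \<le> sum w T"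
  shows "det_n N (\<lambda>i j. \<Sum>\<alpha>\<in>S. C i \<alpha> * R \<alpha> j) \<in> vanish_at a W"
  unfolding det_n_expand_rows[OF assms(1)]
proof (rule vanish_at_sum)
  fix g assume g: "g \<in> {..<N} \<rightarrow>\<^sub>E S"
  show "(\<Prod>i<N. C i (g i)) * det_n N (\<lambda>i. R (g i)) \<in> vanish_at a W"
  proof (cases "inj_on g {..<N}")
    case True
    have "(\<Prod>i<N. C i (g i)) \<in> vanish_at a (\<Sum>i<N. w (g i))"
      by (rule vanish_at_prod) (use g in \<open>auto intro!: C\<close>)
    moreover have "(\<Sum>i<N. w (g i)) = sum w (g ` {..<N})" using True by (simp add: sum.reindex)
    moreover have "W \<le> sum w (g ` {..<N})"
      by (rule W) (use g True in \<open>auto simp: card_image\<close>)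
    ultimately have "(\<Prod>i<N. C i (g i)) \<in> vanish_at a W" using vanish_at_mono by metis
    moreover have "det_n N (\<lambda>i. R (g i)) \<in> vanish_at a 0"
      unfolding det_n_def
    proof (intro vanish_at_sum vanish_at_mult0)
      fix p assume "p \<in> {p. p permutes {..<N}}"
      then have p: "p i < N" if "i < N" for i using that permutes_in_image[of p "{..<N}" i] by simp
      have "rhom (to_fract :: 'a poly \<Rightarrow> 'a poly fract)" by (rule rhom_to_fract)
      then have "of_int (sign p) = to_fract (of_int (sign p) :: 'a poly)" by (simp add: rhom_of_int)
      then show "of_int (sign p) \<in> vanish_at a 0" using vanish_at_to_fract by metis
      have "(\<Prod>i<N. R (g i) (p i)) \<in> vanish_at a (\<Sum>i<N. 0)"
        by (rule vanish_at_prod) (use g p in \<open>auto intro!: R\<close>)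
      then show "(\<Prod>i<N. R (g i) (p i)) \<in> vanish_at a 0" by simp
    qed
    ultimately show ?thesis using vanish_at_mult[of _ a W _ 0] by simp
  next
    case False
    then obtain i k where ik: "i < N" "k < N" "i \<noteq> k" "g i = g k" unfolding inj_on_def by blast
    have "det_n N (\<lambda>i. R (g i)) = 0" by (rule det_n_equal_rows[OF ik(1-3)]) (simp add: ik(4))
    then show ?thesis by (simp add: vanish_at_0)
  qed
qed

lemma degree_det_n:
  fixes A :: "nat \<Rightarrow> nat \<Rightarrow> 'a::idom poly"
  assumes "\<And>i j. i < N \<Longrightarrow> j < N \<Longrightarrow> degree (A i j) \<le> m"
  shows "degree (det_n N A) \<le> N * m"
  unfolding det_n_def
proof (rule degree_sum_le)
  show "finite {p. p permutes {..<N}}" by (simp add: finite_permutations)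
  fix p assume "p \<in> {p. p permutes {..<N}}"
  then have p: "p i < N" if "i < N" for i using that permutes_in_image[of p "{..<N}" i] by simp
  have "of_int (sign p) = [:of_int (sign p) :: 'a:]" by (simp add: of_int_poly)
  then have "degree (of_int (sign p) * (\<Prod>i<N. A i (p i))) \<le> degree (\<Prod>i<N. A i (p i))"
    by (simp add: degree_smult_le)
  also have "\<dots> \<le> (\<Sum>i<N. degree (A i (p i)))" using degree_prod_sum_le[of "{..<N}" "\<lambda>i. A i (p i)"] by (simp add: o_def)
  also have "\<dots> \<le> (\<Sum>i<N. m)" by (intro sum_mono assms p) auto
  finally show "degree (of_int (sign p) * (\<Prod>i<N. A i (p i))) \<le> N * m" by simp
qed

text \<open>
  Among \<open>N\<close> distinct monomials in two variables the total degree is at least \<open>kN\<close> minus the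
  sum of \<open>k - |\<alpha>|\<close> over all monomials \<open>\<alpha>\<close> of degree below \<open>k\<close>.
\<close>

lemma sum_triangle: "6 * (\<Sum>l<k. (l + 1) * (k - l)) = k * (k + 1) * (k + 2)" for k :: nat
proof (induction k)
  case (Suc k)
  have "(\<Sum>l<Suc k. (l + 1) * (Suc k - l)) = (\<Sum>l<Suc k. (l + 1) * (k - l) + (l + 1))"
  proof (intro sum.cong refl)
    fix l assume "l \<in> {..<Suc k}"
    then have "Suc k - l = (k - l) + 1" by auto
    then show "(l + 1) * (Suc k - l) = (l + 1) * (k - l) + (l + 1)" by (simp only: distrib_left mult_1_right)
  qed
  also have "\<dots> = (\<Sum>l<k. (l + 1) * (k - l)) + (\<Sum>l<Suc k. l + 1)" by (simp only: sum.distrib) simp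
  finally have e: "(\<Sum>l<Suc k. (l + 1) * (Suc k - l)) = (\<Sum>l<k. (l + 1) * (k - l)) + (\<Sum>l<Suc k. l + 1)" .
  have "2 * (\<Sum>l<Suc k. l + 1) = (k + 1) * (k + 2)" by (induction k) (auto simp: algebra_simps)
  then have "6 * (\<Sum>l<Suc k. l + 1) = 3 * ((k + 1) * (k + 2))" by linarith
  then have "6 * (\<Sum>l<Suc k. (l + 1) * (Suc k - l)) = k * (k + 1) * (k + 2) + 3 * ((k + 1) * (k + 2))"
    unfolding e distrib_left Suc by simp
  then show ?case by (simp add: algebra_simps)
qed simp

lemma sum_weights_ge:
  fixes T :: "(nat \<times> nat) set"
  assumes "finite T"
  shows "6 * k * card T \<le> 6 * (\<Sum>(i, j)\<in>T. i + j) + k * (k + 1) * (k + 2)"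
proof -
  let ?w = "\<lambda>(i, j). i + j :: nat"
  let ?B = "SIGMA l:{..<k}. {..l}"
  \<comment> \<open>As subtraction is truncated, \<open>?w t + (k - ?w t)\<close> is the maximum of
    \<open>?w t\<close> and \<open>k\<close>.\<close>
  have "k * card T \<le> (\<Sum>t\<in>T. ?w t + (k - ?w t))"
    using sum_mono[of T "\<lambda>_. k" "\<lambda>t. ?w t + (k - ?w t)"] by (simp add: mult.commute)
  also have "\<dots> = sum ?w T + (\<Sum>t\<in>T. k - ?w t)" by (simp add: sum.distrib)
  finally have 1: "k * card T \<le> sum ?w T + (\<Sum>t\<in>T. k - ?w t)" .
  have "(\<Sum>t\<in>T. k - ?w t) = (\<Sum>t\<in>{t\<in>T. ?w t < k}. k - ?w t)"
    by (rule sum.mono_neutral_right) (use assms in auto)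
  also have "\<dots> \<le> (\<Sum>t\<in>(\<lambda>(l, i). (i, l - i)) ` ?B. k - ?w t)"
  proof (rule sum_mono2)
    show "{t\<in>T. ?w t < k} \<subseteq> (\<lambda>(l, i). (i, l - i)) ` ?B"
    proof
      fix t assume t: "t \<in> {t\<in>T. ?w t < k}"
      obtain i j where ij: "t = (i, j)" by (cases t)
      then show "t \<in> (\<lambda>(l, i). (i, l - i)) ` ?B" using t by (intro image_eqI[of _ _ "(i + j, i)"]) auto
    qed
  qed auto
  also have "\<dots> = (\<Sum>(l, i)\<in>?B. k - l)"
  proof (subst sum.reindex)
    show "inj_on (\<lambda>(l, i). (i, l - i)) ?B" by (rule inj_onI) auto
    show "sum ((\<lambda>t. k - ?w t) \<circ> (\<lambda>(l, i). (i, l - i))) ?B = (\<Sum>(l, i)\<in>?B. k - l)"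
      by (intro sum.cong refl) auto
  qed
  also have "\<dots> = (\<Sum>l<k. \<Sum>i\<le>l. k - l)" by (subst sum.Sigma) auto
  also have "\<dots> = (\<Sum>l<k. (l + 1) * (k - l))" by simp
  finally have 2: "(\<Sum>t\<in>T. k - ?w t) \<le> (\<Sum>l<k. (l + 1) * (k - l))" .
  have "6 * (k * card T) \<le> 6 * (sum ?w T + (\<Sum>l<k. (l + 1) * (k - l)))"
    using 1 2 by (intro mult_le_mono2) linarith
  then show ?thesis using sum_triangle[of k] by (simp add: algebra_simps)
qed

section \<open>Wronskians and lines\<close>

lemma homogeneous_system_nontrivial:
  fixes A :: "'l \<Rightarrow> 'b \<Rightarrow> 'a::field"
  assumes "finite L" "finite B" "card L < card B"
  shows "\<exists>c. (\<exists>b\<in>B. c b \<noteq> 0) \<and> (\<forall>l\<in>L. (\<Sum>b\<in>B. c b * A l b) = 0)"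
  using assms
proof (induction L arbitrary: B A rule: finite_induct)
  case empty
  then show ?case by (intro exI[of _ "\<lambda>_. 1"]) (auto simp: card_gt_0_iff)
next
  case (insert l0 L)
  show ?case
  proof (cases "\<exists>b\<in>B. A l0 b \<noteq> 0")
    case False
    then show ?thesis using insert.IH[of B A] insert.prems insert.hyps by auto
  next
    case True
    then obtain b0 where b0: "b0 \<in> B" "A l0 b0 \<noteq> 0" by blast
    let ?B = "B - {b0}"
    define A' where "A' l b = A l b - A l b0 / A l0 b0 * A l0 b" for l b
    have "card L < card ?B" using insert.prems insert.hyps b0 by simp
    then obtain c where c: "\<exists>b\<in>?B. c b \<noteq> 0" "\<forall>l\<in>L. (\<Sum>b\<in>?B. c b * A' l b) = 0"
      using insert.IH[of ?B A'] insert.prems(1) by auto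
    define c' where "c' b = (if b = b0 then - (\<Sum>b\<in>?B. c b * A l0 b) / A l0 b0 else c b)" for b
    have s: "(\<Sum>b\<in>B. c' b * A l b) = c' b0 * A l b0 + (\<Sum>b\<in>?B. c b * A l b)" for l
      using b0 insert.prems(1) by (simp add: sum.remove[of B b0] c'_def)
    have "(\<Sum>b\<in>B. c' b * A l0 b) = 0" unfolding s using b0 by (simp add: c'_def)
    moreover have "(\<Sum>b\<in>B. c' b * A l b) = 0" if "l \<in> L" for l
    proof -
      have "(\<Sum>b\<in>?B. c b * A' l b) = (\<Sum>b\<in>?B. c b * A l b) - A l b0 / A l0 b0 * (\<Sum>b\<in>?B. c b * A l0 b)"
        by (simp add: A'_def algebra_simps sum_subtractf sum_distrib_left)
      then show ?thesis unfolding s using c(2) that by (simp add: c'_def)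
    qed
    moreover have "\<exists>b\<in>B. c' b \<noteq> 0" using c(1) by (auto simp: c'_def)
    ultimately show ?thesis by (intro exI[of _ c']) auto
  qed
qed

definition det3 :: "(4 \<Rightarrow> 'a::comm_ring_1) \<Rightarrow> (4 \<Rightarrow> 'a) \<Rightarrow> (4 \<Rightarrow> 'a) \<Rightarrow> 4 \<Rightarrow> 4 \<Rightarrow> 4 \<Rightarrow> 'a" where
  "det3 u v w p q j = u p * (v q * w j - v j * w q) - u q * (v p * w j - v j * w p) + u j * (v p * w q - v q * w p)"

lemma det3_hom: "rhom h \<Longrightarrow> h (det3 u v w p q j) = det3 (\<lambda>i. h (u i)) (\<lambda>i. h (v i)) (\<lambda>i. h (w i)) p q j"
  by (simp add: det3_def rhom_add rhom_diff rhom_mult)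

text \<open>Modulo \<tau> the three rows are multiples of one vector \<open>e\<close>. A term of the
  expansion containing two of these multiples vanishes, so at least two factors \<tau>
  remain.\<close>

lemma det3_common_direction:
  assumes "\<And>i. u i = \<alpha> * e i + \<tau> * u' i" "\<And>i. v i = \<beta> * e i + \<tau> * v' i" "\<And>i. w i = \<gamma> * e i + \<tau> * w' i"
  shows "\<tau>\<^sup>2 dvd det3 u v w p q j"
proof
  show "det3 u v w p q j = \<tau>\<^sup>2 * (\<alpha> * det3 e v' w' p q j + \<beta> * det3 u' e w' p q j + \<gamma> * det3 u' v' e p q j
     + \<tau> * det3 u' v' w' p q j)"
    unfolding det3_def assms by (simp add: algebra_simps power2_eq_square)
qed

lemma degree_det3:
  fixes u v w :: "4 \<Rightarrow> 'a::idom poly"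
  assumes "\<And>i. degree (u i) \<le> m" "\<And>i. degree (v i) \<le> m" "\<And>i. degree (w i) \<le> m"
  shows "degree (det3 u v w p q j) \<le> 3 * m"
proof -
  have 2: "degree (v i * w k) \<le> 2 * m" for i k
    using degree_mult_le[of "v i" "w k"] assms(2)[of i] assms(3)[of k] by linarith
  have "degree (u i * (v k * w l - v l * w k)) \<le> 3 * m" for i k l
    using degree_mult_le[of "u i" "v k * w l - v l * w k"] assms(1)[of i] degree_diff_le[OF 2 2, of k l l k] by linarith
  then show ?thesis unfolding det3_def by (intro degree_add_le degree_diff_le) auto
qed

text \<open>The minor is homogeneous of degree 3 under scaling of \<open>X\<close>, and derivatives
  of the scale factor only add multiples of earlier rows. After division by \<open>X p\<close> the
  first column is \<open>(1, 0, 0)\<close>.\<close>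

lemma wronskian_dehomogenize:
  fixes X :: "4 \<Rightarrow> 'a::field" and p q j :: 4
  assumes d: "derivation \<delta>" and p: "X p \<noteq> 0"
  defines "u \<equiv> X q / X p" and "w \<equiv> X j / X p"
  shows "det3 X (\<lambda>i. \<delta> (X i)) (\<lambda>i. \<delta> (\<delta> (X i))) p q j = X p ^ 3 * (\<delta> u * \<delta> (\<delta> w) - \<delta> w * \<delta> (\<delta> u))"
proof -
  have X: "X q = u * X p" "X j = w * X p" using p by (simp_all add: u_def w_def)
  show ?thesis unfolding det3_def X
    by (simp only: der_mult[OF d] der_add[OF d]) algebra
qed

lemma sum_order_le_degree:
  fixes p :: "'a::field poly"
  assumes "p \<noteq> 0" "finite A"
  shows "(\<Sum>a\<in>A. order a p) \<le> degree p"
proof -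
  have "(\<Sum>a\<in>A. order a p) = (\<Sum>a\<in>A. count (proots p) a)" using assms by simp
  also have "\<dots> = (\<Sum>a\<in>A \<inter> set_mset (proots p). count (proots p) a)"
    using assms(2) by (intro sum.mono_neutral_right) (auto simp: not_in_iff)
  also have "\<dots> \<le> (\<Sum>a\<in>set_mset (proots p). count (proots p) a)" by (intro sum_mono2) auto
  also have "\<dots> = size (proots p)" by (simp add: size_multiset_overloaded_eq)
  also have "\<dots> \<le> degree p" by (rule size_proots_le)
  finally show ?thesis .
qed

text \<open>An element that \<delta> moves is transcendental over the constants of \<delta>:
  differentiating a relation with constant coefficients yields one of smaller degree.\<close>

lemma poly_zero_of_nonconstant_root:
  fixes f :: "'a::field_char_0 poly"
  assumes d: "derivation \<delta>" and f: "map_poly \<delta> f = 0" "poly f u = 0" and u: "\<delta> u \<noteq> 0"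
  shows "f = 0"
  using f
proof (induction "degree f" arbitrary: f rule: less_induct)
  case less
  have "\<delta> (poly f u) = poly (map_poly \<delta> f) u + poly (pderiv f) u * \<delta> u" by (rule der_poly[OF d])
  then have e: "poly (pderiv f) u = 0" using less.prems u der_0[OF d] by simp
  have "\<delta> (coeff f n) = 0" for n using less.prems(1) coeff_map_poly_der[OF d, of f n] by simp
  then have "map_poly \<delta> (pderiv f) = 0"
    by (intro poly_eqI) (simp add: coeff_map_poly_der[OF d] coeff_pderiv der_mult[OF d] der_of_nat[OF d] der_add[OF d] der_1[OF d])
  show ?case
  proof (cases "degree f = 0")
    case True
    then obtain a where "f = [:a:]" by (auto elim: degree_eq_zeroE)
    then show ?thesis using less.prems by simp
  next
    case False
    then have "pderiv f = 0" using less.hyps[of "pderiv f"] e \<open>map_poly \<delta> (pderiv f) = 0\<close> by (simp add: degree_pderiv)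
    then show ?thesis using False by (simp add: pderiv_eq_0_iff)
  qed
qed

text \<open>
  If \<open>X\<close>, \<open>\<delta> X\<close>, \<open>\<delta>\<^sup>2 X\<close> are dependent, the point \<open>X\<close> moves along \<open>\<delta>\<close> on a line whose equations are
  killed by \<open>\<delta>\<close>; a form vanishing at the moving point vanishes on this line.
\<close>

lemma form_vanishes_on_wronskian_line:
  fixes X :: "4 \<Rightarrow> 'b::field_char_0" and F :: "(4, 'k::comm_ring_1) mpoly"
  assumes d: "derivation \<delta>" and kk: "\<And>k. \<delta> (kk k) = 0" and F: "is_form UNIV d F" "ev_hom kk F X = 0"
    and p: "X p \<noteq> 0" and S: "X p * \<delta> (X q) - X q * \<delta> (X p) \<noteq> 0"
    and det: "\<And>j. det3 X (\<lambda>i. \<delta> (X i)) (\<lambda>i. \<delta> (\<delta> (X i))) p q j = 0"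
  shows "ev_hom kk F (\<lambda>i. X i + of_nat n * \<delta> (X i)) = 0"
proof -
  let ?S = "X p * \<delta> (X q) - X q * \<delta> (X p)"
  \<comment> \<open>Cramer's rule for the coordinate \<open>j\<close> in terms of \<open>p\<close>
    and \<open>q\<close>; the vanishing minors extend this relation to the second
    derivatives.\<close>
  define \<alpha> \<beta> where "\<alpha> j = (X j * \<delta> (X q) - X q * \<delta> (X j)) / ?S"
    and "\<beta> j = (X p * \<delta> (X j) - X j * \<delta> (X p)) / ?S" for j
  have X: "X j = \<alpha> j * X p + \<beta> j * X q" for j
    using S by (simp add: \<alpha>_def \<beta>_def add_divide_distrib[symmetric] eq_divide_eq) (simp add: algebra_simps)
  have X1: "\<delta> (X j) = \<alpha> j * \<delta> (X p) + \<beta> j * \<delta> (X q)" for j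
    using S by (simp add: \<alpha>_def \<beta>_def add_divide_distrib[symmetric] eq_divide_eq) (simp add: algebra_simps)
  have X2: "\<delta> (\<delta> (X j)) = \<alpha> j * \<delta> (\<delta> (X p)) + \<beta> j * \<delta> (\<delta> (X q))" for j
  proof -
    have "?S * (\<alpha> j * \<delta> (\<delta> (X p)) + \<beta> j * \<delta> (\<delta> (X q))) =
      (X j * \<delta> (X q) - X q * \<delta> (X j)) * \<delta> (\<delta> (X p)) + (X p * \<delta> (X j) - X j * \<delta> (X p)) * \<delta> (\<delta> (X q))"
      using S by (simp add: \<alpha>_def \<beta>_def distrib_left)
    also have "\<dots> = ?S * \<delta> (\<delta> (X j))" using det[of j] unfolding det3_def by algebra
    finally show ?thesis using S by simp
  qed
  \<comment> \<open>Differentiating the relations for \<open>X\<close> and its first derivative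
    shows that the derivatives of \<alpha> and \<beta> solve a homogeneous system with determinant
    \<open>?S\<close>.\<close>
  have const: "\<delta> (\<alpha> j) = 0 \<and> \<delta> (\<beta> j) = 0" for j
  proof -
    have "\<delta> (X j) = \<alpha> j * \<delta> (X p) + \<delta> (\<alpha> j) * X p + (\<beta> j * \<delta> (X q) + \<delta> (\<beta> j) * X q)"
      by (subst X) (simp add: der_add[OF d] der_mult[OF d])
    then have 1: "\<delta> (\<alpha> j) * X p + \<delta> (\<beta> j) * X q = 0" using X1[of j] by (simp add: algebra_simps)
    have "\<delta> (\<delta> (X j)) = \<alpha> j * \<delta> (\<delta> (X p)) + \<delta> (\<alpha> j) * \<delta> (X p) + (\<beta> j * \<delta> (\<delta> (X q)) + \<delta> (\<beta> j) * \<delta> (X q))"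
      by (subst X1) (simp add: der_add[OF d] der_mult[OF d])
    then have 2: "\<delta> (\<alpha> j) * \<delta> (X p) + \<delta> (\<beta> j) * \<delta> (X q) = 0" using X2[of j] by (simp add: algebra_simps)
    have "\<delta> (\<alpha> j) * ?S = 0" "\<delta> (\<beta> j) * ?S = 0" using 1 2 by algebra+
    then show ?thesis using S by simp
  qed
  \<comment> \<open>The form restricted to the fixed line, in the parameter
    \<open>X q / X p\<close>. Its coefficients are killed by \<delta>, but this root is not.\<close>
  define f where "f = ev_hom (\<lambda>k. [:kk k:]) F (\<lambda>i. [:\<alpha> i, \<beta> i:])"
  have rpoly: "rhom (\<lambda>g. poly g z)" for z :: 'b by (auto simp: rhom_def)
  have fval: "poly f z = ev_hom kk F (\<lambda>i. \<alpha> i + \<beta> i * z)" for z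
    unfolding f_def by (subst ev_hom_hom[OF rpoly[of z]]) (simp add: mult.commute)
  note dm = derivation_map_poly[OF d]
  have "map_poly \<delta> f = (\<Sum>i\<in>UNIV. ev_pd (\<lambda>k. [:kk k:]) F (\<lambda>i. [:\<alpha> i, \<beta> i:]) i * map_poly \<delta> [:\<alpha> i, \<beta> i:])"
    unfolding f_def by (rule der_ev_hom[OF dm]) (simp add: map_poly_der_pCons[OF d] kk)
  then have mf: "map_poly \<delta> f = 0" using const by (simp add: map_poly_der_pCons[OF d])
  have "\<delta> (X q / X p) \<noteq> 0" using S p by (simp add: derivation_divide[OF d] algebra_simps)
  moreover have "poly f (X q / X p) = 0"
  proof -
    have "X = (\<lambda>i. X p * (\<alpha> i + \<beta> i * (X q / X p)))"
    proof
      fix i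
      have "X p * (\<alpha> i + \<beta> i * (X q / X p)) = \<alpha> i * X p + \<beta> i * X q" using p by (simp add: field_simps)
      then show "X i = X p * (\<alpha> i + \<beta> i * (X q / X p))" using X[of i] by (rule trans[OF _ sym, THEN sym])
    qed
    then have "ev_hom kk F X = ev_hom kk F (\<lambda>i. X p * (\<alpha> i + \<beta> i * (X q / X p)))" by (rule arg_cong)
    also have "\<dots> = X p ^ d * poly f (X q / X p)" by (simp only: ev_hom_scale[OF F(1)] fval)
    finally have "ev_hom kk F X = X p ^ d * poly f (X q / X p)" .
    then show ?thesis using F(2) p by simp
  qed
  ultimately have "f = 0" using poly_zero_of_nonconstant_root[OF d mf] by blast
  then have f0: "ev_hom kk F (\<lambda>i. \<alpha> i + \<beta> i * z) = 0" for z using fval[of z] by simp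
  \<comment> \<open>The points \<open>X + z * \<delta> X\<close> lie on the same line. Only finitely
    many \<open>z\<close>, at which the coordinate \<open>p\<close> vanishes, escape the
    parametrisation, so \<open>g\<close> has infinitely many roots.\<close>
  define g where "g = ev_hom (\<lambda>k. [:kk k:]) F (\<lambda>i. [:X i, \<delta> (X i):])"
  have gval: "poly g z = ev_hom kk F (\<lambda>i. X i + \<delta> (X i) * z)" for z
    unfolding g_def by (subst ev_hom_hom[OF rpoly[of z]]) (simp add: mult.commute)
  have g0: "poly g z = 0" if z: "X p + z * \<delta> (X p) \<noteq> 0" for z
  proof -
    let ?a = "X p + z * \<delta> (X p)" and ?b = "X q + z * \<delta> (X q)"
    have "(\<lambda>i. X i + \<delta> (X i) * z) = (\<lambda>i. ?a * (\<alpha> i + \<beta> i * (?b / ?a)))"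
    proof
      fix i
      have "?a * (\<alpha> i + \<beta> i * (?b / ?a)) = \<alpha> i * ?a + \<beta> i * ?b" using z by (simp add: field_simps)
      also have "\<dots> = (\<alpha> i * X p + \<beta> i * X q) + (\<alpha> i * \<delta> (X p) + \<beta> i * \<delta> (X q)) * z" by (simp add: algebra_simps)
      finally show "X i + \<delta> (X i) * z = ?a * (\<alpha> i + \<beta> i * (?b / ?a))"
        unfolding X[of i, symmetric] X1[of i, symmetric] by (rule sym)
    qed
    then have "poly g z = ev_hom kk F (\<lambda>i. ?a * (\<alpha> i + \<beta> i * (?b / ?a)))" unfolding gval by (rule arg_cong)
    then show ?thesis by (simp only: ev_hom_scale[OF F(1)] f0) simp
  qed
  have "g = 0"
  proof (rule ccontr)
    assume "g \<noteq> 0"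
    then have "finite {z. poly g z = 0}" by (rule poly_roots_finite)
    moreover have "- {z. X p + z * \<delta> (X p) = 0} \<subseteq> {z. poly g z = 0}" using g0 by auto
    moreover have "finite {z. X p + z * \<delta> (X p) = 0}"
    proof -
      have "{z. X p + z * \<delta> (X p) = 0} \<subseteq> {z. poly [:X p, \<delta> (X p):] z = 0}" by auto
      moreover have "[:X p, \<delta> (X p):] \<noteq> 0" using p by simp
      ultimately show ?thesis using poly_roots_finite finite_subset by blast
    qed
    ultimately have "finite (UNIV :: 'b set)" using finite_subset finite_compl by blast
    then show False using infinite_UNIV_char_0 by blast
  qed
  then show ?thesis using gval[of "of_nat n"] by (simp add: mult.commute)
qed

section \<open>Moving points\<close>

lemma rhom_to_fract_map_poly: "rhom h \<Longrightarrow> rhom (\<lambda>p. to_fract (map_poly h p))"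
  using rhom_comp[OF rhom_to_fract rhom_map_poly] by (simp add: comp_def)

lemma inj_to_fract_map_poly:
  fixes h :: "'a::field \<Rightarrow> 'b::idom"
  assumes h: "rhom h" shows "inj (\<lambda>p. to_fract (map_poly h p))"
proof (rule injI)
  fix p q assume "to_fract (map_poly h p) = to_fract (map_poly h q)"
  then have "map_poly h p = map_poly h q" by simp
  then have "h (coeff p n) = h (coeff q n)" for n by (metis coeff_map_poly_rhom[OF h])
  then show "p = q" using rhom_inj[OF h] by (simp add: poly_eq_iff inj_eq)
qed

lemma poly_map_poly_der_at_constant:
  fixes D :: "'a::idom \<Rightarrow> 'a"
  assumes "derivation D" "D a = 0" shows "poly (map_poly D p) a = D (poly p a)"
  using der_poly[OF assms(1), of p a] assms(2) by simp

text \<open>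
  The coordinates \<open>x\<close> describe a point of \<open>\<P>\<^sup>3\<close> over the rational functions in one variable with
  coefficients in an extension \<open>'o\<close> of the complex numbers; \<open>D b\<close> are derivations dual to those
  coefficients of \<open>x\<close> that are indexed by \<open>B\<close>.
\<close>

locale moving_point =
  fixes emb :: "complex \<Rightarrow> 'o::field_char_0"
    and x :: "4 \<Rightarrow> 'o poly" and m :: nat
    and B :: "(4 \<times> nat) set" and Db :: "4 \<times> nat \<Rightarrow> 'o \<Rightarrow> 'o"
    and F :: "(4, ratfun) mpoly" and d :: nat
  assumes emb: "rhom emb"
    and degree_x: "\<And>i. degree (x i) \<le> m"
    and coprime_x: "\<And>q. (\<And>i. q dvd x i) \<Longrightarrow> q dvd 1"
    and finite_B: "finite B"
    and derivation_Db: "\<And>b. b \<in> B \<Longrightarrow> derivation (Db b)"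
    and Db_emb: "\<And>b c. b \<in> B \<Longrightarrow> Db b (emb c) = 0"
    and Db_coeff: "\<And>b b'. b \<in> B \<Longrightarrow> b' \<in> B \<Longrightarrow> Db b (coeff (x (fst b')) (snd b')) = (if b = b' then 1 else 0)"
    and form_F: "is_form UNIV d F"
    and F_x: "ev_hom (fract_hom (\<lambda>p. to_fract (map_poly emb p))) F (\<lambda>i. to_fract (x i)) = 0"
begin

definition kk :: "ratfun \<Rightarrow> 'o poly fract" where
  "kk = fract_hom (\<lambda>p. to_fract (map_poly emb p))"

definition DD :: "('o \<Rightarrow> 'o) set" where
  "DD = {D. derivation D \<and> (\<forall>c. D (emb c) = 0)}"

definition X :: "4 \<Rightarrow> 'o poly fract" where "X i = to_fract (x i)"

definition dx :: "('o \<Rightarrow> 'o) \<Rightarrow> 4 \<Rightarrow> 'o poly" where "dx D i = map_poly D (x i)"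

lemma F_X: "ev_hom kk F X = 0"
  using F_x by (simp add: kk_def X_def[abs_def])

lemma rhom_kk: "rhom kk"
  unfolding kk_def by (rule rhom_fract_hom[OF rhom_to_fract_map_poly[OF emb] inj_to_fract_map_poly[OF emb]])

lemma kk_Fract: "q \<noteq> 0 \<Longrightarrow> kk (to_fract p / to_fract q) = to_fract (map_poly emb p) / to_fract (map_poly emb q)"
  unfolding kk_def by (simp add: fract_hom_Fract[OF rhom_to_fract_map_poly[OF emb] inj_to_fract_map_poly[OF emb]] flip: Fract_conv_to_fract)

lemma DD_derivation: "D \<in> DD \<Longrightarrow> derivation D"
  and DD_emb: "D \<in> DD \<Longrightarrow> D (emb c) = 0"
  by (auto simp: DD_def)

lemma DD_lift: "D \<in> DD \<Longrightarrow> derivation (lift_der D)"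
  by (simp add: DD_derivation derivation_lift_der)

lemma DD_kk: "D \<in> DD \<Longrightarrow> lift_der D (kk k) = 0"
proof -
  assume D: "D \<in> DD"
  obtain p q where k: "k = to_fract p / to_fract q" "q \<noteq> 0" by (rule fract_cases_to_fract)
  have e: "map_poly D (map_poly emb r) = 0" for r
    using D by (intro poly_eqI) (simp add: coeff_map_poly_der DD_derivation coeff_map_poly_rhom[OF emb] DD_emb)
  have "map_poly emb q \<noteq> 0"
    using k(2) inj_to_fract_map_poly[OF emb] rhom_0[OF rhom_map_poly[OF emb]] by (metis (no_types, lifting) injD)
  then show ?thesis using D k
    by (simp add: kk_Fract derivation_divide[OF DD_lift] lift_der_to_fract[OF DD_derivation] e)
qed

lemma DD_combination: "(\<lambda>z. \<Sum>b\<in>B. c b * Db b z) \<in> DD"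
  using derivation_Db Db_emb by (auto simp: DD_def intro!: derivation_sum sum.neutral)

lemma DD_bracket: "D \<in> DD \<Longrightarrow> D' \<in> DD \<Longrightarrow> (\<lambda>z. D (D' z) - D' (D z)) \<in> DD"
  by (auto simp: DD_def der_0 intro: derivation_bracket)

lemma lift_der_X: "D \<in> DD \<Longrightarrow> lift_der D (X i) = to_fract (dx D i)"
  by (simp add: X_def dx_def lift_der_to_fract DD_derivation)

lemma degree_dx: "D \<in> DD \<Longrightarrow> degree (dx D i) \<le> m"
  unfolding dx_def using degree_map_poly_der[OF DD_derivation, of D "x i"] degree_x[of i] by linarith

lemma x_nonzero:
  obtains i j where "coeff (x i) j \<noteq> 0"
proof (rule ccontr)
  assume "\<not> thesis"
  then have "x i = 0" for i using that by (auto simp: poly_eq_iff)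
  then have "(0::'o poly) dvd 1" by (intro coprime_x) simp
  then show False by simp
qed

text \<open>
  If a derivation moves \<open>x\<close> in its own direction, coprimality forces the factor to be a constant
  polynomial.
\<close>

lemma proportional_imp_zero:
  assumes D: "D \<in> DD" and prp: "\<And>p q. x p * dx D q = x q * dx D p"
    and e: "coeff (x i) j \<noteq> 0" "D (coeff (x i) j) = 0"
  shows "dx D q = 0"
proof -
  have xi: "x i \<noteq> 0" using e by auto
  define l where "l = to_fract (dx D i) / to_fract (x i)"
  have l: "l * to_fract (x k) = to_fract (dx D k)" for k
  proof -
    have "to_fract (dx D i) * to_fract (x k) = to_fract (dx D k) * to_fract (x i)"
      using prp[of i k] by (metis mult.commute to_fract_mult)
    then show ?thesis using xi by (simp add: l_def field_simps)
  qed
  \<comment> \<open>The proportionality factor \<open>l\<close> is written with a denominator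
    \<open>g\<close> of least degree. Division with remainder shows that \<open>g\<close> divides
    every \<open>x k\<close>, so it is a unit.\<close>
  let ?P = "\<lambda>n. \<exists>g h. g \<noteq> 0 \<and> l * to_fract g = to_fract h \<and> degree g = n"
  have "\<exists>n. ?P n" using l[of i] xi by blast
  then have "?P (Least ?P)" by (rule LeastI_ex)
  then obtain g h where g: "g \<noteq> 0" "l * to_fract g = to_fract h" "degree g = Least ?P" by auto
  have min: "g' = 0" if "l * to_fract g' = to_fract h'" "degree g' < degree g" for g' h'
    using not_less_Least[of "degree g'" ?P] that unfolding g(3) by auto
  have "g dvd x k" for k
  proof -
    have e: "x k = (x k div g) * g + x k mod g" by simp
    have "l * to_fract (x k mod g) = to_fract (dx D k - (x k div g) * h)"
    proof -
      have "to_fract (x k) = to_fract (x k div g) * to_fract g + to_fract (x k mod g)"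
        using e by (metis to_fract_add to_fract_mult)
      then have "l * to_fract (x k mod g) = l * to_fract (x k) - to_fract (x k div g) * (l * to_fract g)"
        by (simp add: algebra_simps)
      then show ?thesis unfolding l g(2) by simp
    qed
    moreover have "x k mod g = 0 \<or> degree (x k mod g) < degree g" using g(1) by (rule degree_mod_less)
    ultimately have "x k mod g = 0" using min by blast
    then show ?thesis by (simp add: mod_eq_0_iff_dvd)
  qed
  then have "g dvd 1" by (rule coprime_x)
  then obtain g' where "1 = g * g'" by (elim dvdE)
  then have "to_fract g * to_fract g' = 1" by (metis to_fract_1 to_fract_mult)
  then have "l = to_fract (h * g')" using g(2) by (metis mult.assoc mult.right_neutral to_fract_mult)
  then obtain l' where l': "l = to_fract l'" by blast
  have "l' * x k = dx D k" for k using l[of k] unfolding l' by (metis to_fract_eq_iff to_fract_mult)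
  note l'' = this
  \<comment> \<open>Differentiating coefficients does not raise the degree, so the polynomial
    \<open>l'\<close> is constant; the fixed nonzero coefficient of \<open>x i\<close> then forces
    it to be zero.\<close>
  have "degree l' = 0 \<or> l' = 0"
  proof (rule ccontr)
    assume "\<not> ?thesis"
    then have "degree (l' * x i) > degree (x i)" using xi by (simp add: degree_mult_eq)
    moreover have "degree (dx D i) \<le> degree (x i)" unfolding dx_def by (rule degree_map_poly_der[OF DD_derivation[OF D]])
    ultimately show False using l''[of i] by simp
  qed
  then obtain c where c: "l' = [:c:]" by (metis degree_eq_zeroE pCons_0_0)
  have "dx D i = smult c (x i)" using l''[of i] c by simp
  then have "coeff (dx D i) j = c * coeff (x i) j" by simp
  then have "c * coeff (x i) j = D (coeff (x i) j)"
    by (simp add: dx_def coeff_map_poly_der[OF DD_derivation[OF D]])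
  then have "c = 0" using e by simp
  then show ?thesis using l''[of q] c by simp
qed

text \<open>Besides the values in \<open>L\<close> one nonzero coefficient of \<open>x\<close> is
  kept fixed, which accounts for the extra 1. A combination of the dual derivations that only
  rescales \<open>x\<close> would then kill all coefficients of \<open>x\<close>, against
  duality.\<close>

lemma moving_derivation:
  assumes "finite L" "card L + 1 < card B"
  obtains D p q where "D \<in> DD" "\<forall>l\<in>L. D l = 0" "x p * dx D q \<noteq> x q * dx D p"
proof -
  obtain i j where e: "coeff (x i) j \<noteq> 0" by (rule x_nonzero)
  let ?L = "insert (coeff (x i) j) L"
  have "card ?L < card B" using assms card_insert_le_m1[of "card L + 1" L] by (simp add: card_insert_if)
  then obtain c where c: "\<exists>b\<in>B. c b \<noteq> 0" "\<forall>l\<in>?L. (\<Sum>b\<in>B. c b * Db b l) = 0"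
    using homogeneous_system_nontrivial[of ?L B "\<lambda>l b. Db b l"] assms(1) finite_B by auto
  define D where "D = (\<lambda>z. \<Sum>b\<in>B. c b * Db b z)"
  have D: "D \<in> DD" unfolding D_def by (rule DD_combination)
  have "\<exists>p q. x p * dx D q \<noteq> x q * dx D p"
  proof (rule ccontr)
    assume "\<not> ?thesis"
    then have prp: "\<And>p q. x p * dx D q = x q * dx D p" by blast
    have "dx D q = 0" for q
      by (rule proportional_imp_zero[OF D prp e]) (use c(2) in \<open>simp add: D_def\<close>)
    then have z: "D (coeff (x q) n) = 0" for q n
      using coeff_map_poly_der[OF DD_derivation[OF D], of "x q" n] by (simp add: dx_def)
    obtain b where b: "b \<in> B" "c b \<noteq> 0" using c(1) by blast
    have "D (coeff (x (fst b)) (snd b)) = (\<Sum>b'\<in>B. c b' * (if b' = b then 1 else 0))"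
      unfolding D_def using b by (intro sum.cong) (auto simp: Db_coeff)
    also have "\<dots> = (\<Sum>b'\<in>B. if b' = b then c b' else 0)" by (intro sum.cong) auto
    also have "\<dots> = c b" using b finite_B by simp
    finally show False using z b by simp
  qed
  then obtain p q where "x p * dx D q \<noteq> x q * dx D p" by blast
  then show thesis using D c(2) by (intro that[of D p q]) (auto simp: D_def)
qed

end

section \<open>The Wronskian along a derivation that fixes given values\<close>

context moving_point
begin

lemma dx_twice: "D \<in> DD \<Longrightarrow> lift_der D (to_fract (dx D i)) = to_fract (map_poly D (dx D i))"
  by (simp add: lift_der_to_fract DD_derivation)

lemma DD_of_nat: "D \<in> DD \<Longrightarrow> D (of_nat n) = 0"
  by (simp add: der_of_nat DD_derivation)

text \<open>
  \<open>K\<close> consists of values that are kept fixed, so the bracket of two derivations killing \<open>K\<close>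
  kills \<open>K\<close> again. Since all these derivations move \<open>x\<close> along one curve, the Wronskian of \<open>x\<close>
  along \<open>D\<close> is, up to a factor that does not depend on \<open>D\<close>, the cube of \<open>D (x\<^sub>q / x\<^sub>p)\<close>.
\<close>

lemma wronskian_vanishes_to_order_3:
  assumes K: "\<And>D D' p q j. D \<in> DD \<Longrightarrow> D' \<in> DD \<Longrightarrow> (\<forall>l\<in>K. D l = 0) \<Longrightarrow> (\<forall>l\<in>K. D' l = 0) \<Longrightarrow>
      det3 x (dx D) (dx D') p q j = 0"
    and D0: "D0 \<in> DD" "\<And>l. l \<in> K \<Longrightarrow> D0 l = 0" and M: "M = x p * dx D0 q - x q * dx D0 p"
    and D: "D \<in> DD" "\<And>l. l \<in> K \<Longrightarrow> D l = 0"
    and a: "D0 a = 0" "D a = 0" "poly (x p) a \<noteq> 0" "poly M a \<noteq> 0" "D (poly (x q) a / poly (x p) a) = 0"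
  shows "to_fract (det3 x (dx D) (\<lambda>i. map_poly D (dx D i)) p q j) \<in> vanish_at a 3"
proof -
  have xp: "x p \<noteq> 0" "X p \<noteq> 0" using a(3) by (auto simp: X_def)
  have M0: "M \<noteq> 0" using a(4) by auto
  define u w where "u = X q / X p" and "w = X j / X p"
  define \<delta> \<delta>0 where "\<delta> = lift_der D" and "\<delta>0 = lift_der D0"
  have d: "derivation \<delta>" "derivation \<delta>0" by (simp_all add: \<delta>_def \<delta>0_def DD_lift D D0)
  have quot: "lift_der D' (X i / X p) = to_fract (x p * dx D' i - x i * dx D' p) / (to_fract (x p))\<^sup>2"
    if "D' \<in> DD" for D' i
    using xp that by (simp add: derivation_divide[OF DD_lift[OF that]] lift_der_X[OF that]) (simp add: X_def algebra_simps)
  have u0: "\<delta>0 u = to_fract M / (to_fract (x p))\<^sup>2" unfolding u_def \<delta>0_def quot[OF D0(1)] M ..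
  then have u0nz: "\<delta>0 u \<noteq> 0" using M0 xp by simp
  \<comment> \<open>The common slope: all derivations killing \<open>K\<close> move the affine
    coordinates \<open>u\<close> and \<open>w\<close> in this ratio.\<close>
  define g where "g = \<delta>0 w / \<delta>0 u"
  have wg: "lift_der D' w = g * lift_der D' u" if D': "D' \<in> DD" "\<And>l. l \<in> K \<Longrightarrow> D' l = 0" for D'
  proof -
    let ?S = "\<lambda>D i. x p * dx D i - x i * dx D p"
    have "x p * (?S D' j * M - ?S D0 j * ?S D' q) = x p * (x p * det3 x (dx D0) (dx D') p q j)"
      unfolding M det3_def by algebra
    also have "det3 x (dx D0) (dx D') p q j = 0" using K D0 D' by blast
    finally have "?S D' j * M = ?S D0 j * ?S D' q" using xp by simp
    then have e1: "to_fract (?S D' j) * to_fract M = to_fract (?S D0 j) * to_fract (?S D' q)" by (metis to_fract_mult)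
    have gen: "P / c = (Q / c) / (R / c) * (T / c)" if "P * R = Q * T" "R \<noteq> 0" "c \<noteq> 0" for P Q R T c :: "'o poly fract"
      using that by (simp add: field_simps)
    have "to_fract (?S D' j) / (to_fract (x p))\<^sup>2 = (to_fract (?S D0 j) / (to_fract (x p))\<^sup>2) /
        (to_fract M / (to_fract (x p))\<^sup>2) * (to_fract (?S D' q) / (to_fract (x p))\<^sup>2)"
      by (rule gen[OF e1]) (use M0 xp in \<open>simp_all only: to_fract_eq_0_iff power_eq_0_iff not_False_eq_True simp_thms\<close>)
    then show ?thesis unfolding g_def u0 unfolding w_def u_def \<delta>0_def quot[OF D'(1)] quot[OF D0(1)] .
  qed
  have dw: "\<delta> w = g * \<delta> u" "\<delta>0 w = g * \<delta>0 u" using wg D D0 by (auto simp: \<delta>_def \<delta>0_def)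
  \<comment> \<open>The bracket also kills \<open>K\<close>, so it has the same slope. Comparing
    both sides, the second derivatives cancel, and the derivatives of \<open>g\<close> along
    \<open>D\<close> and \<open>D0\<close> become proportional to those of \<open>u\<close>.\<close>
  have "lift_der (\<lambda>z. D (D0 z) - D0 (D z)) w = g * lift_der (\<lambda>z. D (D0 z) - D0 (D z)) u"
    using D D0 by (intro wg DD_bracket) (auto simp: der_0 DD_derivation)
  then have "\<delta> (\<delta>0 w) - \<delta>0 (\<delta> w) = g * (\<delta> (\<delta>0 u) - \<delta>0 (\<delta> u))"
    using D D0 by (simp add: lift_der_bracket DD_derivation \<delta>_def \<delta>0_def)
  then have gg: "\<delta> g * \<delta>0 u = \<delta>0 g * \<delta> u"
    unfolding dw by (simp add: der_mult[OF d(1)] der_mult[OF d(2)] algebra_simps)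
  have "to_fract (det3 x (dx D) (\<lambda>i. map_poly D (dx D i)) p q j) = det3 X (\<lambda>i. \<delta> (X i)) (\<lambda>i. \<delta> (\<delta> (X i))) p q j"
    using D by (simp add: det3_hom[OF rhom_to_fract] X_def[symmetric] \<delta>_def lift_der_X dx_twice)
  also have "\<dots> = X p ^ 3 * (\<delta> u * \<delta> (\<delta> w) - \<delta> w * \<delta> (\<delta> u))"
    unfolding u_def w_def by (rule wronskian_dehomogenize) (use d xp in auto)
  also have "\<dots> = X p ^ 3 * (\<delta> u * \<delta> u * \<delta> g)" unfolding dw by (simp add: der_mult[OF d(1)] algebra_simps)
  also have "\<delta> g = \<delta>0 g * \<delta> u * inverse (\<delta>0 u)" using gg u0nz by (simp add: field_simps)
  \<comment> \<open>Up to factors that are regular at \<open>a\<close> the Wronskian is the cube of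
    \<open>\<delta> u\<close>, which vanishes at \<open>a\<close> because \<open>D\<close> fixes the
    value of \<open>u\<close> there.\<close>
  finally have e: "to_fract (det3 x (dx D) (\<lambda>i. map_poly D (dx D i)) p q j) =
      (X p ^ 3 * \<delta>0 g * inverse (\<delta>0 u)) * (\<delta> u * \<delta> u * \<delta> u)" by (simp add: algebra_simps)
  have v0: "to_fract r / to_fract s \<in> vanish_at a 0" if "poly s a \<noteq> 0" for r s
    using vanish_at_mult0[OF vanish_at_to_fract vanish_at_inverse[OF that]] by (simp add: divide_inverse)
  have "poly (x p * dx D q - x q * dx D p) a = 0"
  proof -
    have "D (poly (x q) a / poly (x p) a) * (poly (x p) a)\<^sup>2 = D (poly (x q) a) * poly (x p) a - poly (x q) a * D (poly (x p) a)"
      using a(3) by (simp add: derivation_divide[OF DD_derivation[OF D(1)]])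
    then show ?thesis using a(5)
      by (simp add: dx_def poly_map_poly_der_at_constant[OF DD_derivation[OF D(1)] a(2)] algebra_simps)
  qed
  then have "to_fract (x p * dx D q - x q * dx D p) * inverse (to_fract ((x p)\<^sup>2)) \<in> vanish_at a (1 + 0)"
    using a(3) by (intro vanish_at_mult vanish_at_to_fract_root vanish_at_inverse) auto
  moreover have "\<delta> u = to_fract (x p * dx D q - x q * dx D p) * inverse (to_fract ((x p)\<^sup>2))"
    unfolding \<delta>_def u_def quot[OF D(1)] by (simp add: divide_inverse power2_eq_square)
  ultimately have du: "\<delta> u \<in> vanish_at a 1" by simp
  have "\<delta>0 w = to_fract (x p * dx D0 j - x j * dx D0 p) / (to_fract (x p))\<^sup>2"
    unfolding \<delta>0_def w_def by (rule quot[OF D0(1)])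
  then have "g = to_fract (x p * dx D0 j - x j * dx D0 p) / to_fract M"
    unfolding g_def u0 using xp by simp
  then have "g \<in> vanish_at a 0" using v0[OF a(4)] by (simp only:)
  then have dg: "\<delta>0 g \<in> vanish_at a 0" unfolding \<delta>0_def by (rule vanish_at_lift_der[OF DD_derivation[OF D0(1)] a(1)])
  have "inverse (\<delta>0 u) = to_fract ((x p)\<^sup>2) / to_fract M" unfolding u0 by (simp add: power2_eq_square)
  then have "inverse (\<delta>0 u) \<in> vanish_at a 0" using v0[OF a(4)] by metis
  moreover have "X p ^ 3 \<in> vanish_at a 0"
    using vanish_at_to_fract[of "x p ^ 3" a] by (simp add: X_def power3_eq_cube)
  ultimately have "X p ^ 3 * \<delta>0 g * inverse (\<delta>0 u) \<in> vanish_at a 0" using dg by (intro vanish_at_mult0)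
  moreover have "\<delta> u * \<delta> u * \<delta> u \<in> vanish_at a (1 + 1 + 1)" by (intro vanish_at_mult du)
  ultimately show ?thesis unfolding e using vanish_at_mult0[of "X p ^ 3 * \<delta>0 g * inverse (\<delta>0 u)" a "\<delta> u * \<delta> u * \<delta> u" 3]
    by (simp add: numeral_3_eq_3)
qed

text \<open>Since \<open>D\<close> fixes \<open>a\<close> and the direction \<open>e\<close> of the
  point there, the values at \<open>a\<close> of \<open>x\<close> and of its first two derivatives
  along \<open>D\<close> are all multiples of \<open>e\<close>.\<close>

lemma wronskian_vanishes_to_order_2:
  assumes D: "D \<in> DD" "D a = 0" and e: "\<And>i. poly (x i) a = \<mu> * e i" "\<And>i. D (e i) = 0"
  shows "[:- a, 1:]\<^sup>2 dvd det3 x (dx D) (\<lambda>i. map_poly D (dx D i)) p q j"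
proof -
  note d = DD_derivation[OF D(1)]
  have split: "\<exists>r. \<forall>i. f i = [:\<nu>:] * [:e i:] + [:- a, 1:] * r i" if "\<And>i. poly (f i) a = \<nu> * e i" for f \<nu>
  proof -
    have "[:- a, 1:] dvd f i - [:\<nu> * e i:]" for i using that[of i] by (simp add: poly_eq_0_iff_dvd[symmetric])
    then have "\<exists>r. f i - [:\<nu> * e i:] = [:- a, 1:] * r" for i unfolding dvd_def .
    then obtain r where r: "\<And>i. f i - [:\<nu> * e i:] = [:- a, 1:] * r i" by metis
    have "f i = [:\<nu>:] * [:e i:] + [:- a, 1:] * r i" for i
    proof -
      have "[:\<nu>:] * [:e i:] = [:\<nu> * e i:]" by simp
      then show ?thesis unfolding r[of i, symmetric] by simp
    qed
    then show ?thesis by blast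
  qed
  have 1: "poly (dx D i) a = D \<mu> * e i" for i
    using e by (simp add: dx_def poly_map_poly_der_at_constant[OF d D(2)] der_mult[OF d])
  have 2: "poly (map_poly D (dx D i)) a = D (D \<mu>) * e i" for i
    using e by (simp add: 1 poly_map_poly_der_at_constant[OF d D(2)] der_mult[OF d])
  obtain r1 where r1: "\<forall>i. x i = [:\<mu>:] * [:e i:] + [:- a, 1:] * r1 i" using split[of x \<mu>] e(1) by blast
  obtain r2 where r2: "\<forall>i. dx D i = [:D \<mu>:] * [:e i:] + [:- a, 1:] * r2 i" using split[of "dx D" "D \<mu>"] 1 by blast
  obtain r3 where r3: "\<forall>i. map_poly D (dx D i) = [:D (D \<mu>):] * [:e i:] + [:- a, 1:] * r3 i"
    using split[of "\<lambda>i. map_poly D (dx D i)" "D (D \<mu>)"] 2 by blast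
  show ?thesis
    by (rule det3_common_direction[where e = "\<lambda>i. [:e i:]", OF r1[rule_format] r2[rule_format] r3[rule_format]])
qed

text \<open>Two sets of places are played off against the degree \<open>3 * m\<close>: on
  \<open>A\<close> the whole point is fixed, at \<open>s\<close> further places only one affine
  coordinate. The cost of the first is contained in \<open>K\<close>; each further place adds one
  condition.\<close>

theorem line_through_moving_point:
  assumes Kfin: "finite K" and A: "finite A" "A \<subseteq> range of_nat"
    and K: "\<And>D D' p q j. D \<in> DD \<Longrightarrow> D' \<in> DD \<Longrightarrow> (\<forall>l\<in>K. D l = 0) \<Longrightarrow> (\<forall>l\<in>K. D' l = 0) \<Longrightarrow>
      det3 x (dx D) (dx D') p q j = 0"
    and dir: "\<And>a. a \<in> A \<Longrightarrow> \<exists>\<mu> e. (\<forall>i. poly (x i) a = \<mu> * e i) \<and>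
      (\<forall>D\<in>DD. (\<forall>l\<in>K. D l = 0) \<longrightarrow> (\<forall>i. D (e i) = 0))"
    and count: "card K + s + 2 \<le> card B" and deg: "3 * m < 2 * card A + 3 * s"
  shows "\<exists>y. (\<forall>i. degree (y i) \<le> m) \<and> (\<exists>p q. x p * y q \<noteq> x q * y p) \<and>
    (\<forall>n. ev_hom kk F (\<lambda>i. to_fract (x i) + of_nat n * to_fract (y i)) = 0)"
proof -
  have cardK0: "card K + 1 < card B" using count by linarith
  obtain D0 p0 q0 where D0: "D0 \<in> DD" "\<forall>l\<in>K. D0 l = 0" and pq0: "x p0 * dx D0 q0 \<noteq> x q0 * dx D0 p0"
    by (rule moving_derivation[OF Kfin cardK0])
  obtain p q where pq: "x p \<noteq> 0" "x p * dx D0 q \<noteq> x q * dx D0 p"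
  proof (cases "x p0 = 0")
    case True
    then have "x q0 \<noteq> 0" using pq0 by auto
    then show ?thesis using that[of q0 p0] pq0 by metis
  qed (use that pq0 in blast)
  define M where "M = x p * dx D0 q - x q * dx D0 p"
  have M0: "M \<noteq> 0" using pq by (simp add: M_def)
  \<comment> \<open>The new places avoid the zeros of \<open>x p\<close> and \<open>M\<close>, where
    the argument for order 3 breaks down, and are again natural numbers, which every derivation
    kills.\<close>
  have "finite (A \<union> {a. poly (x p) a = 0} \<union> {a. poly M a = 0})"
    using A(1) poly_roots_finite[OF pq(1)] poly_roots_finite[OF M0] by simp
  moreover have "infinite (range of_nat :: 'o set)" by (simp add: infinite_UNIV_char_0 inj_of_nat range_inj_infinite)
  ultimately have "infinite (range of_nat - (A \<union> {a. poly (x p) a = 0} \<union> {a. poly M a = 0}))" by (rule Diff_infinite_finite)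
  then obtain A' where A': "finite A'" "card A' = s"
    "A' \<subseteq> range of_nat - (A \<union> {a. poly (x p) a = 0} \<union> {a. poly M a = 0})"
    using infinite_arbitrarily_large by blast
  let ?K' = "(\<lambda>a. poly (x q) a / poly (x p) a) ` A'"
  have fin: "finite (K \<union> ?K')" using Kfin A'(1) by simp
  have cardK: "card (K \<union> ?K') + 1 < card B"
    using card_Un_le[of K ?K'] card_image_le[OF A'(1), of "\<lambda>a. poly (x q) a / poly (x p) a"] count A'(2) by linarith
  obtain D p1 q1 where D: "D \<in> DD" "\<forall>l\<in>K \<union> ?K'. D l = 0" and pq1: "x p1 * dx D q1 \<noteq> x q1 * dx D p1"
    by (rule moving_derivation[OF fin cardK])
  have DK: "D l = 0" if "l \<in> K" for l using D(2) that by blast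
  \<comment> \<open>By \<open>K\<close>, the vectors \<open>x\<close>, \<open>dx D0\<close> and
    \<open>dx D\<close> are dependent. If \<open>D\<close> left the ratio of the coordinates
    \<open>q\<close> and \<open>p\<close> unchanged, which \<open>D0\<close> moves, then
    \<open>D\<close> could only rescale \<open>x\<close>.\<close>
  have S: "x p * dx D q - x q * dx D p \<noteq> 0"
  proof
    assume S0: "x p * dx D q - x q * dx D p = 0"
    have "x p * dx D j = x j * dx D p" for j
    proof -
      have "det3 x (dx D0) (dx D) p q j = 0" using K[OF D0(1) D(1)] D0(2) DK by blast
      then have "x p * (M * (x p * dx D j - x j * dx D p)) = 0" using S0 unfolding M_def det3_def by algebra
      then show ?thesis using pq(1) M0 by simp
    qed
    note j = this
    have "x p * (x p1 * dx D q1) = x p * (x q1 * dx D p1)" using j[of p1] j[of q1] by algebra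
    then show False using pq1 pq(1) by simp
  qed
  have det: "det3 x (dx D) (\<lambda>i. map_poly D (dx D i)) p q j = 0" for j
  proof (rule ccontr)
    let ?d = "det3 x (dx D) (\<lambda>i. map_poly D (dx D i)) p q j"
    assume nz: "?d \<noteq> 0"
    have o2: "order a ?d \<ge> 2" if aA: "a \<in> A" for a
    proof -
      obtain \<mu> e where e: "\<forall>i. poly (x i) a = \<mu> * e i" "\<forall>D\<in>DD. (\<forall>l\<in>K. D l = 0) \<longrightarrow> (\<forall>i. D (e i) = 0)"
        using dir[OF aA] by blast
      have "D a = 0" using A(2) aA DD_of_nat[OF D(1)] by auto
      then have "[:- a, 1:]\<^sup>2 dvd ?d"
        using e D DK by (intro wronskian_vanishes_to_order_2[where \<mu> = \<mu> and e = e]) auto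
      then show ?thesis using nz order_divides[of a 2 ?d] by simp
    qed
    have o3: "order a ?d \<ge> 3" if "a \<in> A'" for a
    proof -
      have a: "a \<in> range of_nat" "poly (x p) a \<noteq> 0" "poly M a \<noteq> 0" using A'(3) that by auto
      then have z: "D0 a = 0" "D a = 0" using DD_of_nat[OF D(1)] DD_of_nat[OF D0(1)] by auto
      have "to_fract ?d \<in> vanish_at a 3"
        by (rule wronskian_vanishes_to_order_3[OF K D0(1) D0(2)[rule_format] M_def D(1) DK z a(2,3)]) (use D(2) that in auto)
      then have "[:- a, 1:] ^ 3 dvd ?d" by (rule vanish_at_dvd)
      then show ?thesis using nz order_divides[of a 3 ?d] by simp
    qed
    have disj: "A \<inter> A' = {}" using A'(3) by blast
    have "3 * m < 2 * card A + 3 * s" by (rule deg)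
    also have "\<dots> = (\<Sum>a\<in>A. 2) + (\<Sum>a\<in>A'. 3)" using A'(2) by simp
    also have "\<dots> \<le> (\<Sum>a\<in>A. order a ?d) + (\<Sum>a\<in>A'. order a ?d)" by (intro add_mono sum_mono o2 o3)
    also have "\<dots> = (\<Sum>a\<in>A \<union> A'. order a ?d)" by (rule sum.union_disjoint[symmetric]) (use A(1) A'(1) disj in auto)
    also have "\<dots> \<le> degree ?d" by (rule sum_order_le_degree[OF nz]) (use A(1) A'(1) in auto)
    also have "\<dots> \<le> 3 * m"
    proof (rule degree_det3[OF degree_x degree_dx[OF D(1)]])
      show "degree (map_poly D (dx D i)) \<le> m" for i
        using degree_map_poly_der[OF DD_derivation[OF D(1)], of "dx D i"] degree_dx[OF D(1), of i] by linarith
    qed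
    finally show False by simp
  qed
  have "ev_hom kk F (\<lambda>i. X i + of_nat n * lift_der D (X i)) = 0" for n
  proof (rule form_vanishes_on_wronskian_line[OF DD_lift[OF D(1)] DD_kk[OF D(1)] form_F F_X])
    show "X p \<noteq> 0" using pq(1) by (simp add: X_def)
    have "X p * lift_der D (X q) - X q * lift_der D (X p) = to_fract (x p * dx D q - x q * dx D p)"
      by (simp only: lift_der_X[OF D(1)]) (simp add: X_def)
    then show "X p * lift_der D (X q) - X q * lift_der D (X p) \<noteq> 0" using S by (metis to_fract_eq_0_iff)
    have "det3 X (\<lambda>i. lift_der D (X i)) (\<lambda>i. lift_der D (lift_der D (X i))) p q j =
        to_fract (det3 x (dx D) (\<lambda>i. map_poly D (dx D i)) p q j)" for j
      using D by (simp add: det3_hom[OF rhom_to_fract] X_def[symmetric] lift_der_X dx_twice)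
    then show "det3 X (\<lambda>i. lift_der D (X i)) (\<lambda>i. lift_der D (lift_der D (X i))) p q j = 0" for j
      using det by simp
  qed
  then have "ev_hom kk F (\<lambda>i. to_fract (x i) + of_nat n * to_fract (dx D i)) = 0" for n
    by (simp only: lift_der_X[OF D(1)] flip: X_def)
  then show ?thesis using degree_dx[OF D(1)] pq1 by (intro exI[of _ "dx D"]) blast
qed

end

section \<open>Generic points of a surface\<close>

lemma finite_not_regular:
  fixes z :: "'a::field poly fract"
  shows "finite {a. z \<notin> vanish_at a 0}"
proof -
  obtain p q where z: "z = to_fract p / to_fract q" "q \<noteq> 0" by (rule fract_cases_to_fract)
  have "{a. z \<notin> vanish_at a 0} \<subseteq> {a. poly q a = 0}"
  proof (intro subsetI CollectI, rule ccontr)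
    fix a assume a: "a \<in> {a. z \<notin> vanish_at a 0}" "poly q a \<noteq> 0"
    then have "z \<in> vanish_at a 0" using z by (intro vanish_atI[where q = q and p = p]) auto
    then show False using a by simp
  qed
  then show ?thesis using poly_roots_finite[OF z(2)] finite_subset by blast
qed

lemma cramer3:
  fixes a1 :: "'a::field"
  assumes "a1 * (b2 * c3 - b3 * c2) - a2 * (b1 * c3 - b3 * c1) + a3 * (b1 * c2 - b2 * c1) \<noteq> 0" (is "?J \<noteq> 0")
  obtains \<alpha> \<beta> \<gamma> where "\<alpha> * a1 + \<beta> * b1 + \<gamma> * c1 = v1" "\<alpha> * a2 + \<beta> * b2 + \<gamma> * c2 = v2"
    "\<alpha> * a3 + \<beta> * b3 + \<gamma> * c3 = v3"
proof -
  define A where "A = v1 * (b2 * c3 - b3 * c2) - v2 * (b1 * c3 - b3 * c1) + v3 * (b1 * c2 - b2 * c1)"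
  define B where "B = a1 * (v2 * c3 - v3 * c2) - a2 * (v1 * c3 - v3 * c1) + a3 * (v1 * c2 - v2 * c1)"
  define C where "C = a1 * (b2 * v3 - b3 * v2) - a2 * (b1 * v3 - b3 * v1) + a3 * (b1 * v2 - b2 * v1)"
  define j where "j = ?J"
  have e: "A * a1 + B * b1 + C * c1 = v1 * j" "A * a2 + B * b2 + C * c2 = v2 * j" "A * a3 + B * b3 + C * c3 = v3 * j"
    unfolding A_def B_def C_def j_def by algebra+
  have j: "j \<noteq> 0" using assms by (simp add: j_def)
  have "A / j * s + B / j * t + C / j * u = (A * s + B * t + C * u) / j" for s t u
    by (simp add: add_divide_distrib)
  then have "A / j * a1 + B / j * b1 + C / j * c1 = v1" "A / j * a2 + B / j * b2 + C / j * c2 = v2"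
    "A / j * a3 + B / j * b3 + C / j * c3 = v3"
    using e j by simp_all
  then show thesis by (rule that)
qed

lemma nat_avoiding_roots:
  fixes p :: "'a::{idom, ring_char_0} poly" and q :: "'b::{idom, ring_char_0} poly"
  assumes "p \<noteq> 0" "q \<noteq> 0"
  obtains n :: nat where "poly p (of_nat n) \<noteq> 0" "poly q (of_nat n) \<noteq> 0"
proof -
  have fin: "finite {n. poly r (of_nat n) = 0}" if "r \<noteq> 0" for r :: "'z::{idom, ring_char_0} poly"
  proof -
    have "of_nat ` {n. poly r (of_nat n) = 0} \<subseteq> {a. poly r a = 0}" by auto
    then have "finite (of_nat ` {n. poly r (of_nat n) = 0} :: 'z set)" using poly_roots_finite[OF that] finite_subset by blast
    then show ?thesis by (rule finite_imageD) (simp add: inj_on_def)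
  qed
  have "finite ({n. poly p (of_nat n) = 0} \<union> {n. poly q (of_nat n) = 0})" using fin[OF assms(1)] fin[OF assms(2)] by simp
  then obtain n where "n \<notin> {n. poly p (of_nat n) = 0} \<union> {n. poly q (of_nat n) = 0}" by (metis ex_new_if_finite infinite_UNIV_nat)
  then have "poly p (of_nat n) \<noteq> 0" "poly q (of_nat n) \<noteq> 0" by simp_all
  then show thesis by (rule that)
qed

text \<open>One natural point has to avoid the zeros of polynomials over two different rings: the
  surface is given over the rational functions, the tangent plane over the polynomials in which
  \<open>x\<close> lives.\<close>

lemma nat_point_avoiding_zeros:
  fixes P :: "'a::{idom, ring_char_0} poly4" and Q :: "'b::{idom, ring_char_0} poly4"
  assumes "P \<noteq> 0" "Q \<noteq> 0"
  obtains n1 n2 n3 n4 :: nat where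
    "ev4 (\<lambda>x. x) (of_nat n1) (of_nat n2) (of_nat n3) (of_nat n4) P \<noteq> 0"
    "ev4 (\<lambda>x. x) (of_nat n1) (of_nat n2) (of_nat n3) (of_nat n4) Q \<noteq> 0"
proof -
  have rp: "rhom (\<lambda>p. poly p a)" for a :: "'z::comm_ring_1" by (auto simp: rhom_def)
  have ev: "ev4 (\<lambda>x. x) (of_nat n1) (of_nat n2) (of_nat n3) (of_nat n4) R =
      poly (poly (poly (poly R (of_nat n4)) (of_nat n3)) (of_nat n2)) (of_nat n1)"
    for R :: "'z::{idom, ring_char_0} poly4" and n1 n2 n3 n4
  proof (rule rhom_poly4_eqI[OF rhom_ev4[OF rhom_id]])
    show "rhom (\<lambda>R :: 'z poly4. poly (poly (poly (poly R (of_nat n4)) (of_nat n3)) (of_nat n2)) (of_nat n1))"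
      by (auto simp: rhom_def)
  qed (simp_all only: ev4_simps[OF rhom_id], simp_all add: const4_def Y1_def Y2_def Y3_def Y4_def rhom_of_nat[OF rp])
  obtain n4 where 4: "poly P (of_nat n4) \<noteq> 0" "poly Q (of_nat n4) \<noteq> 0" by (rule nat_avoiding_roots[OF assms])
  obtain n3 where 3: "poly (poly P (of_nat n4)) (of_nat n3) \<noteq> 0" "poly (poly Q (of_nat n4)) (of_nat n3) \<noteq> 0"
    by (rule nat_avoiding_roots[OF 4])
  obtain n2 where 2: "poly (poly (poly P (of_nat n4)) (of_nat n3)) (of_nat n2) \<noteq> 0"
    "poly (poly (poly Q (of_nat n4)) (of_nat n3)) (of_nat n2) \<noteq> 0"
    by (rule nat_avoiding_roots[OF 3])
  obtain n1 where 1: "poly (poly (poly (poly P (of_nat n4)) (of_nat n3)) (of_nat n2)) (of_nat n1) \<noteq> 0"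
    "poly (poly (poly (poly Q (of_nat n4)) (of_nat n3)) (of_nat n2)) (of_nat n1) \<noteq> 0"
    by (rule nat_avoiding_roots[OF 2])
  show thesis by (rule that[of n1 n2 n3 n4]) (use 1 in \<open>simp_all add: ev\<close>)
qed

definition adapted :: "(4 \<Rightarrow> 'a::field) \<Rightarrow> (4 \<Rightarrow> 'a poly) \<Rightarrow> 4 \<Rightarrow> 'a poly" where
  "adapted c u = vec4 (u 1 - smult (c 1) (u 4)) (u 2 - smult (c 2) (u 4)) (u 3 - smult (c 3) (u 4)) (u 4)"

text \<open>\<open>E\<close> is the infinitesimal scaling of the cone of coefficient vectors. The
  assumption \<open>constants\<close> lets linear relations descend to the base field; for the
  ultrapower it rests on the complex numbers being algebraically closed.\<close>

locale generic_point = moving_point +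
  fixes E
  assumes irreducible_F: "irreducible F"
    and E: "derivation E" "\<And>c. E (emb c) = 0" "\<And>i j. E (coeff (x i) j) = coeff (x i) j"
    and constants: "\<And>w. (\<And>D. derivation D \<Longrightarrow> (\<And>c. D (emb c) = 0) \<Longrightarrow> D w = 0) \<Longrightarrow> w \<in> range emb"
begin

lemma E_DD: "E \<in> DD" using E by (simp add: DD_def)

lemma dx_E: "dx E i = x i"
  unfolding dx_def by (rule poly_eqI) (simp add: coeff_map_poly_der E)

lemma lift_E_X: "lift_der E (X i) = X i"
  using lift_der_X[OF E_DD] by (simp add: dx_E X_def)

lemma constants_lift:
  assumes "\<And>D. D \<in> DD \<Longrightarrow> lift_der D g = 0"
  obtains k where "g = kk k"
proof -
  have ex: "\<exists>p'. map_poly emb p' = p" if "\<And>D n. D \<in> DD \<Longrightarrow> D (coeff p n) = 0" for p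
  proof -
    have c: "coeff p n \<in> range emb" for n by (rule constants) (use that in \<open>auto simp: DD_def\<close>)
    have inv: "emb (inv emb w) = w" if "w \<in> range emb" for w using that by (rule f_inv_into_f)
    have "inv emb 0 = 0" using rhom_0[OF emb] rhom_inj[OF emb] by (metis inv_f_f)
    then have "map_poly emb (map_poly (inv emb) p) = p"
      by (intro poly_eqI) (simp add: coeff_map_poly_rhom[OF emb] coeff_map_poly inv c)
    then show ?thesis by blast
  qed
  show thesis
  proof (rule lift_der_constants[OF DD_derivation assms])
    fix p q :: "'a poly"
    assume pq: "q \<noteq> 0" "g = to_fract p / to_fract q"
      "\<And>D n. D \<in> DD \<Longrightarrow> D (coeff p n) = 0" "\<And>D n. D \<in> DD \<Longrightarrow> D (coeff q n) = 0"
    have "\<exists>p'. map_poly emb p' = p" by (rule ex) (rule pq(3))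
    moreover have "\<exists>q'. map_poly emb q' = q" by (rule ex) (rule pq(4))
    ultimately obtain p' q' where "map_poly emb p' = p" "map_poly emb q' = q" by auto
    moreover from this have "q' \<noteq> 0" using pq(1) by auto
    ultimately have "g = kk (to_fract p' / to_fract q')" using pq(2) by (simp add: kk_Fract)
    then show thesis by (rule that)
  qed
qed

end

text \<open>
  Linear coordinates \<open>y\<close> adapted to the point \<open>c\<close>: it has coordinates \<open>(0, 0, 0, 1)\<close>, does not lie
  on the surface, and does not lie in the tangent plane at \<open>x\<close>.
\<close>

locale chart = generic_point +
  fixes cK :: "4 \<Rightarrow> ratfun" and c
  assumes cK4: "cK 4 = 1" and F_cK: "ev_hom (\<lambda>x. x) F cK \<noteq> 0" and kk_cK: "\<And>i. kk (cK i) = to_fract [:c i:]"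
    and DD_c: "\<And>D i. D \<in> DD \<Longrightarrow> D (c i) = 0" and d_pos: "d > 0"
begin

definition y :: "4 \<Rightarrow> 'a poly" where "y = adapted c x"

definition Y :: "4 \<Rightarrow> 'a poly fract" where "Y i = to_fract (y i)"

end

lemma rhom_divide:
  fixes h :: "'a::field \<Rightarrow> 'b::field"
  assumes "rhom h" shows "h (a / b) = h a / h b"
proof (cases "b = 0")
  case True then show ?thesis using rhom_0[OF assms] by simp
next
  case False
  then have "h b \<noteq> 0" by (rule rhom_nonzero[OF assms])
  moreover have "h (a / b) * h b = h a" using False by (simp flip: rhom_mult[OF assms])
  ultimately show ?thesis by (simp add: eq_divide_eq)
qed

lemma det3_all_zero:
  fixes u v w :: "4 \<Rightarrow> 'a::idom"
  assumes "det3 u v w 1 2 3 = 0" "det3 u v w 4 2 3 = 0" "det3 u v w 1 4 3 = 0" "det3 u v w 1 2 4 = 0"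
  shows "det3 u v w p q j = 0"
proof -
  have swap: "det3 u v w p q j = - det3 u v w q p j" "det3 u v w p q j = - det3 u v w p j q" for p q j
    unfolding det3_def by (simp_all add: algebra_simps)
  have diag: "det3 u v w p p j = 0" "det3 u v w p q q = 0" "det3 u v w p q p = 0" for p q j
    unfolding det3_def by (simp_all add: algebra_simps)
  have sorted: "det3 u v w 1 2 3 = 0" "det3 u v w 1 2 4 = 0" "det3 u v w 1 3 4 = 0" "det3 u v w 2 3 4 = 0"
    using assms swap(1)[of 4 2 3] swap(2)[of 2 4 3] swap(2)[of 1 4 3] by auto
  have 3: "det3 u v w p j q = 0" "det3 u v w q p j = 0" "det3 u v w q j p = 0" "det3 u v w j p q = 0" "det3 u v w j q p = 0"
    if "det3 u v w p q j = 0" for p q j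
    using that swap(1)[of p q j] swap(2)[of p q j] swap(1)[of p j q] swap(2)[of q p j] swap(1)[of q j p] by auto
  note s = sorted sorted[THEN 3(1)] sorted[THEN 3(2)] sorted[THEN 3(3)] sorted[THEN 3(4)] sorted[THEN 3(5)]
  have "\<forall>p q j. det3 u v w p q j = 0"
    unfolding forall_4 by (simp only: s diag simp_thms)
  then show ?thesis by blast
qed

lemma det3_adapted:
  "det3 (adapted c u) (adapted c v) (adapted c w) 1 2 3 = det3 u v w 1 2 3 - [:c 1:] * det3 u v w 4 2 3
     - [:c 2:] * det3 u v w 1 4 3 - [:c 3:] * det3 u v w 1 2 4"
  unfolding det3_def adapted_def by simp (simp add: algebra_simps smult_add_right smult_diff_right)

text \<open>The centre of projection has to avoid the surface and the plane spanned by
  \<open>x\<close> and its two derivatives; the four minors are, up to sign, the coefficients of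
  that plane.\<close>

lemma (in generic_point) chart_exists:
  assumes "d > 0" and D: "D1 \<in> DD" "D2 \<in> DD" and nz: "det3 x (dx D1) (dx D2) p q j \<noteq> 0"
  obtains cK c where "chart emb x m B Db F d E cK c"
    "det3 (adapted c x) (adapted c (dx D1)) (adapted c (dx D2)) 1 2 3 \<noteq> 0"
proof -
  let ?n = "\<lambda>p q j. det3 x (dx D1) (dx D2) p q j"
  define P where "P = to_poly4 (\<lambda>_. 0) F"
  \<comment> \<open>The extra factor \<open>Y4\<close> keeps the last coordinate nonzero, so that
    the point can be normalised to \<open>cK 4 = 1\<close>.\<close>
  define Q where "Q = (const4 (?n 1 2 3) * Y4 - const4 (?n 4 2 3) * Y1 - const4 (?n 1 4 3) * Y2 - const4 (?n 1 2 4) * Y3) * Y4"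
  have P: "P \<noteq> 0" using irreducible_to_poly4[OF irreducible_F, of "\<lambda>_. 0"] by (auto simp: P_def)
  have evQ: "ev4 (\<lambda>x. x) a b e f Q = (?n 1 2 3 * f - ?n 4 2 3 * a - ?n 1 4 3 * b - ?n 1 2 4 * e) * f" for a b e f
    unfolding Q_def by (simp add: rhom_mult[OF rhom_ev4[OF rhom_id]] rhom_diff[OF rhom_ev4[OF rhom_id]] ev4_simps[OF rhom_id])
  have Q: "Q \<noteq> 0"
  proof
    assume Q0: "Q = 0"
    have z: "(?n 1 2 3 * f - ?n 4 2 3 * a - ?n 1 4 3 * b - ?n 1 2 4 * e) * f = 0" for a b e f
      unfolding evQ[symmetric] Q0 by (rule rhom_0[OF rhom_ev4[OF rhom_id]])
    have "?n 1 2 3 = 0" using z[of 1 0 0 0] by simp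
    moreover have "?n 4 2 3 = 0" using z[of 1 1 0 0] \<open>?n 1 2 3 = 0\<close> by simp
    moreover have "?n 1 4 3 = 0" using z[of 1 0 1 0] \<open>?n 1 2 3 = 0\<close> by simp
    moreover have "?n 1 2 4 = 0" using z[of 1 0 0 1] \<open>?n 1 2 3 = 0\<close> by simp
    ultimately show False using det3_all_zero nz by blast
  qed
  obtain n1 n2 n3 n4 :: nat where
    nP: "ev4 (\<lambda>x. x) (of_nat n1) (of_nat n2) (of_nat n3) (of_nat n4) P \<noteq> 0" and
    nQ: "ev4 (\<lambda>x. x) (of_nat n1) (of_nat n2) (of_nat n3) (of_nat n4) Q \<noteq> 0"
    by (rule nat_point_avoiding_zeros[OF P Q])
  have n4: "n4 \<noteq> 0" using nQ by (auto simp: evQ)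
  define cK :: "4 \<Rightarrow> ratfun" where "cK i = of_nat (vec4 n1 n2 n3 n4 i) / of_nat n4" for i
  define c :: "4 \<Rightarrow> 'a" where "c i = of_nat (vec4 n1 n2 n3 n4 i) / of_nat n4" for i
  have "chart emb x m B Db F d E cK c"
  proof unfold_locales
    show "cK 4 = 1" using n4 by (simp add: cK_def)
    have "ev4 (\<lambda>x. x) (of_nat n1) (of_nat n2) (of_nat n3) (of_nat n4) P =
       ev_hom (\<lambda>x. x) F (\<lambda>i. of_nat (vec4 n1 n2 n3 n4 i))"
    proof -
      note r = rhom_ev4[OF rhom_id, of "of_nat n1 :: ratfun" "of_nat n2" "of_nat n3" "of_nat n4"]
      have "(\<lambda>i. ev4 (\<lambda>x. x) (of_nat n1 :: ratfun) (of_nat n2) (of_nat n3) (of_nat n4) (subst4 (\<lambda>_. 0) i)) =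
          (\<lambda>i. of_nat (vec4 n1 n2 n3 n4 i))"
        by (simp add: fun_eq_4 subst4_def rhom_add[OF r] rhom_mult[OF r] ev4_simps[OF rhom_id])
      then show ?thesis unfolding P_def to_poly4_def ev_hom_hom[OF r] by (simp add: ev4_simps[OF rhom_id])
    qed
    also have "(\<lambda>i. of_nat (vec4 n1 n2 n3 n4 i)) = (\<lambda>i. of_nat n4 * cK i)" using n4 by (simp add: cK_def fun_eq_iff)
    also have "ev_hom (\<lambda>x. x) F (\<lambda>i. of_nat n4 * cK i) = of_nat n4 ^ d * ev_hom (\<lambda>x. x) F cK"
      by (rule ev_hom_scale[OF form_F])
    finally show "ev_hom (\<lambda>x. x) F cK \<noteq> 0" using nP by auto
    have r: "rhom (\<lambda>a::'a. to_fract [:a:])" using rhom_comp[OF rhom_to_fract rhom_const_poly] by (simp add: comp_def)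
    show "kk (cK i) = to_fract [:c i:]" for i
      by (simp add: cK_def c_def rhom_divide[OF rhom_kk] rhom_divide[OF r] rhom_of_nat[OF rhom_kk] rhom_of_nat[OF r])
    show "D (c i) = 0" if "D \<in> DD" for D i
      using n4 by (simp add: c_def derivation_divide[OF DD_derivation[OF that]] DD_of_nat[OF that])
    show "d > 0" by (rule assms)
  qed
  moreover have "det3 (adapted c x) (adapted c (dx D1)) (adapted c (dx D2)) 1 2 3 \<noteq> 0"
  proof
    assume z: "det3 (adapted c x) (adapted c (dx D1)) (adapted c (dx D2)) 1 2 3 = 0"
    have "of_nat n4 * [:c i:] = of_nat (vec4 n1 n2 n3 n4 i)" for i
      using n4 by (simp add: c_def of_nat_poly)
    then have cn: "of_nat n1 = of_nat n4 * [:c 1:]" "of_nat n2 = of_nat n4 * [:c 2:]" "of_nat n3 = of_nat n4 * [:c 3:]"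
      by (metis vec4_simps)+
    have "?n 1 2 3 * of_nat n4 - ?n 4 2 3 * of_nat n1 - ?n 1 4 3 * of_nat n2 - ?n 1 2 4 * of_nat n3 =
       of_nat n4 * det3 (adapted c x) (adapted c (dx D1)) (adapted c (dx D2)) 1 2 3"
      unfolding det3_adapted cn by (simp only: right_diff_distrib mult.assoc mult.left_commute mult.commute)
    then show False using nQ z by (simp add: evQ)
  qed
  ultimately show thesis by (rule that)
qed

context chart
begin

lemma Y_values: "y 1 = x 1 - smult (c 1) (x 4)" "y 2 = x 2 - smult (c 2) (x 4)"
  "y 3 = x 3 - smult (c 3) (x 4)" "y 4 = x 4"
  by (simp_all add: y_def adapted_def)

lemma X_of_Y: "X = vec4 (Y 1 + kk (cK 1) * Y 4) (Y 2 + kk (cK 2) * Y 4) (Y 3 + kk (cK 3) * Y 4) (Y 4)"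
proof -
  have "to_fract (smult a p) = to_fract [:a:] * to_fract p" for a and p :: "'a poly"
    by (simp flip: to_fract_mult)
  then show ?thesis by (simp add: fun_eq_4 X_def Y_def Y_values kk_cK)
qed

lemma X_of_Y': "X i = (if i = 4 then 0 else Y i) + kk (cK i) * Y 4"
proof -
  have "\<forall>i. X i = (if i = 4 then 0 else Y i) + kk (cK i) * Y 4"
    unfolding forall_4 by (subst (1 2 3 4) X_of_Y) (simp add: cK4 rhom_1[OF rhom_kk])
  then show ?thesis by blast
qed

lemma degree_y: "degree (y i) \<le> m"
proof -
  have "degree (x j - smult a (x 4)) \<le> m" for j a
    using degree_x[of j] degree_x[of 4] by (intro degree_diff_le) (auto intro: order_trans[OF degree_smult_le])
  then have "\<forall>i. degree (y i) \<le> m" unfolding forall_4 Y_values using degree_x by simp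
  then show ?thesis by blast
qed

lemma lift_E_Y: "lift_der E (Y i) = Y i"
proof -
  have c: "E (c i) = 0" for i using DD_c[OF E_DD] .
  note l = DD_lift[OF E_DD]
  have "to_fract (smult a p) = to_fract [:a:] * to_fract p" for a and p :: "'a poly"
    by (simp flip: to_fract_mult)
  then have "Y 1 = X 1 - kk (cK 1) * X 4" "Y 2 = X 2 - kk (cK 2) * X 4" "Y 3 = X 3 - kk (cK 3) * X 4" "Y 4 = X 4"
    by (simp_all add: Y_def X_def Y_values kk_cK)
  then have "\<forall>i. lift_der E (Y i) = Y i"
    unfolding forall_4 by (simp add: der_diff[OF l] der_mult[OF l] DD_kk[OF E_DD] lift_E_X)
  then show ?thesis by blast
qed

lemma lift_der_Y: "D \<in> DD \<Longrightarrow> lift_der D (Y i) = to_fract (adapted c (dx D) i)"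
proof -
  assume D: "D \<in> DD"
  note d = DD_derivation[OF D]
  have "map_poly D (smult (c i) p) = smult (c i) (map_poly D p)" for i p
    using DD_c[OF D] by (intro poly_eqI) (simp add: coeff_map_poly_der[OF d] der_mult[OF d])
  then have "\<forall>i. map_poly D (y i) = adapted c (dx D) i"
    unfolding forall_4 Y_values by (simp add: adapted_def dx_def der_diff[OF derivation_map_poly[OF d]])
  then show ?thesis by (simp add: Y_def lift_der_to_fract[OF d])
qed

text \<open>The three vectors remain independent after projection from the centre \<open>c\<close>,
  so \<open>E\<close>, \<open>D1\<close>, \<open>D2\<close> account for all tangent directions of
  the cone over the surface.\<close>

definition frame :: "('a \<Rightarrow> 'a) \<Rightarrow> ('a \<Rightarrow> 'a) \<Rightarrow> bool" where
  "frame D1 D2 \<longleftrightarrow> D1 \<in> DD \<and> D2 \<in> DD \<and> det3 y (adapted c (dx D1)) (adapted c (dx D2)) 1 2 3 \<noteq> 0"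

lemma frame_solve:
  assumes "frame D1 D2"
  obtains \<alpha> \<beta> \<gamma> where "\<alpha> * Y 1 + \<beta> * lift_der D1 (Y 1) + \<gamma> * lift_der D2 (Y 1) = v1"
    "\<alpha> * Y 2 + \<beta> * lift_der D1 (Y 2) + \<gamma> * lift_der D2 (Y 2) = v2"
    "\<alpha> * Y 3 + \<beta> * lift_der D1 (Y 3) + \<gamma> * lift_der D2 (Y 3) = v3"
proof -
  have D: "D1 \<in> DD" "D2 \<in> DD" and nz: "det3 y (adapted c (dx D1)) (adapted c (dx D2)) 1 2 3 \<noteq> 0"
    using assms by (auto simp: frame_def)
  have "to_fract (det3 y (adapted c (dx D1)) (adapted c (dx D2)) 1 2 3) =
      det3 Y (\<lambda>i. lift_der D1 (Y i)) (\<lambda>i. lift_der D2 (Y i)) 1 2 3"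
    by (simp add: det3_hom[OF rhom_to_fract] lift_der_Y D) (simp add: Y_def[abs_def])
  then have "det3 Y (\<lambda>i. lift_der D1 (Y i)) (\<lambda>i. lift_der D2 (Y i)) 1 2 3 \<noteq> 0" using nz by (metis to_fract_eq_0_iff)
  then show thesis unfolding det3_def by (rule cramer3) (rule that)
qed

text \<open>The coefficients may be taken from the large field, so suitable combinations of
  \<open>E\<close>, \<open>D1\<close>, \<open>D2\<close> have any values on \<open>Y 1\<close>,
  \<open>Y 2\<close>, \<open>Y 3\<close>. This is the hypothesis \<open>solve\<close> used for the
  independence of monomials.\<close>

lemma frame_derivation:
  assumes "frame D1 D2"
  shows "\<exists>\<delta>. derivation \<delta> \<and> (\<forall>k. \<delta> (kk k) = 0) \<and> \<delta> (Y 1) = v1 \<and> \<delta> (Y 2) = v2 \<and> \<delta> (Y 3) = v3"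
proof -
  have D: "D1 \<in> DD" "D2 \<in> DD" using assms by (auto simp: frame_def)
  obtain \<alpha> \<beta> \<gamma> where s: "\<alpha> * Y 1 + \<beta> * lift_der D1 (Y 1) + \<gamma> * lift_der D2 (Y 1) = v1"
    "\<alpha> * Y 2 + \<beta> * lift_der D1 (Y 2) + \<gamma> * lift_der D2 (Y 2) = v2"
    "\<alpha> * Y 3 + \<beta> * lift_der D1 (Y 3) + \<gamma> * lift_der D2 (Y 3) = v3"
    by (rule frame_solve[OF assms])
  let ?d = "\<lambda>z. \<alpha> * lift_der E z + \<beta> * lift_der D1 z + \<gamma> * lift_der D2 z"
  have "derivation ?d" by (intro derivation_add derivation_scale DD_lift E_DD D)
  moreover have "\<forall>k. ?d (kk k) = 0" by (simp add: DD_kk E_DD D)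
  ultimately show ?thesis using s by (intro exI[of _ ?d]) (simp add: lift_E_Y)
qed

lemma F_Y: "ev_hom kk F (vec4 (Y 1 + kk (cK 1) * Y 4) (Y 2 + kk (cK 2) * Y 4) (Y 3 + kk (cK 3) * Y 4) (Y 4)) = 0"
  using F_X by (simp flip: X_of_Y)

text \<open>The derivative of the equation at \<open>X\<close> in the direction of the centre, that
  is, its partial derivative in the coordinate \<open>Y 4\<close>.\<close>

definition gx :: "'a poly fract" where "gx = (\<Sum>i\<in>UNIV. ev_pd kk F X i * kk (cK i))"

lemma gx_nonzero: "frame D1 D2 \<Longrightarrow> gx \<noteq> 0"
  using directional_derivative_nonzero[OF irreducible_F form_F d_pos rhom_kk cK4 F_cK F_Y frame_derivation]
  unfolding gx_def by (subst (asm) (1) X_of_Y[symmetric])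

lemma Y_monomials_independent:
  assumes "frame D1 D2" "finite J" "\<And>l i j k. (l, i, j, k) \<in> J \<Longrightarrow> k < d"
    "(\<Sum>(l, i, j, k)\<in>J. kk (\<kappa> (l, i, j, k)) * (Y 1 ^ l * Y 2 ^ i * Y 3 ^ j * Y 4 ^ k)) = 0" "t \<in> J"
  shows "\<kappa> t = 0"
  using monomials_independent[OF irreducible_F form_F d_pos rhom_kk cK4 F_cK F_Y frame_derivation[OF assms(1)] assms(2-5)] .

text \<open>Implicit differentiation of the equation \<open>F_X\<close>.\<close>

lemma der_Y4:
  assumes "derivation \<delta>" "\<And>k. \<delta> (kk k) = 0"
  shows "gx * \<delta> (Y 4) = - (ev_pd kk F X 1 * \<delta> (Y 1) + ev_pd kk F X 2 * \<delta> (Y 2) + ev_pd kk F X 3 * \<delta> (Y 3))"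
proof -
  have "0 = \<delta> (ev_hom kk F X)" by (simp add: F_X der_0[OF assms(1)])
  also have "\<dots> = (\<Sum>i\<in>UNIV. ev_pd kk F X i * \<delta> (X i))" by (rule der_ev_hom[OF assms])
  also have "\<dots> = (\<Sum>i\<in>UNIV. ev_pd kk F X i * (if i = 4 then 0 else \<delta> (Y i)) + ev_pd kk F X i * kk (cK i) * \<delta> (Y 4))"
    by (intro sum.cong refl)
       (simp add: X_of_Y'[of 4] X_of_Y' der_add[OF assms(1)] der_mult[OF assms(1)] assms(2) der_0[OF assms(1)] algebra_simps)
  also have "\<dots> = (\<Sum>i\<in>UNIV. ev_pd kk F X i * (if i = 4 then 0 else \<delta> (Y i))) + gx * \<delta> (Y 4)"
    by (simp add: sum.distrib gx_def sum_distrib_right)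
  finally show ?thesis by (simp add: sum_4 eq_neg_iff_add_eq_0 algebra_simps)
qed

lemma der_kills_Y4:
  assumes "gx \<noteq> 0" "derivation \<delta>" "\<And>k. \<delta> (kk k) = 0" "\<delta> (Y 1) = 0" "\<delta> (Y 2) = 0" "\<delta> (Y 3) = 0"
  shows "\<delta> (Y i) = 0"
proof -
  have "gx * \<delta> (Y 4) = 0" using der_Y4[OF assms(2,3)] assms by simp
  then have "\<forall>i. \<delta> (Y i) = 0" unfolding forall_4 using assms by simp
  then show ?thesis by blast
qed

end

section \<open>Derivations along the surface\<close>

lemma det3_combination:
  "det3 u (\<lambda>i. a1 * u i + b1 * v i + c1 * w i) (\<lambda>i. a2 * u i + b2 * v i + c2 * w i) p q j =
     (b1 * c2 - b2 * c1) * det3 u v w p q j"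
  unfolding det3_def by (simp add: algebra_simps)

context chart
begin

text \<open>Elements on which a derivation over the base field is determined by its values on \<open>Y\<^sub>1, Y\<^sub>2, Y\<^sub>3\<close>.\<close>

definition LL :: "'a poly fract set" where
  "LL = {z. \<forall>\<delta>. derivation \<delta> \<longrightarrow> (\<forall>k. \<delta> (kk k) = 0) \<longrightarrow> \<delta> (Y 1) = 0 \<longrightarrow> \<delta> (Y 2) = 0 \<longrightarrow> \<delta> (Y 3) = 0 \<longrightarrow> \<delta> z = 0}"

lemma LL_D: "z \<in> LL \<Longrightarrow> derivation \<delta> \<Longrightarrow> (\<And>k. \<delta> (kk k) = 0) \<Longrightarrow> \<delta> (Y 1) = 0 \<Longrightarrow> \<delta> (Y 2) = 0 \<Longrightarrow> \<delta> (Y 3) = 0 \<Longrightarrow> \<delta> z = 0"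
  by (simp add: LL_def)

lemma subring_LL: "subring_set LL"
  by (auto simp: subring_set_def LL_def der_1 der_diff der_mult)

lemma LL_kk: "kk k \<in> LL" by (simp add: LL_def)

lemma LL_Y: "gx \<noteq> 0 \<Longrightarrow> Y i \<in> LL" by (simp add: LL_def der_kills_Y4)

lemma LL_X: "gx \<noteq> 0 \<Longrightarrow> X i \<in> LL"
  unfolding X_of_Y'[of i] by (auto intro!: subring_set_closed[OF subring_LL] LL_kk LL_Y)

lemma LL_inverse: "z \<in> LL \<Longrightarrow> inverse z \<in> LL"
  by (cases "z = 0") (auto simp: LL_def derivation_inverse)

lemma frame_express:
  assumes "frame D1 D2" "D \<in> DD"
  shows "\<exists>\<alpha> \<beta> \<gamma>. \<forall>z\<in>LL. lift_der D z = \<alpha> * lift_der E z + \<beta> * lift_der D1 z + \<gamma> * lift_der D2 z"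
proof -
  have D: "D1 \<in> DD" "D2 \<in> DD" using assms(1) by (auto simp: frame_def)
  obtain \<alpha> \<beta> \<gamma> where s: "\<alpha> * Y 1 + \<beta> * lift_der D1 (Y 1) + \<gamma> * lift_der D2 (Y 1) = lift_der D (Y 1)"
    "\<alpha> * Y 2 + \<beta> * lift_der D1 (Y 2) + \<gamma> * lift_der D2 (Y 2) = lift_der D (Y 2)"
    "\<alpha> * Y 3 + \<beta> * lift_der D1 (Y 3) + \<gamma> * lift_der D2 (Y 3) = lift_der D (Y 3)"
    by (rule frame_solve[OF assms(1)])
  let ?d = "\<lambda>z. lift_der D z - (\<alpha> * lift_der E z + \<beta> * lift_der D1 z + \<gamma> * lift_der D2 z)"
  have "?d z = 0" if "z \<in> LL" for z
  proof (rule LL_D[OF that])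
    show "derivation ?d" by (intro derivation_minus derivation_add derivation_scale DD_lift E_DD D assms)
  qed (simp_all add: DD_kk E_DD D assms lift_E_Y s)
  then show ?thesis by (intro exI[of _ \<alpha>] exI[of _ \<beta>] exI[of _ \<gamma>]) simp
qed

text \<open>Passing to another pair of derivations multiplies the determinants formed from
  \<open>X\<close> and from \<open>Y\<close> by the same factor, so it does not matter on which one
  this factor is seen to be nonzero. Hence one chart serves all pairs.\<close>

lemma frame_transfer:
  assumes fr: "frame D1 D2" and D': "D1' \<in> DD" "D2' \<in> DD" and nz: "det3 x (dx D1') (dx D2') p q j \<noteq> 0"
  shows "frame D1' D2'"
proof -
  have g: "gx \<noteq> 0" by (rule gx_nonzero[OF fr])
  have D: "D1 \<in> DD" "D2 \<in> DD" and J: "det3 y (adapted c (dx D1)) (adapted c (dx D2)) 1 2 3 \<noteq> 0"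
    using fr by (auto simp: frame_def)
  obtain \<alpha>1 \<beta>1 \<gamma>1 where 1: "\<forall>z\<in>LL. lift_der D1' z = \<alpha>1 * lift_der E z + \<beta>1 * lift_der D1 z + \<gamma>1 * lift_der D2 z"
    using frame_express[OF fr D'(1)] by blast
  obtain \<alpha>2 \<beta>2 \<gamma>2 where 2: "\<forall>z\<in>LL. lift_der D2' z = \<alpha>2 * lift_der E z + \<beta>2 * lift_der D1 z + \<gamma>2 * lift_der D2 z"
    using frame_express[OF fr D'(2)] by blast
  have gen: "det3 U (\<lambda>i. lift_der D1' (U i)) (\<lambda>i. lift_der D2' (U i)) p q j =
      (\<beta>1 * \<gamma>2 - \<beta>2 * \<gamma>1) * det3 U (\<lambda>i. lift_der D1 (U i)) (\<lambda>i. lift_der D2 (U i)) p q j"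
    if "\<And>i. U i \<in> LL" "\<And>i. lift_der E (U i) = U i" for U p q j
  proof -
    have "lift_der D1' (U i) = \<alpha>1 * U i + \<beta>1 * lift_der D1 (U i) + \<gamma>1 * lift_der D2 (U i)"
      "lift_der D2' (U i) = \<alpha>2 * U i + \<beta>2 * lift_der D1 (U i) + \<gamma>2 * lift_der D2 (U i)" for i
      using that 1 2 by simp_all
    then show ?thesis by (simp only: det3_combination)
  qed
  have "det3 X (\<lambda>i. lift_der D1' (X i)) (\<lambda>i. lift_der D2' (X i)) p q j = to_fract (det3 x (dx D1') (dx D2') p q j)"
    by (simp add: det3_hom[OF rhom_to_fract] lift_der_X D') (simp add: X_def[abs_def])
  then have "\<beta>1 * \<gamma>2 - \<beta>2 * \<gamma>1 \<noteq> 0" using nz gen[of X p q j] LL_X[OF g] lift_E_X by auto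
  have Yd: "det3 Y (\<lambda>i. lift_der D (Y i)) (\<lambda>i. lift_der D'' (Y i)) 1 2 3 =
      to_fract (det3 y (adapted c (dx D)) (adapted c (dx D'')) 1 2 3)" if "D \<in> DD" "D'' \<in> DD" for D D''
    by (simp add: det3_hom[OF rhom_to_fract] lift_der_Y that) (simp add: Y_def[abs_def])
  have "to_fract (det3 y (adapted c (dx D1')) (adapted c (dx D2')) 1 2 3) =
      (\<beta>1 * \<gamma>2 - \<beta>2 * \<gamma>1) * to_fract (det3 y (adapted c (dx D1)) (adapted c (dx D2)) 1 2 3)"
    using gen[of Y 1 2 3] LL_Y[OF g] lift_E_Y Yd D D' by simp
  then have "det3 y (adapted c (dx D1')) (adapted c (dx D2')) 1 2 3 \<noteq> 0"
    using J \<open>\<beta>1 * \<gamma>2 - \<beta>2 * \<gamma>1 \<noteq> 0\<close> by (metis mult_eq_0_iff to_fract_eq_0_iff)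
  then show ?thesis using D' by (simp add: frame_def)
qed

end

text \<open>
  \<open>P\<close> and \<open>Q\<close> are the partial derivatives with respect to the affine coordinates
  \<open>u = Y\<^sub>2 / Y\<^sub>1\<close> and \<open>w = Y\<^sub>3 / Y\<^sub>1\<close> on the surface, extended by \<open>P Y\<^sub>1 = Q Y\<^sub>1 = 0\<close>.
\<close>

locale affine_coords = chart +
  fixes P Q
  assumes gx0: "gx \<noteq> 0" and Y10: "Y 1 \<noteq> 0"
    and P: "derivation P" "\<And>k. P (kk k) = 0" "P (Y 1) = 0" "P (Y 2) = Y 1" "P (Y 3) = 0"
    and Q: "derivation Q" "\<And>k. Q (kk k) = 0" "Q (Y 1) = 0" "Q (Y 2) = 0" "Q (Y 3) = Y 1"
begin

text \<open>Finitely many generators, so all elements are regular outside a finite set of places;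
  \<open>gx\<close> is the only denominator that \<open>P\<close> and \<open>Q\<close> introduce.
  The part \<open>RR0\<close> without denominators comes first, so that \<open>gx\<close> lies in it
  before its inverse is adjoined.\<close>

inductive_set RR0 :: "'a poly fract set" where
  "1 \<in> RR0"
| "k \<in> Poly_Mapping.keys F \<Longrightarrow> kk (Poly_Mapping.lookup F k) \<in> RR0"
| "kk (cK i) \<in> RR0"
| "Y i \<in> RR0"
| "z \<in> RR0 \<Longrightarrow> z' \<in> RR0 \<Longrightarrow> z - z' \<in> RR0"
| "z \<in> RR0 \<Longrightarrow> z' \<in> RR0 \<Longrightarrow> z * z' \<in> RR0"

inductive_set RR :: "'a poly fract set" where
  "z \<in> RR0 \<Longrightarrow> z \<in> RR"
| "inverse gx \<in> RR"
| "z \<in> RR \<Longrightarrow> z' \<in> RR \<Longrightarrow> z - z' \<in> RR"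
| "z \<in> RR \<Longrightarrow> z' \<in> RR \<Longrightarrow> z * z' \<in> RR"

lemma subring_RR0: "subring_set RR0" by (auto simp: subring_set_def intro: RR0.intros)

lemma subring_RR: "subring_set RR" by (auto simp: subring_set_def intro: RR.intros RR0.intros)

lemmas RR_closed = subring_set_closed[OF subring_RR]
lemmas RR0_closed = subring_set_closed[OF subring_RR0]

lemma X_RR0: "X i \<in> RR0"
  unfolding X_of_Y'[of i] by (auto intro!: RR0_closed intro: RR0.intros)

lemma ev_pd_RR0: "ev_pd kk F X i \<in> RR0"
  by (rule ev_pd_in_subring[OF subring_RR0]) (auto intro: RR0.intros X_RR0)

lemma gx_RR0: "gx \<in> RR0"
  unfolding gx_def by (intro subring_set_sum[OF subring_RR0] RR0_closed(4) ev_pd_RR0) (rule RR0.intros)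

lemma RR_LL: "z \<in> RR \<Longrightarrow> z \<in> LL"
proof -
  have 0: "z \<in> LL" if "z \<in> RR0" for z using that
    by induction (auto intro!: subring_set_closed[OF subring_LL] LL_kk LL_Y gx0)
  show "z \<in> RR \<Longrightarrow> z \<in> LL"
    by (induction rule: RR.induct) (auto intro: subring_set_closed(4,6)[OF subring_LL] 0 LL_inverse gx_RR0)
qed

lemma der_RR:
  assumes \<delta>: "derivation \<delta>" "\<And>k. \<delta> (kk k) = 0" and Y: "\<delta> (Y 1) \<in> RR" "\<delta> (Y 2) \<in> RR" "\<delta> (Y 3) \<in> RR"
    and z: "z \<in> RR"
  shows "\<delta> z \<in> RR"
proof -
  have "\<delta> (Y 4) = inverse gx * - (ev_pd kk F X 1 * \<delta> (Y 1) + ev_pd kk F X 2 * \<delta> (Y 2) + ev_pd kk F X 3 * \<delta> (Y 3))"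
    using der_Y4[OF \<delta>] gx0 by (simp add: field_simps)
  also have "\<dots> \<in> RR" by (intro RR_closed RR.intros(2) Y RR.intros(1)[OF ev_pd_RR0])
  finally have "\<forall>i. \<delta> (Y i) \<in> RR" unfolding forall_4 using Y by simp
  then have Y': "\<delta> (Y i) \<in> RR" for i by blast
  have 0: "\<delta> z \<in> RR" if "z \<in> RR0" for z using that
    by induction (auto simp: \<delta> der_1 der_diff der_mult intro!: RR_closed Y' intro: RR.intros)
  show ?thesis using z
  proof induction
    case 2
    have "\<delta> (inverse gx) = - (inverse gx * inverse gx * \<delta> gx)"
      using derivation_inverse[OF \<delta>(1) gx0] by (simp add: divide_inverse power2_eq_square mult.commute)
    then show ?case by (simp only:) (intro RR_closed RR.intros(2) 0 gx_RR0)
  qed (auto simp: der_diff[OF \<delta>(1)] der_mult[OF \<delta>(1)] intro!: RR_closed intro: 0)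
qed

lemma P_RR: "z \<in> RR \<Longrightarrow> P z \<in> RR"
  by (rule der_RR[OF P(1,2)]) (auto simp: P intro: RR_closed(1) RR.intros RR0.intros)

lemma Q_RR: "z \<in> RR \<Longrightarrow> Q z \<in> RR"
  by (rule der_RR[OF Q(1,2)]) (auto simp: Q intro: RR_closed(1) RR.intros RR0.intros)

text \<open>The bracket is a derivation that kills \<open>Y 1\<close>, \<open>Y 2\<close>,
  \<open>Y 3\<close>, hence all of \<open>LL\<close>. The commutation with \<open>E\<close> has the
  same reason.\<close>

lemma PQ_commute: "z \<in> RR \<Longrightarrow> Q (P z) = P (Q z)"
proof -
  assume "z \<in> RR"
  have "(\<lambda>z. Q (P z) - P (Q z)) z = 0"
    by (rule LL_D[OF RR_LL[OF \<open>z \<in> RR\<close>]])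
       (auto simp: P Q der_0 intro: derivation_bracket)
  then show ?thesis by simp
qed

lemma EP_commute: "z \<in> RR \<Longrightarrow> lift_der E (P z) = P (lift_der E z)"
proof -
  assume "z \<in> RR"
  have "(\<lambda>z. lift_der E (P z) - P (lift_der E z)) z = 0"
    by (rule LL_D[OF RR_LL[OF \<open>z \<in> RR\<close>]])
       (auto simp: P lift_E_Y DD_kk E_DD der_0[OF DD_lift[OF E_DD]] der_0[OF P(1)] intro: derivation_bracket[OF DD_lift[OF E_DD] P(1)])
  then show ?thesis by simp
qed

lemma EQ_commute: "z \<in> RR \<Longrightarrow> lift_der E (Q z) = Q (lift_der E z)"
proof -
  assume "z \<in> RR"
  have "(\<lambda>z. lift_der E (Q z) - Q (lift_der E z)) z = 0"
    by (rule LL_D[OF RR_LL[OF \<open>z \<in> RR\<close>]])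
       (auto simp: Q lift_E_Y DD_kk E_DD der_0[OF DD_lift[OF E_DD]] der_0[OF Q(1)] intro: derivation_bracket[OF DD_lift[OF E_DD] Q(1)])
  then show ?thesis by simp
qed

definition PQ :: "nat \<Rightarrow> nat \<Rightarrow> 'a poly fract \<Rightarrow> 'a poly fract" where
  "PQ i j z = (P ^^ i) ((Q ^^ j) z)"

lemma Qpow_RR: "z \<in> RR \<Longrightarrow> (Q ^^ j) z \<in> RR"
  by (induction j) (auto intro: Q_RR)

lemma Ppow_RR: "z \<in> RR \<Longrightarrow> (P ^^ i) z \<in> RR"
  by (induction i) (auto intro: P_RR)

lemma PQ_RR: "z \<in> RR \<Longrightarrow> PQ i j z \<in> RR"
  by (simp add: PQ_def Qpow_RR Ppow_RR)

lemma P_PQ: "P (PQ i j z) = PQ (Suc i) j z"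
  by (simp add: PQ_def)

lemma Q_PQ: "z \<in> RR \<Longrightarrow> Q (PQ i j z) = PQ i (Suc j) z"
proof -
  assume z: "z \<in> RR"
  have "Q ((P ^^ i) z') = (P ^^ i) (Q z')" if "z' \<in> RR" for z'
    using that by (induction i) (auto simp: PQ_commute Ppow_RR)
  then show ?thesis using z by (simp add: PQ_def Qpow_RR)
qed

lemma E_PQ:
  assumes z: "z \<in> RR" "lift_der E z = of_nat e * z"
  shows "lift_der E (PQ i j z) = of_nat e * PQ i j z"
proof -
  have 1: "lift_der E ((Q ^^ j) z) = of_nat e * (Q ^^ j) z" for j
    by (induction j) (use z in \<open>auto simp: EQ_commute Qpow_RR der_mult[OF Q(1)] der_of_nat[OF Q(1)]\<close>)
  have "lift_der E ((P ^^ i) z') = of_nat e * (P ^^ i) z'" if "z' \<in> RR" "lift_der E z' = of_nat e * z'" for z' i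
    by (induction i) (use that in \<open>auto simp: EP_commute Ppow_RR der_mult[OF P(1)] der_of_nat[OF P(1)]\<close>)
  then show ?thesis using 1 z by (simp add: PQ_def Qpow_RR)
qed

text \<open>On \<open>RR\<close> a derivation over the base field is determined by its values on
  \<open>Y 1\<close>, \<open>Y 2\<close>, \<open>Y 3\<close>; the coefficients of
  \<open>lift_der E\<close>, \<open>P\<close>, \<open>Q\<close> are chosen to match them.\<close>

lemma lift_der_RR:
  assumes D: "D \<in> DD" and z: "z \<in> RR"
  shows "lift_der D z = lift_der D (Y 1) / Y 1 * lift_der E z + lift_der D (Y 2 / Y 1) * P z + lift_der D (Y 3 / Y 1) * Q z"
proof -
  let ?d = "\<lambda>z. lift_der D z - (lift_der D (Y 1) / Y 1 * lift_der E z + lift_der D (Y 2 / Y 1) * P z + lift_der D (Y 3 / Y 1) * Q z)"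
  have q: "lift_der D (Y i / Y 1) * Y 1 = lift_der D (Y i) - lift_der D (Y 1) / Y 1 * Y i" for i
    using Y10 by (simp add: derivation_divide[OF DD_lift[OF D]] field_simps power2_eq_square)
  have "?d z = 0"
  proof (rule LL_D[OF RR_LL[OF z]])
    show "derivation ?d" by (intro derivation_minus derivation_add derivation_scale DD_lift E_DD D P(1) Q(1))
  qed (simp_all add: P Q lift_E_Y DD_kk E_DD D q Y10)
  then show ?thesis by simp
qed

end

text \<open>The sum of \<open>k - |\<alpha>|\<close> over the monomials \<alpha> of degree below
  \<open>k\<close> in two variables, of which \<open>l + 1\<close> have degree
  \<open>l\<close>.\<close>

definition tri :: "nat \<Rightarrow> nat" where "tri k = (\<Sum>l<k. (l + 1) * (k - l))"

lemma tri_eq: "6 * tri k = k * (k + 1) * (k + 2)"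
  unfolding tri_def by (rule sum_triangle)

text \<open>The order of composition matters, since the two derivations need not commute. In
  contrast to \<open>P\<close> and \<open>Q\<close>, lifted derivations map polynomials to
  polynomials of no larger degree.\<close>

inductive_set words :: "('a \<Rightarrow> 'a) \<Rightarrow> ('a \<Rightarrow> 'a) \<Rightarrow> ('a \<Rightarrow> 'a) set" for \<delta>1 \<delta>2 where
  words_id: "(\<lambda>z. z) \<in> words \<delta>1 \<delta>2"
| words_1: "\<theta> \<in> words \<delta>1 \<delta>2 \<Longrightarrow> (\<lambda>z. \<delta>1 (\<theta> z)) \<in> words \<delta>1 \<delta>2"
| words_2: "\<theta> \<in> words \<delta>1 \<delta>2 \<Longrightarrow> (\<lambda>z. \<delta>2 (\<theta> z)) \<in> words \<delta>1 \<delta>2"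

context affine_coords
begin

text \<open>Homogeneity of degree \<open>e\<close> in the coefficients of \<open>x\<close>, as seen
  by the Euler derivation.\<close>

definition eig :: "nat \<Rightarrow> 'a poly fract \<Rightarrow> bool" where
  "eig e z \<longleftrightarrow> lift_der E z = of_nat e * z"

lemma eig_mult: "eig e z \<Longrightarrow> eig e' z' \<Longrightarrow> eig (e + e') (z * z')"
  by (simp add: eig_def der_mult[OF DD_lift[OF E_DD]] algebra_simps)

lemma eig_Y_power: "eig n (Y i ^ n)"
  by (induction n) (use eig_mult[of 1 "Y i"] in \<open>auto simp: eig_def lift_E_Y der_1[OF DD_lift[OF E_DD]]\<close>)

text \<open>Functions of the index \<open>n\<close>: one differential operator, with coefficients
  that do not depend on \<open>n\<close>, is applied to all \<open>\<rho> n\<close> at once. This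
  uniformity makes a row of the determinant a combination of the rows given by
  \<open>PQ i j\<close>.\<close>

inductive_set WW :: "'a \<Rightarrow> (nat \<Rightarrow> 'a poly fract) \<Rightarrow> (nat \<Rightarrow> 'a poly fract) set" for a \<rho> where
  WW_single: "z \<in> vanish_at a (i + j) \<Longrightarrow> (\<lambda>n. z * PQ i j (\<rho> n)) \<in> WW a \<rho>"
| WW_add: "T \<in> WW a \<rho> \<Longrightarrow> T' \<in> WW a \<rho> \<Longrightarrow> (\<lambda>n. T n + T' n) \<in> WW a \<rho>"

text \<open>
  A word in derivations that fix the values of \<open>u\<close> and \<open>w\<close> at \<open>a\<close> is a differential operator in
  \<open>\<partial>\<^sub>u, \<partial>\<^sub>w\<close> whose coefficient at \<open>\<partial>\<^sub>u\<^sup>i \<partial>\<^sub>w\<^sup>j\<close> vanishes to order \<open>i + j\<close> at \<open>a\<close>.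
\<close>

lemma WW_derivation:
  assumes D: "D \<in> DD" "D a = 0" and Y1: "lift_der D (Y 1) / Y 1 \<in> vanish_at a 0"
    and uw: "lift_der D (Y 2 / Y 1) \<in> vanish_at a 1" "lift_der D (Y 3 / Y 1) \<in> vanish_at a 1"
    and \<rho>: "\<And>n. \<rho> n \<in> RR" "\<And>n. eig e (\<rho> n)" and T: "T \<in> WW a \<rho>"
  shows "(\<lambda>n. lift_der D (T n)) \<in> WW a \<rho>"
  using T
proof induction
  case (WW_single z i j)
  let ?c = "lift_der D (Y 1) / Y 1" and ?u = "lift_der D (Y 2 / Y 1)" and ?w = "lift_der D (Y 3 / Y 1)"
  have "lift_der D (PQ i j (\<rho> n)) = ?c * (of_nat e * PQ i j (\<rho> n)) + ?u * PQ (Suc i) j (\<rho> n) + ?w * PQ i (Suc j) (\<rho> n)" for n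
    using lift_der_RR[OF D(1) PQ_RR[OF \<rho>(1)]] E_PQ[OF \<rho>(1)] \<rho>(2)
    by (simp add: eig_def P_PQ Q_PQ[OF \<rho>(1)])
  then have eq: "lift_der D (z * PQ i j (\<rho> n)) = ((lift_der D z + of_nat e * ?c * z) * PQ i j (\<rho> n) + (?u * z) * PQ (Suc i) j (\<rho> n))
      + (?w * z) * PQ i (Suc j) (\<rho> n)" for n
    by (simp only: der_mult[OF DD_lift[OF D(1)]]) (simp add: algebra_simps)
  have "of_nat e = to_fract (of_nat e :: 'a poly)" by (simp add: rhom_of_nat[OF rhom_to_fract])
  then have e: "of_nat e \<in> vanish_at a 0" using vanish_at_to_fract by metis
  have 0: "lift_der D z + of_nat e * ?c * z \<in> vanish_at a (i + j)"
    by (intro vanish_at_add vanish_at_lift_der[OF DD_derivation[OF D(1)] D(2)] vanish_at_mult0 e Y1 WW_single)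
  have 1: "?u * z \<in> vanish_at a (Suc i + j)" "?w * z \<in> vanish_at a (i + Suc j)"
    using vanish_at_mult[OF uw(1) WW_single] vanish_at_mult[OF uw(2) WW_single] by simp_all
  show ?case unfolding eq
    by (intro WW.WW_add WW.WW_single 0 1)
next
  case (WW_add T T')
  then show ?case by (simp add: der_add[OF DD_lift[OF D(1)]] WW.WW_add)
qed

lemma WW_sum_form:
  assumes "T \<in> WW a \<rho>"
  shows "\<exists>S C. finite S \<and> (\<forall>\<alpha>\<in>S. C \<alpha> \<in> vanish_at a (fst \<alpha> + snd \<alpha>)) \<and>
    (\<forall>n. T n = (\<Sum>\<alpha>\<in>S. C \<alpha> * PQ (fst \<alpha>) (snd \<alpha>) (\<rho> n)))"
  using assms
proof induction
  case (WW_single z i j)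
  then show ?case by (intro exI[of _ "{(i, j)}"] exI[of _ "\<lambda>_. z"]) simp
next
  case (WW_add T T')
  then obtain S C S' C' where 1: "finite S" "\<forall>\<alpha>\<in>S. C \<alpha> \<in> vanish_at a (fst \<alpha> + snd \<alpha>)"
      "\<forall>n. T n = (\<Sum>\<alpha>\<in>S. C \<alpha> * PQ (fst \<alpha>) (snd \<alpha>) (\<rho> n))"
    and 2: "finite S'" "\<forall>\<alpha>\<in>S'. C' \<alpha> \<in> vanish_at a (fst \<alpha> + snd \<alpha>)"
      "\<forall>n. T' n = (\<Sum>\<alpha>\<in>S'. C' \<alpha> * PQ (fst \<alpha>) (snd \<alpha>) (\<rho> n))" by auto
  define z where "z C S \<alpha> = (if \<alpha> \<in> S then C \<alpha> else 0)" for C :: "nat \<times> nat \<Rightarrow> 'a poly fract" and S :: "(nat \<times> nat) set" and \<alpha>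
  have ext: "(\<Sum>\<alpha>\<in>S. C \<alpha> * PQ (fst \<alpha>) (snd \<alpha>) (\<rho> n)) = (\<Sum>\<alpha>\<in>S \<union> S'. z C S \<alpha> * PQ (fst \<alpha>) (snd \<alpha>) (\<rho> n))"
    "(\<Sum>\<alpha>\<in>S'. C' \<alpha> * PQ (fst \<alpha>) (snd \<alpha>) (\<rho> n)) = (\<Sum>\<alpha>\<in>S \<union> S'. z C' S' \<alpha> * PQ (fst \<alpha>) (snd \<alpha>) (\<rho> n))" for n
    using 1(1) 2(1) by (auto simp: z_def intro!: sum.mono_neutral_cong_left)
  have "\<forall>n. T n + T' n = (\<Sum>\<alpha>\<in>S \<union> S'. (z C S \<alpha> + z C' S' \<alpha>) * PQ (fst \<alpha>) (snd \<alpha>) (\<rho> n))"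
    using 1(3) 2(3) by (simp add: ext distrib_right sum.distrib)
  moreover have "\<forall>\<alpha>\<in>S \<union> S'. z C S \<alpha> + z C' S' \<alpha> \<in> vanish_at a (fst \<alpha> + snd \<alpha>)"
    using 1(2) 2(2) by (auto simp: z_def vanish_at_0 intro!: vanish_at_add)
  ultimately show ?case using 1(1) 2(1) by (intro exI[of _ "S \<union> S'"] exI[of _ "\<lambda>\<alpha>. z C S \<alpha> + z C' S' \<alpha>"]) simp
qed

lemma words_WW:
  assumes D: "\<And>D. D \<in> {D1, D2} \<Longrightarrow> D \<in> DD \<and> D a = 0 \<and> lift_der D (Y 1) / Y 1 \<in> vanish_at a 0 \<and>
      lift_der D (Y 2 / Y 1) \<in> vanish_at a 1 \<and> lift_der D (Y 3 / Y 1) \<in> vanish_at a 1"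
    and \<rho>: "\<And>n. \<rho> n \<in> RR" "\<And>n. eig e (\<rho> n)" and \<theta>: "\<theta> \<in> words (lift_der D1) (lift_der D2)"
  shows "(\<lambda>n. \<theta> (\<rho> n)) \<in> WW a \<rho>"
  using \<theta>
proof induction
  case words_id
  then show ?case using WW_single[of 1 a 0 0 \<rho>] by (simp add: PQ_def vanish_at_1)
next
  case (words_1 \<theta>)
  then show ?case using D[of D1] by (intro WW_derivation[OF _ _ _ _ _ \<rho>]) auto
next
  case (words_2 \<theta>)
  then show ?case using D[of D2] by (intro WW_derivation[OF _ _ _ _ _ \<rho>]) auto
qed

lemma words_polynomial:
  assumes "D1 \<in> DD" "D2 \<in> DD" and "\<theta> \<in> words (lift_der D1) (lift_der D2)"
  shows "\<exists>p'. \<theta> (to_fract p) = to_fract p' \<and> degree p' \<le> degree p"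
  using assms(3)
proof induction
  case (words_1 \<theta>)
  then obtain p' where p': "\<theta> (to_fract p) = to_fract p'" "degree p' \<le> degree p" by auto
  have "degree (map_poly D1 p') \<le> degree p" using degree_map_poly_der[OF DD_derivation[OF assms(1)], of p'] p'(2) by linarith
  then show ?case using p' lift_der_to_fract[OF DD_derivation[OF assms(1)]] by (intro exI[of _ "map_poly D1 p'"]) simp
next
  case (words_2 \<theta>)
  then obtain p' where p': "\<theta> (to_fract p) = to_fract p'" "degree p' \<le> degree p" by auto
  have "degree (map_poly D2 p') \<le> degree p" using degree_map_poly_der[OF DD_derivation[OF assms(2)], of p'] p'(2) by linarith
  then show ?case using p' lift_der_to_fract[OF DD_derivation[OF assms(2)]] by (intro exI[of _ "map_poly D2 p'"]) simp
qed auto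

text \<open>
  Words in two derivations spanning the tangent plane detect linear dependence over the base
  field: the relations between the \<open>\<theta> \<rho>\<^sub>j\<close> are stable under all derivations, so one of minimal
  support has constant coefficients.
\<close>

lemma words_detect_independence:
  fixes N :: nat
  assumes fr: "frame D1 D2" and \<rho>: "\<And>n. \<rho> n \<in> RR" "\<And>n. eig e (\<rho> n)"
    and indep: "\<And>\<kappa> j. (\<Sum>n<N. kk (\<kappa> n) * \<rho> n) = 0 \<Longrightarrow> j < N \<Longrightarrow> \<kappa> j = 0"
    and rel: "\<And>\<theta>. \<theta> \<in> words (lift_der D1) (lift_der D2) \<Longrightarrow> (\<Sum>n<N. cf n * \<theta> (\<rho> n)) = 0"
  shows "j < N \<Longrightarrow> cf j = 0"
proof -
  let ?W = "words (lift_der D1) (lift_der D2)"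
  define Ann where "Ann cf \<longleftrightarrow> (\<forall>\<theta>\<in>?W. (\<Sum>n<N. cf n * \<theta> (\<rho> n)) = 0)" for cf
  have D12: "D1 \<in> DD" "D2 \<in> DD" using fr by (auto simp: frame_def)
  \<comment> \<open>Differentiate the relation for a word and subtract the relation for the word
    prolonged by \<open>D\<close>: the differentiated coefficients annihilate the same
    words.\<close>
  have AnnD: "Ann (\<lambda>n. lift_der D (cf n))"
    if D: "D \<in> {D1, D2}" and cf: "Ann cf" for D cf
    unfolding Ann_def
  proof
    fix \<theta> assume \<theta>: "\<theta> \<in> ?W"
    have l: "derivation (lift_der D)" using D D12 DD_lift by blast
    have "(\<lambda>z. lift_der D (\<theta> z)) \<in> ?W" using D \<theta> by (auto intro: words.intros)
    from bspec[OF cf[unfolded Ann_def] this]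
    have "(\<Sum>n<N. cf n * lift_der D (\<theta> (\<rho> n))) = 0" .
    moreover have "lift_der D (\<Sum>n<N. cf n * \<theta> (\<rho> n)) = 0" using cf \<theta> der_0[OF l] by (simp add: Ann_def)
    ultimately show "(\<Sum>n<N. lift_der D (cf n) * \<theta> (\<rho> n)) = 0"
      by (simp add: der_sum[OF l] der_mult[OF l] sum.distrib)
  qed
  \<comment> \<open>An arbitrary \<open>D\<close> may be put in front of a word. For the empty word
    it is a combination of \<open>E\<close>, \<open>D1\<close>, \<open>D2\<close>; otherwise it is
    commuted past the first letter, at the cost of a bracket to which the induction hypothesis
    applies as well.\<close>
  have G: "\<forall>D\<in>DD. \<forall>cf. Ann cf \<longrightarrow> (\<Sum>n<N. cf n * lift_der D (\<theta> (\<rho> n))) = 0" if "\<theta> \<in> ?W" for \<theta>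
    using that
  proof induction
    case words_id
    show ?case
    proof (intro ballI allI impI)
      fix D cf assume D: "D \<in> DD" and cf: "Ann cf"
      obtain \<alpha> \<beta> \<gamma> where ex: "\<forall>z\<in>LL. lift_der D z = \<alpha> * lift_der E z + \<beta> * lift_der D1 z + \<gamma> * lift_der D2 z"
        using frame_express[OF fr D] by blast
      have "lift_der D (\<rho> n) = \<alpha> * of_nat e * \<rho> n + \<beta> * lift_der D1 (\<rho> n) + \<gamma> * lift_der D2 (\<rho> n)" for n
        using ex RR_LL[OF \<rho>(1)[of n]] \<rho>(2)[of n] by (simp add: eig_def mult.assoc)
      then have "(\<Sum>n<N. cf n * lift_der D (\<rho> n)) = \<alpha> * of_nat e * (\<Sum>n<N. cf n * \<rho> n) +
          \<beta> * (\<Sum>n<N. cf n * lift_der D1 (\<rho> n)) + \<gamma> * (\<Sum>n<N. cf n * lift_der D2 (\<rho> n))"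
        by (simp add: distrib_left sum.distrib sum_distrib_left mult.assoc mult.left_commute)
      moreover have "(\<Sum>n<N. cf n * \<rho> n) = 0" "(\<Sum>n<N. cf n * lift_der D1 (\<rho> n)) = 0" "(\<Sum>n<N. cf n * lift_der D2 (\<rho> n)) = 0"
        by (rule bspec[OF cf[unfolded Ann_def] words.words_id] bspec[OF cf[unfolded Ann_def] words.words_1[OF words.words_id]]
          bspec[OF cf[unfolded Ann_def] words.words_2[OF words.words_id]])+
      ultimately show "(\<Sum>n<N. cf n * lift_der D (\<rho> n)) = 0" by simp
    qed
  next
    case (words_1 \<theta>)
    show ?case
    proof (intro ballI allI impI)
      fix D cf assume D: "D \<in> DD" and cf: "Ann cf"
      note l = DD_lift[OF D12(1)]
      have br: "lift_der D (lift_der D1 z) = lift_der D1 (lift_der D z) + lift_der (\<lambda>z. D (D1 z) - D1 (D z)) z" for z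
        by (simp add: lift_der_bracket DD_derivation D D12)
      have 1: "(\<Sum>n<N. cf n * lift_der (\<lambda>z. D (D1 z) - D1 (D z)) (\<theta> (\<rho> n))) = 0"
        using words_1.IH DD_bracket[OF D D12(1)] cf by blast
      have 2: "(\<Sum>n<N. lift_der D1 (cf n) * lift_der D (\<theta> (\<rho> n))) = 0"
        using words_1.IH D AnnD[OF _ cf, of D1] by blast
      have "lift_der D1 (\<Sum>n<N. cf n * lift_der D (\<theta> (\<rho> n))) = 0"
        using words_1.IH D cf der_0[OF l] by simp
      then have 3: "(\<Sum>n<N. cf n * lift_der D1 (lift_der D (\<theta> (\<rho> n)))) = 0"
        using 2 by (simp add: der_sum[OF l] der_mult[OF l] sum.distrib)
      show "(\<Sum>n<N. cf n * lift_der D (lift_der D1 (\<theta> (\<rho> n)))) = 0"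
        unfolding br distrib_left sum.distrib 1 3 by simp
    qed
  next
    case (words_2 \<theta>)
    show ?case
    proof (intro ballI allI impI)
      fix D cf assume D: "D \<in> DD" and cf: "Ann cf"
      note l = DD_lift[OF D12(2)]
      have br: "lift_der D (lift_der D2 z) = lift_der D2 (lift_der D z) + lift_der (\<lambda>z. D (D2 z) - D2 (D z)) z" for z
        by (simp add: lift_der_bracket DD_derivation D D12)
      have 1: "(\<Sum>n<N. cf n * lift_der (\<lambda>z. D (D2 z) - D2 (D z)) (\<theta> (\<rho> n))) = 0"
        using words_2.IH DD_bracket[OF D D12(2)] cf by blast
      have 2: "(\<Sum>n<N. lift_der D2 (cf n) * lift_der D (\<theta> (\<rho> n))) = 0"
        using words_2.IH D AnnD[OF _ cf, of D2] by blast
      have "lift_der D2 (\<Sum>n<N. cf n * lift_der D (\<theta> (\<rho> n))) = 0"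
        using words_2.IH D cf der_0[OF l] by simp
      then have 3: "(\<Sum>n<N. cf n * lift_der D2 (lift_der D (\<theta> (\<rho> n)))) = 0"
        using 2 by (simp add: der_sum[OF l] der_mult[OF l] sum.distrib)
      show "(\<Sum>n<N. cf n * lift_der D (lift_der D2 (\<theta> (\<rho> n)))) = 0"
        unfolding br distrib_left sum.distrib 1 3 by simp
    qed
  qed
  have "\<forall>j<N. cf j = 0" if "Ann cf" for cf
    using that
  proof (induction "card {j. j < N \<and> cf j \<noteq> 0}" arbitrary: cf rule: less_induct)
    case less
    show ?case
    proof (rule ccontr)
      assume "\<not> (\<forall>j<N. cf j = 0)"
      then obtain j0 where j0: "j0 < N" "cf j0 \<noteq> 0" by auto
      \<comment> \<open>Normalised so that the entry at \<open>j0\<close> is 1. The derivative then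
        has smaller support, hence vanishes, and all entries are constants.\<close>
      define cf' where "cf' j = cf j / cf j0" for j
      have Ac': "Ann cf'" using less.prems unfolding Ann_def cf'_def
        by (simp add: sum_divide_distrib[symmetric])
      have "\<exists>k. cf' j = kk k" if j: "j < N" for j
      proof (rule constants_lift[of "cf' j"])
        fix D assume D: "D \<in> DD"
        note l = DD_lift[OF D]
        have "Ann (\<lambda>n. lift_der D (cf' n))" unfolding Ann_def
        proof
          fix \<theta> assume \<theta>: "\<theta> \<in> ?W"
          have "lift_der D (\<Sum>n<N. cf' n * \<theta> (\<rho> n)) = 0" using Ac' \<theta> der_0[OF l] by (simp add: Ann_def)
          then show "(\<Sum>n<N. lift_der D (cf' n) * \<theta> (\<rho> n)) = 0"
            using G[OF \<theta>] D Ac' by (simp add: der_sum[OF l] der_mult[OF l] sum.distrib)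
        qed
        moreover have "card {j. j < N \<and> lift_der D (cf' j) \<noteq> 0} < card {j. j < N \<and> cf j \<noteq> 0}"
        proof (rule psubset_card_mono)
          show "{j. j < N \<and> lift_der D (cf' j) \<noteq> 0} \<subset> {j. j < N \<and> cf j \<noteq> 0}"
          proof
            show "{j. j < N \<and> lift_der D (cf' j) \<noteq> 0} \<subseteq> {j. j < N \<and> cf j \<noteq> 0}"
              by (auto simp: cf'_def der_0[OF l])
            have "lift_der D (cf' j0) = 0" using j0 by (simp add: cf'_def der_1[OF l])
            then show "{j. j < N \<and> lift_der D (cf' j) \<noteq> 0} \<noteq> {j. j < N \<and> cf j \<noteq> 0}" using j0 by auto
          qed
        qed simp
        ultimately show "lift_der D (cf' j) = 0" using less.hyps[of "\<lambda>n. lift_der D (cf' n)"] j by blast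
      next
        fix k assume "cf' j = kk k"
        then show ?thesis by blast
      qed
      then obtain \<kappa> where \<kappa>: "\<And>j. j < N \<Longrightarrow> cf' j = kk (\<kappa> j)" by metis
      have "(\<Sum>n<N. cf' n * \<rho> n) = 0" by (rule bspec[OF Ac'[unfolded Ann_def] words.words_id])
      then have "(\<Sum>n<N. kk (\<kappa> n) * \<rho> n) = 0" using \<kappa> by simp
      then have "\<kappa> j0 = 0" using indep j0(1) by blast
      then have "cf' j0 = 0" using \<kappa>[OF j0(1)] rhom_0[OF rhom_kk] by simp
      then show False using j0 by (simp add: cf'_def)
    qed
  qed
  then show "j < N \<Longrightarrow> cf j = 0" using rel unfolding Ann_def by blast
qed

end

section \<open>The determinant estimate\<close>

lemma card_below_diagonal: "2 * card {(i, j). i + j < (q::nat)} = q * (q + 1)"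
proof -
  have "{(i, j). i + j < q} = (SIGMA i:{..<q}. {..<q - i})" by auto
  then have "card {(i, j). i + j < q} = (\<Sum>i<q. q - i)" by simp
  also have "2 * (\<Sum>i<q. q - i) = q * (q + 1)"
  proof (induction q)
    case (Suc q)
    have "(\<Sum>i<Suc q. Suc q - i) = (\<Sum>i<q. q - i + 1) + 1" by (simp add: Suc_diff_le)
    also have "\<dots> = (\<Sum>i<q. q - i) + q + 1" by (subst sum.distrib) simp
    finally show ?case using Suc by simp
  qed simp
  finally show ?thesis .
qed

text \<open>Exponents \<open>(k, i, j)\<close> of \<open>Y 4\<close>, \<open>Y 2\<close>,
  \<open>Y 3\<close>. The bound \<open>k < d\<close> makes the monomials independent on the surface;
  a power of \<open>Y 1\<close> fills them up to the common degree \<open>q + d\<close>.\<close>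

definition mon_index :: "nat \<Rightarrow> nat \<Rightarrow> (nat \<times> nat \<times> nat) set" where
  "mon_index d q = {..<d} \<times> {(i, j). i + j < q}"

lemma finite_mon_index: "finite (mon_index d q)"
proof -
  have "{(i, j). i + j < q} \<subseteq> {..<q} \<times> {..<q}" by auto
  then show ?thesis unfolding mon_index_def using finite_subset by blast
qed

lemma card_mon_index: "2 * card (mon_index d q) = d * q * (q + 1)"
proof -
  have "2 * card (mon_index d q) = d * (2 * card {(i, j). i + j < q})"
    by (simp add: mon_index_def card_cartesian_product)
  then show ?thesis by (simp only: card_below_diagonal mult.assoc)
qed

text \<open>Both sides are cubic in \<open>q\<close> up to lower order when \<open>k\<close> is the
  integer part of \<open>q\<close> times the square root of \<open>d\<close>. If the claim failed,
  the leading coefficient of the difference would be positive, against the hypothesis for large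
  \<open>q\<close>.\<close>

lemma determinant_bound_asymptotics:
  assumes "d > 0" and bd: "\<And>q k. r * (k * card (mon_index d q) - tri k) \<le> card (mon_index d q) * ((q + d) * m)"
  shows "2 * real r * sqrt (real d) \<le> 3 * real m"
proof (rule ccontr)
  define s where "s = sqrt (real d)"
  have s: "s * s = real d" "s \<ge> 1" using assms(1) by (auto simp: s_def)
  assume "\<not> ?thesis"
  then have gt: "2 * real r * s > 3 * real m" by (simp add: s_def)
  \<comment> \<open>Coefficients of a cubic in \<open>q\<close> that bounds the difference of the
    two sides from below; the leading one decides.\<close>
  define c3 where "c3 = real r * s * real d / 3 - real d * real m / 2"
  define c2 where "c2 = real r * (s * real d / 2 - real d) - real d * real m / 2 * (1 + real d)"
  define c1 where "c1 = real r * (- real d / 2 - s / 3) - real d * real m / 2 * real d"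
  have "c3 = real d / 6 * (2 * real r * s - 3 * real m)" by (simp add: c3_def algebra_simps)
  moreover have "real d / 6 * (2 * real r * s - 3 * real m) > 0" using gt assms(1) by (intro mult_pos_pos) auto
  ultimately have c3: "c3 > 0" by simp
  have main: "c3 * real q ^ 3 + c2 * real q ^ 2 + c1 * real q \<le> 0" for q
  proof -
    define k where "k = nat \<lfloor>s * real q\<rfloor>"
    have k: "real k \<le> s * real q" "real k \<ge> s * real q - 1" "k \<ge> 0"
      using s(2) by (auto simp: k_def)
    define N where "N = card (mon_index d q)"
    have N: "real N = real d * real q * (real q + 1) / 2"
      using card_mon_index[of d q] unfolding N_def
      by (metis (no_types, lifting) nonzero_mult_div_cancel_left of_nat_1 of_nat_add of_nat_mult of_nat_numeral zero_neq_numeral)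
    have "6 * real (tri k) = real k * (real k + 1) * (real k + 2)"
      using tri_eq[of k] by (metis (no_types, lifting) of_nat_1 of_nat_add of_nat_mult of_nat_numeral)
    also have "\<dots> \<le> (s * real q) * (s * real q + 1) * (s * real q + 2)"
      using k(1) by (intro mult_mono) auto
    finally have t: "real (tri k) \<le> (s * real q) * (s * real q + 1) * (s * real q + 2) / 6" by simp
    have "real k * real N \<ge> (s * real q - 1) * real N" using k(2) by (intro mult_right_mono) auto
    then have "(s * real q - 1) * real N - (s * real q) * (s * real q + 1) * (s * real q + 2) / 6 \<le> real k * real N - real (tri k)"
      using t by linarith
    also have "\<dots> \<le> real (k * N - tri k)" by (cases "tri k \<le> k * N") (auto simp flip: of_nat_mult)
    finally have "real r * ((s * real q - 1) * real N - (s * real q) * (s * real q + 1) * (s * real q + 2) / 6)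
        \<le> real r * real (k * N - tri k)" by (intro mult_left_mono) auto
    also have "\<dots> \<le> real (N * ((q + d) * m))" using bd[of k q] by (simp add: N_def flip: of_nat_mult)
    finally have "real r * ((s * real q - 1) * real N - (s * real q) * (s * real q + 1) * (s * real q + 2) / 6)
        - real N * ((real q + real d) * real m) \<le> 0" by simp
    also have "real r * ((s * real q - 1) * real N - (s * real q) * (s * real q + 1) * (s * real q + 2) / 6)
        - real N * ((real q + real d) * real m) = c3 * real q ^ 3 + c2 * real q ^ 2 + c1 * real q"
      unfolding N c3_def c2_def c1_def s(1)[symmetric] by (simp add: field_simps power2_eq_square power3_eq_cube)
    finally show ?thesis .
  qed
  obtain q :: nat where q: "real q > (\<bar>c2\<bar> + \<bar>c1\<bar>) / c3" using reals_Archimedean2 by blast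
  have q1: "real q \<ge> 1"
  proof -
    have "(\<bar>c2\<bar> + \<bar>c1\<bar>) / c3 \<ge> 0" using c3 by simp
    then have "real q > 0" using q by linarith
    then show ?thesis by simp
  qed
  have "c3 * real q > \<bar>c2\<bar> + \<bar>c1\<bar>" using q c3 by (simp add: field_simps)
  then have "c3 * real q * real q ^ 2 > (\<bar>c2\<bar> + \<bar>c1\<bar>) * real q ^ 2" using q1 by (intro mult_strict_right_mono) auto
  moreover have "c2 * real q ^ 2 \<ge> - \<bar>c2\<bar> * real q ^ 2" by (intro mult_right_mono) auto
  moreover have "c1 * real q \<ge> - \<bar>c1\<bar> * real q ^ 2"
  proof -
    have "- \<bar>c1\<bar> * real q ^ 2 \<le> - \<bar>c1\<bar> * real q" using q1 by (simp add: power2_eq_square mult_left_mono)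
    also have "\<dots> \<le> c1 * real q" by (intro mult_right_mono) auto
    finally show ?thesis .
  qed
  ultimately show False using main[of q] by (simp add: power3_eq_cube power2_eq_square algebra_simps)
qed

context affine_coords
begin

text \<open>One nonzero determinant is estimated twice: the words keep its entries polynomial of
  degree at most \<open>(q + d) * m\<close>, while at each place of \<open>A\<close> the expansion
  of its rows in \<open>PQ\<close> forces a high order of vanishing.\<close>

lemma determinant_inequality:
  assumes fr: "frame D1 D2" and A: "finite A" and reg: "\<And>a. a \<in> A \<Longrightarrow> RR \<subseteq> vanish_at a 0"
    and D: "\<And>D a. D \<in> {D1, D2} \<Longrightarrow> a \<in> A \<Longrightarrow> D \<in> DD \<and> D a = 0 \<and> lift_der D (Y 1) / Y 1 \<in> vanish_at a 0 \<and>
      lift_der D (Y 2 / Y 1) \<in> vanish_at a 1 \<and> lift_der D (Y 3 / Y 1) \<in> vanish_at a 1"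
  shows "card A * (k * card (mon_index d q) - tri k) \<le> card (mon_index d q) * ((q + d) * m)"
proof -
  define N where "N = card (mon_index d q)"
  obtain en where en: "bij_betw en {..<N} (mon_index d q)"
    unfolding N_def using ex_bij_betw_nat_finite[OF finite_mon_index] by (auto simp: lessThan_atLeast0)
  define ex :: "nat \<times> nat \<times> nat \<Rightarrow> nat \<times> nat \<times> nat \<times> nat"
    where "ex = (\<lambda>(k, i, j). (q + d - k - i - j, i, j, k))"
  define rp where "rp n = (case en n of (k, i, j) \<Rightarrow> y 1 ^ (q + d - k - i - j) * y 2 ^ i * y 3 ^ j * y 4 ^ k)" for n
  define \<rho> where "\<rho> n = (if n < N then to_fract (rp n) else 0)" for n
  have en_in: "fst (en n) < d \<and> fst (snd (en n)) + snd (snd (en n)) < q" if "n < N" for n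
  proof -
    have "en n \<in> mon_index d q" using bij_betwE[OF en] that by blast
    then show ?thesis by (cases "en n") (auto simp: mon_index_def)
  qed
  have tp: "to_fract (p ^ n) = to_fract p ^ n" for p :: "'a poly" and n by (rule rhom_power[OF rhom_to_fract])
  have \<rho>_Y: "\<rho> n = (case en n of (k, i, j) \<Rightarrow> Y 1 ^ (q + d - k - i - j) * Y 2 ^ i * Y 3 ^ j * Y 4 ^ k)" if "n < N" for n
    using that by (simp add: \<rho>_def rp_def Y_def tp split: prod.split)
  have \<rho>_RR: "\<rho> n \<in> RR" for n
  proof (cases "n < N")
    case True
    show ?thesis unfolding \<rho>_Y[OF True] case_prod_beta
      by (intro RR_closed(4) subring_set_power[OF subring_RR] RR.intros(1) RR0.intros(4))
  qed (simp add: \<rho>_def RR_closed(1))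
  have \<rho>_eig: "eig (q + d) (\<rho> n)" for n
  proof (cases "n < N")
    case True
    obtain k i j where kij: "en n = (k, i, j)" by (cases "en n")
    have "eig (q + d - k - i - j + i + j + k) (Y 1 ^ (q + d - k - i - j) * Y 2 ^ i * Y 3 ^ j * Y 4 ^ k)"
      by (intro eig_mult eig_Y_power)
    moreover have "q + d - k - i - j + i + j + k = q + d" using en_in[OF True] by (simp add: kij)
    ultimately show ?thesis using \<rho>_Y[OF True] by (simp add: kij)
  qed (simp add: \<rho>_def eig_def der_0[OF DD_lift[OF E_DD]])
  have indep: "\<kappa> j = 0" if rel: "(\<Sum>n<N. kk (\<kappa> n) * \<rho> n) = 0" and j: "j < N" for \<kappa> j
  proof -
    define g where "g = ex \<circ> en"
    have inj: "inj_on g {..<N}"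
    proof -
      have "inj ex" by (auto simp: ex_def inj_def)
      then show ?thesis unfolding g_def using en by (intro comp_inj_on) (auto simp: bij_betw_def intro: inj_on_subset)
    qed
    define \<kappa>' where "\<kappa>' t = \<kappa> (the_inv_into {..<N} g t)" for t
    have \<kappa>': "\<kappa>' (g n) = \<kappa> n" if "n < N" for n using the_inv_into_f_f[OF inj] that by (simp add: \<kappa>'_def)
    have "(\<Sum>(l, i, j, k)\<in>g ` {..<N}. kk (\<kappa>' (l, i, j, k)) * (Y 1 ^ l * Y 2 ^ i * Y 3 ^ j * Y 4 ^ k)) = 0"
    proof (subst sum.reindex[OF inj])
      have "(\<Sum>n<N. (case g n of (l, i, j, k) \<Rightarrow> kk (\<kappa>' (l, i, j, k)) * (Y 1 ^ l * Y 2 ^ i * Y 3 ^ j * Y 4 ^ k)))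
          = (\<Sum>n<N. kk (\<kappa> n) * \<rho> n)"
      proof (intro sum.cong refl)
        fix n assume "n \<in> {..<N}"
        then have n: "n < N" by simp
        obtain k i j where kij: "en n = (k, i, j)" by (cases "en n")
        have gn: "g n = (q + d - k - i - j, i, j, k)" by (simp add: g_def ex_def kij)
        show "(case g n of (l, i, j, k) \<Rightarrow> kk (\<kappa>' (l, i, j, k)) * (Y 1 ^ l * Y 2 ^ i * Y 3 ^ j * Y 4 ^ k)) = kk (\<kappa> n) * \<rho> n"
          using \<kappa>'[OF n] by (simp add: gn \<rho>_Y[OF n] kij)
      qed
      then show "sum ((\<lambda>(l, i, j, k). kk (\<kappa>' (l, i, j, k)) * (Y 1 ^ l * Y 2 ^ i * Y 3 ^ j * Y 4 ^ k)) \<circ> g) {..<N} = 0"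
        using rel by (simp add: o_def)
    qed
    moreover have "k < d" if "(l, i, j, k) \<in> g ` {..<N}" for l i j k
    proof -
      from that obtain n where n: "n < N" "g n = (l, i, j, k)" by auto
      then show ?thesis using en_in[OF n(1)] by (cases "en n") (simp add: g_def ex_def)
    qed
    ultimately have "\<kappa>' (g j) = 0"
      by (intro Y_monomials_independent[OF fr, of "g ` {..<N}" \<kappa>' "g j"]) (use j in auto)
    then show ?thesis using \<kappa>'[OF j] by simp
  qed
  have "\<exists>\<theta>s. (\<forall>i<N. \<theta>s i \<in> words (lift_der D1) (lift_der D2)) \<and> det_n N (\<lambda>i j. \<theta>s i (\<rho> j)) \<noteq> 0"
  proof (rule det_n_select[where f = "\<lambda>j \<theta>. \<theta> (\<rho> j)"])
    fix cf j
    assume rel: "\<And>\<theta>. \<theta> \<in> words (lift_der D1) (lift_der D2) \<Longrightarrow> (\<Sum>j<N. cf j * \<theta> (\<rho> j)) = 0" and j: "j < N"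
    show "cf j = 0"
      by (rule words_detect_independence[OF fr \<rho>_RR \<rho>_eig, where N = N and cf = cf]) (use indep rel j in auto)
  qed
  then obtain \<theta>s where \<theta>s: "\<And>i. i < N \<Longrightarrow> \<theta>s i \<in> words (lift_der D1) (lift_der D2)"
    and nz: "det_n N (\<lambda>i j. \<theta>s i (\<rho> j)) \<noteq> 0" by blast
  have D12: "D1 \<in> DD" "D2 \<in> DD" using fr by (auto simp: frame_def)
  have deg_rp: "degree (rp n) \<le> (q + d) * m" if "n < N" for n
  proof -
    obtain k i j where kij: "en n = (k, i, j)" by (cases "en n")
    have pw: "degree (y i ^ n) \<le> n * m" for i n
      using le_trans[OF degree_power_le[of "y i" n] mult_le_mono1[OF degree_y[of i], of n]] by (simp only: mult.commute)
    have "degree (rp n) \<le> (q + d - k - i - j) * m + i * m + j * m + k * m"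
      unfolding rp_def kij by (simp, intro order_trans[OF degree_mult_le] add_mono pw)
    also have "\<dots> = (q + d - k - i - j + i + j + k) * m" by (simp add: algebra_simps)
    also have "q + d - k - i - j + i + j + k = q + d" using en_in[OF that] by (simp add: kij)
    finally show ?thesis .
  qed
  have "\<exists>p'. \<theta>s i (\<rho> j) = to_fract p' \<and> degree p' \<le> (q + d) * m" if "i < N" "j < N" for i j
    using words_polynomial[OF D12 \<theta>s[OF that(1)], of "rp j"] deg_rp[OF that(2)] that(2) by (force simp: \<rho>_def)
  then obtain pm where pm: "\<And>i j. i < N \<Longrightarrow> j < N \<Longrightarrow> \<theta>s i (\<rho> j) = to_fract (pm i j) \<and> degree (pm i j) \<le> (q + d) * m"
    by metis
  have det_pm: "det_n N (\<lambda>i j. \<theta>s i (\<rho> j)) = to_fract (det_n N pm)"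
    unfolding det_n_hom[OF rhom_to_fract]
    unfolding det_n_def
  proof (intro sum.cong refl arg_cong2[where f = "(*)"] prod.cong)
    fix p i assume p: "p \<in> {p. p permutes {..<N}}" and i: "i \<in> {..<N}"
    then have "p i < N" using permutes_in_image[of p "{..<N}" i] by simp
    then show "\<theta>s i (\<rho> (p i)) = to_fract (pm i (p i))" using pm i by simp
  qed
  have ord: "order a (det_n N pm) \<ge> k * N - tri k" if a: "a \<in> A" for a
  proof -
    have "\<forall>i. \<exists>S C. i < N \<longrightarrow> finite S \<and> (\<forall>\<alpha>\<in>S. C \<alpha> \<in> vanish_at a (fst \<alpha> + snd \<alpha>)) \<and>
        (\<forall>n. \<theta>s i (\<rho> n) = (\<Sum>\<alpha>\<in>S. C \<alpha> * PQ (fst \<alpha>) (snd \<alpha>) (\<rho> n)))"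
    proof
      fix i
      have "(\<lambda>n. \<theta>s i (\<rho> n)) \<in> WW a \<rho>" if i: "i < N"
        by (rule words_WW[OF D[OF _ a] \<rho>_RR \<rho>_eig \<theta>s[OF i]]) simp
      from WW_sum_form[OF this] show "\<exists>S C. i < N \<longrightarrow> finite S \<and> (\<forall>\<alpha>\<in>S. C \<alpha> \<in> vanish_at a (fst \<alpha> + snd \<alpha>)) \<and>
        (\<forall>n. \<theta>s i (\<rho> n) = (\<Sum>\<alpha>\<in>S. C \<alpha> * PQ (fst \<alpha>) (snd \<alpha>) (\<rho> n)))" by (cases "i < N") auto
    qed
    then obtain S C where SC0: "\<forall>i. i < N \<longrightarrow> finite (S i) \<and> (\<forall>\<alpha>\<in>S i. C i \<alpha> \<in> vanish_at a (fst \<alpha> + snd \<alpha>)) \<and>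
        (\<forall>n. \<theta>s i (\<rho> n) = (\<Sum>\<alpha>\<in>S i. C i \<alpha> * PQ (fst \<alpha>) (snd \<alpha>) (\<rho> n)))"
      unfolding choice_iff by (elim exE) (rule that)
    have SC: "finite (S i)" "\<forall>\<alpha>\<in>S i. C i \<alpha> \<in> vanish_at a (fst \<alpha> + snd \<alpha>)"
        "\<forall>n. \<theta>s i (\<rho> n) = (\<Sum>\<alpha>\<in>S i. C i \<alpha> * PQ (fst \<alpha>) (snd \<alpha>) (\<rho> n))" if "i < N" for i
      using spec[OF SC0, of i] that by (blast, blast, blast)
    \<comment> \<open>Rows may involve different operators; a common index set is obtained by
      padding with zero coefficients.\<close>
    define U where "U = (\<Union>i<N. S i)"
    define C' where "C' i \<alpha> = (if \<alpha> \<in> S i then C i \<alpha> else 0)" for i \<alpha>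
    have U: "finite U" using SC(1) by (auto simp: U_def)
    have row: "\<theta>s i (\<rho> n) = (\<Sum>\<alpha>\<in>U. C' i \<alpha> * PQ (fst \<alpha>) (snd \<alpha>) (\<rho> n))" if "i < N" for i n
    proof -
      have "\<theta>s i (\<rho> n) = (\<Sum>\<alpha>\<in>S i. C i \<alpha> * PQ (fst \<alpha>) (snd \<alpha>) (\<rho> n))" using SC(3)[OF that] by blast
      also have "\<dots> = (\<Sum>\<alpha>\<in>U. C' i \<alpha> * PQ (fst \<alpha>) (snd \<alpha>) (\<rho> n))"
        using U that by (intro sum.mono_neutral_cong_left) (auto simp: U_def C'_def)
      finally show ?thesis .
    qed
    have "det_n N (\<lambda>i j. \<theta>s i (\<rho> j)) = det_n N (\<lambda>i j. \<Sum>\<alpha>\<in>U. C' i \<alpha> * PQ (fst \<alpha>) (snd \<alpha>) (\<rho> j))"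
      unfolding det_n_def by (intro sum.cong refl arg_cong2[where f = "(*)"] prod.cong) (simp add: row)
    also have "\<dots> \<in> vanish_at a (k * N - tri k)"
    proof (rule det_n_vanish_at[OF U, where w = "\<lambda>\<alpha>. fst \<alpha> + snd \<alpha>"])
      show "C' i \<alpha> \<in> vanish_at a (fst \<alpha> + snd \<alpha>)" if "i < N" "\<alpha> \<in> U" for i \<alpha>
        using SC(2)[OF that(1)] by (auto simp: C'_def vanish_at_0)
      show "PQ (fst \<alpha>) (snd \<alpha>) (\<rho> j) \<in> vanish_at a 0" for \<alpha> j
        using reg[OF a] PQ_RR[OF \<rho>_RR] by blast
      fix T assume "T \<subseteq> U" "card T = N"
      then have "finite T" using U finite_subset by blast
      then have "6 * k * N \<le> 6 * (\<Sum>(i, j)\<in>T. i + j) + 6 * tri k"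
        using sum_weights_ge[of T k] \<open>card T = N\<close> tri_eq[of k] by simp
      then show "k * N - tri k \<le> (\<Sum>\<alpha>\<in>T. fst \<alpha> + snd \<alpha>)" by (simp add: case_prod_beta)
    qed
    finally have "[:- a, 1:] ^ (k * N - tri k) dvd det_n N pm" unfolding det_pm by (rule vanish_at_dvd)
    moreover have "det_n N pm \<noteq> 0" using nz by (auto simp: det_pm)
    ultimately show ?thesis by (simp add: order_divides)
  qed
  have "card A * (k * N - tri k) = (\<Sum>a\<in>A. k * N - tri k)" by simp
  also have "\<dots> \<le> (\<Sum>a\<in>A. order a (det_n N pm))" by (intro sum_mono ord)
  also have "\<dots> \<le> degree (det_n N pm)" by (rule sum_order_le_degree) (use nz A in \<open>auto simp: det_pm\<close>)
  also have "\<dots> \<le> N * ((q + d) * m)" by (rule degree_det_n) (use pm in blast)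
  finally show ?thesis by (simp add: N_def)
qed

end

text \<open>Turns vanishing at the place \<open>a\<close> into a condition on a single field
  element, which is linear in \<open>D\<close> and can be imposed by counting.\<close>

lemma ratio_derivative_vanishes_iff:
  fixes D :: "'a::field \<Rightarrow> 'a"
  assumes D: "derivation D" "D a = 0" and p: "poly p a \<noteq> 0"
  shows "lift_der D (to_fract q / to_fract p) \<in> vanish_at a 1 \<longleftrightarrow> D (poly q a / poly p a) = 0"
proof -
  let ?n = "map_poly D q * p - q * map_poly D p"
  have p0: "p \<noteq> 0" using p by auto
  have l: "lift_der D (to_fract q / to_fract p) = to_fract ?n / to_fract (p\<^sup>2)"
    using p0 by (simp add: derivation_divide[OF derivation_lift_der[OF D(1)]] lift_der_to_fract[OF D(1)] power2_eq_square)
  have "poly (p\<^sup>2) a \<noteq> 0" using p by simp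
  then have "to_fract ?n / to_fract (p\<^sup>2) \<in> vanish_at a 1 \<longleftrightarrow> poly ?n a = 0"
    using vanish_at_eval[of "p\<^sup>2" a ?n] vanish_at_mult[OF vanish_at_to_fract_root[of ?n a] vanish_at_inverse[of "p\<^sup>2" a]]
    by (auto simp: divide_inverse)
  moreover have "D (poly q a / poly p a) = poly ?n a / (poly p a)\<^sup>2"
    using p by (simp add: derivation_divide[OF D(1)] poly_map_poly_der_at_constant[OF D])
  ultimately show ?thesis using p l by simp
qed

context affine_coords
begin

lemma RR_regular:
  assumes "inverse gx \<in> vanish_at a 0" "\<And>k. k \<in> Poly_Mapping.keys F \<Longrightarrow> kk (Poly_Mapping.lookup F k) \<in> vanish_at a 0"
  shows "RR \<subseteq> vanish_at a 0"
proof
  fix z assume "z \<in> RR"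
  moreover have "z \<in> vanish_at a 0" if "z \<in> RR0" for z
    using that by induction (auto simp: vanish_at_1 assms kk_cK Y_def vanish_at_to_fract vanish_at_diff vanish_at_mult0)
  ultimately show "z \<in> vanish_at a 0"
    by (induction rule: RR.induct) (auto simp: assms vanish_at_diff vanish_at_mult0)
qed

text \<open>On the surface \<open>Y 4\<close> depends on the other coordinates, and
  \<open>P (Y 4)\<close>, \<open>Q (Y 4)\<close> are regular at \<open>a\<close>. So two conditions
  at a place fix the whole point there.\<close>

lemma Y4_ratio_vanishes:
  assumes D: "D \<in> DD" and a: "poly (y 1) a \<noteq> 0" and reg: "RR \<subseteq> vanish_at a 0"
    and uw: "lift_der D (Y 2 / Y 1) \<in> vanish_at a 1" "lift_der D (Y 3 / Y 1) \<in> vanish_at a 1"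
  shows "lift_der D (Y 4 / Y 1) \<in> vanish_at a 1"
proof -
  have R: "Y 4 \<in> RR" by (intro RR.intros(1) RR0.intros)
  have "lift_der D (Y 4 / Y 1) = inverse (Y 1) * (lift_der D (Y 4) - lift_der D (Y 1) / Y 1 * Y 4)"
    using Y10 by (simp add: derivation_divide[OF DD_lift[OF D]] field_simps power2_eq_square)
  also have "lift_der D (Y 4) - lift_der D (Y 1) / Y 1 * Y 4 = P (Y 4) * lift_der D (Y 2 / Y 1) + Q (Y 4) * lift_der D (Y 3 / Y 1)"
    using lift_der_RR[OF D R] by (simp add: lift_E_Y mult.commute)
  also have "inverse (Y 1) * \<dots> \<in> vanish_at a 1"
  proof (intro vanish_at_mult0 vanish_at_add uw)
    show "inverse (Y 1) \<in> vanish_at a 0" unfolding Y_def by (rule vanish_at_inverse[OF a])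
    show "P (Y 4) \<in> vanish_at a 0" "Q (Y 4) \<in> vanish_at a 0" using reg P_RR[OF R] Q_RR[OF R] by blast+
  qed
  finally show ?thesis .
qed

text \<open>\<open>K\<close> holds the values of the two affine coordinates at \<open>r\<close>
  places. Two derivations that kill \<open>K\<close> and move \<open>x\<close> in independent
  directions would form a frame to which the determinant inequality applies, in contradiction to the
  size of \<open>r\<close>.\<close>

lemma line_from_rank_drop:
  assumes fr: "frame D1 D2" and r: "3 * real m < 2 * real r * sqrt (real d)" and rs: "3 * m < 2 * r + 3 * s"
    and B: "2 * r + s + 2 \<le> card B"
  shows "\<exists>y. (\<forall>i. degree (y i) \<le> m) \<and> (\<exists>p q. x p * y q \<noteq> x q * y p) \<and>
    (\<forall>n. ev_hom kk F (\<lambda>i. to_fract (x i) + of_nat n * to_fract (y i)) = 0)"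
proof -
  \<comment> \<open>Finitely many places are lost: the poles of \<open>inverse gx\<close> and of the
    coefficients of \<open>F\<close>, and the zeros of \<open>y 1\<close>, the denominator of the
    affine coordinates.\<close>
  define bad where "bad = {a. inverse gx \<notin> vanish_at a 0} \<union> {a. poly (y 1) a = 0} \<union>
     (\<Union>k\<in>Poly_Mapping.keys F. {a. kk (Poly_Mapping.lookup F k) \<notin> vanish_at a 0})"
  have y1: "y 1 \<noteq> 0" using Y10 by (simp add: Y_def)
  have "finite bad" unfolding bad_def using poly_roots_finite[OF y1] by (intro finite_UnI finite_UN_I finite_not_regular) auto
  moreover have "infinite (range of_nat :: 'a set)" by (simp add: infinite_UNIV_char_0 inj_of_nat range_inj_infinite)
  ultimately have "infinite (range of_nat - bad)" by (rule Diff_infinite_finite)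
  then obtain A where A: "finite A" "card A = r" "A \<subseteq> range of_nat - bad"
    using infinite_arbitrarily_large by blast
  have a_props: "poly (y 1) a \<noteq> 0" "RR \<subseteq> vanish_at a 0" if "a \<in> A" for a
  proof -
    have "a \<notin> bad" using A(3) that by blast
    then show "poly (y 1) a \<noteq> 0" by (simp add: bad_def)
    show "RR \<subseteq> vanish_at a 0" by (rule RR_regular) (use \<open>a \<notin> bad\<close> in \<open>auto simp: bad_def\<close>)
  qed
  let ?v = "\<lambda>i a. poly (y i) a / poly (y 1) a"
  define K where "K = (?v 2 ` A) \<union> (?v 3 ` A)"
  have Kfin: "finite K" using A(1) by (simp add: K_def)
  have Kcard: "card K \<le> 2 * r"
    unfolding K_def using card_Un_le[of "?v 2 ` A" "?v 3 ` A"] card_image_le[OF A(1), of "?v 2"] card_image_le[OF A(1), of "?v 3"] A(2)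
    by linarith
  have Da: "D a = 0" if "D \<in> DD" "a \<in> A" for D a using A(3) that DD_of_nat by auto
  have uw: "lift_der D (Y 2 / Y 1) \<in> vanish_at a 1" "lift_der D (Y 3 / Y 1) \<in> vanish_at a 1"
    if "D \<in> DD" "\<forall>l\<in>K. D l = 0" "a \<in> A" for D a
    unfolding Y_def ratio_derivative_vanishes_iff[OF DD_derivation[OF that(1)] Da[OF that(1,3)] a_props(1)[OF that(3)]]
    using that by (auto simp: K_def)
  show ?thesis
  proof (rule line_through_moving_point[OF Kfin A(1)])
    show "A \<subseteq> range of_nat" using A(3) by blast
    show "card K + s + 2 \<le> card B" using Kcard B by linarith
    show "3 * m < 2 * card A + 3 * s" using A(2) rs by simp
  next
    fix D D' p q j
    assume D: "D \<in> DD" "D' \<in> DD" "\<forall>l\<in>K. D l = 0" "\<forall>l\<in>K. D' l = 0"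
    show "det3 x (dx D) (dx D') p q j = 0"
    proof (rule ccontr)
      assume "det3 x (dx D) (dx D') p q j \<noteq> 0"
      then have fr': "frame D D'" by (rule frame_transfer[OF fr D(1,2)])
      have cond: "D'' \<in> DD \<and> D'' a = 0 \<and> lift_der D'' (Y 1) / Y 1 \<in> vanish_at a 0 \<and>
          lift_der D'' (Y 2 / Y 1) \<in> vanish_at a 1 \<and> lift_der D'' (Y 3 / Y 1) \<in> vanish_at a 1"
        if D'': "D'' \<in> {D, D'}" and a: "a \<in> A" for D'' a
      proof -
        have d: "D'' \<in> DD" "\<forall>l\<in>K. D'' l = 0" using D'' D by auto
        have "lift_der D'' (Y 1) / Y 1 = to_fract (adapted c (dx D'') 1) * inverse (to_fract (y 1))"
          by (simp add: lift_der_Y[OF d(1)] divide_inverse) (simp add: Y_def)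
        also have "\<dots> \<in> vanish_at a 0" by (intro vanish_at_mult0 vanish_at_to_fract vanish_at_inverse a_props(1)[OF a])
        finally show ?thesis using d uw[OF d a] Da[OF d(1) a] by blast
      qed
      have "r * (k * card (mon_index d q) - tri k) \<le> card (mon_index d q) * ((q + d) * m)" for q k
        using determinant_inequality[OF fr' A(1) a_props(2) cond] by (simp only: A(2))
      then have "2 * real r * sqrt (real d) \<le> 3 * real m" by (rule determinant_bound_asymptotics[OF d_pos])
      then show False using r by simp
    qed
  next
    fix a assume a: "a \<in> A"
    show "\<exists>\<mu> e. (\<forall>i. poly (x i) a = \<mu> * e i) \<and> (\<forall>D\<in>DD. (\<forall>l\<in>K. D l = 0) \<longrightarrow> (\<forall>i. D (e i) = 0))"
    proof (intro exI conjI ballI allI impI)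
      \<comment> \<open>The point at \<open>a\<close> is normalised by its coordinate
        \<open>y 1\<close>; what remains is expressed in affine coordinates that \<open>D\<close>
        fixes.\<close>
      show "poly (x i) a = poly (y 1) a * (poly (x i) a / poly (y 1) a)" for i using a_props(1)[OF a] by simp
      fix D i assume D: "D \<in> DD" "\<forall>l\<in>K. D l = 0"
      note d = DD_derivation[OF D(1)]
      have v: "D (?v i a) = 0" if "lift_der D (Y i / Y 1) \<in> vanish_at a 1" for i
        using that ratio_derivative_vanishes_iff[OF d Da[OF D(1) a] a_props(1)[OF a]] by (simp add: Y_def)
      have v234: "D (?v 2 a) = 0" "D (?v 3 a) = 0" "D (?v 4 a) = 0"
        using uw[OF D a] Y4_ratio_vanishes[OF D(1) a_props[OF a] uw[OF D a]] by (auto intro: v)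
      have v1: "D (?v 1 a) = 0" using a_props(1)[OF a] by (simp add: der_1[OF d])
      have "poly (x 1) a = poly (y 1) a + c 1 * poly (y 4) a" "poly (x 2) a = poly (y 2) a + c 2 * poly (y 4) a"
        "poly (x 3) a = poly (y 3) a + c 3 * poly (y 4) a" "poly (x 4) a = poly (y 4) a"
        by (simp_all add: Y_values)
      then have px: "poly (x 1) a / poly (y 1) a = ?v 1 a + c 1 * ?v 4 a" "poly (x 2) a / poly (y 1) a = ?v 2 a + c 2 * ?v 4 a"
        "poly (x 3) a / poly (y 1) a = ?v 3 a + c 3 * ?v 4 a" "poly (x 4) a / poly (y 1) a = ?v 4 a"
        by (simp_all only: add_divide_distrib times_divide_eq_right)
      have "\<forall>i. D (poly (x i) a / poly (y 1) a) = 0"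
        unfolding forall_4 px der_add[OF d] der_mult[OF d] v1 v234 DD_c[OF D(1)] by simp
      then show "D (poly (x i) a / poly (y 1) a) = 0" by blast
    qed
  qed
qed

end

theorem (in generic_point) line_through_generic_point:
  assumes d: "d > 0" and r: "3 * real m < 2 * real r * sqrt (real d)" and rs: "3 * m < 2 * r + 3 * s"
    and B: "2 * r + s + 2 \<le> card B"
  shows "\<exists>y. (\<forall>i. degree (y i) \<le> m) \<and> (\<exists>p q. x p * y q \<noteq> x q * y p) \<and>
    (\<forall>n. ev_hom kk F (\<lambda>i. to_fract (x i) + of_nat n * to_fract (y i)) = 0)"
proof (cases "\<exists>D1\<in>DD. \<exists>D2\<in>DD. \<exists>p q j. det3 x (dx D1) (dx D2) p q j \<noteq> 0")
  case False
  have "r \<noteq> 0" using r by (intro notI) simp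
  \<comment> \<open>All derivations already move \<open>x\<close> along one curve, so no values need
    to be fixed; order 3 at \<open>m + 1\<close> places alone exceeds the degree
    \<open>3 * m\<close>.\<close>
  show ?thesis
    by (rule line_through_moving_point[where K = "{}" and A = "{}" and s = "m + 1"])
       (use False rs B \<open>r \<noteq> 0\<close> in auto)
next
  case True
  then obtain D1 D2 p q j where D: "D1 \<in> DD" "D2 \<in> DD" "det3 x (dx D1) (dx D2) p q j \<noteq> 0" by blast
  obtain cK c where ch: "chart emb x m B Db F d E cK c"
    and J: "det3 (adapted c x) (adapted c (dx D1)) (adapted c (dx D2)) 1 2 3 \<noteq> 0"
    by (rule chart_exists[OF d D])
  interpret chart emb x m B Db F d E cK c by (rule ch)
  have fr: "frame D1 D2" using D J by (simp add: frame_def y_def)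
  have Y10: "Y 1 \<noteq> 0"
  proof
    assume Y1: "Y 1 = 0"
    have z: "adapted c (dx D) 1 = 0" if "D \<in> DD" for D
    proof -
      have "to_fract (adapted c (dx D) 1) = 0"
        using lift_der_Y[OF that, of 1] der_0[OF DD_lift[OF that]] by (simp add: Y1)
      then show ?thesis by simp
    qed
    have "adapted c x 1 = 0" using Y1 by (simp add: Y_def y_def)
    then show False using J z[OF D(1)] z[OF D(2)] by (simp add: det3_def)
  qed
  obtain P where P: "derivation P" "\<forall>k. P (kk k) = 0" "P (Y 1) = 0" "P (Y 2) = Y 1" "P (Y 3) = 0"
    using frame_derivation[OF fr, of 0 "Y 1" 0] by blast
  obtain Q where Q: "derivation Q" "\<forall>k. Q (kk k) = 0" "Q (Y 1) = 0" "Q (Y 2) = 0" "Q (Y 3) = Y 1"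
    using frame_derivation[OF fr, of 0 0 "Y 1"] by blast
  interpret affine_coords emb x m B Db F d E cK c P Q
    by unfold_locales (use gx_nonzero[OF fr] Y10 P Q in auto)
  show ?thesis by (rule line_from_rank_drop[OF fr r rs B])
qed

section \<open>An ultrapower of the complex numbers\<close>

definition fip :: "'i set set \<Rightarrow> bool" where
  "fip G \<longleftrightarrow> (\<forall>H. finite H \<and> H \<subseteq> G \<longrightarrow> \<Inter>H \<noteq> {})"

definition large_base :: "'x set set set" where
  "large_base = range (\<lambda>f. {A. finite A \<and> f \<in> A})"

lemma fip_large_base: "fip large_base"
  unfolding fip_def
proof (intro allI impI)
  fix H :: "'a set set set" assume H: "finite H \<and> H \<subseteq> large_base"
  then obtain F where F: "finite F" "H = (\<lambda>f. {A. finite A \<and> f \<in> A}) ` F"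
    unfolding large_base_def by (meson finite_subset_image)
  then have "F \<in> \<Inter>H" by auto
  then show "\<Inter>H \<noteq> {}" by blast
qed

text \<open>A family that is maximal with the finite intersection property is an ultrafilter; in
  this form Zorn's lemma applies directly.\<close>

lemma ultra_exists: "\<exists>G :: 'x set set set. large_base \<subseteq> G \<and> fip G \<and> (\<forall>G'. fip G' \<longrightarrow> G \<subseteq> G' \<longrightarrow> G' = G)"
proof -
  let ?S = "{G :: 'x set set set. large_base \<subseteq> G \<and> fip G}"
  have "\<exists>M\<in>?S. \<forall>X\<in>?S. M \<subseteq> X \<longrightarrow> X = M"
  proof (rule subset_Zorn_nonempty)
    show "?S \<noteq> {}" using fip_large_base by auto
    fix C assume C: "C \<noteq> {}" "subset.chain ?S C"
    then have CS: "C \<subseteq> ?S" by (simp add: subset_chain_def)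
    have "fip (\<Union>C)" unfolding fip_def
    proof (intro allI impI)
      fix H assume H: "finite H \<and> H \<subseteq> \<Union>C"
      then obtain G where "G \<in> C" "H \<subseteq> G" using finite_subset_Union_chain[of H C ?S] C by auto
      then show "\<Inter>H \<noteq> {}" using CS H by (auto simp: fip_def)
    qed
    moreover have "large_base \<subseteq> \<Union>C" using C(1) CS by auto
    ultimately show "\<Union>C \<in> ?S" by simp
  qed
  then obtain M where M: "M \<in> ?S" "\<forall>X\<in>?S. M \<subseteq> X \<longrightarrow> X = M" by (elim bexE)
  then have "large_base \<subseteq> M" "fip M" by simp_all
  show ?thesis
  proof (rule exI[of _ M], intro conjI allI impI)
    show "large_base \<subseteq> M" by fact
    show "fip M" by fact
    fix G' assume "fip G'" "M \<subseteq> G'"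
    then have "G' \<in> ?S" using \<open>large_base \<subseteq> M\<close> by simp
    then show "G' = M" using M(2) \<open>M \<subseteq> G'\<close> by simp
  qed
qed

text \<open>
  The index \<open>A\<close> is the finite set of functions that the \<open>A\<close>-th member of a family of points avoids, so
  every function is avoided by almost all members.
\<close>

definition ultra :: "'x set set set" where
  "ultra = (SOME G. large_base \<subseteq> G \<and> fip G \<and> (\<forall>G'. fip G' \<longrightarrow> G \<subseteq> G' \<longrightarrow> G' = G))"

lemma ultra_props:
  "large_base \<subseteq> (ultra :: 'x set set set) \<and> fip (ultra :: 'x set set set) \<and>
    (\<forall>G'. fip G' \<longrightarrow> (ultra :: 'x set set set) \<subseteq> G' \<longrightarrow> G' = ultra)"
  unfolding ultra_def by (rule someI_ex[OF ultra_exists])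

lemma ultra_base: "{A. finite A \<and> f \<in> A} \<in> ultra"
  by (rule subsetD[OF conjunct1[OF ultra_props]]) (simp add: large_base_def)

lemma ultra_fip: "fip ultra"
  using ultra_props by (elim conjE)

lemma ultra_max: "fip G' \<Longrightarrow> ultra \<subseteq> G' \<Longrightarrow> G' = ultra"
  by (rule mp[OF mp[OF spec[OF conjunct2[OF conjunct2[OF ultra_props]]]]])

text \<open>By maximality, a set outside \<open>ultra\<close> misses some finite intersection of
  members. If this held for \<open>U\<close> and for its complement, the two intersections together
  would be empty.\<close>

lemma ultra_cases: "U \<in> ultra \<or> - U \<in> ultra"
proof (rule ccontr)
  assume "\<not> ?thesis"
  then have n: "U \<notin> ultra" "- U \<notin> ultra" by auto
  have ex: "\<exists>H. finite H \<and> H \<subseteq> ultra \<and> \<Inter>H \<inter> V = {}" if "V \<notin> ultra" for V :: "'a set set"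
  proof -
    have "\<not> fip (insert V ultra)" using ultra_max[of "insert V ultra"] that by auto
    then obtain H where H: "finite H" "H \<subseteq> insert V ultra" "\<Inter>H = {}" unfolding fip_def by auto
    have "\<Inter>(H - {V}) \<inter> V \<subseteq> \<Inter>H" by auto
    then show ?thesis using H by (intro exI[of _ "H - {V}"]) auto
  qed
  obtain H where H: "finite H" "H \<subseteq> ultra" "\<Inter>H \<inter> U = {}" using ex[OF n(1)] by auto
  obtain H' where H': "finite H'" "H' \<subseteq> ultra" "\<Inter>H' \<inter> - U = {}" using ex[OF n(2)] by auto
  have "\<Inter>(H \<union> H') = {}" using H(3) H'(3) by auto
  moreover have "finite (H \<union> H') \<and> H \<union> H' \<subseteq> ultra" using H H' by auto
  ultimately show False using ultra_fip unfolding fip_def by blast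
qed

lemma ultra_superset:
  assumes "U \<in> ultra" "U \<subseteq> V" shows "V \<in> ultra"
proof (rule ccontr)
  assume "V \<notin> ultra"
  then have "- V \<in> ultra" using ultra_cases by blast
  then have "finite {U, - V} \<and> {U, - V} \<subseteq> ultra" using assms by simp
  moreover have "\<Inter>{U, - V} = {}" using assms by auto
  ultimately show False using ultra_fip unfolding fip_def by blast
qed

lemma ultra_Int:
  assumes "U \<in> ultra" "V \<in> ultra" shows "U \<inter> V \<in> ultra"
proof (rule ccontr)
  assume "U \<inter> V \<notin> ultra"
  then have "- (U \<inter> V) \<in> ultra" using ultra_cases by blast
  then have "finite {U, V, - (U \<inter> V)} \<and> {U, V, - (U \<inter> V)} \<subseteq> ultra" using assms by simp
  moreover have "\<Inter>{U, V, - (U \<inter> V)} = {}" by auto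
  ultimately show False using ultra_fip unfolding fip_def by blast
qed

lemma ultra_superset2: "U \<in> ultra \<Longrightarrow> V \<in> ultra \<Longrightarrow> U \<inter> V \<subseteq> W \<Longrightarrow> W \<in> ultra"
  by (rule ultra_superset[OF ultra_Int])

lemma ultra_nonempty: "U \<in> ultra \<Longrightarrow> U \<noteq> {}"
  using ultra_fip unfolding fip_def by (auto dest!: spec[of _ "{U}"])

lemma ultra_UNIV: "UNIV \<in> ultra"
  by (rule ultra_superset[OF ultra_base subset_UNIV])

lemma ultra_finite_INT: "finite I \<Longrightarrow> (\<And>i. i \<in> I \<Longrightarrow> {A. P i A} \<in> ultra) \<Longrightarrow> {A. \<forall>i\<in>I. P i A} \<in> ultra"
proof (induction I rule: finite_induct)
  case (insert i I)
  have "{A. \<forall>j\<in>insert i I. P j A} = {A. P i A} \<inter> {A. \<forall>j\<in>I. P j A}" by auto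
  then show ?case using insert by (simp add: ultra_Int)
qed (simp add: ultra_UNIV)

quotient_type 'x hcomplex = "'x set \<Rightarrow> complex" / "\<lambda>f g. {A. f A = g A} \<in> ultra"
proof (rule equivpI)
  show "reflp (\<lambda>f g :: 'x set \<Rightarrow> complex. {A. f A = g A} \<in> ultra)" by (rule reflpI) (simp add: ultra_UNIV)
  show "symp (\<lambda>f g :: 'x set \<Rightarrow> complex. {A. f A = g A} \<in> ultra)" by (rule sympI) (simp add: eq_commute)
  show "transp (\<lambda>f g :: 'x set \<Rightarrow> complex. {A. f A = g A} \<in> ultra)"
  proof (rule transpI)
    fix f g h :: "'x set \<Rightarrow> complex"
    assume "{A. f A = g A} \<in> ultra" "{A. g A = h A} \<in> ultra"
    then have "{A. f A = g A} \<inter> {A. g A = h A} \<in> ultra" by (rule ultra_Int)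
    then show "{A. f A = h A} \<in> ultra" by (rule ultra_superset) auto
  qed
qed

lift_definition hc :: "('x set \<Rightarrow> complex) \<Rightarrow> 'x hcomplex" is "\<lambda>f. f" .

instantiation hcomplex :: (type) field
begin

lift_definition zero_hcomplex :: "'a hcomplex" is "\<lambda>_. 0" .
lift_definition one_hcomplex :: "'a hcomplex" is "\<lambda>_. 1" .
lift_definition plus_hcomplex :: "'a hcomplex \<Rightarrow> 'a hcomplex \<Rightarrow> 'a hcomplex" is "\<lambda>f g A. f A + g A"
  by (erule (1) ultra_superset2) auto
lift_definition minus_hcomplex :: "'a hcomplex \<Rightarrow> 'a hcomplex \<Rightarrow> 'a hcomplex" is "\<lambda>f g A. f A - g A"
  by (erule (1) ultra_superset2) auto
lift_definition uminus_hcomplex :: "'a hcomplex \<Rightarrow> 'a hcomplex" is "\<lambda>f A. - f A"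
  by (erule ultra_superset) auto
lift_definition times_hcomplex :: "'a hcomplex \<Rightarrow> 'a hcomplex \<Rightarrow> 'a hcomplex" is "\<lambda>f g A. f A * g A"
  by (erule (1) ultra_superset2) auto
lift_definition inverse_hcomplex :: "'a hcomplex \<Rightarrow> 'a hcomplex" is "\<lambda>f A. inverse (f A)"
  by (erule ultra_superset) auto
lift_definition divide_hcomplex :: "'a hcomplex \<Rightarrow> 'a hcomplex \<Rightarrow> 'a hcomplex" is "\<lambda>f g A. f A / g A"
  by (erule (1) ultra_superset2) auto

instance
proof
  fix a b c :: "'a hcomplex"
  show "a * b * c = a * (b * c)" by transfer (simp add: ultra_UNIV mult.assoc)
  show "a * b = b * a" by transfer (simp add: ultra_UNIV mult.commute)
  show "1 * a = a" by transfer (simp add: ultra_UNIV)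
  show "a + b + c = a + (b + c)" by transfer (simp add: ultra_UNIV add.assoc)
  show "a + b = b + a" by transfer (simp add: ultra_UNIV add.commute)
  show "0 + a = a" by transfer (simp add: ultra_UNIV)
  show "- a + a = 0" by transfer (simp add: ultra_UNIV)
  show "a - b = a + - b" by transfer (simp add: ultra_UNIV)
  show "(a + b) * c = a * c + b * c" by transfer (simp add: ultra_UNIV distrib_right)
  show "(0::'a hcomplex) \<noteq> 1" by transfer (use ultra_nonempty[of "{}"] in auto)
  show "a div b = a * inverse b" by transfer (simp add: ultra_UNIV divide_inverse)
  show "inverse (0::'a hcomplex) = 0" by transfer (simp add: ultra_UNIV)
  show "a \<noteq> 0 \<Longrightarrow> inverse a * a = 1"
  proof transfer
    fix f :: "'a set \<Rightarrow> complex" assume "{A. f A = 0} \<notin> ultra"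
    then have "- {A. f A = 0} \<in> ultra" using ultra_cases by blast
    then show "{A. inverse (f A) * f A = 1} \<in> ultra" by (rule ultra_superset) auto
  qed
qed

end

lemma hc_eq_iff: "hc f = hc g \<longleftrightarrow> {A. f A = g A} \<in> ultra"
  by transfer simp

lemma hc_surj: "\<exists>f. z = hc f"
proof transfer
  fix g :: "'a set \<Rightarrow> complex"
  show "\<exists>f. {A. g A = f A} \<in> ultra" by (rule exI[of _ g]) (simp add: ultra_UNIV)
qed

lemma hc_0: "hc (\<lambda>_. 0) = 0" and hc_1: "hc (\<lambda>_. 1) = 1"
  and hc_add: "hc f + hc g = hc (\<lambda>A. f A + g A)" and hc_mult: "hc f * hc g = hc (\<lambda>A. f A * g A)"
  by (transfer, simp add: ultra_UNIV)+

lemma hc_diff: "hc f - hc g = hc (\<lambda>A. f A - g A)"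
  by transfer (simp add: ultra_UNIV)

lemma hc_sum: "(\<Sum>i\<in>I. hc (f i)) = hc (\<lambda>A. \<Sum>i\<in>I. f i A)"
  by (induction I rule: infinite_finite_induct) (simp_all add: hc_0 hc_add)

definition hemb :: "complex \<Rightarrow> 'x hcomplex" where "hemb c = hc (\<lambda>_. c)"

lemma rhom_hemb: "rhom hemb"
  by (simp add: rhom_def hemb_def hc_1 hc_add hc_mult)

instance hcomplex :: (type) field_char_0
proof
  show "inj (of_nat :: nat \<Rightarrow> 'a hcomplex)"
  proof (rule injI)
    fix m n assume "(of_nat m :: 'a hcomplex) = of_nat n"
    then have "hemb (of_nat m) = (hemb (of_nat n) :: 'a hcomplex)" by (simp add: rhom_of_nat[OF rhom_hemb])
    then have "{A :: 'a set. (of_nat m :: complex) = of_nat n} \<in> ultra" by (simp add: hemb_def hc_eq_iff)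
    then show "m = n" using ultra_nonempty by fastforce
  qed
qed

text \<open>The degree bound is uniform in \<open>A\<close>, so that equality of polynomials almost
  everywhere reduces to finitely many coefficients and closure of \<open>ultra\<close> under finite
  intersections suffices.\<close>

definition rep_poly :: "'x hcomplex poly \<Rightarrow> ('x set \<Rightarrow> complex poly) \<Rightarrow> bool" where
  "rep_poly p pf \<longleftrightarrow>
    (\<exists>n. \<forall>A. degree (pf A) \<le> n) \<and> (\<forall>l. coeff p l = hc (\<lambda>A. coeff (pf A) l))"

lemma degree_bounded_add:
  assumes "\<forall>A. degree (p A) \<le> m" "\<forall>A. degree (q A) \<le> n" shows "\<exists>k. \<forall>A. degree (p A + q A) \<le> k"
proof (rule exI[of _ "max m n"], rule allI)
  fix A show "degree (p A + q A) \<le> max m n"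
    using assms[THEN spec, of A] by (intro degree_add_le) auto
qed

lemma degree_bounded_mult:
  assumes "\<forall>A. degree (p A) \<le> m" "\<forall>A. degree (q A) \<le> n" shows "\<exists>k. \<forall>A. degree (p A * q A) \<le> k"
proof (rule exI[of _ "m + n"], rule allI)
  fix A show "degree (p A * q A) \<le> m + n"
    using assms[THEN spec, of A] by (intro order.trans[OF degree_mult_le]) auto
qed

lemma rep_poly_add: "rep_poly p pf \<Longrightarrow> rep_poly q qf \<Longrightarrow> rep_poly (p + q) (\<lambda>A. pf A + qf A)"
  by (auto simp: rep_poly_def hc_add intro!: degree_bounded_add)

lemma rep_poly_diff:
  assumes "rep_poly p pf" "rep_poly q qf" shows "rep_poly (p - q) (\<lambda>A. pf A - qf A)"
proof -
  obtain m n where "\<forall>A. degree (pf A) \<le> m" "\<forall>A. degree (qf A) \<le> n"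
    using assms unfolding rep_poly_def by auto
  then have "\<exists>k. \<forall>A. degree (pf A - qf A) \<le> k"
    using degree_bounded_add[of pf m "\<lambda>A. - qf A" n] by simp
  then show ?thesis using assms by (simp add: rep_poly_def hc_diff)
qed

lemma rep_poly_mult: "rep_poly p pf \<Longrightarrow> rep_poly q qf \<Longrightarrow> rep_poly (p * q) (\<lambda>A. pf A * qf A)"
  by (auto simp: rep_poly_def hc_mult hc_sum coeff_mult intro!: degree_bounded_mult)

lemma rep_poly_emb: "rep_poly (map_poly hemb p) (\<lambda>_. p)"
  by (auto simp: rep_poly_def coeff_map_poly_rhom[OF rhom_hemb]) (simp add: hemb_def)

lemma rep_poly_0: "rep_poly 0 (\<lambda>_. 0)"
  by (simp add: rep_poly_def hc_0)

lemma rep_poly_1: "rep_poly 1 (\<lambda>_. 1)"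
  using rep_poly_emb[of 1] by (simp add: rhom_1[OF rhom_map_poly[OF rhom_hemb]])

lemma rep_poly_of_nat: "rep_poly (of_nat n) (\<lambda>_. of_nat n)"
  by (induction n) (auto simp: rep_poly_0 intro!: rep_poly_add rep_poly_1)

lemma rep_poly_power: "rep_poly p pf \<Longrightarrow> rep_poly (p ^ n) (\<lambda>A. pf A ^ n)"
  by (induction n) (auto simp: rep_poly_1 intro!: rep_poly_mult)

lemma rep_poly_prod: "(\<And>i. i \<in> I \<Longrightarrow> rep_poly (p i) (pf i)) \<Longrightarrow> rep_poly (prod p I) (\<lambda>A. \<Prod>i\<in>I. pf i A)"
  by (induction I rule: infinite_finite_induct) (auto simp: rep_poly_1 intro!: rep_poly_mult)

lemma rep_poly_sum: "(\<And>i. i \<in> I \<Longrightarrow> rep_poly (p i) (pf i)) \<Longrightarrow> rep_poly (sum p I) (\<lambda>A. \<Sum>i\<in>I. pf i A)"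
  by (induction I rule: infinite_finite_induct) (auto simp: rep_poly_0 intro!: rep_poly_add)

lemma rep_poly_exists: "\<exists>pf. rep_poly p pf"
proof -
  have "\<forall>l. \<exists>f. coeff p l = hc f" by (intro allI hc_surj)
  from choice[OF this] obtain f where f: "\<forall>l. coeff p l = hc (f l)" by auto
  define pf where "pf A = (\<Sum>l\<le>degree p. monom (f l A) l)" for A
  have c: "coeff (pf A) l = (if l \<le> degree p then f l A else 0)" for A l
    by (simp add: pf_def coeff_sum)
  have "degree (pf A) \<le> degree p" for A by (rule degree_le) (simp add: c)
  moreover have "coeff p l = hc (\<lambda>A. coeff (pf A) l)" for l
  proof (cases "l \<le> degree p")
    case True then show ?thesis using f by (simp add: c)
  qed (simp add: c hc_0 coeff_eq_0)
  ultimately show ?thesis unfolding rep_poly_def by auto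
qed

lemma rep_poly_eq:
  assumes "rep_poly p pf" "rep_poly p qf"
  shows "{A. pf A = qf A} \<in> ultra"
proof -
  obtain m n where mn: "\<forall>A. degree (pf A) \<le> m" "\<forall>A. degree (qf A) \<le> n"
    using assms unfolding rep_poly_def by auto
  have "{A. \<forall>l\<in>{..max m n}. coeff (pf A) l = coeff (qf A) l} \<in> ultra"
    by (rule ultra_finite_INT) (use assms(1,2) in \<open>simp_all add: rep_poly_def hc_eq_iff[symmetric]\<close>)
  then show ?thesis
  proof (rule ultra_superset, intro Collect_mono impI poly_eqI)
    fix A l assume A: "\<forall>l\<in>{..max m n}. coeff (pf A) l = coeff (qf A) l"
    show "coeff (pf A) l = coeff (qf A) l"
      using A mn[THEN spec, of A] by (cases "l \<le> max m n") (auto simp: coeff_eq_0)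
  qed
qed

lemma rep_poly_eq_0:
  assumes "rep_poly p pf" shows "p = 0 \<longleftrightarrow> {A. pf A = 0} \<in> ultra"
proof
  assume "p = 0"
  then show "{A. pf A = 0} \<in> ultra" using rep_poly_eq[OF assms, of "\<lambda>_. 0"] rep_poly_0 by simp
next
  assume U: "{A. pf A = 0} \<in> ultra"
  show "p = 0"
  proof (rule poly_eqI)
    fix l
    have "{A. coeff (pf A) l = 0} \<in> ultra" using U by (rule ultra_superset) auto
    then have "hc (\<lambda>A. coeff (pf A) l) = hc (\<lambda>_. 0)" by (simp add: hc_eq_iff)
    then show "coeff p l = coeff 0 l" using assms by (simp add: rep_poly_def hc_0)
  qed
qed

section \<open>Polynomial functions and the Zariski topology\<close>

text \<open>Functions rather than formal polynomials, so that evaluation at the generic point is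
  composition with a family of points.\<close>

inductive_set polyfuns :: "'j set \<Rightarrow> (('j \<Rightarrow> complex) \<Rightarrow> complex) set" for J where
  polyfuns_const: "(\<lambda>_. c) \<in> polyfuns J"
| polyfuns_var: "j \<in> J \<Longrightarrow> (\<lambda>v. v j) \<in> polyfuns J"
| polyfuns_add: "f \<in> polyfuns J \<Longrightarrow> g \<in> polyfuns J \<Longrightarrow> (\<lambda>v. f v + g v) \<in> polyfuns J"
| polyfuns_mult: "f \<in> polyfuns J \<Longrightarrow> g \<in> polyfuns J \<Longrightarrow> (\<lambda>v. f v * g v) \<in> polyfuns J"

lemma polyfuns_mono: "f \<in> polyfuns J \<Longrightarrow> J \<subseteq> J' \<Longrightarrow> f \<in> polyfuns J'"
  by (induction rule: polyfuns.induct) (auto intro: polyfuns.intros)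

lemma polyfuns_cong: "f \<in> polyfuns J \<Longrightarrow> \<forall>j\<in>J. u j = v j \<Longrightarrow> f u = f v"
  by (induction rule: polyfuns.induct) auto

lemma polyfuns_diff:
  assumes "f \<in> polyfuns J" "g \<in> polyfuns J" shows "(\<lambda>v. f v - g v) \<in> polyfuns J"
  using polyfuns_add[OF assms(1) polyfuns_mult[OF polyfuns_const[of "- 1"] assms(2)]] by simp

lemma polyfuns_sum:
  assumes "\<forall>i\<in>A. f i \<in> polyfuns J" shows "(\<lambda>v. \<Sum>i\<in>A. f i v) \<in> polyfuns J"
  using assms by (induction A rule: infinite_finite_induct) (simp_all add: polyfuns_const polyfuns_add)

lemma polyfuns_prod:
  assumes "\<forall>i\<in>A. f i \<in> polyfuns J" shows "(\<lambda>v. \<Prod>i\<in>A. f i v) \<in> polyfuns J"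
  using assms by (induction A rule: infinite_finite_induct) (simp_all add: polyfuns_const polyfuns_mult)

lemma polyfuns_power: "f \<in> polyfuns J \<Longrightarrow> (\<lambda>v. f v ^ n) \<in> polyfuns J"
  by (induction n) (simp_all add: polyfuns_const polyfuns_mult)

lemma polyfuns_ray: "f \<in> polyfuns J \<Longrightarrow> \<exists>p. \<forall>c. f (\<lambda>j. c * v j) = poly p c"
proof (induction rule: polyfuns.induct)
  case (polyfuns_const c)
  show ?case by (rule exI[of _ "[:c:]"]) simp
next
  case (polyfuns_var j)
  show ?case by (rule exI[of _ "[:0, v j:]"]) simp
next
  case (polyfuns_add f g)
  from polyfuns_add.IH obtain p q where "\<forall>c. f (\<lambda>j. c * v j) = poly p c" "\<forall>c. g (\<lambda>j. c * v j) = poly q c"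
    by (elim exE)
  then show ?case by (intro exI[of _ "p + q"]) simp
next
  case (polyfuns_mult f g)
  from polyfuns_mult.IH obtain p q where "\<forall>c. f (\<lambda>j. c * v j) = poly p c" "\<forall>c. g (\<lambda>j. c * v j) = poly q c"
    by (elim exE)
  then show ?case by (intro exI[of _ "p * q"]) simp
qed

lemma mpoly_eval_in_polyfuns:
  assumes "\<forall>m\<in>Poly_Mapping.keys g. Poly_Mapping.keys m \<subseteq> J"
  shows "mpoly_eval g \<in> polyfuns J"
proof -
  have "mpoly_eval g = (\<lambda>v. \<Sum>m\<in>Poly_Mapping.keys g. Poly_Mapping.lookup g m *
      (\<Prod>i\<in>Poly_Mapping.keys m. v i ^ Poly_Mapping.lookup m i))"
    by (rule ext) (simp add: mpoly_eval_def)
  moreover have "\<dots> \<in> polyfuns J"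
    using assms by (intro polyfuns_sum polyfuns_mult polyfuns_const polyfuns_prod polyfuns_power polyfuns_var ballI) auto
  ultimately show ?thesis by simp
qed

lemma polyfuns_mpoly:
  "f \<in> polyfuns J \<Longrightarrow> \<exists>g. (\<forall>m\<in>Poly_Mapping.keys g. Poly_Mapping.keys m \<subseteq> J) \<and> (\<forall>v. f v = mpoly_eval g v)"
proof (induction rule: polyfuns.induct)
  case (polyfuns_const c)
  show ?case
    by (rule exI[of _ "mconst c"]) (simp add: mpoly_eval_ev_hom ev_hom_const[OF rhom_id], simp add: mconst_def)
next
  case (polyfuns_var j)
  then show ?case
    by (intro exI[of _ "mvar j"]) (simp add: mpoly_eval_ev_hom ev_hom_var[OF rhom_id], simp add: mvar_def)
next
  case (polyfuns_add f g)
  from polyfuns_add.IH obtain p q where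
    p: "\<forall>m\<in>Poly_Mapping.keys p. Poly_Mapping.keys m \<subseteq> J" "\<forall>v. f v = mpoly_eval p v" and
    q: "\<forall>m\<in>Poly_Mapping.keys q. Poly_Mapping.keys m \<subseteq> J" "\<forall>v. g v = mpoly_eval q v"
    by (elim exE conjE)
  have "\<forall>m\<in>Poly_Mapping.keys (p + q). Poly_Mapping.keys m \<subseteq> J"
    using keys_add[of p q] p(1) q(1) by auto
  moreover have "\<forall>v. f v + g v = mpoly_eval (p + q) v"
    using p(2) q(2) by (simp add: mpoly_eval_ev_hom ev_hom_add[OF rhom_id])
  ultimately show ?case by (intro exI[of _ "p + q"] conjI)
next
  case (polyfuns_mult f g)
  from polyfuns_mult.IH obtain p q where
    p: "\<forall>m\<in>Poly_Mapping.keys p. Poly_Mapping.keys m \<subseteq> J" "\<forall>v. f v = mpoly_eval p v" and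
    q: "\<forall>m\<in>Poly_Mapping.keys q. Poly_Mapping.keys m \<subseteq> J" "\<forall>v. g v = mpoly_eval q v"
    by (elim exE conjE)
  have "\<forall>m\<in>Poly_Mapping.keys (p * q). Poly_Mapping.keys m \<subseteq> J"
  proof
    fix m assume "m \<in> Poly_Mapping.keys (p * q)"
    then obtain a b where "m = a + b" "a \<in> Poly_Mapping.keys p" "b \<in> Poly_Mapping.keys q"
      using keys_mult[of p q] by auto
    then show "Poly_Mapping.keys m \<subseteq> J" using keys_add[of a b] p(1) q(1) by auto
  qed
  moreover have "\<forall>v. f v * g v = mpoly_eval (p * q) v"
    using p(2) q(2) by (simp add: mpoly_eval_ev_hom ev_hom_mult[OF rhom_id])
  ultimately show ?case by (intro exI[of _ "p * q"] conjI)
qed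

lemma poly_zero_outside_0:
  fixes p :: "'a::{idom, ring_char_0} poly"
  assumes "\<forall>c. c \<noteq> 0 \<longrightarrow> poly p c = 0" shows "p = 0"
proof (rule ccontr)
  assume "p \<noteq> 0"
  then have "finite {c. poly p c = 0}" by (rule poly_roots_finite)
  then have "finite (insert 0 {c. poly p c = 0})" by simp
  moreover have "insert 0 {c. poly p c = 0} = UNIV" using assms by auto
  ultimately show False using infinite_UNIV_char_0[where 'a='a] by simp
qed

section \<open>Points of projective space as punctured lines\<close>

lemma proj_space_scale:
  assumes "p \<in> proj_space I" "v \<in> p" "c \<noteq> 0" shows "(\<lambda>i. c * v i) \<in> p"
proof -
  obtain w where w: "p = proj_point w" using assms(1) by (auto simp: proj_space_def)
  then obtain k where "k \<noteq> 0" "v = (\<lambda>i. k * w i)" using assms(2) by (auto simp: proj_point_def)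
  then show ?thesis using assms(3) unfolding w proj_point_def
    by (intro CollectI exI[of _ "c * k"]) (auto simp: mult.assoc)
qed

lemma proj_space_rescale:
  assumes "p \<in> proj_space I" "v \<in> p" "w \<in> p" shows "\<exists>c. c \<noteq> 0 \<and> w = (\<lambda>i. c * v i)"
proof -
  obtain u where u: "p = proj_point u" using assms(1) by (auto simp: proj_space_def)
  obtain k where k: "k \<noteq> 0" "v = (\<lambda>i. k * u i)" using assms(2) u by (auto simp: proj_point_def)
  obtain l where l: "l \<noteq> 0" "w = (\<lambda>i. l * u i)" using assms(3) u by (auto simp: proj_point_def)
  show ?thesis using k l by (intro exI[of _ "l / k"]) auto
qed

lemma proj_space_point:
  assumes "p \<in> proj_space I" "w \<in> p" shows "p = proj_point w"
proof
  show "p \<subseteq> proj_point w" using proj_space_rescale[OF assms] by (auto simp: proj_point_def)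
  show "proj_point w \<subseteq> p" using proj_space_scale[OF assms] by (auto simp: proj_point_def)
qed

lemma proj_space_vector:
  assumes "p \<in> proj_space I" "v \<in> p" shows "v \<noteq> (\<lambda>_. 0)" "i \<notin> I \<Longrightarrow> v i = 0"
  using assms by (auto simp: proj_space_def proj_point_def fun_eq_iff)

lemma proj_space_nonempty: "p \<in> proj_space I \<Longrightarrow> p \<noteq> {}"
  by (auto simp: proj_space_def proj_point_def)

text \<open>A point is a punctured line, on which polynomial functions become polynomials in one
  variable and have no zero divisors. This lets inhomogeneous functions take the place of
  forms.\<close>

lemma polyfuns_product_vanishes:
  assumes p: "p \<in> proj_space I" and f: "f \<in> polyfuns J" and g: "g \<in> polyfuns J'"
    and fg: "\<forall>v\<in>p. f v * g v = 0"
  shows "(\<forall>v\<in>p. f v = 0) \<or> (\<forall>v\<in>p. g v = 0)"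
proof -
  obtain v where v: "v \<in> p" using proj_space_nonempty[OF p] by auto
  from polyfuns_ray[OF f, of v] obtain a where a: "\<forall>c. f (\<lambda>j. c * v j) = poly a c" by (elim exE)
  from polyfuns_ray[OF g, of v] obtain b where b: "\<forall>c. g (\<lambda>j. c * v j) = poly b c" by (elim exE)
  have "\<forall>c. c \<noteq> 0 \<longrightarrow> poly (a * b) c = 0"
    using fg proj_space_scale[OF p v] a b by fastforce
  then have "a * b = 0" by (rule poly_zero_outside_0)
  then consider "a = 0" | "b = 0" by auto
  then show ?thesis
  proof cases
    case 1
    have "f w = 0" if "w \<in> p" for w using proj_space_rescale[OF p v that] a 1 by auto
    then show ?thesis by simp
  next
    case 2
    have "g w = 0" if "w \<in> p" for w using proj_space_rescale[OF p v that] b 2 by auto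
    then show ?thesis by simp
  qed
qed

section \<open>The Zariski topology\<close>

lemma topspace_zariski: "topspace (zariski I) = proj_space I"
proof -
  have "is_form I 0 (mconst 1 :: ('a, 'b) mpoly)" by (simp add: is_form_def mconst_def)
  moreover have "proj_zeros I (mconst 1 :: ('a, 'b) mpoly) = {}"
    using proj_space_nonempty
    by (auto simp: proj_zeros_def mpoly_eval_ev_hom ev_hom_const[OF rhom_id])
  ultimately have "proj_space I \<in> {proj_space I - proj_zeros I f | f :: ('a, 'b) mpoly. \<exists>d. is_form I d f}"
    by force
  then show ?thesis unfolding zariski_def by (auto simp: topology_generated_by_topspace)
qed

lemma closedin_proj_zeros: "is_form I d f \<Longrightarrow> closedin (zariski I) (proj_zeros I f)"
  unfolding closedin_def topspace_zariski
  by (auto simp: zariski_def proj_zeros_def intro!: topology_generated_by_Basis)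

text \<open>A function vanishes on a whole punctured line exactly when its homogeneous components
  do, since these are the coefficients of the polynomial obtained by scaling.\<close>

lemma closedin_polyfun:
  assumes f: "f \<in> polyfuns I"
  shows "closedin (zariski I) {p \<in> proj_space I. \<forall>v\<in>p. f v = 0}"
proof -
  from polyfuns_mpoly[OF f] obtain g where g: "\<forall>m\<in>Poly_Mapping.keys g. Poly_Mapping.keys m \<subseteq> I"
    "\<forall>v. f v = mpoly_eval g v" by (elim exE conjE)
  define dg where "dg m = (\<Sum>i\<in>Poly_Mapping.keys m. Poly_Mapping.lookup m i)" for m :: "'a \<Rightarrow>\<^sub>0 nat"
  define G where "G e = (\<Sum>m\<in>{m \<in> Poly_Mapping.keys g. dg m = e}. Poly_Mapping.single m (Poly_Mapping.lookup g m))" for e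
  define E where "E = dg ` Poly_Mapping.keys g"
  have form: "is_form I e (G e)" for e
    unfolding is_form_def
  proof
    fix m assume "m \<in> Poly_Mapping.keys (G e)"
    then have "m \<in> Poly_Mapping.keys g \<and> dg m = e"
      by (auto simp: G_def in_keys_iff lookup_sum lookup_single when_def split: if_splits dest!: sum.not_neutral_contains_not_neutral)
    then show "Poly_Mapping.keys m \<subseteq> I \<and> (\<Sum>i\<in>Poly_Mapping.keys m. Poly_Mapping.lookup m i) = e"
      using g(1) by (auto simp: dg_def)
  qed
  have G: "mpoly_eval (G e) v = (\<Sum>m\<in>{m \<in> Poly_Mapping.keys g. dg m = e}. Poly_Mapping.lookup g m * mon_val m v)" for e v
    unfolding G_def mpoly_eval_ev_hom by (simp add: ev_hom_sum[OF rhom_id] ev_hom_single[OF rhom_id])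
  have sum: "f v = (\<Sum>e\<in>E. mpoly_eval (G e) v)" for v
  proof -
    have "f v = (\<Sum>m\<in>Poly_Mapping.keys g. Poly_Mapping.lookup g m * mon_val m v)"
      using g(2) by (simp add: mpoly_eval_ev_hom ev_hom_def)
    also have "\<dots> = (\<Sum>e\<in>E. mpoly_eval (G e) v)"
      unfolding G E_def by (rule sum.image_gen) simp
    finally show ?thesis .
  qed
  have "finite E" by (simp add: E_def)
  have eq: "{p \<in> proj_space I. \<forall>v\<in>p. f v = 0} = \<Inter>(insert (proj_space I) ((\<lambda>e. proj_zeros I (G e)) ` E))" (is "?L = ?R")
  proof
    show "?R \<subseteq> ?L" by (auto simp: sum proj_zeros_def)
    show "?L \<subseteq> ?R"
    proof
      fix p assume p: "p \<in> ?L"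
      have "mpoly_eval (G e) v = 0" if e: "e \<in> E" and v: "v \<in> p" for e v
      proof -
        define P where "P = (\<Sum>e\<in>E. monom (mpoly_eval (G e) v) e)"
        have "poly P c = f (\<lambda>i. c * v i)" for c
          by (simp add: P_def poly_sum poly_monom sum mpoly_eval_scale[OF form] mult.commute)
        then have "P = 0" using p proj_space_scale[OF _ v] by (intro poly_zero_outside_0) auto
        moreover have "coeff P e = mpoly_eval (G e) v"
          using e \<open>finite E\<close> by (simp add: P_def coeff_sum)
        ultimately show ?thesis by simp
      qed
      then show "p \<in> ?R" using p by (auto simp: proj_zeros_def)
    qed
  qed
  show ?thesis unfolding eq
    by (rule closedin_Inter) (use closedin_proj_zeros[OF form] closedin_topspace[of "zariski I"] in \<open>auto simp: topspace_zariski\<close>)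
qed

lemma zariski_open_neighbourhood:
  fixes W :: "('j \<Rightarrow> complex) set set"
  assumes "openin (zariski I) W" "p \<in> W"
  shows "\<exists>f\<in>polyfuns I. (\<exists>v\<in>p. f v \<noteq> 0) \<and> (\<forall>q\<in>proj_space I. (\<exists>v\<in>q. f v \<noteq> 0) \<longrightarrow> q \<in> W)"
proof -
  have "generate_topology_on {proj_space I - proj_zeros I f | f. \<exists>d. is_form I d f} W"
    using assms(1) unfolding zariski_def by (simp add: openin_topology_generated_by_iff)
  then show ?thesis using assms(2)
  proof (induction rule: generate_topology_on.induct)
    case (Int a b)
    then have ab: "p \<in> a" "p \<in> b" by auto
    from Int.IH(1)[OF ab(1)] obtain f where f: "f \<in> polyfuns I" "\<exists>v\<in>p. f v \<noteq> 0"
      "\<forall>q\<in>proj_space I. (\<exists>v\<in>q. f v \<noteq> 0) \<longrightarrow> q \<in> a" by - (erule bexE, erule conjE, rule that)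
    from Int.IH(2)[OF ab(2)] obtain g where g: "g \<in> polyfuns I" "\<exists>v\<in>p. g v \<noteq> 0"
      "\<forall>q\<in>proj_space I. (\<exists>v\<in>q. g v \<noteq> 0) \<longrightarrow> q \<in> b" by - (erule bexE, erule conjE, rule that)
    have "p \<in> proj_space I" using openin_subset[OF assms(1)] assms(2) by (auto simp: topspace_zariski)
    from polyfuns_product_vanishes[OF this f(1) g(1)] have "\<exists>v\<in>p. f v * g v \<noteq> 0" using f(2) g(2) by auto
    then show ?case using f g by (intro bexI[OF _ polyfuns_mult[OF f(1) g(1)]]) auto
  next
    case (UN K)
    then obtain k where k: "k \<in> K" "p \<in> k" by auto
    from UN.IH[OF k] obtain f where f: "f \<in> polyfuns I" "\<exists>v\<in>p. f v \<noteq> 0"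
      "\<forall>q\<in>proj_space I. (\<exists>v\<in>q. f v \<noteq> 0) \<longrightarrow> q \<in> k" by - (erule bexE, erule conjE, rule that)
    then show ?case using k(1) by (intro bexI[OF _ f(1)]) auto
  next
    case (Basis s)
    then obtain f d where f: "s = proj_space I - proj_zeros I f" "is_form I d f" by auto
    have "mpoly_eval f \<in> polyfuns I" using f(2) by (intro mpoly_eval_in_polyfuns) (auto simp: is_form_def)
    then show ?case using Basis.prems f(1) by (intro bexI[of _ "mpoly_eval f"]) (auto simp: proj_zeros_def)
  qed auto
qed

lemma irreducible_cone:
  fixes Z S :: "('j \<Rightarrow> complex) set set"
  assumes Z: "irreducible_in (subtopology (zariski I) S) Z"
    and f: "f \<in> polyfuns I" and g: "g \<in> polyfuns I" and fg: "\<forall>v\<in>\<Union>Z. f v * g v = 0"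
  shows "(\<forall>v\<in>\<Union>Z. f v = 0) \<or> (\<forall>v\<in>\<Union>Z. g v = 0)"
proof -
  let ?V = "\<lambda>f. {p \<in> proj_space I. \<forall>v\<in>p. f v = 0}"
  have sub: "Z \<subseteq> S" "Z \<subseteq> proj_space I"
    using Z by (auto simp: irreducible_in_def topspace_zariski)
  have "Z \<subseteq> (?V f \<inter> S) \<union> (?V g \<inter> S)"
  proof
    fix p assume p: "p \<in> Z"
    then have "p \<in> proj_space I" "p \<in> S" using sub by auto
    moreover have "(\<forall>v\<in>p. f v = 0) \<or> (\<forall>v\<in>p. g v = 0)"
      by (rule polyfuns_product_vanishes[OF \<open>p \<in> proj_space I\<close> f g]) (use fg p in auto)
    ultimately show "p \<in> (?V f \<inter> S) \<union> (?V g \<inter> S)" by auto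
  qed
  note cover = this
  have cl: "closedin (subtopology (zariski I) S) (?V h \<inter> S)" if "h \<in> polyfuns I" for h
    unfolding closedin_subtopology by (rule exI[of _ "?V h"]) (simp add: closedin_polyfun[OF that])
  have "\<forall>A B. closedin (subtopology (zariski I) S) A \<and> closedin (subtopology (zariski I) S) B \<and> Z \<subseteq> A \<union> B \<longrightarrow>
      Z \<subseteq> A \<or> Z \<subseteq> B"
    using Z unfolding irreducible_in_def by (elim conjE)
  from this[rule_format, OF conjI[OF cl[OF f] conjI[OF cl[OF g] cover]]] show ?thesis by auto
qed

lemma closed_cone_separation:
  fixes Z S :: "('j \<Rightarrow> complex) set set"
  assumes Z: "closedin (subtopology (zariski I) S) Z"
    and Z': "Z' \<subseteq> topspace (subtopology (zariski I) S)" "\<not> Z' \<subseteq> Z"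
  shows "\<exists>f\<in>polyfuns I. (\<forall>v\<in>\<Union>Z. f v = 0) \<and> (\<exists>v\<in>\<Union>Z'. f v \<noteq> 0)"
proof -
  obtain C where C: "closedin (zariski I) C" "Z = C \<inter> S" using Z unfolding closedin_subtopology by auto
  obtain p where p: "p \<in> Z'" "p \<notin> Z" using Z'(2) by auto
  have "p \<in> proj_space I" "p \<in> S" using p(1) Z'(1) by (auto simp: topspace_zariski)
  then have "p \<in> proj_space I - C" using p(2) C(2) by auto
  moreover have "openin (zariski I) (proj_space I - C)"
    using C(1) unfolding closedin_def topspace_zariski by simp
  ultimately obtain f where f: "f \<in> polyfuns I" "\<exists>v\<in>p. f v \<noteq> 0"
    "\<forall>q\<in>proj_space I. (\<exists>v\<in>q. f v \<noteq> 0) \<longrightarrow> q \<in> proj_space I - C"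
    using zariski_open_neighbourhood[of I "proj_space I - C" p] by - (drule (1) meta_mp, drule (1) meta_mp, erule bexE, erule conjE, rule that)
  have "f v = 0" if v: "v \<in> \<Union>Z" for v
  proof -
    obtain q where q: "q \<in> Z" "v \<in> q" using v by auto
    then have "q \<in> proj_space I" "q \<in> C"
      using C closedin_subset[OF C(1)] by (auto simp: topspace_zariski)
    then show ?thesis using f(3) q(2) by auto
  qed
  then show ?thesis using f(1,2) p(1) by (intro bexI[OF _ f(1)]) auto
qed

section \<open>Generic points of cones\<close>

lemma derivation_kills_algebraic:
  fixes p :: "'a::field_char_0 poly"
  assumes D: "derivation D" and A: "subring_set A" and DA: "\<forall>a\<in>A. D a = 0"
  shows "p \<noteq> 0 \<Longrightarrow> \<forall>n. coeff p n \<in> A \<Longrightarrow> poly p w = 0 \<Longrightarrow> D w = 0"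
proof (induction "degree p" arbitrary: p rule: less_induct)
  case less
  have "degree p \<noteq> 0"
  proof
    assume "degree p = 0"
    then obtain c where "p = [:c:]" by (rule degree_eq_zeroE)
    then show False using less.prems by simp
  qed
  have "map_poly D p = 0"
    using less.prems(2) DA by (simp add: poly_eq_iff coeff_map_poly_der[OF D])
  then have eq: "poly (pderiv p) w * D w = 0"
    using der_poly[OF D, of p w] less.prems(3) der_0[OF D] by simp
  show ?case
  proof (cases "poly (pderiv p) w = 0")
    case True
    have "coeff (pderiv p) n \<in> A" for n
      using less.prems(2) A by (simp add: coeff_pderiv subring_set_closed(4) subring_set_of_nat del: of_nat_Suc)
    then show ?thesis
      using \<open>degree p \<noteq> 0\<close> True by (intro less.hyps[of "pderiv p"]) (auto simp: degree_pderiv pderiv_eq_0_iff)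
  qed (use eq in simp)
qed

lemma poly_relation_nonzero_constant:
  fixes p :: "'a::idom poly"
  assumes "w \<noteq> 0"
  shows "p \<noteq> 0 \<Longrightarrow> \<forall>n. coeff p n \<in> A \<Longrightarrow> poly p w = 0 \<Longrightarrow>
    \<exists>q. (\<forall>n. coeff q n \<in> A) \<and> poly q w = 0 \<and> coeff q 0 \<noteq> 0"
proof (induction p)
  case (pCons a p)
  show ?case
  proof (cases "a = 0")
    case False
    then show ?thesis using pCons.prems by (intro exI[of _ "pCons a p"]) simp
  next
    case True
    have "coeff p n \<in> A" for n using pCons.prems(2)[rule_format, of "Suc n"] by simp
    then show ?thesis using True pCons.prems assms by (intro pCons.IH) auto
  qed
qed simp

text \<open>The complex numbers are algebraically closed, so \<open>q\<close> splits into linear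
  factors whose roots lie in the image.\<close>

lemma root_in_range_hemb:
  fixes w :: "'x hcomplex"
  shows "degree q = n \<Longrightarrow> q \<noteq> 0 \<Longrightarrow> poly (map_poly hemb q) w = 0 \<Longrightarrow> w \<in> range hemb"
proof (induction n arbitrary: q)
  case 0
  then obtain c where "q = [:c:]" by (metis degree_eq_zeroE)
  then show ?case using 0 rhom_nonzero[OF rhom_hemb[where 'a='x], of c] by (simp add: map_poly_rhom_pCons[OF rhom_hemb])
next
  case (Suc n)
  have "\<not> constant (poly q)" using Suc.prems(1) by (simp add: constant_degree)
  then obtain a where "poly q a = 0" using fundamental_theorem_of_algebra by auto
  then obtain r where r: "q = [:- a, 1:] * r" by (auto simp: poly_eq_0_iff_dvd elim: dvdE)
  note h = rhom_hemb[where 'a='x]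
  note mp = rhom_map_poly[OF h]
  have "map_poly hemb [:- a, 1:] = ([:- hemb a, 1:] :: 'x hcomplex poly)"
    by (simp add: map_poly_rhom_pCons[OF h] rhom_minus[OF h] rhom_1[OF h])
  then have "map_poly hemb q = [:- hemb a, 1:] * (map_poly hemb r :: 'x hcomplex poly)"
    using rhom_mult[OF mp, of "[:- a, 1:]" r] by (simp only: r)
  then have "poly (map_poly hemb q) w = (w - hemb a) * poly (map_poly hemb r) w" by (simp add: left_diff_distrib)
  then have "(w - hemb a) * poly (map_poly hemb r) w = 0" using Suc.prems(3) by (simp only:)
  then consider "w = hemb a" | "poly (map_poly hemb r) w = 0" by auto
  then show ?case
  proof cases
    case 2
    have "r \<noteq> 0" using r Suc.prems(2) by auto
    then have "degree r = n" using Suc.prems(1) unfolding r by (subst (asm) degree_mult_eq) auto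
    then show ?thesis using Suc.IH \<open>r \<noteq> 0\<close> 2 by simp
  qed simp
qed

text \<open>An element outside the image is transcendental over it, hence is moved by some
  derivation over the complex numbers.\<close>

lemma hcomplex_constants:
  fixes w :: "'x hcomplex"
  assumes "\<forall>D. derivation D \<longrightarrow> (\<forall>c. D (hemb c) = 0) \<longrightarrow> D w = 0"
  shows "w \<in> range hemb"
proof (rule ccontr)
  assume w: "w \<notin> range hemb"
  note h = rhom_hemb[where 'a='x]
  have sub: "subring_set (range hemb :: 'x hcomplex set)"
    unfolding subring_set_def
    by (auto simp: rhom_diff[OF h, symmetric] rhom_mult[OF h, symmetric] rhom_1[OF h, symmetric])
  have "p = 0" if p: "\<forall>n. coeff p n \<in> range hemb" "poly p w = 0" for p
  proof (rule ccontr)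
    assume "p \<noteq> 0"
    have "\<forall>n. \<exists>c. coeff p n = hemb c" using p(1) by auto
    then obtain c where c: "\<forall>n. coeff p n = hemb (c n)" by (rule choice[THEN exE])
    define q where "q = (\<Sum>n\<le>degree p. monom (c n) n)"
    have "map_poly hemb q = p"
    proof (rule poly_eqI)
      fix n
      have "coeff q n = (if n \<le> degree p then c n else 0)" by (simp add: q_def coeff_sum)
      moreover have "hemb (if n \<le> degree p then c n else 0) = coeff p n"
      proof (cases "n \<le> degree p")
        case True then show ?thesis using c by simp
      qed (simp add: rhom_0[OF h] coeff_eq_0)
      ultimately show "coeff (map_poly hemb q) n = coeff p n"
        by (simp only: coeff_map_poly_rhom[OF h])
    qed
    moreover from this have "q \<noteq> 0" using \<open>p \<noteq> 0\<close> by auto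
    ultimately show False using root_in_range_hemb[OF refl, of q w] p(2) w by simp
  qed
  then have "\<exists>D. derivation D \<and> (\<forall>a\<in>range hemb. D a = 0) \<and> D w = 1"
    by (intro derivation_of_transcendental[OF sub]) blast
  then obtain D where "derivation D" "\<forall>a\<in>range hemb. D a = 0" "D w = 1" by (elim exE conjE)
  then show False using assms by auto
qed

text \<open>Algebraic independence, over the complex numbers, of the coordinate functions in
  \<open>J\<close> restricted to \<open>C\<close>.\<close>

definition independent_on :: "('j \<Rightarrow> complex) set \<Rightarrow> 'j set \<Rightarrow> bool" where
  "independent_on C J \<longleftrightarrow> (\<forall>f\<in>polyfuns J. (\<forall>v\<in>C. f v = 0) \<longrightarrow> (\<forall>v. f v = 0))"

lemma polyfuns_insert:
  "f \<in> polyfuns (insert j J) \<Longrightarrow> \<exists>p. (\<forall>n. (\<lambda>v. coeff (p v) n) \<in> polyfuns J) \<and>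
    (\<exists>N. \<forall>v. degree (p v) \<le> N) \<and> (\<forall>v. f v = poly (p v) (v j))"
proof (induction rule: polyfuns.induct)
  case (polyfuns_const c)
  have "(\<lambda>v. coeff [:c:] n) \<in> polyfuns J" for n by (rule polyfuns.polyfuns_const)
  then show ?case by (intro exI[of _ "\<lambda>_. [:c:]"]) auto
next
  case (polyfuns_var i)
  show ?case
  proof (cases "i = j")
    case True
    have "(\<lambda>v. coeff [:0, 1:] n) \<in> polyfuns J" for n by (rule polyfuns.polyfuns_const)
    then show ?thesis using True by (intro exI[of _ "\<lambda>_. [:0, 1:]"]) auto
  next
    case False
    then have "i \<in> J" using polyfuns_var by simp
    then have "(\<lambda>v. coeff [:v i:] n) \<in> polyfuns J" for n
      by (cases n) (simp_all add: polyfuns.polyfuns_const polyfuns.polyfuns_var)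
    then show ?thesis by (intro exI[of _ "\<lambda>v. [:v i:]"]) auto
  qed
next
  case (polyfuns_add f g)
  from polyfuns_add.IH(1) obtain p M where p: "\<forall>n. (\<lambda>v. coeff (p v) n) \<in> polyfuns J"
    "\<forall>v. degree (p v) \<le> M" "\<forall>v. f v = poly (p v) (v j)" by (elim exE conjE)
  from polyfuns_add.IH(2) obtain q N where q: "\<forall>n. (\<lambda>v. coeff (q v) n) \<in> polyfuns J"
    "\<forall>v. degree (q v) \<le> N" "\<forall>v. g v = poly (q v) (v j)" by (elim exE conjE)
  show ?case
  proof (rule exI[of _ "\<lambda>v. p v + q v"], intro conjI)
    show "\<forall>n. (\<lambda>v. coeff (p v + q v) n) \<in> polyfuns J" using p(1) q(1) by (simp add: polyfuns.polyfuns_add)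
    show "\<exists>N. \<forall>v. degree (p v + q v) \<le> N" by (rule degree_bounded_add[OF p(2) q(2)])
    show "\<forall>v. f v + g v = poly (p v + q v) (v j)" using p(3) q(3) by simp
  qed
next
  case (polyfuns_mult f g)
  from polyfuns_mult.IH(1) obtain p M where p: "\<forall>n. (\<lambda>v. coeff (p v) n) \<in> polyfuns J"
    "\<forall>v. degree (p v) \<le> M" "\<forall>v. f v = poly (p v) (v j)" by (elim exE conjE)
  from polyfuns_mult.IH(2) obtain q N where q: "\<forall>n. (\<lambda>v. coeff (q v) n) \<in> polyfuns J"
    "\<forall>v. degree (q v) \<le> N" "\<forall>v. g v = poly (q v) (v j)" by (elim exE conjE)
  show ?case
  proof (rule exI[of _ "\<lambda>v. p v * q v"], intro conjI)
    show "\<forall>n. (\<lambda>v. coeff (p v * q v) n) \<in> polyfuns J"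
      using p(1) q(1) unfolding coeff_mult by (intro allI polyfuns_sum ballI polyfuns.polyfuns_mult) auto
    show "\<exists>N. \<forall>v. degree (p v * q v) \<le> N" by (rule degree_bounded_mult[OF p(2) q(2)])
    show "\<forall>v. f v * g v = poly (p v * q v) (v j)" using p(3) q(3) by simp
  qed
qed

locale irreducible_cone =
  fixes I :: "'j set" and C :: "('j \<Rightarrow> complex) set"
  assumes C_nonempty: "C \<noteq> {}"
    and C_scale: "v \<in> C \<Longrightarrow> c \<noteq> 0 \<Longrightarrow> (\<lambda>j. c * v j) \<in> C"
    and C_irreducible: "f \<in> polyfuns I \<Longrightarrow> g \<in> polyfuns I \<Longrightarrow> \<forall>v\<in>C. f v * g v = 0 \<Longrightarrow>
      (\<forall>v\<in>C. f v = 0) \<or> (\<forall>v\<in>C. g v = 0)"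
begin

text \<open>\<open>A\<close> lists the functions whose zeros are to be avoided, as far as they do
  not vanish on all of \<open>C\<close>. For infinite \<open>A\<close> an arbitrary point of
  \<open>C\<close> is taken.\<close>

definition pt :: "(('j \<Rightarrow> complex) \<Rightarrow> complex) set \<Rightarrow> 'j \<Rightarrow> complex" where
  "pt A = (SOME v. v \<in> C \<and> (finite A \<longrightarrow> (\<forall>f\<in>A \<inter> polyfuns I. (\<exists>u\<in>C. f u \<noteq> 0) \<longrightarrow> f v \<noteq> 0)))"

lemma common_nonzero:
  assumes "finite A" "A \<subseteq> polyfuns I" "\<forall>f\<in>A. \<exists>u\<in>C. f u \<noteq> 0"
  shows "\<exists>v\<in>C. \<forall>f\<in>A. f v \<noteq> 0"
proof -
  have "(\<lambda>v. \<Prod>f\<in>A. f v) \<in> polyfuns I \<and> (\<exists>v\<in>C. (\<Prod>f\<in>A. f v) \<noteq> 0)"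
    using assms
  proof (induction A rule: finite_induct)
    case empty
    then show ?case using C_nonempty by (auto intro: polyfuns_const)
  next
    case (insert f A)
    have IH: "(\<lambda>v. \<Prod>f\<in>A. f v) \<in> polyfuns I" "\<exists>v\<in>C. (\<Prod>f\<in>A. f v) \<noteq> 0"
      using insert.IH insert.prems by simp_all
    have f: "f \<in> polyfuns I" "\<exists>u\<in>C. f u \<noteq> 0" using insert.prems by simp_all
    have "\<exists>v\<in>C. f v * (\<Prod>f\<in>A. f v) \<noteq> 0"
      using C_irreducible[OF f(1) IH(1)] f(2) IH(2) by auto
    then show ?case using insert.hyps polyfuns_mult[OF f(1) IH(1)] by simp
  qed
  then show ?thesis using assms(1) by auto
qed

lemma pt: "pt A \<in> C" "finite A \<Longrightarrow> f \<in> A \<Longrightarrow> f \<in> polyfuns I \<Longrightarrow> \<exists>u\<in>C. f u \<noteq> 0 \<Longrightarrow> f (pt A) \<noteq> 0"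
proof -
  let ?P = "\<lambda>v. v \<in> C \<and> (finite A \<longrightarrow> (\<forall>f\<in>A \<inter> polyfuns I. (\<exists>u\<in>C. f u \<noteq> 0) \<longrightarrow> f v \<noteq> 0))"
  have "\<exists>v. ?P v"
  proof (cases "finite A")
    case True
    have "\<exists>v\<in>C. \<forall>f\<in>{f \<in> A. f \<in> polyfuns I \<and> (\<exists>u\<in>C. f u \<noteq> 0)}. f v \<noteq> 0"
      by (rule common_nonzero) (use True in auto)
    then show ?thesis by auto
  next
    case False
    then show ?thesis using C_nonempty by auto
  qed
  then have P: "?P (pt A)" unfolding pt_def by (rule someI_ex)
  then show "pt A \<in> C" by simp
  show "f (pt A) \<noteq> 0" if "finite A" "f \<in> A" "f \<in> polyfuns I" "\<exists>u\<in>C. f u \<noteq> 0"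
    using P that by simp
qed

definition val :: "(('j \<Rightarrow> complex) \<Rightarrow> complex) \<Rightarrow> (('j \<Rightarrow> complex) \<Rightarrow> complex) hcomplex" where
  "val f = hc (\<lambda>A. f (pt A))"

definition zc :: "'j \<Rightarrow> (('j \<Rightarrow> complex) \<Rightarrow> complex) hcomplex" where "zc j = hc (\<lambda>A. pt A j)"

lemma val_const: "val (\<lambda>_. c) = hemb c" and val_var: "val (\<lambda>v. v j) = zc j"
  and val_add: "val (\<lambda>v. f v + g v) = val f + val g" and val_diff: "val (\<lambda>v. f v - g v) = val f - val g"
  and val_mult: "val (\<lambda>v. f v * g v) = val f * val g"
  by (simp_all add: val_def hemb_def zc_def hc_add hc_mult hc_diff)

lemma val_0: "val (\<lambda>_. 0) = 0"
  by (simp add: val_def hc_0)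

lemma val_sum: "val (\<lambda>v. \<Sum>i\<in>A. f i v) = (\<Sum>i\<in>A. val (f i))"
  by (simp add: val_def hc_sum)

lemma val_power: "val (\<lambda>v. f v ^ n) = val f ^ n"
  by (induction n) (simp_all add: val_mult val_def[of "\<lambda>_. 1"] hc_1)

text \<open>Almost all index sets \<open>A\<close> are finite and contain \<open>f\<close>; if
  \<open>f\<close> is not zero on \<open>C\<close>, then \<open>pt A\<close> avoids its
  zeros.\<close>

lemma val_eq_0:
  assumes f: "f \<in> polyfuns I" shows "val f = 0 \<longleftrightarrow> (\<forall>v\<in>C. f v = 0)"
proof
  assume "\<forall>v\<in>C. f v = 0"
  then show "val f = 0" by (simp add: val_def pt(1) hc_0)
next
  assume "val f = 0"
  then have "{A. f (pt A) = 0} \<in> ultra" by (simp add: val_def hc_eq_iff hc_0[symmetric])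
  then have "{A. f (pt A) = 0} \<inter> {A. finite A \<and> f \<in> A} \<in> ultra" by (rule ultra_Int[OF _ ultra_base])
  then have "{A. f (pt A) = 0} \<inter> {A. finite A \<and> f \<in> A} \<noteq> {}" by (rule ultra_nonempty)
  then obtain A where "f (pt A) = 0" "finite A" "f \<in> A" by auto
  then show "\<forall>v\<in>C. f v = 0" using pt(2)[of A f] f by auto
qed

lemma subring_val: "subring_set (val ` polyfuns J)"
  unfolding subring_set_def
proof (intro conjI ballI)
  show "1 \<in> val ` polyfuns J"
    by (rule image_eqI[OF _ polyfuns_const[of 1]]) (simp add: val_def hc_1)
  fix a b assume "a \<in> val ` polyfuns J" "b \<in> val ` polyfuns J"
  then obtain f g where fg: "f \<in> polyfuns J" "a = val f" "g \<in> polyfuns J" "b = val g" by auto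
  show "a - b \<in> val ` polyfuns J"
    by (rule image_eqI[OF _ polyfuns_diff[OF fg(1,3)]]) (simp add: fg val_diff)
  show "a * b \<in> val ` polyfuns J"
    by (rule image_eqI[OF _ polyfuns_mult[OF fg(1,3)]]) (simp add: fg val_mult)
qed

lemma val_poly_function:
  assumes "\<forall>n. coeff p n = val (c n)"
  shows "val (\<lambda>v. \<Sum>n\<le>degree p. c n v * g v ^ n) = poly p (val g)"
  using assms by (simp add: val_sum val_mult val_power poly_altdef)

lemma val_coefficients:
  assumes "\<forall>n. coeff p n \<in> val ` polyfuns J"
  shows "\<exists>c. \<forall>n. c n \<in> polyfuns J \<and> coeff p n = val (c n)"
proof -
  have "\<forall>n. \<exists>c. c \<in> polyfuns J \<and> coeff p n = val c" using assms by (auto simp: image_iff)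
  then show ?thesis by (rule choice)
qed

lemma independent_onD: "independent_on C' J \<Longrightarrow> f \<in> polyfuns J \<Longrightarrow> \<forall>v\<in>C'. f v = 0 \<Longrightarrow> f v = 0"
  unfolding independent_on_def by blast

text \<open>A relation involving \<open>j\<close> is a polynomial in the coordinate \<open>j\<close>
  with coefficients over \<open>J\<close>; these do not all vanish at the generic point because
  \<open>J\<close> is independent.\<close>

lemma dependent_algebraic:
  assumes J: "J \<subseteq> I" "independent_on C J" and j: "j \<in> I" "\<not> independent_on C (insert j J)"
  shows "\<exists>p. p \<noteq> 0 \<and> (\<forall>n. coeff p n \<in> val ` polyfuns J) \<and> poly p (zc j) = 0"
proof -
  obtain f u where f: "f \<in> polyfuns (insert j J)" "\<forall>v\<in>C. f v = 0" "f u \<noteq> 0"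
    using j(2) unfolding independent_on_def by auto
  from polyfuns_insert[OF f(1)] obtain p N where p: "\<forall>n. (\<lambda>v. coeff (p v) n) \<in> polyfuns J"
    "\<forall>v. degree (p v) \<le> N" "\<forall>v. f v = poly (p v) (v j)" by (elim exE conjE)
  define P where "P = (\<Sum>n\<le>N. monom (val (\<lambda>v. coeff (p v) n)) n)"
  have c0: "val (\<lambda>v. coeff (p v) n) = 0" if "n > N" for n
  proof -
    have "coeff (p v) n = 0" for v using p(2)[rule_format, of v] that by (intro coeff_eq_0) simp
    then show ?thesis by (simp add: val_0)
  qed
  have cP: "coeff P n = val (\<lambda>v. coeff (p v) n)" for n
    using c0[of n] by (cases "n \<le> N") (simp_all add: P_def coeff_sum)
  have "poly P (zc j) = val f"
  proof -
    have "f v = (\<Sum>n\<le>N. coeff (p v) n * v j ^ n)" for v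
      using arg_cong[OF poly_as_sum_of_monoms'[OF p(2)[rule_format, of v]], of "\<lambda>q. poly q (v j)"] p(3)
      by (simp add: poly_sum poly_monom)
    then have "val f = val (\<lambda>v. \<Sum>n\<le>N. coeff (p v) n * v j ^ n)" by presburger
    then have "val f = (\<Sum>n\<le>N. val (\<lambda>v. coeff (p v) n) * zc j ^ n)"
      by (simp add: val_sum val_mult val_power val_var)
    then show ?thesis by (simp add: P_def poly_sum poly_monom)
  qed
  moreover have "val f = 0" using f(2) polyfuns_mono[OF f(1), of I] J(1) j(1) by (simp add: val_eq_0)
  moreover have "P \<noteq> 0"
  proof
    assume "P = 0"
    then have "val (\<lambda>v. coeff (p v) n) = 0" for n using cP[of n] by simp
    then have "\<forall>v\<in>C. coeff (p v) n = 0" for n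
      using val_eq_0[OF polyfuns_mono[OF p(1)[rule_format, of n] J(1)]] by simp
    then have "coeff (p u) n = 0" for n by (rule independent_onD[OF J(2) p(1)[rule_format]])
    then have "p u = 0" by (simp add: poly_eq_iff)
    then show False using f(3) p(3) by simp
  qed
  ultimately show ?thesis using cP p(1) by (intro exI[of _ P]) auto
qed

text \<open>
  If every further coordinate were algebraic over the coordinates in \<open>J\<close> at the generic point,
  then \<open>g\<close> would satisfy a relation with nonzero constant term, which restricts to \<open>C'\<close>.
\<close>

lemma independent_extend:
  assumes J: "J \<subseteq> I" "independent_on C' J" and C': "C' \<subseteq> C"
    and g: "g \<in> polyfuns I" "\<forall>v\<in>C'. g v = 0" "\<exists>v\<in>C. g v \<noteq> 0"
  shows "\<exists>j\<in>I - J. independent_on C (insert j J)"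
proof (rule ccontr)
  assume contr: "\<not> ?thesis"
  have JC: "independent_on C J" using J(2) C' unfolding independent_on_def by auto
  let ?A = "val ` polyfuns J"
  have "\<exists>p. p \<noteq> 0 \<and> (\<forall>n. coeff p n \<in> ?A) \<and> poly p (val g) = 0"
  proof (rule ccontr)
    assume "\<not> ?thesis"
    \<comment> \<open>Were \<open>g\<close> transcendental over \<open>J\<close>, some derivation
      would kill \<open>J\<close> and move \<open>g\<close>. But it kills everything algebraic over
      \<open>J\<close>, hence all coordinates.\<close>
    then have "\<forall>p. (\<forall>n. coeff p n \<in> ?A) \<longrightarrow> poly p (val g) = 0 \<longrightarrow> p = 0" by auto
    from derivation_of_transcendental[OF subring_val this] obtain D where
      D: "derivation D" "\<forall>a\<in>?A. D a = 0" "D (val g) = 1" by (elim exE conjE)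
    have z: "D (zc j) = 0" if j: "j \<in> I" for j
    proof (cases "j \<in> J")
      case True
      then have "zc j \<in> ?A" using val_var[of j] polyfuns_var[of j J] by (metis imageI)
      then show ?thesis by (rule bspec[OF D(2)])
    next
      case False
      then have "\<not> independent_on C (insert j J)" using contr j by auto
      from dependent_algebraic[OF J(1) JC j this] obtain p where
        "p \<noteq> 0" "\<forall>n. coeff p n \<in> ?A" "poly p (zc j) = 0" by (elim exE conjE)
      then show ?thesis by (rule derivation_kills_algebraic[OF D(1) subring_val D(2)])
    qed
    have "D (hemb c) = 0" for c
    proof -
      have "hemb c \<in> ?A" using val_const[of c] polyfuns_const[of c J] by (metis imageI)
      then show ?thesis by (rule bspec[OF D(2)])
    qed
    note emb = this
    have "D (val f) = 0" if "f \<in> polyfuns I" for f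
      using that
    proof induction
      case (polyfuns_var j)
      then show ?case using z by (simp add: val_var)
    qed (simp_all add: emb val_const val_add val_mult der_add[OF D(1)] der_mult[OF D(1)])
    then show False using g(1) D(3) by simp
  qed
  then obtain p where p: "p \<noteq> 0" "\<forall>n. coeff p n \<in> ?A" "poly p (val g) = 0" by (elim exE conjE)
  have "val g \<noteq> 0" using g(1,3) val_eq_0 by auto
  from poly_relation_nonzero_constant[OF this p] obtain q where
    q: "\<forall>n. coeff q n \<in> ?A" "poly q (val g) = 0" "coeff q 0 \<noteq> 0" by (elim exE conjE)
  from val_coefficients[OF q(1)] obtain c where c: "\<forall>n. c n \<in> polyfuns J \<and> coeff q n = val (c n)" by (elim exE)
  let ?h = "\<lambda>v. \<Sum>n\<le>degree q. c n v * g v ^ n"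
  have "val ?h = 0" using val_poly_function[of q c g] c q(2) by simp
  moreover have "?h \<in> polyfuns I"
    using c polyfuns_mono[OF _ J(1)] g(1) by (intro polyfuns_sum ballI polyfuns_mult polyfuns_power) auto
  ultimately have h: "?h v = 0" if "v \<in> C" for v using val_eq_0 that by blast
  have "\<forall>v\<in>C'. c 0 v = 0"
  proof
    fix v assume v: "v \<in> C'"
    have "?h v = (\<Sum>n\<le>degree q. if n = 0 then c 0 v else 0)"
      using g(2) v by (intro sum.cong) auto
    then show "c 0 v = 0" using h[of v] C' v by auto
  qed
  then have "c 0 v = 0" for v using c by (intro independent_onD[OF J(2)]) auto
  then have "val (c 0) = 0" by (simp add: val_def hc_0)
  then show False using c q(3) by simp
qed

text \<open>The cone is stable under scaling, so the coordinate \<open>j\<close> takes all nonzero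
  values on it.\<close>

lemma independent_start: "\<exists>v\<in>C. v j \<noteq> 0 \<Longrightarrow> independent_on C {j}"
  unfolding independent_on_def
proof (intro ballI impI allI)
  fix f u assume ex: "\<exists>v\<in>C. v j \<noteq> 0" and f: "f \<in> polyfuns {j}" "\<forall>v\<in>C. f v = 0"
  obtain v where v: "v \<in> C" "v j \<noteq> 0" using ex by auto
  from polyfuns_ray[OF f(1), of v] obtain p where p: "\<forall>c. f (\<lambda>i. c * v i) = poly p c" by (elim exE)
  have "\<forall>c. c \<noteq> 0 \<longrightarrow> poly p c = 0"
    using p f(2) C_scale[OF v(1)] by metis
  then have "p = 0" by (rule poly_zero_outside_0)
  have "f u = f (\<lambda>i. (u j / v j) * v i)" by (rule polyfuns_cong[OF f(1)]) (simp add: v(2))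
  also have "\<dots> = 0" using p[rule_format, of "u j / v j"] \<open>p = 0\<close> by simp
  finally show "f u = 0" .
qed

text \<open>Independence of \<open>J\<close> makes the coordinate \<open>b\<close> transcendental
  over the others, so a derivation can take the value 1 there and 0 on the rest.\<close>

lemma dual_derivation:
  assumes J: "J \<subseteq> I" "independent_on C J" and b: "b \<in> J"
  shows "\<exists>D. derivation D \<and> (\<forall>c. D (hemb c) = 0) \<and> (\<forall>j\<in>J. D (zc j) = (if b = j then 1 else 0))"
proof -
  let ?A = "val ` polyfuns (J - {b})"
  have "p = 0" if p: "\<forall>n. coeff p n \<in> ?A" "poly p (zc b) = 0" for p
  proof -
    from val_coefficients[OF p(1)] obtain c where c: "\<forall>n. c n \<in> polyfuns (J - {b}) \<and> coeff p n = val (c n)"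
      by (elim exE)
    let ?h = "\<lambda>v. \<Sum>n\<le>degree p. c n v * v b ^ n"
    have "val ?h = 0" using val_poly_function[of p c "\<lambda>v. v b"] c p(2) by (simp add: val_var)
    moreover have h: "?h \<in> polyfuns J"
      using c polyfuns_mono[of _ "J - {b}" J] b
      by (intro polyfuns_sum ballI polyfuns_mult polyfuns_power polyfuns_var) auto
    ultimately have "\<forall>v\<in>C. ?h v = 0" using val_eq_0[OF polyfuns_mono[OF h J(1)]] by simp
    then have h0: "?h v = 0" for v by (rule independent_onD[OF J(2) h])
    have "c n v = 0" if "n \<le> degree p" for n v
    proof -
      define P where "P = (\<Sum>n\<le>degree p. monom (c n v) n)"
      have "poly P a = 0" for a
      proof -
        have "c n (v(b := a)) = c n v" for n by (rule polyfuns_cong[of _ "J - {b}"]) (use c in auto)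
        then show ?thesis using h0[of "v(b := a)"] by (simp add: P_def poly_sum poly_monom)
      qed
      then have "P = 0" by (intro poly_zero_outside_0) simp
      moreover have "coeff P n = c n v" using that by (simp add: P_def coeff_sum)
      ultimately show ?thesis by simp
    qed
    then have "coeff p n = 0" if "n \<le> degree p" for n using c that by (simp add: val_def hc_0)
    then show "p = 0" by (metis le_refl leading_coeff_0_iff)
  qed
  then have "\<forall>p. (\<forall>n. coeff p n \<in> ?A) \<longrightarrow> poly p (zc b) = 0 \<longrightarrow> p = 0" by simp
  from derivation_of_transcendental[OF subring_val this] obtain D where
    D: "derivation D" "\<forall>a\<in>?A. D a = 0" "D (zc b) = 1" by (elim exE conjE)
  have "D (hemb c) = 0" for c
  proof -
    have "hemb c \<in> ?A" using val_const[of c] polyfuns_const[of c "J - {b}"] by (metis imageI)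
    then show ?thesis by (rule bspec[OF D(2)])
  qed
  moreover have "D (zc j) = 0" if "j \<in> J" "j \<noteq> b" for j
  proof -
    have "zc j \<in> ?A" using val_var[of j] polyfuns_var[of j "J - {b}"] that by (metis DiffI imageI singletonD)
    then show ?thesis by (rule bspec[OF D(2)])
  qed
  ultimately show ?thesis using D(1,3) by (intro exI[of _ D]) auto
qed

text \<open>Differentiation of \<open>f (\<lambda>j. c * v j)\<close> in \<open>c\<close> at 1. It
  is well defined on values at the generic point, since a function vanishing on \<open>C\<close>
  vanishes along the rays of \<open>C\<close>; \<open>der_graph_extend\<close> carries it to the
  whole field.\<close>

lemma euler_derivation:
  "\<exists>E. derivation E \<and> (\<forall>c. E (hemb c) = 0) \<and> (\<forall>j\<in>I. E (zc j) = zc j)"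
proof -
  let ?d = "\<lambda>f f'. f \<in> polyfuns I \<and> f' \<in> polyfuns I \<and>
    (\<forall>v. ((\<lambda>c. f (\<lambda>j. c * v j)) has_field_derivative f' v) (at 1))"
  let ?G = "{(val f, val f') | f f'. ?d f f'}"
  have uniq: "val f' = val g'" if fg: "?d f f'" "?d g g'" and eq: "val f = val g" for f f' g g'
  proof -
    have h: "(\<lambda>v. f v - g v) \<in> polyfuns I" "(\<lambda>v. f' v - g' v) \<in> polyfuns I" using fg polyfuns_diff by auto
    have "val (\<lambda>v. f v - g v) = 0" using eq by (simp add: val_diff)
    then have C0: "\<forall>v\<in>C. f v - g v = 0" using val_eq_0[OF h(1)] by simp
    have "f' v - g' v = 0" if v: "v \<in> C" for v
    proof -
      from polyfuns_ray[OF h(1), of v] obtain p where p: "\<forall>c. f (\<lambda>j. c * v j) - g (\<lambda>j. c * v j) = poly p c"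
        by (elim exE)
      have "\<forall>c. c \<noteq> 0 \<longrightarrow> poly p c = 0" using p C0 C_scale[OF v] by metis
      then have "p = 0" by (rule poly_zero_outside_0)
      have "((\<lambda>c. f (\<lambda>j. c * v j) - g (\<lambda>j. c * v j)) has_field_derivative f' v - g' v) (at 1)"
        using fg by (intro DERIV_diff) auto
      then have "((\<lambda>c. 0) has_field_derivative f' v - g' v) (at (1::complex))" using p \<open>p = 0\<close> by simp
      then show ?thesis by (rule DERIV_unique[OF _ DERIV_const])
    qed
    then have "val (\<lambda>v. f' v - g' v) = 0" using val_eq_0[OF h(2)] by simp
    then show ?thesis by (simp add: val_diff)
  qed
  have "der_graph ?G" unfolding der_graph_def
  proof (intro conjI allI impI)
    have "?d (\<lambda>_. 1) (\<lambda>_. 0)" by (simp add: polyfuns_const)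
    then show "(1, 0) \<in> ?G" using val_0 by (intro CollectI exI[of _ "\<lambda>_. 1"] exI[of _ "\<lambda>_. 0"]) (simp add: val_def hc_1)
    fix a x y assume "(a, x) \<in> ?G \<and> (a, y) \<in> ?G"
    then show "x = y" using uniq by auto
  next
    have G: "(val f, val f') \<in> ?G" if "?d f f'" for f f' using that by blast
    fix a b x y assume "(a, x) \<in> ?G \<and> (b, y) \<in> ?G"
    then obtain f f' g g' where fg: "?d f f'" "?d g g'" "a = val f" "x = val f'" "b = val g" "y = val g'" by auto
    have "?d (\<lambda>v. f v - g v) (\<lambda>v. f' v - g' v)"
      using fg(1,2) by (auto intro!: polyfuns_diff DERIV_diff)
    from G[OF this] show "(a - b, x - y) \<in> ?G" by (simp only: fg(3-6) val_diff)
    have "((\<lambda>c. f (\<lambda>j. c * v j) * g (\<lambda>j. c * v j)) has_field_derivative f v * g' v + f' v * g v) (at 1)" for v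
      using DERIV_mult[of "\<lambda>c. f (\<lambda>j. c * v j)" "f' v" 1 UNIV "\<lambda>c. g (\<lambda>j. c * v j)" "g' v"] fg(1,2)
      by (simp add: algebra_simps)
    then have "?d (\<lambda>v. f v * g v) (\<lambda>v. f v * g' v + f' v * g v)"
      using fg(1,2) by (auto intro!: polyfuns_add polyfuns_mult)
    from G[OF this] show "(a * b, a * y + x * b) \<in> ?G" by (simp only: fg(3-6) val_add val_mult)
  qed
  from der_graph_extend[OF this] obtain E where E: "derivation E" "\<forall>(a, x)\<in>?G. E a = x" by (elim exE conjE)
  have Ed: "E (val f) = val f'" if "?d f f'" for f f'
  proof -
    have "(val f, val f') \<in> ?G" using that by blast
    then show ?thesis using E(2) by auto
  qed
  have "E (hemb c) = 0" for c
    using Ed[of "\<lambda>_. c" "\<lambda>_. 0"] by (simp add: val_const polyfuns_const hemb_def hc_0)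
  moreover have "E (zc j) = zc j" if "j \<in> I" for j
  proof -
    have "((\<lambda>c. c * v j) has_field_derivative v j) (at 1)" for v :: "'j \<Rightarrow> complex"
      by (auto intro!: derivative_eq_intros)
    then show ?thesis using Ed[of "\<lambda>v. v j" "\<lambda>v. v j"] that by (simp add: val_var polyfuns_var)
  qed
  ultimately show ?thesis using E(1) by (intro exI[of _ E]) auto
qed

end

section \<open>Lines on hypersurfaces\<close>

lemma common_denominator:
  fixes c :: "'m \<Rightarrow> 'a::idom fract"
  assumes "finite A"
  shows "\<exists>q g. q \<noteq> 0 \<and> (\<forall>m\<in>A. c m = to_fract (g m) / to_fract q)"
  using assms
proof (induction A rule: finite_induct)
  case empty
  show ?case by (rule exI[of _ 1]) simp
next
  case (insert a A)
  from insert.IH obtain q g where q: "q \<noteq> 0" "\<forall>m\<in>A. c m = to_fract (g m) / to_fract q" by (elim exE conjE)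
  obtain p r where r: "c a = to_fract p / to_fract r" "r \<noteq> 0" by (rule fract_cases_to_fract)
  let ?g = "\<lambda>m. if m = a then p * q else g m * r"
  have "\<forall>m\<in>insert a A. c m = to_fract (?g m) / to_fract (q * r)"
    using q r insert.hyps by auto
  then show ?case using q(1) r(2) by (intro exI[of _ "q * r"] exI[of _ ?g]) simp
qed

section \<open>Transfer of equations to the ultrapower\<close>

lemma rep_poly_mon_val:
  assumes "\<forall>i. rep_poly (X i) (\<lambda>A. Xf A i)"
  shows "rep_poly (mon_val m X) (\<lambda>A. mon_val m (Xf A))"
  unfolding mon_val_def by (intro rep_poly_prod rep_poly_power) (use assms in auto)

lemma to_fract_mon_val: "to_fract (mon_val m X) = mon_val m (\<lambda>i. to_fract (X i))"
  by (rule mon_val_hom[OF rhom_to_fract])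

text \<open>After clearing denominators the value of \<open>F\<close> becomes a single polynomial
  over the ultrapower, represented by the corresponding values at the members of the family.\<close>

lemma form_value_zero_iff:
  fixes X :: "'i \<Rightarrow> 'x hcomplex poly" and F :: "('i, ratfun) mpoly"
  assumes X: "\<forall>i. rep_poly (X i) (\<lambda>A. Xf A i)"
  shows "ev_hom (fract_hom (\<lambda>p. to_fract (map_poly hemb p))) F (\<lambda>i. to_fract (X i)) = 0 \<longleftrightarrow>
    {A. mpoly_eval F (\<lambda>i. to_fract (Xf A i)) = 0} \<in> ultra"
proof -
  let ?t = "\<lambda>p. to_fract (map_poly hemb p) :: 'x hcomplex poly fract"
  note h = rhom_to_fract_map_poly[OF rhom_hemb[where 'a='x]] and inj = inj_to_fract_map_poly[OF rhom_hemb[where 'a='x]]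
  from common_denominator[OF finite_keys[of F], of "Poly_Mapping.lookup F"] obtain q g where
    q: "q \<noteq> 0" and g: "\<forall>m\<in>Poly_Mapping.keys F. Poly_Mapping.lookup F m = to_fract (g m) / to_fract q"
    by (elim exE conjE)
  have tq: "?t q \<noteq> 0" using rhom_inj_nonzero[OF h inj q] .
  define G where "G = (\<Sum>m\<in>Poly_Mapping.keys F. map_poly hemb (g m) * mon_val m X)"
  define Gf where "Gf A = (\<Sum>m\<in>Poly_Mapping.keys F. g m * mon_val m (Xf A))" for A
  have rep: "rep_poly G Gf"
    unfolding G_def Gf_def[abs_def]
    by (intro rep_poly_sum rep_poly_mult rep_poly_emb rep_poly_mon_val[OF X])
  have "fract_hom ?t (Poly_Mapping.lookup F m) = ?t (g m) / ?t q" if "m \<in> Poly_Mapping.keys F" for m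
    using g that fract_hom_Fract[OF h inj q, of "g m"] by (simp flip: Fract_conv_to_fract)
  then have "ev_hom (fract_hom ?t) F (\<lambda>i. to_fract (X i)) = to_fract G / ?t q"
    unfolding ev_hom_def G_def rhom_sum[OF rhom_to_fract] sum_divide_distrib
    by (intro sum.cong refl) (simp add: to_fract_mon_val)
  then have 1: "ev_hom (fract_hom ?t) F (\<lambda>i. to_fract (X i)) = 0 \<longleftrightarrow> G = 0" using tq by simp
  have "mpoly_eval F (\<lambda>i. to_fract (Xf A i)) = to_fract (Gf A) / to_fract q" for A
    unfolding mpoly_eval_ev_hom ev_hom_def Gf_def rhom_sum[OF rhom_to_fract] sum_divide_distrib
    by (intro sum.cong refl) (simp add: to_fract_mon_val g)
  then have "mpoly_eval F (\<lambda>i. to_fract (Xf A i)) = 0 \<longleftrightarrow> Gf A = 0" for A using q by simp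
  then show ?thesis using 1 rep_poly_eq_0[OF rep] by simp
qed

lemma degree_mon_val_linear:
  assumes "\<forall>i. degree (X i) \<le> 1"
  shows "degree (mon_val m X) \<le> (\<Sum>i\<in>Poly_Mapping.keys m. Poly_Mapping.lookup m i)"
proof -
  have "degree (X i ^ Poly_Mapping.lookup m i) \<le> Poly_Mapping.lookup m i" for i
    using order.trans[OF degree_power_le mult_right_mono[OF assms[rule_format]]] by simp
  then show ?thesis unfolding mon_val_def
    by (intro order.trans[OF degree_prod_sum_le] sum_mono) auto
qed

text \<open>On the line the form is a polynomial of degree at most \<open>d\<close> with
  \<open>d + 1\<close> roots; the point \<open>v\<close> at infinity is reached by homogeneity. A
  finite set of conditions is what passes from the ultrapower to a single member.\<close>

lemma form_on_line:
  fixes F :: "('i, 'a::field_char_0) mpoly"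
  assumes F: "is_form I d F" and z: "\<forall>n\<le>d. mpoly_eval F (\<lambda>i. u i + of_nat n * v i) = 0"
  shows "mpoly_eval F (\<lambda>i. r * u i + s * v i) = 0"
proof -
  have poly: "poly (ev_hom (\<lambda>c. [:c:]) F X) t = mpoly_eval F (\<lambda>i. poly (X i) t)" for X t
  proof -
    have "rhom (\<lambda>p. poly p t)" by (simp add: rhom_def)
    from ev_hom_hom[OF this, of "\<lambda>c. [:c:]" F X] show ?thesis by (simp add: mpoly_eval_ev_hom)
  qed
  define P where "P = ev_hom (\<lambda>c. [:c:]) F (\<lambda>i. [:u i, v i:])"
  have Pt: "poly P t = mpoly_eval F (\<lambda>i. u i + t * v i)" for t
    unfolding P_def poly by simp
  have "degree P \<le> d"
    unfolding P_def ev_hom_def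
  proof (intro degree_sum_le)
    fix m assume m: "m \<in> Poly_Mapping.keys F"
    have "degree (mon_val m (\<lambda>i. [:u i, v i:])) \<le> d"
      using degree_mon_val_linear[of "\<lambda>i. [:u i, v i:]" m] F m by (simp add: is_form_def)
    then show "degree ([:Poly_Mapping.lookup F m:] * mon_val m (\<lambda>i. [:u i, v i:])) \<le> d"
      by (intro order.trans[OF degree_mult_le]) simp
  qed simp
  have "P = 0"
  proof (rule ccontr)
    assume "P \<noteq> 0"
    have "of_nat ` {..d} \<subseteq> {t. poly P t = 0}" using z by (auto simp: Pt)
    then have "card (of_nat ` {..d} :: 'a set) \<le> card {t. poly P t = 0}"
      by (intro card_mono poly_roots_finite[OF \<open>P \<noteq> 0\<close>])
    also have "\<dots> \<le> degree P" by (rule card_poly_roots_bound[OF \<open>P \<noteq> 0\<close>])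
    finally show False using \<open>degree P \<le> d\<close> by (simp add: card_image inj_on_def)
  qed
  define Q where "Q = ev_hom (\<lambda>c. [:c:]) F (\<lambda>i. [:s * v i, u i:])"
  have Qt: "poly Q t = mpoly_eval F (\<lambda>i. s * v i + t * u i)" for t
    unfolding Q_def poly by simp
  have "poly Q t = 0" if "t \<noteq> 0" for t
  proof -
    have "(\<lambda>i. s * v i + t * u i) = (\<lambda>i. t * (u i + s / t * v i))" using that by (auto simp: field_simps)
    then have "poly Q t = t ^ d * poly P (s / t)"
      unfolding Qt Pt by (simp only: mpoly_eval_scale[OF F])
    then show ?thesis using \<open>P = 0\<close> by simp
  qed
  then have "Q = 0" by (intro poly_zero_outside_0) auto
  then show ?thesis using Qt[of r] by (simp add: add.commute)
qed

lemma line_in_hypersurface: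
  fixes F :: "('i, 'a::field_char_0) mpoly"
  assumes F: "is_form UNIV d F" and z: "\<forall>n\<le>d. mpoly_eval F (\<lambda>i. u i + of_nat n * v i) = 0"
    and uv: "u p * v q \<noteq> u q * v p"
  shows "\<exists>l. is_proj_line l \<and> l \<subseteq> proj_zeros UNIV F \<and> proj_point u \<in> l"
proof -
  let ?l = "{proj_point (\<lambda>i. r * u i + s * v i) | r s. r \<noteq> 0 \<or> s \<noteq> 0}"
  have indep: "r = 0 \<and> s = 0" if "\<forall>i. r * u i + s * v i = 0" for r s
  proof -
    have e: "r * u p + s * v p = 0" "r * u q + s * v q = 0" using that by auto
    have "r * (u p * v q - u q * v p) = 0" "s * (u p * v q - u q * v p) = 0" using e by algebra+
    then show ?thesis using uv by simp
  qed
  have "is_proj_line ?l" unfolding is_proj_line_def using indep by (intro exI[of _ u] exI[of _ v]) blast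
  moreover have "?l \<subseteq> proj_zeros UNIV F"
  proof
    fix x assume "x \<in> ?l"
    then obtain r s where rs: "x = proj_point (\<lambda>i. r * u i + s * v i)" "r \<noteq> 0 \<or> s \<noteq> 0" by auto
    have "(\<lambda>i. r * u i + s * v i) \<noteq> (\<lambda>_. 0)" using indep[of r s] rs(2) by (auto simp: fun_eq_iff)
    then have "x \<in> proj_space UNIV" unfolding rs(1) proj_space_def by auto
    moreover have "mpoly_eval F w = 0" if "w \<in> x" for w
    proof -
      obtain c where "w = (\<lambda>i. c * (r * u i + s * v i))" using \<open>w \<in> x\<close> rs(1) by (auto simp: proj_point_def)
      then show ?thesis by (simp only: mpoly_eval_scale[OF F] form_on_line[OF F z] mult_zero_right)
    qed
    ultimately show "x \<in> proj_zeros UNIV F" by (simp add: proj_zeros_def)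
  qed
  moreover have "proj_point u \<in> ?l"
  proof (intro CollectI exI conjI)
    show "proj_point u = proj_point (\<lambda>i. 1 * u i + 0 * v i)" by simp
  qed simp
  ultimately show ?thesis by blast
qed

section \<open>Points recovered from their coefficient vectors\<close>

definition coeff_poly :: "nat \<Rightarrow> ('i \<times> nat \<Rightarrow> 'a::comm_monoid_add) \<Rightarrow> 'i \<Rightarrow> 'a poly" where
  "coeff_poly b v i = (\<Sum>j<b. monom (v (i, j)) j)"

lemma coeff_coeff_poly: "coeff (coeff_poly b v i) l = (if l < b then v (i, l) else 0)"
  by (simp add: coeff_poly_def coeff_sum)

lemma degree_coeff_poly: "degree (coeff_poly b v i) \<le> b - 1"
  by (rule degree_le) (auto simp: coeff_coeff_poly)

lemma coeff_point_vector:
  fixes U :: "('i::finite \<Rightarrow> ratfun) set set"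
  assumes "p \<in> coeff_point ` bounded_height U b" "p \<in> proj_space (UNIV \<times> {..<b})" "v \<in> p"
  shows "(\<forall>q. (\<forall>i. q dvd coeff_poly b v i) \<longrightarrow> q dvd 1) \<and> (\<exists>x\<in>U. (\<lambda>i. to_fract (coeff_poly b v i)) \<in> x)"
proof -
  obtain x where x: "x \<in> U" "p = coeff_point x" using assms(1) by (auto simp: bounded_height_def)
  obtain y where y: "coprime_rep x y" "v = (\<lambda>(i, j). coeff (y i) j)"
    using assms(3) unfolding x(2) coeff_point_def by auto
  have "coeff_poly b v i = y i" for i
  proof (rule poly_eqI)
    fix l show "coeff (coeff_poly b v i) l = coeff (y i) l"
      using proj_space_vector(2)[OF assms(2,3), of "(i, l)"] by (simp add: coeff_coeff_poly y(2))
  qed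
  then show ?thesis using y(1) x(1) unfolding coprime_rep_def by auto
qed

section \<open>The dimension bound\<close>

text \<open>If \<open>J\<close> were larger, the generic point of the cone would satisfy the
  hypotheses of \<open>line_through_generic_point\<close>. The line found there specialises, for
  almost all \<open>A\<close>, to a line through the point with coefficients \<open>pt A\<close>,
  which belongs to \<open>U\<close>.\<close>

theorem independent_coordinates_bound:
  fixes F :: "(4, ratfun) mpoly" and C :: "(4 \<times> nat \<Rightarrow> complex) set"
  assumes cone: "irreducible_cone (UNIV \<times> {..<b}) C"
    and F: "irreducible F" "is_form UNIV d F" and d: "d > 0"
    and U: "\<forall>x\<in>U. x \<in> proj_zeros UNIV F \<and> (\<forall>l. is_proj_line l \<and> l \<subseteq> proj_zeros UNIV F \<longrightarrow> x \<notin> l)"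
    and C: "\<forall>v\<in>C. (\<forall>q. (\<forall>i. q dvd coeff_poly b v i) \<longrightarrow> q dvd 1) \<and>
      (\<exists>x\<in>U. (\<lambda>i. to_fract (coeff_poly b v i)) \<in> x)"
    and J: "J \<subseteq> UNIV \<times> {..<b}" "independent_on C J"
    and r: "3 * real (b - 1) < 2 * real r * sqrt (real d)" and rs: "3 * (b - 1) < 2 * r + 3 * s"
  shows "card J \<le> 2 * r + s + 1"
proof (rule ccontr)
  assume J_large: "\<not> ?thesis"
  interpret irreducible_cone "UNIV \<times> {..<b}" C by (rule cone)
  define x where "x i = coeff_poly b zc i" for i
  define xf where "xf A i = coeff_poly b (pt A) i" for A i
  have rep: "rep_poly (x i) (\<lambda>A. xf A i)" for i
    unfolding rep_poly_def
  proof (intro conjI allI)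
    show "\<exists>n. \<forall>A. degree (xf A i) \<le> n" unfolding xf_def by (intro exI[of _ "b - 1"] allI degree_coeff_poly)
    show "coeff (x i) l = hc (\<lambda>A. coeff (xf A i) l)" for l
      by (simp add: x_def xf_def coeff_coeff_poly zc_def hc_0)
  qed
  have point: "proj_point (\<lambda>i. to_fract (xf A i)) \<in> U" for A
  proof -
    have "\<exists>x\<in>U. (\<lambda>i. to_fract (xf A i)) \<in> x" unfolding xf_def by (rule conjunct2[OF bspec[OF C pt(1)]])
    then obtain x where x: "x \<in> U" "(\<lambda>i. to_fract (xf A i)) \<in> x" by (rule bexE)
    have "x \<in> proj_zeros UNIV F" by (rule conjunct1[OF bspec[OF U x(1)]])
    then have "x \<in> proj_space UNIV" by (simp add: proj_zeros_def)
    from proj_space_point[OF this x(2)] x(1) show ?thesis by simp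
  qed
  have self: "v \<in> proj_point v" for v :: "4 \<Rightarrow> ratfun"
    unfolding proj_point_def by (intro CollectI exI[of _ 1]) simp
  have F_xf: "mpoly_eval F (\<lambda>i. to_fract (xf A i)) = 0" for A
    using conjunct1[OF bspec[OF U point[of A]]] self by (simp add: proj_zeros_def)
  have ultra_ex: "\<exists>A. P A" if "{A. P A} \<in> ultra" for P :: "((4 \<times> nat \<Rightarrow> complex) \<Rightarrow> complex) set \<Rightarrow> bool"
    using ultra_nonempty[OF that] by auto
  \<comment> \<open>Coprimality passes to the generic point: a common factor is a unit at almost all
    members, hence has no coefficients of positive degree.\<close>
  have coprime: "q dvd 1" if q: "\<And>i. q dvd x i" for q
  proof -
    have "\<forall>i. \<exists>k. x i = q * k" using q by (auto simp: dvd_def)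
    then obtain k where k: "\<forall>i. x i = q * k i" by (rule choice[THEN exE])
    obtain qf where qf: "rep_poly q qf" using rep_poly_exists ..
    have "\<forall>i. \<exists>kf. rep_poly (k i) kf" using rep_poly_exists by blast
    then obtain kf where kf: "\<forall>i. rep_poly (k i) (kf i)" by (rule choice[THEN exE])
    have "{A. xf A i = qf A * kf i A} \<in> ultra" for i
      by (rule rep_poly_eq[OF rep]) (use k rep_poly_mult[OF qf kf[rule_format, of i]] in simp)
    then have "{A. \<forall>i\<in>UNIV. xf A i = qf A * kf i A} \<in> ultra" by (intro ultra_finite_INT) auto
    then have unit: "{A. qf A dvd 1} \<in> ultra"
    proof (rule ultra_superset, intro Collect_mono impI)
      fix A assume "\<forall>i\<in>UNIV. xf A i = qf A * kf i A"
      then have "\<forall>i. qf A dvd coeff_poly b (pt A) i" unfolding xf_def by simp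
      then show "qf A dvd 1" by (rule conjunct1[OF bspec[OF C pt(1)], THEN spec, THEN mp])
    qed
    have "q \<noteq> 0"
    proof
      assume "q = 0"
      then have "{A. qf A = 0} \<in> ultra" using rep_poly_eq_0[OF qf] by simp
      then have "{A. qf A = 0} \<inter> {A. qf A dvd 1} \<in> ultra" using unit by (rule ultra_Int)
      moreover have "{A. qf A = 0} \<inter> {A. qf A dvd 1} = {}" by auto
      ultimately show False using ultra_nonempty by metis
    qed
    moreover have "coeff q l = 0" if "l > 0" for l
    proof -
      have "coeff (qf A) l = 0" if "qf A dvd 1" for A
      proof -
        have "qf A \<noteq> 0" using that by auto
        then have "degree (qf A) = 0" using that by (simp add: is_unit_iff_degree)
        then show ?thesis using \<open>l > 0\<close> by (simp add: coeff_eq_0)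
      qed
      then have "{A. coeff (qf A) l = 0} \<in> ultra" by (intro ultra_superset[OF unit]) auto
      then have "hc (\<lambda>A. coeff (qf A) l) = hc (\<lambda>_. 0)" by (simp add: hc_eq_iff)
      then show ?thesis using qf by (simp add: rep_poly_def hc_0)
    qed
    then have "degree q = 0" by (metis gr0I leading_coeff_0_iff degree_0)
    ultimately show ?thesis by (simp add: is_unit_iff_degree)
  qed
  have "\<forall>j\<in>J. \<exists>D. derivation D \<and> (\<forall>c. D (hemb c) = 0) \<and> (\<forall>i\<in>J. D (zc i) = (if j = i then 1 else 0))"
    by (intro ballI dual_derivation[OF J])
  then obtain Db where Db: "\<forall>j\<in>J. derivation (Db j) \<and> (\<forall>c. Db j (hemb c) = 0) \<and>
      (\<forall>i\<in>J. Db j (zc i) = (if j = i then 1 else 0))" by (rule bchoice[THEN exE])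
  from euler_derivation obtain E where E: "derivation E" "\<forall>c. E (hemb c) = 0"
    "\<forall>j\<in>UNIV \<times> {..<b}. E (zc j) = zc j" by (elim exE conjE)
  have F_x: "ev_hom (fract_hom (\<lambda>p. to_fract (map_poly hemb p))) F (\<lambda>i. to_fract (x i)) = 0"
    using form_value_zero_iff[of x xf F] rep by (simp add: F_xf ultra_UNIV)
  interpret G: generic_point hemb x "b - 1" J Db F d E
  proof
    show "rhom hemb" by (rule rhom_hemb)
    show "degree (x i) \<le> b - 1" for i unfolding x_def by (rule degree_coeff_poly)
    show "q dvd 1" if "\<And>i. q dvd x i" for q using that by (rule coprime)
    show "finite J" using J(1) by (rule finite_subset) simp
    show "derivation (Db j)" if "j \<in> J" for j using Db that by simp
    show "Db j (hemb c) = 0" if "j \<in> J" for j c using Db that by simp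
    show "Db j (coeff (x (fst i)) (snd i)) = (if j = i then 1 else 0)" if "j \<in> J" "i \<in> J" for j i
    proof -
      have "snd i < b" using J(1) that(2) by auto
      then show ?thesis using Db that by (simp add: x_def coeff_coeff_poly)
    qed
    show "is_form UNIV d F" by fact
    show "ev_hom (fract_hom (\<lambda>p. to_fract (map_poly hemb p))) F (\<lambda>i. to_fract (x i)) = 0" by (rule F_x)
    show "irreducible F" by fact
    show "derivation E" by fact
    show "E (hemb c) = 0" for c using E(2) by simp
    show "E (coeff (x i) j) = coeff (x i) j" for i j
    proof (cases "j < b")
      case True
      then have "E (zc (i, j)) = zc (i, j)" by (intro bspec[OF E(3)]) simp
      then show ?thesis using True by (simp add: x_def coeff_coeff_poly)
    qed (simp add: x_def coeff_coeff_poly der_0[OF E(1)])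
    show "w \<in> range hemb" if w: "\<And>D. derivation D \<Longrightarrow> (\<And>c. D (hemb c) = 0) \<Longrightarrow> D w = 0"
      for w :: "((4 \<times> nat \<Rightarrow> complex) \<Rightarrow> complex) hcomplex"
    proof (intro hcomplex_constants allI impI)
      fix D :: "((4 \<times> nat \<Rightarrow> complex) \<Rightarrow> complex) hcomplex \<Rightarrow> _"
      assume D: "derivation D" "\<forall>c. D (hemb c) = 0"
      show "D w = 0" by (rule w[OF D(1) D(2)[rule_format]])
    qed
  qed
  from G.line_through_generic_point[OF d r rs] J_large obtain y p q where
    pq: "x p * y q \<noteq> x q * y p" and
    F_y: "\<forall>n. ev_hom G.kk F (\<lambda>i. to_fract (x i) + of_nat n * to_fract (y i)) = 0"
    by (auto simp del: of_nat_mult)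
  have "\<forall>i. \<exists>yf. rep_poly (y i) yf" using rep_poly_exists by blast
  then obtain yf where yf: "\<forall>i. rep_poly (y i) (yf i)" by (rule choice[THEN exE])
  have 1: "{A. mpoly_eval F (\<lambda>i. to_fract (xf A i + of_nat n * yf i A)) = 0} \<in> ultra" for n
  proof -
    have "(\<lambda>i. to_fract (x i) + of_nat n * to_fract (y i)) = (\<lambda>i. to_fract (x i + of_nat n * y i))"
      by (simp add: rhom_of_nat[OF rhom_to_fract, symmetric])
    from F_y[rule_format, of n, unfolded this]
    have "ev_hom G.kk F (\<lambda>i. to_fract (x i + of_nat n * y i)) = 0" .
    moreover have "\<forall>i. rep_poly (x i + of_nat n * y i) (\<lambda>A. xf A i + of_nat n * yf i A)"
      using yf by (intro allI rep_poly_add rep rep_poly_mult rep_poly_of_nat) auto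
    ultimately show ?thesis
      using form_value_zero_iff[of "\<lambda>i. x i + of_nat n * y i" "\<lambda>A i. xf A i + of_nat n * yf i A" F]
      by (simp add: G.kk_def)
  qed
  \<comment> \<open>For a line \<open>d + 1\<close> values of \<open>n\<close> suffice, and finitely
    many conditions hold simultaneously almost everywhere.\<close>
  then have "{A. \<forall>n\<in>{..d}. mpoly_eval F (\<lambda>i. to_fract (xf A i + of_nat n * yf i A)) = 0} \<in> ultra"
    by (intro ultra_finite_INT) auto
  moreover have "{A. xf A p * yf q A - xf A q * yf p A = 0} \<notin> ultra"
  proof -
    have "rep_poly (x p * y q - x q * y p) (\<lambda>A. xf A p * yf q A - xf A q * yf p A)"
      using rep yf by (intro rep_poly_diff rep_poly_mult) auto
    then show ?thesis using rep_poly_eq_0 pq by fastforce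
  qed
  then have "- {A. xf A p * yf q A - xf A q * yf p A = 0} \<in> ultra" using ultra_cases by blast
  ultimately have "{A. \<forall>n\<in>{..d}. mpoly_eval F (\<lambda>i. to_fract (xf A i + of_nat n * yf i A)) = 0} \<inter>
      - {A. xf A p * yf q A - xf A q * yf p A = 0} \<in> ultra" by (rule ultra_Int)
  from ultra_nonempty[OF this] obtain A where
    A: "\<forall>n\<in>{..d}. mpoly_eval F (\<lambda>i. to_fract (xf A i + of_nat n * yf i A)) = 0"
      "xf A p * yf q A \<noteq> xf A q * yf p A" by auto
  have "\<exists>l. is_proj_line l \<and> l \<subseteq> proj_zeros UNIV F \<and> proj_point (\<lambda>i. to_fract (xf A i)) \<in> l"
  proof (rule line_in_hypersurface[OF F(2)])
    show "\<forall>n\<le>d. mpoly_eval F (\<lambda>i. to_fract (xf A i) + of_nat n * to_fract (yf i A)) = 0"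
      using A(1) by (simp add: rhom_of_nat[OF rhom_to_fract, symmetric])
    show "to_fract (xf A p) * to_fract (yf q A) \<noteq> to_fract (xf A q) * to_fract (yf p A)"
      using A(2) by (simp flip: to_fract_mult)
  qed
  then show False using conjunct2[OF bspec[OF U point[of A]]] by blast
qed

text \<open>Each strict inclusion provides a function that vanishes on the smaller cone but not on
  the larger, which adds an independent coordinate. The count starts at 1 because a single point is
  already a one-dimensional cone.\<close>

lemma chain_independent:
  fixes S :: "('j \<Rightarrow> complex) set set"
  assumes Z: "\<forall>i\<le>n. closedin (subtopology (zariski I) S) (Z i) \<and> irreducible_in (subtopology (zariski I) S) (Z i)"
    and strict: "\<forall>i<n. Z i \<subset> Z (Suc i)"
  shows "irreducible_cone I (\<Union>(Z n)) \<and> (\<exists>J\<subseteq>I. finite J \<and> card J = Suc n \<and> independent_on (\<Union>(Z n)) J)"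
proof -
  have sub: "Z i \<subseteq> proj_space I" if "i \<le> n" for i
    using Z[rule_format, OF that] by (auto simp: irreducible_in_def topspace_zariski)
  have cone: "irreducible_cone I (\<Union>(Z i))" if i: "i \<le> n" for i
  proof
    have ir: "irreducible_in (subtopology (zariski I) S) (Z i)" using Z i by simp
    then have "Z i \<noteq> {}" by (simp add: irreducible_in_def)
    then show "\<Union>(Z i) \<noteq> {}" using sub[OF i] proj_space_nonempty by fastforce
    show "(\<lambda>j. c * v j) \<in> \<Union>(Z i)" if v: "v \<in> \<Union>(Z i)" "c \<noteq> 0" for v c
    proof -
      obtain p where p: "p \<in> Z i" "v \<in> p" using v(1) by auto
      then have "(\<lambda>j. c * v j) \<in> p" using sub[OF i] v(2) proj_space_scale by blast
      then show ?thesis using p(1) by blast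
    qed
    show "(\<forall>v\<in>\<Union>(Z i). f v = 0) \<or> (\<forall>v\<in>\<Union>(Z i). g v = 0)"
      if "f \<in> polyfuns I" "g \<in> polyfuns I" "\<forall>v\<in>\<Union>(Z i). f v * g v = 0" for f g
      by (rule irreducible_cone[OF ir that])
  qed
  have "\<exists>J\<subseteq>I. finite J \<and> card J = Suc i \<and> independent_on (\<Union>(Z i)) J" if "i \<le> n" for i
    using that
  proof (induction i)
    case 0
    interpret irreducible_cone I "\<Union>(Z 0)" by (rule cone[OF 0])
    obtain v where v: "v \<in> \<Union>(Z 0)" using C_nonempty by auto
    then obtain p where p: "p \<in> proj_space I" "v \<in> p" using sub[OF 0] by auto
    have "v \<noteq> (\<lambda>_. 0)" by (rule proj_space_vector(1)[OF p])
    then obtain j where j: "v j \<noteq> 0" by auto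
    then have "j \<in> I" using proj_space_vector(2)[OF p] by auto
    have "independent_on (\<Union>(Z 0)) {j}" by (rule independent_start) (use v j in auto)
    then show ?case using \<open>j \<in> I\<close> by (intro exI[of _ "{j}"]) simp
  next
    case (Suc i)
    interpret irreducible_cone I "\<Union>(Z (Suc i))" by (rule cone[OF Suc.prems])
    obtain J where J: "J \<subseteq> I" "finite J" "card J = Suc i" "independent_on (\<Union>(Z i)) J"
      using Suc by auto
    have ss: "Z i \<subset> Z (Suc i)" using strict Suc.prems by simp
    have "\<exists>g\<in>polyfuns I. (\<forall>v\<in>\<Union>(Z i). g v = 0) \<and> (\<exists>v\<in>\<Union>(Z (Suc i)). g v \<noteq> 0)"
      by (rule closed_cone_separation[of I S]) (use Z Suc.prems ss in \<open>auto simp: irreducible_in_def\<close>)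
    then obtain g where g: "g \<in> polyfuns I" "(\<forall>v\<in>\<Union>(Z i). g v = 0) \<and> (\<exists>v\<in>\<Union>(Z (Suc i)). g v \<noteq> 0)"
      by (rule bexE)
    have "\<exists>j\<in>I - J. independent_on (\<Union>(Z (Suc i))) (insert j J)"
      by (rule independent_extend[OF J(1,4) _ g(1)]) (use g(2) ss in auto)
    then obtain j where j: "j \<in> I - J" "independent_on (\<Union>(Z (Suc i))) (insert j J)" by (rule bexE)
    then show ?case using J by (intro exI[of _ "insert j J"]) simp
  qed
  then show ?thesis using cone by simp
qed

text \<open>With \<open>r\<close> just above \<open>3 m / (2 sqrt d)\<close> and \<open>s\<close>
  about \<open>m - 2 r / 3\<close>, the sum \<open>2 r + s\<close> is about
  \<open>m + 4 r / 3\<close>, that is \<open>m + 2 m / sqrt d\<close>. Here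
  \<open>2 / sqrt d\<close> is split as \<open>3 / (2 sqrt d) + 1 / (2 sqrt d)\<close>, and the last
  term is at most \<open>1 / 4\<close>.\<close>

lemma dimension_bound_arithmetic:
  fixes b d :: nat
  assumes b: "b \<ge> 1" and d: "d \<ge> 6"
  obtains r s :: nat where "3 * real (b - 1) < 2 * real r * sqrt (real d)" "3 * (b - 1) < 2 * r + 3 * s"
    "real (2 * r + s) \<le> (1 + max (1 / 2) (3 / (2 * sqrt (real d)) + 1 / 3)) * real b + 2"
proof -
  define m where "m = b - 1"
  define w where "w = sqrt (real d)"
  have w: "w \<ge> 2"
  proof -
    have "sqrt 4 \<le> sqrt (real d)" using d by (intro real_sqrt_le_mono) simp
    then show ?thesis by (simp add: w_def)
  qed
  define a where "a = 3 * real m / (2 * w)"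
  have a0: "a \<ge> 0" using w by (simp add: a_def)
  \<comment> \<open>One more than the integer part, so that \<open>a < r\<close> also when
    \<open>a\<close> is an integer.\<close>
  define r where "r = nat \<lfloor>a\<rfloor> + 1"
  have r: "a < real r" "real r \<le> a + 1" using a0 by (simp_all add: r_def) linarith+
  \<comment> \<open>The least \<open>s\<close> with \<open>3 * m < 2 * r + 3 * s\<close>: division
    by 3 loses at most 2, which the offset 3 absorbs, and truncated subtraction gives 0 when
    \<open>r\<close> is large.\<close>
  define s where "s = (3 * m + 3 - 2 * r) div 3"
  have s: "3 * m < 2 * r + 3 * s" by (simp add: s_def)
  have 1: "3 * real m < 2 * real r * w" using r(1) w by (simp add: a_def divide_less_eq mult_ac)
  have m4: "real m / (2 * w) \<le> real m / 4" using w by (intro divide_left_mono) auto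
  have "real (2 * r + s) \<le> (1 + max (1 / 2) (3 / (2 * w) + 1 / 3)) * real b + 2"
  proof (cases "2 * r \<le> 3 * m + 3")
    case True
    have "real (3 * s) \<le> real (3 * m + 3 - 2 * r)" unfolding s_def by (intro of_nat_mono) simp
    then have "3 * real s \<le> 3 * real m + 3 - 2 * real r" using True by (simp add: of_nat_diff)
    then have "real (2 * r + s) \<le> real b + 4 / 3 * a + 4 / 3" using r(2) b by (simp add: m_def of_nat_diff)
    also have "4 / 3 * a = 3 / (2 * w) * real m + real m / (2 * w)" using w by (simp add: a_def field_simps)
    also have "real b + (3 / (2 * w) * real m + real m / (2 * w)) + 4 / 3 \<le> real b + (3 / (2 * w) + 1 / 3) * real b + 2"
    proof -
      have "3 / (2 * w) * real m \<le> 3 / (2 * w) * real b" using w by (intro mult_left_mono) (simp_all add: m_def)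
      then show ?thesis using m4 by (simp add: m_def algebra_simps)
    qed
    also have "\<dots> \<le> real b + max (1 / 2) (3 / (2 * w) + 1 / 3) * real b + 2"
      by (intro add_mono mult_right_mono) auto
    finally show ?thesis by (simp add: algebra_simps)
  next
    case False
    then have "s = 0" by (simp add: s_def)
    then have "real (2 * r + s) \<le> 2 * a + 2" using r(2) by simp
    also have "\<dots> = 6 * (real m / (2 * w)) + 2" by (simp add: a_def)
    also have "\<dots> \<le> real b + 1 / 2 * real b + 2" using m4 by (simp add: m_def)
    also have "\<dots> \<le> real b + max (1 / 2) (3 / (2 * w) + 1 / 3) * real b + 2"
      by (intro add_mono mult_right_mono) auto
    finally show ?thesis by (simp add: algebra_simps)
  qed
  then show thesis using that[of r s] 1 s by (simp add: m_def w_def)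
qed

theorem theorem5:
  fixes F :: "(4, ratfun) mpoly"
    and X L U :: "(4 \<Rightarrow> ratfun) set set"
    and d b :: nat
  assumes "irreducible F" and "is_form UNIV d F" and "d \<ge> 6"
    and "X = proj_zeros UNIV F"
    and "L = \<Union>{l. is_proj_line l \<and> l \<subseteq> X}"
    and "U = X - L"
    and "b \<ge> 1"
  shows "dim_bounded_height U b \<le>
    ereal ((1 + max (1 / 2) (3 / (2 * sqrt (real d)) + 1 / 3)) * real b + 2)"
proof -
  let ?S = "coeff_point ` bounded_height U b" and ?I = "UNIV \<times> {..<b} :: (4 \<times> nat) set"
  obtain r s :: nat where r: "3 * real (b - 1) < 2 * real r * sqrt (real d)" and s: "3 * (b - 1) < 2 * r + 3 * s"
    and bound: "real (2 * r + s) \<le> (1 + max (1 / 2) (3 / (2 * sqrt (real d)) + 1 / 3)) * real b + 2"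
    by (rule dimension_bound_arithmetic[OF assms(7,3)])
  have U: "\<forall>x\<in>U. x \<in> proj_zeros UNIV F \<and> (\<forall>l. is_proj_line l \<and> l \<subseteq> proj_zeros UNIV F \<longrightarrow> x \<notin> l)"
    unfolding assms(4-6) by blast
  have n_le: "n \<le> 2 * r + s"
    if Z: "\<forall>i\<le>n. closedin (subtopology (zariski ?I) ?S) (Z i) \<and> irreducible_in (subtopology (zariski ?I) ?S) (Z i)"
      and strict: "\<forall>i<n. Z i \<subset> Z (Suc i)" for n Z
  proof -
    from chain_independent[OF Z strict] obtain J where cone: "irreducible_cone ?I (\<Union>(Z n))"
      and J: "J \<subseteq> ?I" "card J = Suc n" "independent_on (\<Union>(Z n)) J" by (elim conjE exE)
    have "Z n \<subseteq> ?S" "Z n \<subseteq> proj_space ?I"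
      using Z by (auto simp: irreducible_in_def topspace_zariski)
    then have C: "\<forall>v\<in>\<Union>(Z n). (\<forall>q. (\<forall>i. q dvd coeff_poly b v i) \<longrightarrow> q dvd 1) \<and>
        (\<exists>x\<in>U. (\<lambda>i. to_fract (coeff_poly b v i)) \<in> x)"
      by (intro ballI, elim UnionE) (rule coeff_point_vector, auto)
    have "card J \<le> 2 * r + s + 1"
      by (rule independent_coordinates_bound[OF cone assms(1,2) _ U C J(1,3) r s]) (use assms(3) in simp)
    then show ?thesis using J(2) by simp
  qed
  show ?thesis unfolding dim_bounded_height_def krull_dim_def
  proof (rule Sup_least, elim CollectE exE conjE)
    fix z n Z
    assume z: "z = ereal (real n)" and chain:
      "\<forall>i\<le>n. closedin (subtopology (zariski ?I) ?S) (Z i) \<and> irreducible_in (subtopology (zariski ?I) ?S) (Z i)"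
      "\<forall>i<n. Z i \<subset> Z (Suc i)"
    have "real n \<le> real (2 * r + s)" using n_le[OF chain] by simp
    then show "z \<le> ereal ((1 + max (1 / 2) (3 / (2 * sqrt (real d)) + 1 / 3)) * real b + 2)"
      using bound z by simp
  qed
qed

end
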